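(* Let $T$ be a compact Hausdorff space, and identify $\pi_1(\mathsf{AbC^*Alg},C(T))\cong H^3_{\mathrm{tor}}(T;\mathbb{Z})\rtimes\operatorname{Homeo}(T)$, $\pi_2(\mathsf{AbC^*Alg},C(T))\cong\operatorname{Pic}(T)$ and $\pi_3(\mathsf{AbC^*Alg},C(T))\cong C(T)^\times$ as described in the context. Then the actions of $\pi_1$ on $\pi_2$ and $\pi_3$ are as follows. Given $\omega\in H^3_{\mathrm{tor}}(T;\mathbb{Z})$, a homeomorphism $\Phi\in\operatorname{Homeo}(T)$ and a complex line bundle $E$ over $T$, $$(\omega,\Phi)\curvearrowright E\cong(\Phi^{-1})^*(E),$$ the pullback bundle of $E$ along $\Phi^{-1}$. When $T$ has the homotopy type of a CW-complex (so that $\operatorname{Pic}(T)\cong H^2(T;\mathbb{Z})$ via the first Chern class), this action corresponds to the pullback by $\Phi^{-1}$ on $H^2(T;\mathbb{Z})$. Furthermore, for $f\in C(T)^\times$, $$(\omega,\Phi)\curvearrowright f=f\circ\Phi^{-1}.$$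
   Context: C*-algebras are unital; $Z(A)$ is the center of $A$. An $A$-$B$ correspondence ${}_AX_B$ is a right Hilbert $B$-module $X$ (inner product $\langle\cdot|\cdot\rangle$ linear in the second variable) with a $*$-homomorphism from $A$ to the adjointable operators on $X$; the actions are written $a\triangleright x$ and $x\triangleleft b$. Given central $*$-homomorphisms $\psi\colon C(T)\to Z(A)$ and $\mu\colon C(T)\to Z(B)$, $A\otimes_T B:=(A\otimes_{\max}B)/I_T$, where $I_T$ is the ideal generated by the elements $a\psi(f)\otimes b-a\otimes\mu(f)b$. The (C*-)3-category $\mathsf{AbC^*Alg}$: (0) Objects are the algebras $C(T)$, $T$ compact Hausdorff. (1) A 1-morphism $C(S)\to C(T)$, written ${}_\phi A_\psi$, is a unital C*-algebra $A$ with unital $*$-homomorphisms $\phi\colon C(S)\to Z(A)$, $\psi\colon C(T)\to Z(A)$. The composite of ${}_\phi A_\psi\colon C(S)\to C(T)$ and ${}_\mu B_\nu\colon C(T)\to C(U)$ is $A\otimes_T B$ with central maps $\phi\otimes 1_B$, $1_A\otimes\nu$. The identity of $C(T)$ is ${}_{\mathrm{id}}C(T)_{\mathrm{id}}$. (2) A 2-morphism ${}_\phi A_\psi\Rightarrow{}_\mu B_\nu$ is a correspondence ${}_AX_B$ with $\phi(f)\triangleright x=x\triangleleft\mu(f)$ and $\psi(g)\triangleright x=x\triangleleft\nu(g)$ for all $f,g,x$. Composition of ${}_AX_B$ and ${}_BY_C$ is $X\otimes Y:=X\otimes_BY$ (relative tensor product); the identity $\mathrm{id}_A$ is ${}_AA_A$.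 For $X\colon A\Rightarrow A'$ and $Y\colon B\Rightarrow B'$ with $A,B$ composable over $C(T)$, $X\otimes_TY\colon A\otimes_TB\Rightarrow A'\otimes_TB'$ is the $C(T)$-balanced external tensor product, with $\langle x\otimes y|x'\otimes y'\rangle=\langle x|x'\rangle\otimes_T\langle y|y'\rangle$. (3) 3-morphisms are adjointable bimodule maps, composed as functions. Invertibility of 3-, 2-, 1-morphisms is meant strictly, up to 3-isomorphism, and up to 2-isomorphism, respectively. $\pi_1(\mathsf{AbC^*Alg},C(T))$: invertible 1-morphisms $C(T)\to C(T)$ modulo 2-isomorphism, product $[A][B]=[A\otimes_TB]$. $\pi_2(\mathsf{AbC^*Alg},C(T))$: invertible 2-morphisms ${}_{\mathrm{id}}C(T)_{\mathrm{id}}\Rightarrow{}_{\mathrm{id}}C(T)_{\mathrm{id}}$ modulo 3-isomorphism. $\pi_3(\mathsf{AbC^*Alg},C(T))$: invertible 3-morphisms from the identity 2-morphism $\mathrm{id}_{C(T)}={}_{C(T)}C(T)_{C(T)}$ to itself. Identifications: $\omega\in H^3_{\mathrm{tor}}(T;\mathbb{Z})$ (torsion of third Čech cohomology) corresponds to ${}_{\mathrm{id}}A^\omega_{\mathrm{id}}$, where $A^\omega$ is a unital continuous-trace C*-algebra with spectrum $T$ and Dixmier–Douady class $\omega$ (with $C(T)$ identified with $Z(A^\omega)$); $\Phi\in\operatorname{Homeo}(T)$ corresponds to ${}_{\Phi^*}C(T)_{\mathrm{id}}$, $\Phi^*(f)=f\circ\Phi$; and $(\omega,\Phi)$ is the product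 of these two elements of $\pi_1$. A line bundle $E$ (with any Hermitian metric) corresponds to its $C(T)$-$C(T)$ bimodule of continuous sections $\Gamma(E)$ in $\pi_2$; $\operatorname{Pic}(T)$ is the group of isomorphism classes of complex line bundles. A function $f\in C(T)^\times$ corresponds to multiplication by $f$ on $C(T)$ in $\pi_3$. Actions of $\pi_1$: given ${}_\phi A_\psi\in\pi_1$ with inverse $A^{-1}$, choose a 2-isomorphism $Y\colon A\otimes_T{}_{\mathrm{id}}C(T)_{\mathrm{id}}\otimes_TA^{-1}\Rightarrow{}_{\mathrm{id}}C(T)_{\mathrm{id}}$. For $X\in\pi_2$, $A\curvearrowright X:=Y^{-1}\otimes(\mathrm{id}_A\otimes_TX\otimes_T\mathrm{id}_{A^{-1}})\otimes Y$. For $f\in\pi_3$, put $\tilde f:=\mathrm{id}_{Y^{-1}}\otimes(1_A\otimes_Tf\otimes_T1_{A^{-1}})\otimes\mathrm{id}_Y$, a 3-automorphism of $A\curvearrowright\mathrm{id}_{C(T)}$, choose a 3-isomorphism $g\colon A\curvearrowright\mathrm{id}_{C(T)}\to\mathrm{id}_{C(T)}$, and set $A\curvearrowright f:=g\circ\tilde f\circ g^{-1}$. *)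

theory Defs
  imports "HOL-Analysis.Analysis" "HOL-Algebra.Module" "HOL-Algebra.QuotRing"
begin

section \<open>Completion of a pseudo-metric space\<close>

definition cauchy_in :: "'l set \<Rightarrow> ('l \<Rightarrow> 'l \<Rightarrow> real) \<Rightarrow> (nat \<Rightarrow> 'l) \<Rightarrow> bool" where
  "cauchy_in L d s \<longleftrightarrow> (\<forall>n. s n \<in> L) \<and> (\<forall>e>0. \<exists>N. \<forall>m\<ge>N. \<forall>n\<ge>N. d (s m) (s n) < e)"

definition cauchy_class :: "'l set \<Rightarrow> ('l \<Rightarrow> 'l \<Rightarrow> real) \<Rightarrow> (nat \<Rightarrow> 'l) \<Rightarrow> (nat \<Rightarrow> 'l) set" where
  "cauchy_class L d s = {s'. cauchy_in L d s' \<and> (\<lambda>n. d (s n) (s' n)) \<longlonglongrightarrow> 0}"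

definition completion :: "'l set \<Rightarrow> ('l \<Rightarrow> 'l \<Rightarrow> real) \<Rightarrow> (nat \<Rightarrow> 'l) set set" where
  "completion L d = cauchy_class L d ` {s. cauchy_in L d s}"

definition rep :: "'a set \<Rightarrow> 'a" where
  "rep x = (SOME s. s \<in> x)"


section \<open>Unital C*-algebras\<close>

record 'a cstar = "(complex, 'a) module" +
  adj :: "'a \<Rightarrow> 'a"
  cnorm :: "'a \<Rightarrow> real"

text \<open>The complex numbers serve both as the ring of scalars and as a C*-algebra.\<close>

definition complex_alg :: "complex cstar" where
  "complex_alg = \<lparr>carrier = UNIV, mult = (*), one = 1, zero = 0, add = (+), smult = (*),
     adj = cnj, cnorm = cmod\<rparr>"

text \<open>The zero algebra is allowed, since \<open>C(T)\<close> is zero for empty \<open>T\<close>.\<close>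

locale cstar_algebra = ring A + Module.module complex_alg A for A (structure) +
  assumes smult_mult_left:
    "\<lbrakk>x \<in> carrier A; y \<in> carrier A\<rbrakk> \<Longrightarrow> (c \<odot> x) \<otimes> y = c \<odot> (x \<otimes> y)"
  and smult_mult_right:
    "\<lbrakk>x \<in> carrier A; y \<in> carrier A\<rbrakk> \<Longrightarrow> x \<otimes> (c \<odot> y) = c \<odot> (x \<otimes> y)"
  and adj_closed: "x \<in> carrier A \<Longrightarrow> adj A x \<in> carrier A"
  and adj_adj: "x \<in> carrier A \<Longrightarrow> adj A (adj A x) = x"
  and adj_add: "\<lbrakk>x \<in> carrier A; y \<in> carrier A\<rbrakk> \<Longrightarrow> adj A (x \<oplus> y) = adj A x \<oplus> adj A y"
  and adj_mult: "\<lbrakk>x \<in> carrier A; y \<in> carrier A\<rbrakk> \<Longrightarrow> adj A (x \<otimes> y) = adj A y \<otimes> adj A x"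
  and adj_smult: "x \<in> carrier A \<Longrightarrow> adj A (c \<odot> x) = cnj c \<odot> adj A x"
  and cnorm_nonneg: "x \<in> carrier A \<Longrightarrow> 0 \<le> cnorm A x"
  and cnorm_eq_0: "x \<in> carrier A \<Longrightarrow> cnorm A x = 0 \<longleftrightarrow> x = \<zero>"
  and cnorm_add: "\<lbrakk>x \<in> carrier A; y \<in> carrier A\<rbrakk> \<Longrightarrow> cnorm A (x \<oplus> y) \<le> cnorm A x + cnorm A y"
  and cnorm_smult: "x \<in> carrier A \<Longrightarrow> cnorm A (c \<odot> x) = cmod c * cnorm A x"
  and cnorm_mult: "\<lbrakk>x \<in> carrier A; y \<in> carrier A\<rbrakk> \<Longrightarrow> cnorm A (x \<otimes> y) \<le> cnorm A x * cnorm A y"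
  and cstar_identity: "x \<in> carrier A \<Longrightarrow> cnorm A (adj A x \<otimes> x) = (cnorm A x)\<^sup>2"
  and complete: "cauchy_in (carrier A) (\<lambda>x y. cnorm A (x \<ominus> y)) s \<Longrightarrow>
    \<exists>x\<in>carrier A. (\<lambda>n. cnorm A (s n \<ominus> x)) \<longlonglongrightarrow> 0"

definition cstar_lim :: "'a cstar \<Rightarrow> (nat \<Rightarrow> 'a) \<Rightarrow> 'a" where
  "cstar_lim A s = (THE x. x \<in> carrier A \<and> (\<lambda>n. cnorm A (s n \<ominus>\<^bsub>A\<^esub> x)) \<longlonglongrightarrow> 0)"

definition center :: "'a cstar \<Rightarrow> 'a set" where
  "center A = {z \<in> carrier A. \<forall>a\<in>carrier A. z \<otimes>\<^bsub>A\<^esub> a = a \<otimes>\<^bsub>A\<^esub> z}"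

definition unital_star_hom :: "'a cstar \<Rightarrow> 'b cstar \<Rightarrow> ('a \<Rightarrow> 'b) \<Rightarrow> bool" where
  "unital_star_hom A B f \<longleftrightarrow> f \<in> ring_hom A B \<and>
     (\<forall>a\<in>carrier A. \<forall>c. f (c \<odot>\<^bsub>A\<^esub> a) = c \<odot>\<^bsub>B\<^esub> f a) \<and>
     (\<forall>a\<in>carrier A. f (adj A a) = adj B (f a))"

definition closed_ideal :: "'a cstar \<Rightarrow> 'a set \<Rightarrow> bool" where
  "closed_ideal A J \<longleftrightarrow> ideal J A \<and>
     (\<forall>s. \<forall>x\<in>carrier A. (\<forall>n. s n \<in> J) \<and> (\<lambda>n. cnorm A (s n \<ominus>\<^bsub>A\<^esub> x)) \<longlonglongrightarrow> 0 \<longrightarrow> x \<in> J)"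

definition closed_ideal_gen :: "'a cstar \<Rightarrow> 'a set \<Rightarrow> 'a set" where
  "closed_ideal_gen A G = \<Inter>{J. closed_ideal A J \<and> G \<subseteq> J}"

definition cstar_quot :: "'a cstar \<Rightarrow> 'a set \<Rightarrow> 'a set cstar" where
  "cstar_quot A I = \<lparr>carrier = carrier (A Quot I), mult = mult (A Quot I), one = one (A Quot I),
     zero = zero (A Quot I), add = add (A Quot I),
     smult = (\<lambda>c X. \<Union>x\<in>X. I +>\<^bsub>A\<^esub> (c \<odot>\<^bsub>A\<^esub> x)),
     adj = (\<lambda>X. adj A ` X),
     cnorm = (\<lambda>X. Inf (cnorm A ` X))\<rparr>"

text \<open>\<open>C(T)\<close>, with functions extended by \<open>undefined\<close> outside of \<open>T\<close>. The inserted \<open>0\<close> makes the norm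
  right for empty \<open>T\<close>.\<close>

definition cfun_alg :: "'t topology \<Rightarrow> ('t \<Rightarrow> complex) cstar" where
  "cfun_alg T = \<lparr>carrier = {f \<in> extensional (topspace T). continuous_map T euclidean f},
     mult = (\<lambda>f g. \<lambda>t\<in>topspace T. f t * g t), one = (\<lambda>t\<in>topspace T. 1),
     zero = (\<lambda>t\<in>topspace T. 0), add = (\<lambda>f g. \<lambda>t\<in>topspace T. f t + g t),
     smult = (\<lambda>c f. \<lambda>t\<in>topspace T. c * f t), adj = (\<lambda>f. \<lambda>t\<in>topspace T. cnj (f t)),
     cnorm = (\<lambda>f. Sup (insert 0 ((\<lambda>t. cmod (f t)) ` topspace T)))\<rparr>"


section \<open>Maximal tensor products\<close>

text \<open>A list of pairs stands for the formal sum of the corresponding elementary tensors.\<close>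

definition pair_lists :: "('x, 'm) partial_object_scheme \<Rightarrow> ('y, 'n) partial_object_scheme
    \<Rightarrow> ('x \<times> 'y) list set" where
  "pair_lists X Y = lists (carrier X \<times> carrier Y)"

definition pair_scale :: "(complex, 'x, 'm) module_scheme \<Rightarrow> complex
    \<Rightarrow> ('x \<times> 'y) list \<Rightarrow> ('x \<times> 'y) list" where
  "pair_scale X c l = map (\<lambda>(x, y). (c \<odot>\<^bsub>X\<^esub> x, y)) l"

definition pair_mult :: "'a cstar \<Rightarrow> 'b cstar \<Rightarrow> ('a \<times> 'b) list \<Rightarrow> ('a \<times> 'b) list
    \<Rightarrow> ('a \<times> 'b) list" where
  "pair_mult A B l l' = [(a \<otimes>\<^bsub>A\<^esub> a', b \<otimes>\<^bsub>B\<^esub> b'). (a, b) \<leftarrow> l, (a', b') \<leftarrow> l']"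

definition pair_adj :: "'a cstar \<Rightarrow> 'b cstar \<Rightarrow> ('a \<times> 'b) list \<Rightarrow> ('a \<times> 'b) list" where
  "pair_adj A B l = map (\<lambda>(a, b). (adj A a, adj B b)) l"

text \<open>Equality of formal sums in the algebraic tensor product over the complex numbers.\<close>

inductive alg_tensor_eq :: "'a cstar \<Rightarrow> 'b cstar \<Rightarrow> ('a \<times> 'b) list \<Rightarrow> ('a \<times> 'b) list \<Rightarrow> bool"
  for A B where
  refl: "alg_tensor_eq A B l l"
| sym: "alg_tensor_eq A B l l' \<Longrightarrow> alg_tensor_eq A B l' l"
| trans: "alg_tensor_eq A B l l' \<Longrightarrow> alg_tensor_eq A B l' l'' \<Longrightarrow> alg_tensor_eq A B l l''"
| append: "alg_tensor_eq A B l l' \<Longrightarrow> alg_tensor_eq A B m m' \<Longrightarrow> alg_tensor_eq A B (l @ m) (l' @ m')"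
| commute: "alg_tensor_eq A B (l @ m) (m @ l)"
| zero: "b \<in> carrier B \<Longrightarrow> alg_tensor_eq A B [(\<zero>\<^bsub>A\<^esub>, b)] []"
| add_left: "\<lbrakk>a \<in> carrier A; a' \<in> carrier A; b \<in> carrier B\<rbrakk>
    \<Longrightarrow> alg_tensor_eq A B [(a \<oplus>\<^bsub>A\<^esub> a', b)] [(a, b), (a', b)]"
| add_right: "\<lbrakk>a \<in> carrier A; b \<in> carrier B; b' \<in> carrier B\<rbrakk>
    \<Longrightarrow> alg_tensor_eq A B [(a, b \<oplus>\<^bsub>B\<^esub> b')] [(a, b), (a, b')]"
| scale: "\<lbrakk>a \<in> carrier A; b \<in> carrier B\<rbrakk>
    \<Longrightarrow> alg_tensor_eq A B [(c \<odot>\<^bsub>A\<^esub> a, b)] [(a, c \<odot>\<^bsub>B\<^esub> b)]"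

definition cstar_seminorm :: "'a cstar \<Rightarrow> 'b cstar \<Rightarrow> (('a \<times> 'b) list \<Rightarrow> real) \<Rightarrow> bool" where
  "cstar_seminorm A B p \<longleftrightarrow>
     (\<forall>l\<in>pair_lists A B. \<forall>l'\<in>pair_lists A B.
        (alg_tensor_eq A B l l' \<longrightarrow> p l = p l') \<and>
        0 \<le> p l \<and> (\<forall>c. p (pair_scale A c l) = cmod c * p l) \<and>
        p (l @ l') \<le> p l + p l' \<and> p (pair_mult A B l l') \<le> p l * p l' \<and>
        p (pair_mult A B (pair_adj A B l) l) = (p l)\<^sup>2)"

definition max_norm :: "'a cstar \<Rightarrow> 'b cstar \<Rightarrow> ('a \<times> 'b) list \<Rightarrow> real" where
  "max_norm A B l = Sup {p l |p. cstar_seminorm A B p}"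

definition max_dist :: "'a cstar \<Rightarrow> 'b cstar \<Rightarrow> ('a \<times> 'b) list \<Rightarrow> ('a \<times> 'b) list \<Rightarrow> real" where
  "max_dist A B l l' = max_norm A B (l @ pair_scale A (-1) l')"

abbreviation max_class :: "'a cstar \<Rightarrow> 'b cstar \<Rightarrow> (nat \<Rightarrow> ('a \<times> 'b) list)
    \<Rightarrow> (nat \<Rightarrow> ('a \<times> 'b) list) set" where
  "max_class A B \<equiv> cauchy_class (pair_lists A B) (max_dist A B)"

definition max_tensor :: "'a cstar \<Rightarrow> 'b cstar \<Rightarrow> (nat \<Rightarrow> ('a \<times> 'b) list) set cstar" where
  "max_tensor A B = \<lparr>carrier = completion (pair_lists A B) (max_dist A B),
     mult = (\<lambda>u v. max_class A B (\<lambda>n. pair_mult A B (rep u n) (rep v n))),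
     one = max_class A B (\<lambda>n. [(\<one>\<^bsub>A\<^esub>, \<one>\<^bsub>B\<^esub>)]),
     zero = max_class A B (\<lambda>n. []),
     add = (\<lambda>u v. max_class A B (\<lambda>n. rep u n @ rep v n)),
     smult = (\<lambda>c u. max_class A B (\<lambda>n. pair_scale A c (rep u n))),
     adj = (\<lambda>u. max_class A B (\<lambda>n. pair_adj A B (rep u n))),
     cnorm = (\<lambda>u. lim (\<lambda>n. max_norm A B (rep u n)))\<rparr>"

definition max_elem :: "'a cstar \<Rightarrow> 'b cstar \<Rightarrow> 'a \<Rightarrow> 'b \<Rightarrow> (nat \<Rightarrow> ('a \<times> 'b) list) set" where
  "max_elem A B a b = max_class A B (\<lambda>n. [(a, b)])"


section \<open>1-morphisms\<close>

record ('s, 't, 'a) one_mor =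
  alg :: "'a cstar"
  lmap :: "('s \<Rightarrow> complex) \<Rightarrow> 'a"
  rmap :: "('t \<Rightarrow> complex) \<Rightarrow> 'a"

definition mor1 :: "'s topology \<Rightarrow> 't topology \<Rightarrow> ('s, 't, 'a) one_mor \<Rightarrow> bool" where
  "mor1 S T M \<longleftrightarrow> cstar_algebra (alg M) \<and>
     unital_star_hom (cfun_alg S) (alg M) (lmap M) \<and>
     lmap M ` carrier (cfun_alg S) \<subseteq> center (alg M) \<and>
     unital_star_hom (cfun_alg T) (alg M) (rmap M) \<and>
     rmap M ` carrier (cfun_alg T) \<subseteq> center (alg M)"

definition mor1_id :: "'t topology \<Rightarrow> ('t, 't, 't \<Rightarrow> complex) one_mor" where
  "mor1_id T = \<lparr>alg = cfun_alg T, lmap = (\<lambda>f. f), rmap = (\<lambda>f. f)\<rparr>"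

type_synonym ('a, 'b) bal = "(nat \<Rightarrow> ('a \<times> 'b) list) set set"

definition bal_ideal :: "'t topology \<Rightarrow> ('s, 't, 'a) one_mor \<Rightarrow> ('t, 'u, 'b) one_mor
    \<Rightarrow> (nat \<Rightarrow> ('a \<times> 'b) list) set set" where
  "bal_ideal T M N = closed_ideal_gen (max_tensor (alg M) (alg N))
     {max_elem (alg M) (alg N) (a \<otimes>\<^bsub>alg M\<^esub> rmap M f) b
        \<ominus>\<^bsub>max_tensor (alg M) (alg N)\<^esub> max_elem (alg M) (alg N) a (lmap N f \<otimes>\<^bsub>alg N\<^esub> b) |a b f.
      a \<in> carrier (alg M) \<and> b \<in> carrier (alg N) \<and> f \<in> carrier (cfun_alg T)}"

definition bal_tensor :: "'t topology \<Rightarrow> ('s, 't, 'a) one_mor \<Rightarrow> ('t, 'u, 'b) one_mor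
    \<Rightarrow> ('a, 'b) bal cstar" where
  "bal_tensor T M N = cstar_quot (max_tensor (alg M) (alg N)) (bal_ideal T M N)"

definition bal_elem :: "'t topology \<Rightarrow> ('s, 't, 'a) one_mor \<Rightarrow> ('t, 'u, 'b) one_mor
    \<Rightarrow> 'a \<Rightarrow> 'b \<Rightarrow> ('a, 'b) bal" where
  "bal_elem T M N a b =
     bal_ideal T M N +>\<^bsub>max_tensor (alg M) (alg N)\<^esub> max_elem (alg M) (alg N) a b"

text \<open>A sequence of formal sums converging to a given element of a balanced tensor product.\<close>

definition bal_rep :: "('a, 'b) bal \<Rightarrow> nat \<Rightarrow> ('a \<times> 'b) list" where
  "bal_rep u = rep (rep u)"

definition mor1_comp :: "'t topology \<Rightarrow> ('s, 't, 'a) one_mor \<Rightarrow> ('t, 'u, 'b) one_mor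
    \<Rightarrow> ('s, 'u, ('a, 'b) bal) one_mor" where
  "mor1_comp T M N = \<lparr>alg = bal_tensor T M N,
     lmap = (\<lambda>f. bal_elem T M N (lmap M f) \<one>\<^bsub>alg N\<^esub>),
     rmap = (\<lambda>g. bal_elem T M N \<one>\<^bsub>alg M\<^esub> (rmap N g))\<rparr>"


section \<open>Correspondences: 2-morphisms and 3-morphisms\<close>

text \<open>As for modules in HOL-Algebra, the fields \<open>mult\<close> and \<open>one\<close> play no role.\<close>

record ('a, 'b, 'x) corr = "(complex, 'x) module" +
  hleft :: "'a \<Rightarrow> 'x \<Rightarrow> 'x"
  hright :: "'x \<Rightarrow> 'b \<Rightarrow> 'x"
  hip :: "'x \<Rightarrow> 'x \<Rightarrow> 'b"

definition hnorm :: "'b cstar \<Rightarrow> ('a, 'b, 'x) corr \<Rightarrow> 'x \<Rightarrow> real" where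
  "hnorm B X x = sqrt (cnorm B (hip X x x))"

locale hilbert_module = B: cstar_algebra B + X: Module.module complex_alg X
  for B :: "'b cstar" and X :: "('a, 'b, 'x) corr" +
  assumes right_closed: "\<lbrakk>x \<in> carrier X; b \<in> carrier B\<rbrakk> \<Longrightarrow> hright X x b \<in> carrier X"
  and right_add: "\<lbrakk>x \<in> carrier X; y \<in> carrier X; b \<in> carrier B\<rbrakk>
    \<Longrightarrow> hright X (x \<oplus>\<^bsub>X\<^esub> y) b = hright X x b \<oplus>\<^bsub>X\<^esub> hright X y b"
  and right_add': "\<lbrakk>x \<in> carrier X; b \<in> carrier B; b' \<in> carrier B\<rbrakk>
    \<Longrightarrow> hright X x (b \<oplus>\<^bsub>B\<^esub> b') = hright X x b \<oplus>\<^bsub>X\<^esub> hright X x b'"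
  and right_mult: "\<lbrakk>x \<in> carrier X; b \<in> carrier B; b' \<in> carrier B\<rbrakk>
    \<Longrightarrow> hright X x (b \<otimes>\<^bsub>B\<^esub> b') = hright X (hright X x b) b'"
  and right_one: "x \<in> carrier X \<Longrightarrow> hright X x \<one>\<^bsub>B\<^esub> = x"
  and right_smult: "\<lbrakk>x \<in> carrier X; b \<in> carrier B\<rbrakk>
    \<Longrightarrow> hright X (c \<odot>\<^bsub>X\<^esub> x) b = c \<odot>\<^bsub>X\<^esub> hright X x b"
  and right_smult': "\<lbrakk>x \<in> carrier X; b \<in> carrier B\<rbrakk>
    \<Longrightarrow> hright X x (c \<odot>\<^bsub>B\<^esub> b) = c \<odot>\<^bsub>X\<^esub> hright X x b"
  and ip_closed: "\<lbrakk>x \<in> carrier X; y \<in> carrier X\<rbrakk> \<Longrightarrow> hip X x y \<in> carrier B"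
  and ip_add: "\<lbrakk>x \<in> carrier X; y \<in> carrier X; z \<in> carrier X\<rbrakk>
    \<Longrightarrow> hip X x (y \<oplus>\<^bsub>X\<^esub> z) = hip X x y \<oplus>\<^bsub>B\<^esub> hip X x z"
  and ip_smult: "\<lbrakk>x \<in> carrier X; y \<in> carrier X\<rbrakk> \<Longrightarrow> hip X x (c \<odot>\<^bsub>X\<^esub> y) = c \<odot>\<^bsub>B\<^esub> hip X x y"
  and ip_right: "\<lbrakk>x \<in> carrier X; y \<in> carrier X; b \<in> carrier B\<rbrakk>
    \<Longrightarrow> hip X x (hright X y b) = hip X x y \<otimes>\<^bsub>B\<^esub> b"
  and ip_adj: "\<lbrakk>x \<in> carrier X; y \<in> carrier X\<rbrakk> \<Longrightarrow> adj B (hip X x y) = hip X y x"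
  and ip_pos: "x \<in> carrier X \<Longrightarrow> \<exists>b\<in>carrier B. hip X x x = adj B b \<otimes>\<^bsub>B\<^esub> b"
  and ip_definite: "\<lbrakk>x \<in> carrier X; hip X x x = \<zero>\<^bsub>B\<^esub>\<rbrakk> \<Longrightarrow> x = \<zero>\<^bsub>X\<^esub>"
  and hcomplete: "cauchy_in (carrier X) (\<lambda>x y. hnorm B X (x \<ominus>\<^bsub>X\<^esub> y)) s \<Longrightarrow>
    \<exists>x\<in>carrier X. (\<lambda>n. hnorm B X (s n \<ominus>\<^bsub>X\<^esub> x)) \<longlonglongrightarrow> 0"

locale correspondence = A: cstar_algebra A + hilbert_module B X
  for A :: "'a cstar" and B :: "'b cstar" and X :: "('a, 'b, 'x) corr" +
  assumes left_closed: "\<lbrakk>a \<in> carrier A; x \<in> carrier X\<rbrakk> \<Longrightarrow> hleft X a x \<in> carrier X"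
  and left_add: "\<lbrakk>a \<in> carrier A; x \<in> carrier X; y \<in> carrier X\<rbrakk>
    \<Longrightarrow> hleft X a (x \<oplus>\<^bsub>X\<^esub> y) = hleft X a x \<oplus>\<^bsub>X\<^esub> hleft X a y"
  and left_add': "\<lbrakk>a \<in> carrier A; a' \<in> carrier A; x \<in> carrier X\<rbrakk>
    \<Longrightarrow> hleft X (a \<oplus>\<^bsub>A\<^esub> a') x = hleft X a x \<oplus>\<^bsub>X\<^esub> hleft X a' x"
  and left_mult: "\<lbrakk>a \<in> carrier A; a' \<in> carrier A; x \<in> carrier X\<rbrakk>
    \<Longrightarrow> hleft X (a \<otimes>\<^bsub>A\<^esub> a') x = hleft X a (hleft X a' x)"
  and left_smult: "\<lbrakk>a \<in> carrier A; x \<in> carrier X\<rbrakk>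
    \<Longrightarrow> hleft X (c \<odot>\<^bsub>A\<^esub> a) x = c \<odot>\<^bsub>X\<^esub> hleft X a x"
  and left_adj: "\<lbrakk>a \<in> carrier A; x \<in> carrier X; y \<in> carrier X\<rbrakk>
    \<Longrightarrow> hip X (hleft X a x) y = hip X x (hleft X (adj A a) y)"
  and left_right: "\<lbrakk>a \<in> carrier A; x \<in> carrier X; b \<in> carrier B\<rbrakk>
    \<Longrightarrow> hleft X a (hright X x b) = hright X (hleft X a x) b"

definition mor2 :: "'s topology \<Rightarrow> 't topology \<Rightarrow> ('s, 't, 'a) one_mor \<Rightarrow> ('s, 't, 'b) one_mor
    \<Rightarrow> ('a, 'b, 'x) corr \<Rightarrow> bool" where
  "mor2 S T M N X \<longleftrightarrow> correspondence (alg M) (alg N) X \<and>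
     (\<forall>f\<in>carrier (cfun_alg S). \<forall>x\<in>carrier X. hleft X (lmap M f) x = hright X x (lmap N f)) \<and>
     (\<forall>g\<in>carrier (cfun_alg T). \<forall>x\<in>carrier X. hleft X (rmap M g) x = hright X x (rmap N g))"

definition id_corr :: "'a cstar \<Rightarrow> ('a, 'a, 'a) corr" where
  "id_corr A = \<lparr>carrier = carrier A, mult = mult A, one = one A, zero = zero A, add = add A,
     smult = smult A, hleft = mult A, hright = mult A, hip = (\<lambda>x y. adj A x \<otimes>\<^bsub>A\<^esub> y)\<rparr>"

definition mor3 :: "'a cstar \<Rightarrow> 'b cstar \<Rightarrow> ('a, 'b, 'x) corr \<Rightarrow> ('a, 'b, 'z) corr
    \<Rightarrow> ('x \<Rightarrow> 'z) \<Rightarrow> bool" where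
  "mor3 A B X Z u \<longleftrightarrow> u ` carrier X \<subseteq> carrier Z \<and>
     (\<exists>v. v ` carrier Z \<subseteq> carrier X \<and>
        (\<forall>x\<in>carrier X. \<forall>z\<in>carrier Z. hip Z (u x) z = hip X x (v z))) \<and>
     (\<forall>a\<in>carrier A. \<forall>x\<in>carrier X. u (hleft X a x) = hleft Z a (u x)) \<and>
     (\<forall>b\<in>carrier B. \<forall>x\<in>carrier X. u (hright X x b) = hright Z (u x) b)"

definition iso3 :: "'a cstar \<Rightarrow> 'b cstar \<Rightarrow> ('a, 'b, 'x) corr \<Rightarrow> ('a, 'b, 'z) corr
    \<Rightarrow> ('x \<Rightarrow> 'z) \<Rightarrow> ('z \<Rightarrow> 'x) \<Rightarrow> bool" where
  "iso3 A B X Z u v \<longleftrightarrow> mor3 A B X Z u \<and> mor3 A B Z X v \<and>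
     (\<forall>x\<in>carrier X. v (u x) = x) \<and> (\<forall>z\<in>carrier Z. u (v z) = z)"

definition isomorphic3 :: "'a cstar \<Rightarrow> 'b cstar \<Rightarrow> ('a, 'b, 'x) corr \<Rightarrow> ('a, 'b, 'z) corr \<Rightarrow> bool"
  where "isomorphic3 A B X Z \<longleftrightarrow> (\<exists>u v. iso3 A B X Z u v)"


section \<open>Tensor products of correspondences\<close>

text \<open>Both tensor products are completions of the space of formal sums with respect to a
  semi-inner product with values in \<open>C\<close>, which is given on pairs by a kernel \<open>k\<close>. The operation
  \<open>lf a n\<close> (\<open>rg c n\<close>) is the action on formal sums of the \<open>n\<close>-th approximation of \<open>a\<close> (\<open>c\<close>).\<close>

definition pair_ip :: "'c cstar \<Rightarrow> ('x \<times> 'y \<Rightarrow> 'x \<times> 'y \<Rightarrow> 'c) \<Rightarrow> ('x \<times> 'y) list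
    \<Rightarrow> ('x \<times> 'y) list \<Rightarrow> 'c" where
  "pair_ip C k l l' = foldr (\<lambda>c s. c \<oplus>\<^bsub>C\<^esub> s) [k p q. p \<leftarrow> l, q \<leftarrow> l'] \<zero>\<^bsub>C\<^esub>"

definition pair_dist :: "'c cstar \<Rightarrow> ('x \<times> 'y \<Rightarrow> 'x \<times> 'y \<Rightarrow> 'c) \<Rightarrow> ('a, 'b, 'x) corr
    \<Rightarrow> ('x \<times> 'y) list \<Rightarrow> ('x \<times> 'y) list \<Rightarrow> real" where
  "pair_dist C k X l l' =
     (let m = l @ pair_scale X (-1) l' in sqrt (cnorm C (pair_ip C k m m)))"

definition pair_completion :: "'c cstar \<Rightarrow> ('x \<times> 'y \<Rightarrow> 'x \<times> 'y \<Rightarrow> 'c)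
    \<Rightarrow> ('a, 'b, 'x) corr \<Rightarrow> ('a', 'b', 'y) corr
    \<Rightarrow> ('l \<Rightarrow> nat \<Rightarrow> ('x \<times> 'y) list \<Rightarrow> ('x \<times> 'y) list)
    \<Rightarrow> ('c \<Rightarrow> nat \<Rightarrow> ('x \<times> 'y) list \<Rightarrow> ('x \<times> 'y) list)
    \<Rightarrow> ('l, 'c, (nat \<Rightarrow> ('x \<times> 'y) list) set) corr" where
  "pair_completion C k X Y lf rg =
     (let L = pair_lists X Y; d = pair_dist C k X; q = cauchy_class L d in
      \<lparr>carrier = completion L d, mult = undefined, one = undefined,
       zero = q (\<lambda>n. []),
       add = (\<lambda>z w. q (\<lambda>n. rep z n @ rep w n)),
       smult = (\<lambda>c z. q (\<lambda>n. pair_scale X c (rep z n))),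
       hleft = (\<lambda>a z. q (\<lambda>n. lf a n (rep z n))),
       hright = (\<lambda>z c. q (\<lambda>n. rg c n (rep z n))),
       hip = (\<lambda>z w. cstar_lim C (\<lambda>n. pair_ip C k (rep z n) (rep w n)))\<rparr>)"

definition rel_kernel :: "('a, 'b, 'x) corr \<Rightarrow> ('b, 'c, 'y) corr \<Rightarrow> 'x \<times> 'y \<Rightarrow> 'x \<times> 'y \<Rightarrow> 'c"
  where "rel_kernel X Y = (\<lambda>(x, y) (x', y'). hip Y y (hleft Y (hip X x x') y'))"

text \<open>The relative tensor product of an \<open>A\<close>-\<open>B\<close> and a \<open>B\<close>-\<open>C\<close> correspondence; \<open>A\<close> and \<open>B\<close> are
  not needed in the construction.\<close>

definition rel_tensor :: "'c cstar \<Rightarrow> ('a, 'b, 'x) corr \<Rightarrow> ('b, 'c, 'y) corr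
    \<Rightarrow> ('a, 'c, (nat \<Rightarrow> ('x \<times> 'y) list) set) corr" where
  "rel_tensor C X Y = pair_completion C (rel_kernel X Y) X Y
     (\<lambda>a n. map (\<lambda>(x, y). (hleft X a x, y)))
     (\<lambda>c n. map (\<lambda>(x, y). (x, hright Y y c)))"

text \<open>The tensor product of maps, where \<open>u\<close> and \<open>v\<close> are maps into \<open>X\<close> and \<open>Y\<close>.\<close>

definition rel_map :: "'c cstar \<Rightarrow> ('a, 'b, 'x) corr \<Rightarrow> ('b, 'c, 'y) corr
    \<Rightarrow> ('x0 \<Rightarrow> 'x) \<Rightarrow> ('y0 \<Rightarrow> 'y)
    \<Rightarrow> (nat \<Rightarrow> ('x0 \<times> 'y0) list) set \<Rightarrow> (nat \<Rightarrow> ('x \<times> 'y) list) set" where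
  "rel_map C X Y u v z = cauchy_class (pair_lists X Y) (pair_dist C (rel_kernel X Y) X)
     (\<lambda>n. map (\<lambda>(x, y). (u x, v y)) (rep z n))"

definition ext_kernel :: "'t topology \<Rightarrow> ('s, 't, 'c) one_mor \<Rightarrow> ('t, 'u, 'd) one_mor
    \<Rightarrow> ('a, 'c, 'x) corr \<Rightarrow> ('b, 'd, 'y) corr \<Rightarrow> 'x \<times> 'y \<Rightarrow> 'x \<times> 'y \<Rightarrow> ('c, 'd) bal" where
  "ext_kernel T M N X Y = (\<lambda>(x, y) (x', y'). bal_elem T M N (hip X x x') (hip Y y y'))"

text \<open>The \<open>C(T)\<close>-balanced external tensor product, where \<open>M\<close> and \<open>N\<close> are the targets of \<open>X\<close> and
  \<open>Y\<close>.\<close>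

definition ext_tensor :: "'t topology \<Rightarrow> ('s, 't, 'c) one_mor \<Rightarrow> ('t, 'u, 'd) one_mor
    \<Rightarrow> ('a, 'c, 'x) corr \<Rightarrow> ('b, 'd, 'y) corr
    \<Rightarrow> (('a, 'b) bal, ('c, 'd) bal, (nat \<Rightarrow> ('x \<times> 'y) list) set) corr" where
  "ext_tensor T M N X Y = pair_completion (bal_tensor T M N) (ext_kernel T M N X Y) X Y
     (\<lambda>u n l. [(hleft X a x, hleft Y b y). (a, b) \<leftarrow> bal_rep u n, (x, y) \<leftarrow> l])
     (\<lambda>u n l. [(hright X x c, hright Y y d). (x, y) \<leftarrow> l, (c, d) \<leftarrow> bal_rep u n])"

definition ext_map :: "'t topology \<Rightarrow> ('s, 't, 'c) one_mor \<Rightarrow> ('t, 'u, 'd) one_mor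
    \<Rightarrow> ('a, 'c, 'x) corr \<Rightarrow> ('b, 'd, 'y) corr \<Rightarrow> ('x0 \<Rightarrow> 'x) \<Rightarrow> ('y0 \<Rightarrow> 'y)
    \<Rightarrow> (nat \<Rightarrow> ('x0 \<times> 'y0) list) set \<Rightarrow> (nat \<Rightarrow> ('x \<times> 'y) list) set" where
  "ext_map T M N X Y u v z =
     cauchy_class (pair_lists X Y) (pair_dist (bal_tensor T M N) (ext_kernel T M N X Y) X)
       (\<lambda>n. map (\<lambda>(x, y). (u x, v y)) (rep z n))"


section \<open>Invertibility and the actions of the first homotopy group\<close>

text \<open>Inverses are passed as parameters, because an existential quantifier could only range over
  correspondences or algebras of one fixed type.\<close>

definition inverse2 :: "'s topology \<Rightarrow> 't topology \<Rightarrow> ('s, 't, 'a) one_mor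
    \<Rightarrow> ('s, 't, 'b) one_mor \<Rightarrow> ('a, 'b, 'x) corr \<Rightarrow> ('b, 'a, 'x') corr \<Rightarrow> bool" where
  "inverse2 S T M N X X' \<longleftrightarrow> mor2 S T M N X \<and> mor2 S T N M X' \<and>
     isomorphic3 (alg M) (alg M) (rel_tensor (alg M) X X') (id_corr (alg M)) \<and>
     isomorphic3 (alg N) (alg N) (rel_tensor (alg N) X' X) (id_corr (alg N))"

text \<open>\<open>N\<close> is an inverse of \<open>M\<close>, as witnessed by the 2-isomorphisms \<open>V\<close> and \<open>W\<close>.\<close>

definition inverse1 :: "'s topology \<Rightarrow> 't topology \<Rightarrow> ('s, 't, 'a) one_mor
    \<Rightarrow> ('t, 's, 'b) one_mor
    \<Rightarrow> (('a, 'b) bal, 's \<Rightarrow> complex, 'v) corr \<Rightarrow> ('s \<Rightarrow> complex, ('a, 'b) bal, 'v') corr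
    \<Rightarrow> (('b, 'a) bal, 't \<Rightarrow> complex, 'w) corr \<Rightarrow> ('t \<Rightarrow> complex, ('b, 'a) bal, 'w') corr
    \<Rightarrow> bool" where
  "inverse1 S T M N V V' W W' \<longleftrightarrow> mor1 S T M \<and> mor1 T S N \<and>
     inverse2 S S (mor1_comp T M N) (mor1_id S) V V' \<and>
     inverse2 T T (mor1_comp S N M) (mor1_id T) W W'"

text \<open>The composite \<open>M \<otimes>\<^sub>T C(T) \<otimes>\<^sub>T N\<close>, bracketed to the left.\<close>

abbreviation conj_mor1 :: "'t topology \<Rightarrow> ('t, 't, 'a) one_mor \<Rightarrow> ('t, 't, 'b) one_mor
    \<Rightarrow> ('t, 't, (('a, 't \<Rightarrow> complex) bal, 'b) bal) one_mor" where
  "conj_mor1 T M N \<equiv> mor1_comp T (mor1_comp T M (mor1_id T)) N"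

definition conj_corr :: "'t topology \<Rightarrow> ('t, 't, 'a) one_mor \<Rightarrow> ('t, 't, 'b) one_mor
    \<Rightarrow> ('t \<Rightarrow> complex, 't \<Rightarrow> complex, 'x) corr
    \<Rightarrow> ((('a, 't \<Rightarrow> complex) bal, 'b) bal, (('a, 't \<Rightarrow> complex) bal, 'b) bal,
        (nat \<Rightarrow> ((nat \<Rightarrow> ('a \<times> 'x) list) set \<times> 'b) list) set) corr" where
  "conj_corr T M N X = ext_tensor T (mor1_comp T M (mor1_id T)) N
     (ext_tensor T M (mor1_id T) (id_corr (alg M)) X) (id_corr (alg N))"

definition conj_map :: "'t topology \<Rightarrow> ('t, 't, 'a) one_mor \<Rightarrow> ('t, 't, 'b) one_mor
    \<Rightarrow> ('t \<Rightarrow> complex, 't \<Rightarrow> complex, 'x) corr \<Rightarrow> ('x \<Rightarrow> 'x)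
    \<Rightarrow> (nat \<Rightarrow> ((nat \<Rightarrow> ('a \<times> 'x) list) set \<times> 'b) list) set
    \<Rightarrow> (nat \<Rightarrow> ((nat \<Rightarrow> ('a \<times> 'x) list) set \<times> 'b) list) set" where
  "conj_map T M N X u = ext_map T (mor1_comp T M (mor1_id T)) N
     (ext_tensor T M (mor1_id T) (id_corr (alg M)) X) (id_corr (alg N))
     (ext_map T M (mor1_id T) (id_corr (alg M)) X (\<lambda>a. a) u) (\<lambda>b. b)"

text \<open>The action of \<open>M\<close> on \<open>X\<close>, for \<open>N\<close> inverse to \<open>M\<close> and \<open>Y'\<close> inverse to
  \<open>Y : M \<otimes>\<^sub>T C(T) \<otimes>\<^sub>T N \<Rightarrow> C(T)\<close>.\<close>

definition act2 where
  "act2 T M N Y Y' X = rel_tensor (cfun_alg T)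
     (rel_tensor (alg (conj_mor1 T M N)) Y' (conj_corr T M N X)) Y"

text \<open>The 3-automorphism of the action of \<open>M\<close> on \<open>X\<close> induced by a 3-automorphism \<open>u\<close> of \<open>X\<close>.\<close>

definition act3 where
  "act3 T M N Y Y' X u = rel_map (cfun_alg T)
     (rel_tensor (alg (conj_mor1 T M N)) Y' (conj_corr T M N X)) Y
     (rel_map (alg (conj_mor1 T M N)) Y' (conj_corr T M N X) (\<lambda>y. y) (conj_map T M N X u))
     (\<lambda>y. y)"


section \<open>Line bundles\<close>

record ('t, 'e) cbundle =
  tspace :: "'e topology"
  proj :: "'e \<Rightarrow> 't"
  fadd :: "'e \<Rightarrow> 'e \<Rightarrow> 'e"
  fscale :: "complex \<Rightarrow> 'e \<Rightarrow> 'e"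

text \<open>The local trivialisations make the fibres one-dimensional vector spaces, so that the vector
  space axioms need not be stated separately.\<close>

definition line_bundle :: "'t topology \<Rightarrow> ('t, 'e) cbundle \<Rightarrow> bool" where
  "line_bundle T E \<longleftrightarrow> continuous_map (tspace E) T (proj E) \<and>
     (\<forall>t\<in>topspace T. \<exists>U \<kappa>. openin T U \<and> t \<in> U \<and>
        homeomorphic_map (prod_topology (subtopology T U) (euclidean :: complex topology))
          (subtopology (tspace E) {e. proj E e \<in> U}) \<kappa> \<and>
        (\<forall>x\<in>U. \<forall>z w. proj E (\<kappa> (x, z)) = x \<and>
           fadd E (\<kappa> (x, z)) (\<kappa> (x, w)) = \<kappa> (x, z + w) \<and>
           fscale E w (\<kappa> (x, z)) = \<kappa> (x, w * z)))"

definition pullback_bundle :: "'s topology \<Rightarrow> ('s \<Rightarrow> 't) \<Rightarrow> ('t, 'e) cbundle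
    \<Rightarrow> ('s, 's \<times> 'e) cbundle" where
  "pullback_bundle S \<Psi> E = \<lparr>
     tspace = subtopology (prod_topology S (tspace E)) {(s, e). \<Psi> s = proj E e},
     proj = fst,
     fadd = (\<lambda>(s, e) (s', e'). (s, fadd E e e')),
     fscale = (\<lambda>c (s, e). (s, fscale E c e))\<rparr>"

definition hermitian_metric :: "('t, 'e) cbundle \<Rightarrow> ('e \<Rightarrow> 'e \<Rightarrow> complex) \<Rightarrow> bool" where
  "hermitian_metric E h \<longleftrightarrow>
     continuous_map (subtopology (prod_topology (tspace E) (tspace E)) {(e, e'). proj E e = proj E e'})
       euclidean (\<lambda>(e, e'). h e e') \<and>
     (\<forall>e\<in>topspace (tspace E). \<forall>e'\<in>topspace (tspace E). proj E e = proj E e' \<longrightarrow>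
        h e' e = cnj (h e e') \<and> (\<forall>c. h e (fscale E c e') = c * h e e') \<and>
        (\<forall>e''\<in>topspace (tspace E). proj E e'' = proj E e \<longrightarrow>
           h e (fadd E e' e'') = h e e' + h e e'')) \<and>
     (\<forall>e\<in>topspace (tspace E). e \<noteq> fscale E 0 e \<longrightarrow> 0 < Re (h e e))"

definition sections :: "'t topology \<Rightarrow> ('t, 'e) cbundle \<Rightarrow> ('t \<Rightarrow> 'e) set" where
  "sections T E = {s \<in> extensional (topspace T). continuous_map T (tspace E) s \<and>
     (\<forall>t\<in>topspace T. proj E (s t) = t)}"

definition section_corr :: "'t topology \<Rightarrow> ('t, 'e) cbundle \<Rightarrow> ('e \<Rightarrow> 'e \<Rightarrow> complex)
    \<Rightarrow> ('t \<Rightarrow> complex, 't \<Rightarrow> complex, 't \<Rightarrow> 'e) corr" where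
  "section_corr T E h = \<lparr>carrier = sections T E, mult = undefined, one = undefined,
     zero = (\<lambda>t\<in>topspace T. fscale E 0 (SOME e. e \<in> topspace (tspace E) \<and> proj E e = t)),
     add = (\<lambda>s s'. \<lambda>t\<in>topspace T. fadd E (s t) (s' t)),
     smult = (\<lambda>c s. \<lambda>t\<in>topspace T. fscale E c (s t)),
     hleft = (\<lambda>f s. \<lambda>t\<in>topspace T. fscale E (f t) (s t)),
     hright = (\<lambda>s f. \<lambda>t\<in>topspace T. fscale E (f t) (s t)),
     hip = (\<lambda>s s'. \<lambda>t\<in>topspace T. h (s t) (s' t))\<rparr>"


section \<open>Cech cohomology with integer coefficients\<close>

text \<open>Open covers are indexed by themselves, which suffices for the direct limit over refinements.
  A cochain on \<open>\<U>\<close> assigns to a list of \<open>n + 1\<close> members of \<open>\<U>\<close> a locally constant function on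
  their intersection.\<close>

definition open_cover :: "'t topology \<Rightarrow> 't set set \<Rightarrow> bool" where
  "open_cover T \<U> \<longleftrightarrow> (\<forall>U\<in>\<U>. openin T U) \<and> \<Union>\<U> = topspace T"

definition simplices :: "nat \<Rightarrow> 't set set \<Rightarrow> 't set list set" where
  "simplices n \<U> = {l. length l = Suc n \<and> set l \<subseteq> \<U>}"

definition cobd :: "('t set list \<Rightarrow> 't \<Rightarrow> 'r::comm_ring_1) \<Rightarrow> 't set list \<Rightarrow> 't \<Rightarrow> 'r" where
  "cobd c l t = (\<Sum>k<length l. (-1) ^ k * c (take k l @ drop (Suc k) l) t)"

definition cech_cochain :: "'t topology \<Rightarrow> nat \<Rightarrow> 't set set \<Rightarrow> ('t set list \<Rightarrow> 't \<Rightarrow> int) \<Rightarrow> bool"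
  where "cech_cochain T n \<U> c \<longleftrightarrow>
     (\<forall>l\<in>simplices n \<U>. continuous_map (subtopology T (\<Inter>(set l))) (discrete_topology UNIV) (c l))"

type_synonym 't cech = "'t set set \<times> ('t set list \<Rightarrow> 't \<Rightarrow> int)"

definition cech_cocycles :: "'t topology \<Rightarrow> nat \<Rightarrow> 't cech set" where
  "cech_cocycles T n = {(\<U>, c). open_cover T \<U> \<and> cech_cochain T n \<U> c \<and>
     (\<forall>l\<in>simplices (Suc n) \<U>. \<forall>t\<in>\<Inter>(set l). cobd c l t = 0)}"

definition cech_rel :: "'t topology \<Rightarrow> nat \<Rightarrow> 't cech \<Rightarrow> 't cech \<Rightarrow> bool" where
  "cech_rel T n = (\<lambda>(\<U>, c) (\<V>, c'). \<exists>\<W> r s b. open_cover T \<W> \<and>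
     (\<forall>W\<in>\<W>. r W \<in> \<U> \<and> W \<subseteq> r W \<and> s W \<in> \<V> \<and> W \<subseteq> s W) \<and>
     (if n = 0 then b = (\<lambda>l t. 0) else cech_cochain T (n - 1) \<W> b) \<and>
     (\<forall>l\<in>simplices n \<W>. \<forall>t\<in>\<Inter>(set l). c (map r l) t - c' (map s l) t = cobd b l t))"

definition cech_class :: "'t topology \<Rightarrow> nat \<Rightarrow> 't cech \<Rightarrow> 't cech set" where
  "cech_class T n x = {y \<in> cech_cocycles T n. cech_rel T n x y}"

definition cech_H :: "'t topology \<Rightarrow> nat \<Rightarrow> 't cech set set" where
  "cech_H T n = cech_class T n ` cech_cocycles T n"

definition cech_H_tor :: "'t topology \<Rightarrow> nat \<Rightarrow> 't cech set set" where
  "cech_H_tor T n = {\<omega> \<in> cech_H T n. \<exists>(\<U>, c)\<in>\<omega>. \<exists>m::nat. 0 < m \<and>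
     cech_rel T n (\<U>, \<lambda>l t. int m * c l t) (\<U>, \<lambda>l t. 0)}"

definition cech_pullback :: "'s topology \<Rightarrow> ('s \<Rightarrow> 't) \<Rightarrow> nat \<Rightarrow> 't cech set \<Rightarrow> 's cech set" where
  "cech_pullback S \<Psi> n \<omega> = \<Union>{cech_class S n (\<W>, \<lambda>l s. c (map r l) (\<Psi> s)) |\<W> c r \<U>.
     (\<U>, c) \<in> \<omega> \<and> open_cover S \<W> \<and> (\<forall>W\<in>\<W>. r W \<in> \<U> \<and> \<Psi> ` W \<subseteq> r W)}"

text \<open>The first Chern class is the image of the class of the transition functions
  \<open>g\<^sub>U\<^sub>V = exp (2 \<pi> i h\<^sub>U\<^sub>V)\<close>, where \<open>e\<^sub>V = g\<^sub>U\<^sub>V e\<^sub>U\<close> for local frames \<open>e\<close>, under the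
  connecting map of the exponential sequence. It is the union over all choices, which give the
  same class. All transition functions have a logarithm once the cover is fine enough.\<close>

definition chern_cocycles :: "'t topology \<Rightarrow> ('t, 'e) cbundle \<Rightarrow> 't cech set" where
  "chern_cocycles T E = {(\<U>, c) \<in> cech_cocycles T 2. \<exists>e h.
     (\<forall>U\<in>\<U>. continuous_map (subtopology T U) (tspace E) (e U) \<and>
        (\<forall>t\<in>U. proj E (e U t) = t \<and> e U t \<noteq> fscale E 0 (e U t))) \<and>
     (\<forall>U\<in>\<U>. \<forall>V\<in>\<U>. continuous_map (subtopology T (U \<inter> V)) euclidean (h [U, V]) \<and>
        (\<forall>t\<in>U \<inter> V. e V t = fscale E (exp (2 * complex_of_real pi * \<i> * h [U, V] t)) (e U t))) \<and>
     (\<forall>l\<in>simplices 2 \<U>. \<forall>t\<in>\<Inter>(set l). of_int (c l t) = cobd h l t)}"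

definition chern_class :: "'t topology \<Rightarrow> ('t, 'e) cbundle \<Rightarrow> 't cech set" where
  "chern_class T E = \<Union>(cech_class T 2 ` chern_cocycles T E)"


section \<open>Continuous-trace algebras and their Dixmier--Douady class\<close>

text \<open>Representations on Hilbert spaces are correspondences to the complex numbers. Every
  irreducible representation of \<open>A\<close> is equivalent to one on a quotient of \<open>A\<close> by a left ideal, so
  Hilbert spaces with elements of type \<open>'a set\<close> suffice to describe the spectrum.\<close>

type_synonym 'a hrep = "('a, complex, 'a set) corr"

definition irrep :: "'a cstar \<Rightarrow> 'a hrep \<Rightarrow> bool" where
  "irrep A H \<longleftrightarrow> correspondence A complex_alg H \<and>
     (\<forall>x\<in>carrier H. hleft H \<one>\<^bsub>A\<^esub> x = x) \<and> carrier H \<noteq> {\<zero>\<^bsub>H\<^esub>} \<and>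
     (\<forall>K\<subseteq>carrier H. \<zero>\<^bsub>H\<^esub> \<in> K \<and> (\<forall>x\<in>K. \<forall>y\<in>K. x \<oplus>\<^bsub>H\<^esub> y \<in> K) \<and>
        (\<forall>x\<in>K. (\<forall>c. c \<odot>\<^bsub>H\<^esub> x \<in> K) \<and> (\<forall>a\<in>carrier A. hleft H a x \<in> K)) \<and>
        (\<forall>s. \<forall>x\<in>carrier H. (\<forall>n. s n \<in> K) \<and>
           (\<lambda>n. hnorm complex_alg H (s n \<ominus>\<^bsub>H\<^esub> x)) \<longlonglongrightarrow> 0 \<longrightarrow> x \<in> K) \<longrightarrow>
        K = {\<zero>\<^bsub>H\<^esub>} \<or> K = carrier H)"

definition unitarily_equivalent :: "'a cstar \<Rightarrow> 'a hrep \<Rightarrow> 'a hrep \<Rightarrow> bool" where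
  "unitarily_equivalent A H K \<longleftrightarrow> (\<exists>u. bij_betw u (carrier H) (carrier K) \<and>
     (\<forall>x\<in>carrier H. \<forall>y\<in>carrier H. u (x \<oplus>\<^bsub>H\<^esub> y) = u x \<oplus>\<^bsub>K\<^esub> u y \<and> hip K (u x) (u y) = hip H x y) \<and>
     (\<forall>x\<in>carrier H. (\<forall>c. u (c \<odot>\<^bsub>H\<^esub> x) = c \<odot>\<^bsub>K\<^esub> u x) \<and>
        (\<forall>a\<in>carrier A. u (hleft H a x) = hleft K a (u x))))"

text \<open>\<open>\<sigma>\<close> induces a homeomorphism from the spectrum of \<open>A\<close>, with its Jacobson topology, to \<open>T\<close>.\<close>

definition spectrum_map :: "'t topology \<Rightarrow> 'a cstar \<Rightarrow> ('a hrep \<Rightarrow> 't) \<Rightarrow> bool" where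
  "spectrum_map T A \<sigma> \<longleftrightarrow> \<sigma> ` {H. irrep A H} = topspace T \<and>
     (\<forall>H K. irrep A H \<and> irrep A K \<longrightarrow> (\<sigma> H = \<sigma> K \<longleftrightarrow> unitarily_equivalent A H K)) \<and>
     (\<forall>U\<subseteq>topspace T. openin T U \<longleftrightarrow> (\<exists>J. closed_ideal A J \<and>
        (\<forall>H. irrep A H \<longrightarrow> (\<sigma> H \<in> U \<longleftrightarrow> (\<exists>a\<in>J. \<exists>x\<in>carrier H. hleft H a x \<noteq> \<zero>\<^bsub>H\<^esub>)))))"

definition rank_one_at :: "'a hrep \<Rightarrow> 'a \<Rightarrow> bool" where
  "rank_one_at H p \<longleftrightarrow> (\<exists>\<xi>\<in>carrier H. hip H \<xi> \<xi> = 1 \<and>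
     (\<forall>x\<in>carrier H. hleft H p x = hip H \<xi> x \<odot>\<^bsub>H\<^esub> \<xi>))"

text \<open>Hausdorff spectrum together with Fell's condition on local rank-one projections.\<close>

definition continuous_trace :: "'t topology \<Rightarrow> 'a cstar \<Rightarrow> ('a hrep \<Rightarrow> 't) \<Rightarrow> bool" where
  "continuous_trace T A \<sigma> \<longleftrightarrow> cstar_algebra A \<and> Hausdorff_space T \<and> spectrum_map T A \<sigma> \<and>
     (\<forall>t\<in>topspace T. \<exists>U p. openin T U \<and> t \<in> U \<and> p \<in> carrier A \<and>
        (\<forall>H. irrep A H \<and> \<sigma> H \<in> U \<longrightarrow> rank_one_at H p))"

text \<open>The cocycle \<open>\<nu>\<close> with values in the circle comes from local rank-one projections \<open>p\<^sub>U\<close> and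
  partial isometries \<open>v\<^sub>U\<^sub>V\<close> from \<open>p\<^sub>V\<close> to \<open>p\<^sub>U\<close> by \<open>v\<^sub>U\<^sub>V v\<^sub>V\<^sub>W = \<nu>\<^sub>U\<^sub>V\<^sub>W v\<^sub>U\<^sub>W\<close>; its image
  under the connecting map is the coboundary of \<open>\<rho>\<close>, where \<open>\<nu> = exp (2 \<pi> i \<rho>)\<close>. Identities over
  an open set are imposed in all irreducible representations over that set.\<close>

definition dd_cocycles :: "'t topology \<Rightarrow> 'a cstar \<Rightarrow> ('a hrep \<Rightarrow> 't) \<Rightarrow> 't cech set" where
  "dd_cocycles T A \<sigma> = {(\<U>, c) \<in> cech_cocycles T 3. \<exists>p v \<rho>.
     (\<forall>U\<in>\<U>. p U \<in> carrier A \<and> (\<forall>H. irrep A H \<and> \<sigma> H \<in> U \<longrightarrow> rank_one_at H (p U))) \<and>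
     (\<forall>U\<in>\<U>. \<forall>V\<in>\<U>. v U V \<in> carrier A \<and>
        (\<forall>H. irrep A H \<and> \<sigma> H \<in> U \<inter> V \<longrightarrow> (\<forall>x\<in>carrier H.
           hleft H (adj A (v U V) \<otimes>\<^bsub>A\<^esub> v U V) x = hleft H (p V) x \<and>
           hleft H (v U V \<otimes>\<^bsub>A\<^esub> adj A (v U V)) x = hleft H (p U) x))) \<and>
     (\<forall>U\<in>\<U>. \<forall>V\<in>\<U>. \<forall>W\<in>\<U>.
        continuous_map (subtopology T (U \<inter> V \<inter> W)) euclideanreal (\<rho> [U, V, W]) \<and>
        (\<forall>H. irrep A H \<and> \<sigma> H \<in> U \<inter> V \<inter> W \<longrightarrow> (\<forall>x\<in>carrier H.
           hleft H (v U V \<otimes>\<^bsub>A\<^esub> v V W) x =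
             exp (2 * complex_of_real (pi * \<rho> [U, V, W] (\<sigma> H)) * \<i>) \<odot>\<^bsub>H\<^esub> hleft H (v U W) x))) \<and>
     (\<forall>l\<in>simplices 3 \<U>. \<forall>t\<in>\<Inter>(set l). of_int (c l t) = cobd \<rho> l t)}"

definition dd_class :: "'t topology \<Rightarrow> 'a cstar \<Rightarrow> ('a hrep \<Rightarrow> 't) \<Rightarrow> 't cech set" where
  "dd_class T A \<sigma> = \<Union>(cech_class T 3 ` dd_cocycles T A \<sigma>)"

text \<open>\<open>M\<close> is given by a unital continuous-trace algebra with spectrum \<open>T\<close> and Dixmier--Douady class
  \<open>\<omega>\<close>, whose centre is identified with \<open>C(T)\<close> by the Dauns--Hofmann isomorphism.\<close>

definition dd_mor1 :: "'t topology \<Rightarrow> 't cech set \<Rightarrow> ('t, 't, 'a) one_mor \<Rightarrow> bool" where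
  "dd_mor1 T \<omega> M \<longleftrightarrow> mor1 T T M \<and> rmap M = lmap M \<and>
     bij_betw (lmap M) (carrier (cfun_alg T)) (center (alg M)) \<and>
     (\<exists>\<sigma>. continuous_trace T (alg M) \<sigma> \<and> dd_class T (alg M) \<sigma> = \<omega> \<and>
        (\<forall>f\<in>carrier (cfun_alg T). \<forall>H. irrep (alg M) H \<longrightarrow>
           (\<forall>x\<in>carrier H. hleft H (lmap M f) x = f (\<sigma> H) \<odot>\<^bsub>H\<^esub> x)))"

definition homeo_mor1 :: "'t topology \<Rightarrow> ('t \<Rightarrow> 't) \<Rightarrow> ('t, 't, 't \<Rightarrow> complex) one_mor" where
  "homeo_mor1 T \<Phi> = \<lparr>alg = cfun_alg T, lmap = (\<lambda>f. \<lambda>t\<in>topspace T. f (\<Phi> t)), rmap = (\<lambda>f. f)\<rparr>"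


section \<open>CW-complexes\<close>

definition disc :: "nat \<Rightarrow> (nat \<Rightarrow> real) topology" where
  "disc n = subtopology (Euclidean_space n) {x. (\<Sum>i<n. (x i)\<^sup>2) \<le> 1}"

definition open_disc :: "nat \<Rightarrow> (nat \<Rightarrow> real) set" where
  "open_disc n = {x \<in> topspace (disc n). (\<Sum>i<n. (x i)\<^sup>2) < 1}"

text \<open>A cell is given by its dimension and its characteristic map.\<close>

definition CW_complex :: "'k topology \<Rightarrow> bool" where
  "CW_complex K \<longleftrightarrow> Hausdorff_space K \<and> (\<exists>C :: (nat \<times> ((nat \<Rightarrow> real) \<Rightarrow> 'k)) set.
     (\<forall>(n, \<kappa>)\<in>C. continuous_map (disc n) K \<kappa> \<and>
        homeomorphic_map (subtopology (disc n) (open_disc n)) (subtopology K (\<kappa> ` open_disc n)) \<kappa> \<and>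
        (\<exists>F\<subseteq>{(m, \<theta>)\<in>C. m < n}. finite F \<and>
           \<kappa> ` (topspace (disc n) - open_disc n) \<subseteq> (\<Union>(m, \<theta>)\<in>F. \<theta> ` open_disc m))) \<and>
     pairwise (\<lambda>(n, \<kappa>) (m, \<theta>). disjnt (\<kappa> ` open_disc n) (\<theta> ` open_disc m)) C \<and>
     (\<Union>(n, \<kappa>)\<in>C. \<kappa> ` open_disc n) = topspace K \<and>
     (\<forall>S\<subseteq>topspace K. closedin K S \<longleftrightarrow>
        (\<forall>(n, \<kappa>)\<in>C. closedin (disc n) {x \<in> topspace (disc n). \<kappa> x \<in> S})))"

end

theory Submission
 imports Defs
begin

text \<open>Invertible correspondences are faithful, so \<open>P\<close> forces the right central map of \<open>A\<close> to be the left one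
precomposed with \<open>f \<mapsto> f \<circ> \<Phi>inv\<close>. If \<open>X\<close> has a finite frame, every tensor product formed on the way to the
conjugate of \<open>X\<close> consists of coordinate vectors with respect to that frame. Pairing \<open>Yinv\<close> with \<open>Y\<close> turns
the coordinates into functions on \<open>T\<close>, and the conjugate becomes \<open>X\<close> with scalars transported along \<open>\<Phi>\<close>:
the sections of the pullback bundle. Adjointable isomorphisms of section modules are local, hence carry
local frames to local frames with the same transition cocycle; this gives the Chern class.\<close>

text \<open>The obstacle is how little a tensor product provides by definition: it is a set of
  classes of Cauchy sequences of formal sums, with neither positivity of its form nor completeness,
  and a 3-isomorphism is adjointable but not isometric. Realising a completion inside a power of a
  module already known to be a Hilbert module settles positivity and completeness at once; the frame
  needed for this comes from \<open>rank_one\<close> and compactness. That a balanced tensor product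
  is a C*-algebra is proved only for balancing with \<open>C(T)\<close>, where the product is a copy
  of the other factor; for the next factor it is part of \<open>Y\<close> being a 2-morphism. The
  product of \<open>Yinv\<close> and \<open>Y\<close> has no frame to start from, so positivity is
  proved there from the C*-axioms, and the isomorphism with \<open>C(T)\<close> is rescaled to a
  factorisation \<open>cnj (W p) * W r\<close> of the kernel. The missing isometry costs a positive
  function at that point and a ratio of metrics in the comparison with sections.\<close>

lemma complex_alg_simps [simp]:
 "carrier complex_alg=UNIV" "mult complex_alg=(*)" "one complex_alg=1"
 "zero complex_alg=0" "add complex_alg=(+)" "smult complex_alg=(*)"
 "adj complex_alg=cnj" "cnorm complex_alg=cmod"
 by (simp_all add: complex_alg_def)

lemma cring_complex_alg: "cring complex_alg"
 by (rule cringI; (rule abelian_groupI comm_monoidI)?)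
   (auto simp: algebra_simps intro: exI[of _ "- x" for x])

abbreviation tends (infixr "\<leadsto>" 60) where "f \<leadsto> (l :: 'a :: topological_space)\<equiv>f\<longlonglongrightarrow>l"

section \<open>Complex normed modules and limits of sequences\<close>

locale cnormed = Module.module complex_alg X for X :: "(complex, 'x, 'm) module_scheme" (structure) +
 fixes N :: "'x=>real"
 assumes N_nonneg: "x:carrier X==>0<=N x"
  and N_eq_0: "x:carrier X==>N x=0\<longleftrightarrow>x=\<zero>"
  and N_add: "[|x:carrier X; y:carrier X|]==>N (x\<oplus>y)<=N x + N y"
  and N_smult: "x:carrier X==>N (c\<odot>x)=cmod c * N x"
  and N_complete: "cauchy_in (carrier X) (%x y. N (x\<ominus>y)) s ==>
   \<exists>x\<in>carrier X. (%n. N (s n\<ominus>x)) \<leadsto> 0"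
begin

lemma sm_closed [simp]: "x:carrier X==>c\<odot>x:carrier X"
 using smult_closed by simp

lemma sm_add_left: "x:carrier X==>(c + d)\<odot>x=c\<odot>x\<oplus>d\<odot>x"
 using smult_l_distr by simp

lemma sm_add_right: "[|x:carrier X; y:carrier X|]==>c\<odot>(x\<oplus>y)=c\<odot>x\<oplus>c\<odot>y"
 using smult_r_distr by simp

lemma sm_assoc: "x:carrier X==>c\<odot>(d\<odot>x)=(c * d)\<odot>x"
 using smult_assoc1 by simp

lemma sm_one [simp]: "x:carrier X==>1\<odot>x=x"
 using smult_one by simp

lemma sm_0 [simp]: "x:carrier X==>0\<odot>x=\<zero>"
 using smult_l_null by simp

lemma sm_zero [simp]: "c\<odot>\<zero>=\<zero>"
 using smult_r_null by simp

lemmas add_assoc = a_assoc and add_comm = a_comm and add_ac = add.m_ac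

lemma minus_conv: "x:carrier X==>\<ominus>x=(- 1)\<odot>x"
 using smult_l_minus[of 1 x] by simp
  (metis UNIV_I add.inv_closed add.m_comm add.inv_equality complex_alg_simps(1) eq_neg_iff_add_eq_0 sm_0 sm_add_left sm_closed sm_one)

lemma diff_conv: "[|x:carrier X; y:carrier X|]==>x\<ominus>y=x\<oplus>(- 1)\<odot>y"
 by (simp add: minus_eq minus_conv)

lemma cancel_left [simp]:
 "x:carrier X==>(- 1)\<odot>x\<oplus>x=\<zero>" "x:carrier X==>x\<oplus>(- 1)\<odot>x=\<zero>"
 "[|x:carrier X; z:carrier X|]==>(- 1)\<odot>x\<oplus>(x\<oplus>z)=z"
 "[|x:carrier X; z:carrier X|]==>x\<oplus>((- 1)\<odot>x\<oplus>z)=z"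
 using l_neg[of x] r_neg[of x] by (simp_all flip: minus_conv add: a_assoc[symmetric])

lemma diff_closed [simp]: "[|x:carrier X; y:carrier X|]==>x\<ominus>y:carrier X"
 by simp

lemma diff_self [simp]: "x:carrier X==>x\<ominus>x=\<zero>"
 by (simp add: minus_eq r_neg)

lemma diff_eq_0: "[|x:carrier X; y:carrier X|]==>x\<ominus>y=\<zero>\<longleftrightarrow>x=y"
 by (metis a_minus_def add.inv_closed minus_equality minus_minus r_neg)

lemma diff_add_diff: "[|x:carrier X; y:carrier X; z:carrier X|]
==>(x\<ominus>y)\<oplus>(y\<ominus>z)=x\<ominus>z"
 by (simp add: minus_eq a_assoc) (metis add.inv_closed add.m_assoc l_neg l_zero)

lemma diff_add_cancel: "[|x:carrier X; y:carrier X|]==>(x\<ominus>y)\<oplus>y=x"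
 by (simp add: minus_eq a_assoc l_neg)

lemma sm_diff_right: "[|x:carrier X; y:carrier X|]==>c\<odot>(x\<ominus>y)=c\<odot>x\<ominus>c\<odot>y"
 by (simp add: diff_conv sm_add_right sm_assoc)

lemma diff_add_add: "[|x:carrier X; y:carrier X; x':carrier X; y':carrier X|]
==>(x\<oplus>y)\<ominus>(x'\<oplus>y')=(x\<ominus>x')\<oplus>(y\<ominus>y')"
 by (simp add: diff_conv sm_add_right add.m_ac)

lemma N_zero [simp]: "N \<zero>=0"
 using N_eq_0 by simp

lemma N_minus [simp]: "x:carrier X==>N (\<ominus>x)=N x"
 by (simp add: minus_conv N_smult)

lemma N_diff_commute: "[|x:carrier X; y:carrier X|]==>N (x\<ominus>y)=N (y\<ominus>x)"
 using N_smult[of "y\<ominus>x" "-1"] by (simp add: diff_conv sm_add_right sm_assoc a_comm)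

lemma N_diff_triangle: "[|x:carrier X; y:carrier X; z:carrier X|]
==>N (x\<ominus>z)<=N (x\<ominus>y) + N (y\<ominus>z)"
 using N_add[of "x\<ominus>y" "y\<ominus>z"] by (simp add: diff_add_diff)

lemma N_le_diff: "[|x:carrier X; y:carrier X|]==>N x<=N (x\<ominus>y) + N y"
 using N_add[of "x\<ominus>y" y] by (simp add: diff_add_cancel)

lemma N_abs_diff: "[|x:carrier X; y:carrier X|]==>\<bar>N x - N y\<bar><=N (x\<ominus>y)"
 using N_le_diff[of x y] N_le_diff[of y x] by (simp add: N_diff_commute abs_le_iff)

text \<open>Membership of the terms and of the limit is built in, so that a convergence statement
  also discharges the closure conditions of later steps.\<close>

definition lim_to :: "(nat=>'x)=>'x=>bool" where
 "lim_to s x\<longleftrightarrow>(\<forall>n. s n:carrier X)&x:carrier X&(%n. N (s n\<ominus>x)) \<leadsto> 0"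

lemma lim_toD: "lim_to s x==>s n:carrier X" "lim_to s x==>x:carrier X"
 "lim_to s x==>(%n. N (s n\<ominus>x)) \<leadsto> 0"
 by (auto simp: lim_to_def)

lemma lim_to_bound:
 assumes "!!n. s n:carrier X" "x:carrier X" "!!n. N (s n\<ominus>x)<=e n" "e \<leadsto> 0"
 shows "lim_to s x"
 unfolding lim_to_def using assms(1-3)
 by (auto intro!: tendsto_sandwich[OF _ _ tendsto_const assms(4)] always_eventually N_nonneg diff_closed)

lemma lim_to_const: "x:carrier X==>lim_to (%n. x) x"
 by (simp add: lim_to_def)

lemma lim_to_unique:
 assumes "lim_to s x" "lim_to s y" shows "x=y"
proof -
 note c = lim_toD[OF assms(1)] lim_toD[OF assms(2)]
 have "N (x\<ominus>y)<=N (s n\<ominus>x) + N (s n\<ominus>y)" for n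
  using N_diff_triangle[of x "s n" y] c N_diff_commute[of x "s n"] by auto
 moreover have "(%n. N (s n\<ominus>x) + N (s n\<ominus>y)) \<leadsto> 0"
  using tendsto_add[OF c(3) c(6)] by simp
 ultimately have "N (x\<ominus>y)<=0"
  by (meson LIMSEQ_le_const)
 then show ?thesis
  using N_nonneg[of "x\<ominus>y"] N_eq_0[of "x\<ominus>y"] diff_eq_0 c by auto
qed

lemma lim_to_add:
 assumes "lim_to s x" "lim_to s' x'" shows "lim_to (%n. s n\<oplus>s' n) (x\<oplus>x')"
proof (rule lim_to_bound[where e = "%n. N (s n\<ominus>x) + N (s' n\<ominus>x')"])
 note c = lim_toD[OF assms(1)] lim_toD[OF assms(2)]
 show "N (s n\<oplus>s' n\<ominus>(x\<oplus>x'))<=N (s n\<ominus>x) + N (s' n\<ominus>x')" for n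
  using c N_add by (simp add: diff_add_add)
 show "(%n. N (s n\<ominus>x) + N (s' n\<ominus>x')) \<leadsto> 0"
  using tendsto_add[OF c(3) c(6)] by simp
qed (use lim_toD[OF assms(1)] lim_toD[OF assms(2)] in auto)

lemma lim_to_smult:
 assumes "lim_to s x" shows "lim_to (%n. c\<odot>s n) (c\<odot>x)"
proof (rule lim_to_bound[where e = "%n. cmod c * N (s n\<ominus>x)"])
 note c = lim_toD[OF assms]
 show "N (c\<odot>s n\<ominus>c\<odot>x)<=cmod c * N (s n\<ominus>x)" for n
  using c by (simp add: sm_diff_right[symmetric] N_smult)
 show "(%n. cmod c * N (s n\<ominus>x)) \<leadsto> 0"
  using tendsto_mult_right_zero[OF c(3)] .
qed (use lim_toD[OF assms] in auto)

lemma lim_to_diff: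
 assumes "lim_to s x" "lim_to s' x'" shows "lim_to (%n. s n\<ominus>s' n) (x\<ominus>x')"
 using lim_to_add[OF assms(1) lim_to_smult[OF assms(2), of "-1"]] lim_toD[OF assms(1)] lim_toD[OF assms(2)]
 by (simp add: diff_conv)

lemma lim_to_N:
 assumes "lim_to s x" shows "(%n. N (s n)) \<leadsto> N x"
proof -
 note c = lim_toD[OF assms]
 have "(%n. N (s n) - N x) \<leadsto> 0"
  using c by (intro Lim_null_comparison[OF _ c(3)]) (auto intro!: always_eventually N_abs_diff)
 then show ?thesis by (simp add: LIM_zero_iff)
qed

lemma cauchy_lim:
 assumes "!!n. s n:carrier X" "!!e. e > 0==>\<exists>M. \<forall>m\<ge>M. \<forall>n\<ge>M. N (s m\<ominus>s n) < e"
 shows "\<exists>x. lim_to s x"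
 using N_complete[of s] assms by (auto simp: cauchy_in_def lim_to_def)

text \<open>Meant for an iteration whose convergence need not be geometric: its increments are
  dominated by those of a real Cauchy sequence.\<close>

lemma cauchy_lim_dominated:
 assumes "!!n. s n:carrier X" "Cauchy r" "!!m n. m<=n==>N (s n\<ominus>s m)<=\<bar>r n - r m :: real\<bar>"
 shows "\<exists>x. lim_to s x"
proof (rule cauchy_lim[OF assms(1)])
 fix e :: real assume "e > 0"
 then obtain M where M: "\<forall>m\<ge>M. \<forall>n\<ge>M. \<bar>r m - r n\<bar> < e"
  using \<open>Cauchy r\<close> by (auto simp: Cauchy_def dist_real_def)
 have "N (s m\<ominus>s n) < e" if "m\<ge>M" "n\<ge>M" for m n
 proof (cases "n<=m")
  case True then show ?thesis using assms(3)[of n m] M [rule_format, of m n] that by linarith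
 next
  case False then show ?thesis
   using assms(3)[of m n] M that N_diff_commute[of "s m" "s n"] assms(1) by (metis nle_le order_le_less_trans)
 qed
 then show "\<exists>M. \<forall>m\<ge>M. \<forall>n\<ge>M. N (s m\<ominus>s n) < e" by blast
qed

lemma lim_cauchy:
 assumes "lim_to s x" "e > 0" shows "\<exists>M. \<forall>m\<ge>M. \<forall>n\<ge>M. N (s m\<ominus>s n) < e"
proof -
 note c = lim_toD[OF assms(1)]
 have "eventually (%n. N (s n\<ominus>x) < e / 2) sequentially"
  by (rule order_tendstoD(2)[OF c(3)]) (use assms(2) in simp)
 then obtain M where M: "!!n. n\<ge>M==>N (s n\<ominus>x) < e / 2"
  by (auto simp: eventually_sequentially)
 have "N (s m\<ominus>s n) < e" if "m\<ge>M" "n\<ge>M" for m n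
  using N_diff_triangle[of "s m" x "s n"] M[OF that(1)] M[OF that(2)] c N_diff_commute[of x "s n"]
  by force
 then show ?thesis by blast
qed

end

section \<open>C*-algebras: square roots and positivity without spectral theory\<close>

sublocale cstar_algebra \<subseteq> nv: cnormed A "cnorm A"
 by unfold_locales
  (use cnorm_nonneg cnorm_eq_0 cnorm_add cnorm_smult complete in "auto")

context cstar_algebra
begin

lemma ring_A: "ring A" ..

lemmas A_l_distr = ring.ring_simprules(13)[OF ring_A]
lemmas A_r_distr = ring.ring_simprules(23)[OF ring_A]
lemmas A_assoc = ring.ring_simprules(11)[OF ring_A]
lemmas alg_expand = A_l_distr A_r_distr nv.diff_conv nv.sm_add_right nv.sm_assoc A_assoc

lemma smult_mult_left' [simp]: "[|x:carrier A; y:carrier A|]==>(c\<odot>x)\<otimes>y=c\<odot>(x\<otimes>y)"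
 by (rule smult_mult_left)

lemma smult_mult_right' [simp]: "[|x:carrier A; y:carrier A|]==>x\<otimes>(c\<odot>y)=c\<odot>(x\<otimes>y)"
 by (rule smult_mult_right)

declare adj_closed [simp] adj_adj [simp]

lemma adj_zero [simp]: "adj A \<zero>=\<zero>"
 using adj_smult[of \<zero> 0] by simp

lemma adj_one [simp]: "adj A \<one>=\<one>"
 using adj_mult[of "adj A \<one>" \<one>] by simp

lemma adj_diff: "[|x:carrier A; y:carrier A|]==>adj A (x\<ominus>y)=adj A x\<ominus>adj A y"
 by (simp add: nv.diff_conv adj_add adj_smult)

lemma cnorm_adj [simp]: assumes "x:carrier A" shows "cnorm A (adj A x)=cnorm A x"
proof -
 have le: "cnorm A x<=cnorm A (adj A x)" if "x:carrier A" for x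
 proof (cases "cnorm A x=0")
  case False
  have "cnorm A x * cnorm A x<=cnorm A (adj A x) * cnorm A x"
   using cstar_identity[OF that] cnorm_mult[of "adj A x" x] that by (simp add: power2_eq_square)
  then show ?thesis
   using False cnorm_nonneg[OF that] by (simp add: less_le)
 qed (use cnorm_nonneg that in simp)
 show ?thesis
  using le[OF assms] le[of "adj A x"] assms by simp
qed

lemma lim_mult:
 assumes "nv.lim_to s x" "nv.lim_to s' x'" shows "nv.lim_to (%n. s n\<otimes>s' n) (x\<otimes>x')"
proof (rule nv.lim_to_bound[where e = "%n. cnorm A (s n) * cnorm A (s' n\<ominus>x') + cnorm A (s n\<ominus>x) * cnorm A x'"])
 note c [simp] = nv.lim_toD(1,2)[OF assms(1)] nv.lim_toD(1,2)[OF assms(2)]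
 show "cnorm A (s n\<otimes>s' n\<ominus>x\<otimes>x')<=cnorm A (s n) * cnorm A (s' n\<ominus>x') + cnorm A (s n\<ominus>x) * cnorm A x'" for n
 proof -
  have 1: "s n\<otimes>s' n\<ominus>s n\<otimes>x'=s n\<otimes>(s' n\<ominus>x')" "s n\<otimes>x'\<ominus>x\<otimes>x'=(s n\<ominus>x)\<otimes>x'"
   by (simp_all add: alg_expand)
  have "s n\<otimes>s' n\<ominus>x\<otimes>x'=s n\<otimes>(s' n\<ominus>x')\<oplus>(s n\<ominus>x)\<otimes>x'"
   using nv.diff_add_diff[of "s n\<otimes>s' n" "s n\<otimes>x'" "x\<otimes>x'"] by (simp add: 1)
  then have "cnorm A (s n\<otimes>s' n\<ominus>x\<otimes>x')<=cnorm A (s n\<otimes>(s' n\<ominus>x')) + cnorm A ((s n\<ominus>x)\<otimes>x')"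
   by (simp add: cnorm_add)
  with cnorm_mult[of "s n" "s' n\<ominus>x'"] cnorm_mult[of "s n\<ominus>x" x'] show ?thesis
   by simp
 qed
 have "(%n. cnorm A (s n) * cnorm A (s' n\<ominus>x') + cnorm A (s n\<ominus>x) * cnorm A x') \<leadsto> cnorm A x * 0 + 0 * cnorm A x'"
  using nv.lim_to_N[OF assms(1)] nv.lim_toD(3)[OF assms(1)] nv.lim_toD(3)[OF assms(2)] by (intro tendsto_intros)
 then show "(%n. cnorm A (s n) * cnorm A (s' n\<ominus>x') + cnorm A (s n\<ominus>x) * cnorm A x') \<leadsto> 0" by simp
qed (use nv.lim_toD[OF assms(1)] nv.lim_toD[OF assms(2)] in auto)

lemma lim_adj:
 assumes "nv.lim_to s x" shows "nv.lim_to (%n. adj A (s n)) (adj A x)"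
 using nv.lim_toD[OF assms] by (intro nv.lim_to_bound[OF _ _ _ nv.lim_toD(3)[OF assms]]) (auto simp flip: adj_diff)

text \<open>Square roots without functional calculus: a fixed point of
  \<open>y \<mapsto> (x + y y) / 2\<close> solves \<open>(1 - y) (1 - y) = 1 - x\<close>. The scalar
  iteration \<open>S\<close> is the case \<open>x = 1\<close>; it dominates the norms and the
  increments of \<open>Y\<close>, and it is increasing and bounded by 1. The iterates are
  polynomials in \<open>x\<close>, so commutation with \<open>x\<close> passes to the limit.\<close>

lemma sqrt_one_minus:
 assumes x: "x:carrier A" "adj A x=x" "cnorm A x<=1"
 obtains y where "y:carrier A" "adj A y=y" "cnorm A y<=1" "(\<one>\<ominus>y)\<otimes>(\<one>\<ominus>y)=\<one>\<ominus>x"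
  "!!z. [|z:carrier A; z\<otimes>x=x\<otimes>z|]==>z\<otimes>y=y\<otimes>z"
proof -
 define Y where "Y=rec_nat \<zero> (%n y. (1/2)\<odot>(x\<oplus>y\<otimes>y))"
 define S where "S=rec_nat (0::real) (%n s. (1 + s * s) / 2)"
 have Y0: "Y 0=\<zero>" and YS: "Y (Suc n)=(1/2)\<odot>(x\<oplus>Y n\<otimes>Y n)" for n
  by (simp_all add: Y_def)
 have S0: "S 0=0" and SS: "S (Suc n)=(1 + S n * S n) / 2" for n
  by (simp_all add: S_def)
 have Yc [simp]: "Y n:carrier A" for n
  by (induction n) (auto simp: Y0 YS x)
 have S01: "0<=S n&S n<=1" for n
  by (induction n) (auto simp: S0 SS mult_le_one)
 have Smono: "S n<=S (Suc n)" for n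
  using zero_le_power2[of "1 - S n"] by (simp add: SS power2_eq_square algebra_simps)
 have YN: "cnorm A (Y n)<=S n" for n
 proof (induction n)
  case (Suc n)
  have "cnorm A (x\<oplus>Y n\<otimes>Y n)<=1 + S n * S n"
   using cnorm_add[of x "Y n\<otimes>Y n"] cnorm_mult[of "Y n" "Y n"] mult_mono[OF Suc Suc] S01[of n] x
   by (auto simp: cnorm_nonneg)
  then show ?case by (simp add: YS SS cnorm_smult x)
 qed (simp add: Y0 S0)
 have Ycomm: "z\<otimes>Y n=Y n\<otimes>z" if "z:carrier A" "z\<otimes>x=x\<otimes>z" for z n
 proof (induction n)
  case (Suc n)
  have "z\<otimes>(Y n\<otimes>Y n)=(Y n\<otimes>Y n)\<otimes>z"
   using Suc that by (metis Yc A_assoc)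
  then show ?case using that x by (simp add: YS A_l_distr A_r_distr)
 qed (simp add: Y0 that)
 have YY: "Y n\<otimes>Y m=Y m\<otimes>Y n" for m n
  by (rule Ycomm) (use Ycomm[of x n] x in auto)
 have Yadj: "adj A (Y n)=Y n" for n
  by (induction n) (auto simp: Y0 YS x adj_smult adj_add adj_mult)
 have step: "cnorm A (Y (Suc n)\<ominus>Y n)<=S (Suc n) - S n" for n
 proof (induction n)
  case 0 then show ?case using YN[of "Suc 0"] by (simp add: Y0 S0 nv.diff_conv)
 next
  case (Suc n)
  \<comment> \<open>A difference of squares, which factors because the iterates commute.\<close>
  have e: "Y (Suc (Suc n))\<ominus>Y (Suc n)=(1/2)\<odot>((Y (Suc n)\<ominus>Y n)\<otimes>(Y (Suc n)\<oplus>Y n))"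
  proof -
   define u where "u=Y (Suc n)" define v where "v=Y n"
   have uv: "u:carrier A" "v:carrier A" "u\<otimes>v=v\<otimes>u"
    using YY by (simp_all add: u_def v_def)
   have "(u\<ominus>v)\<otimes>(u\<oplus>v)=u\<otimes>u\<ominus>v\<otimes>v"
    using uv(1,2) by (simp add: alg_expand nv.add_assoc uv(3))
   moreover have "(x\<oplus>u\<otimes>u)\<ominus>(x\<oplus>v\<otimes>v)=u\<otimes>u\<ominus>v\<otimes>v"
    using uv(1,2) x by (simp add: nv.diff_add_add)
   ultimately have "(1/2)\<odot>(x\<oplus>u\<otimes>u)\<ominus>(1/2)\<odot>(x\<oplus>v\<otimes>v)=(1/2)\<odot>((u\<ominus>v)\<otimes>(u\<oplus>v))"
    using uv(1,2) x by (simp flip: nv.sm_diff_right)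
   moreover have "Y (Suc (Suc n))\<ominus>Y (Suc n)=(1/2)\<odot>(x\<oplus>u\<otimes>u)\<ominus>(1/2)\<odot>(x\<oplus>v\<otimes>v)"
    unfolding u_def v_def by (rule arg_cong2[where f = "a_minus A"]; rule YS)
   ultimately show ?thesis unfolding u_def v_def by simp
  qed
  have "cnorm A ((Y (Suc n)\<ominus>Y n)\<otimes>(Y (Suc n)\<oplus>Y n))<=(S (Suc n) - S n) * (S (Suc n) + S n)"
   using cnorm_mult[of "Y (Suc n)\<ominus>Y n" "Y (Suc n)\<oplus>Y n"]
    mult_mono[OF Suc order_trans[OF cnorm_add add_mono[OF YN YN]], of "Suc n" n] Smono[of n]
   by (auto simp: cnorm_nonneg)
  moreover have "cnorm A ((1/2)\<odot>((Y (Suc n)\<ominus>Y n)\<otimes>(Y (Suc n)\<oplus>Y n)))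
    =cnorm A ((Y (Suc n)\<ominus>Y n)\<otimes>(Y (Suc n)\<oplus>Y n)) / 2"
   by (simp add: cnorm_smult)
  ultimately show ?case
   unfolding e using SS[of "Suc n"] SS[of n] square_diff_square_factored[of "S (Suc n)" "S n"]
   by argo
 qed
 have far: "cnorm A (Y n\<ominus>Y m)<=S n - S m" if "m<=n" for m n
  using that
 proof (induction n rule: dec_induct)
  case (step n)
  then show ?case
   using nv.N_diff_triangle[of "Y (Suc n)" "Y n" "Y m"] \<open>\<And>n. cnorm A (Y (Suc n) \<ominus> Y n) \<le> S (Suc n) - S n\<close>[of n]
   by simp
 qed simp
 have "Cauchy S"
 proof -
  have "Bseq S" by (rule BseqI'[of _ 1]) (use S01 in "auto simp: abs_le_iff intro: order_trans[of _ 0]")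
  moreover have "\<forall>m n. m<=n\<longrightarrow>S m<=S n" using lift_Suc_mono_le[of S] Smono by blast
  ultimately show ?thesis using Bseq_mono_convergent convergent_Cauchy by blast
 qed
 moreover have "cnorm A (Y n\<ominus>Y m)<=\<bar>S n - S m\<bar>" if "m<=n" for m n
  using far[OF that] by linarith
 ultimately obtain y where y: "nv.lim_to Y y"
  using nv.cauchy_lim_dominated[of Y S] Yc by blast
 have yc: "y:carrier A" using nv.lim_toD[OF y] by simp
 have "nv.lim_to (%n. Y (Suc n)) y"
  using y LIMSEQ_Suc[OF nv.lim_toD(3)[OF y]] by (simp add: nv.lim_to_def)
 moreover have "nv.lim_to (%n. Y (Suc n)) ((1/2)\<odot>(x\<oplus>y\<otimes>y))"
  unfolding YS by (intro nv.lim_to_smult nv.lim_to_add nv.lim_to_const lim_mult y x)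
 ultimately have fix': "(1/2)\<odot>(x\<oplus>y\<otimes>y)=y" using nv.lim_to_unique by blast
 have "x\<oplus>y\<otimes>y=2\<odot>y"
  using arg_cong[OF fix', of "%z. 2\<odot>z"] x yc by (simp add: nv.sm_assoc)
 then have yy: "y\<otimes>y=2\<odot>y\<ominus>x"
  using x yc nv.diff_add_add[of "y\<otimes>y" x \<zero> x] by (simp add: nv.diff_conv nv.add_comm)
 have sq: "(\<one>\<ominus>y)\<otimes>(\<one>\<ominus>y)=\<one>\<ominus>x"
 proof -
  have "(\<one>\<ominus>y)\<otimes>(\<one>\<ominus>y)=\<one>\<oplus>(- 1)\<odot>y\<oplus>((- 1)\<odot>y\<oplus>y\<otimes>y)"
   using yc by (simp add: alg_expand)
  also have "...=\<one>\<ominus>x\<oplus>((-1)\<odot>y\<oplus>((-1)\<odot>y\<oplus>2\<odot>y))"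
   using yc x by (simp add: yy nv.diff_conv nv.add_ac)
  also have "...=\<one>\<ominus>x"
   using yc x by (simp flip: nv.sm_add_left)
  finally show ?thesis .
 qed
 show ?thesis
 proof (rule that[OF yc _ _ sq])
  show "adj A y=y"
   using nv.lim_to_unique[OF lim_adj[OF y]] y by (simp add: Yadj)
  show "cnorm A y<=1"
   by (rule LIMSEQ_le_const2[OF nv.lim_to_N[OF y]]) (use YN S01 order_trans in blast)
  show "z\<otimes>y=y\<otimes>z" if "z:carrier A" "z\<otimes>x=x\<otimes>z" for z
  proof -
   have "nv.lim_to (%n. z\<otimes>Y n) (z\<otimes>y)" "nv.lim_to (%n. Y n\<otimes>z) (y\<otimes>z)"
    using that y by (auto intro!: lim_mult nv.lim_to_const)
   then show ?thesis using Ycomm[OF that] nv.lim_to_unique by simp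
  qed
 qed
qed

text \<open>Equality fails in the zero algebra, where the unit has norm 0.\<close>

lemma cnorm_one_le: "cnorm A \<one><=1"
 using cstar_identity[of \<one>] cnorm_nonneg[of \<one>] by (simp add: power2_eq_square mult_le_cancel_left1)
  (metis mult_cancel_left1 order_refl zero_le_one)

text \<open>Commuting self-adjoint parts make \<open>a + i b\<close> normal; the last clause
  recovers \<open>a\<close> as its real part.\<close>

lemma cartesian_sq:
 assumes "a:carrier A" "b:carrier A" "adj A a=a" "adj A b=b" "a\<otimes>b=b\<otimes>a"
 shows "adj A (a\<oplus>\<i>\<odot>b)\<otimes>(a\<oplus>\<i>\<odot>b)=a\<otimes>a\<oplus>b\<otimes>b"
  and "(a\<oplus>\<i>\<odot>b)\<otimes>adj A (a\<oplus>\<i>\<odot>b)=a\<otimes>a\<oplus>b\<otimes>b"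
  and "a=(1/2)\<odot>((a\<oplus>\<i>\<odot>b)\<oplus>adj A (a\<oplus>\<i>\<odot>b))"
proof -
 have adj: "adj A (a\<oplus>\<i>\<odot>b)=a\<oplus>(- \<i>)\<odot>b"
  using assms by (simp add: adj_add adj_smult)
 have c: "(- \<i>)\<odot>x\<oplus>\<i>\<odot>x=\<zero>" "\<i>\<odot>x\<oplus>(- \<i>)\<odot>x=\<zero>" if "x:carrier A" for x
  using that by (simp_all flip: nv.sm_add_left)
 have c': "(- \<i>)\<odot>x\<oplus>(\<i>\<odot>x\<oplus>y)=y" "\<i>\<odot>x\<oplus>((- \<i>)\<odot>x\<oplus>y)=y"
  if "x:carrier A" "y:carrier A" for x y
  using that by (simp_all add: nv.add_assoc[symmetric] c)
 show "adj A (a\<oplus>\<i>\<odot>b)\<otimes>(a\<oplus>\<i>\<odot>b)=a\<otimes>a\<oplus>b\<otimes>b"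
  "(a\<oplus>\<i>\<odot>b)\<otimes>adj A (a\<oplus>\<i>\<odot>b)=a\<otimes>a\<oplus>b\<otimes>b"
  using assms(1,2) by (simp_all add: adj alg_expand nv.add_assoc assms(5) c')
 show "a=(1/2)\<odot>((a\<oplus>\<i>\<odot>b)\<oplus>adj A (a\<oplus>\<i>\<odot>b))"
 proof -
  have "(a\<oplus>\<i>\<odot>b)\<oplus>adj A (a\<oplus>\<i>\<odot>b)=a\<oplus>a"
   using assms(1,2) by (simp add: adj nv.add_ac c' c)
  also have "...=2\<odot>a" using assms(1) nv.sm_add_left[of a 1 1] by simp
  finally show ?thesis using assms(1) by (simp add: nv.sm_assoc)
 qed
qed

text \<open>Take \<open>u = h + i k\<close>, where \<open>k\<close> is the root of
  \<open>1 - h h\<close> that commutes with \<open>h\<close>. Estimates for unitaries, where the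
  C*-identity applies directly, thereby reach all self-adjoint contractions.\<close>

lemma sa_unitary:
 assumes h: "h:carrier A" "adj A h=h" "cnorm A h<=1"
 obtains u where "u:carrier A" "adj A u\<otimes>u=\<one>" "u\<otimes>adj A u=\<one>" "h=(1/2)\<odot>(u\<oplus>adj A u)"
proof -
 have "cnorm A (h\<otimes>h)<=1"
  using cnorm_mult[of h h] h cnorm_nonneg[of h] mult_mono[of "cnorm A h" 1 "cnorm A h" 1] by auto
 moreover have "adj A (h\<otimes>h)=h\<otimes>h" using h by (simp add: adj_mult)
 ultimately obtain y where y: "y:carrier A" "adj A y=y" "(\<one>\<ominus>y)\<otimes>(\<one>\<ominus>y)=\<one>\<ominus>h\<otimes>h"
  "!!z. [|z:carrier A; z\<otimes>(h\<otimes>h)=(h\<otimes>h)\<otimes>z|]==>z\<otimes>y=y\<otimes>z"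
  using sqrt_one_minus[of "h\<otimes>h"] h by blast
 define k where "k=\<one>\<ominus>y"
 have k: "k:carrier A" "adj A k=k"
  using y by (simp_all add: k_def adj_diff)
 have "h\<otimes>y=y\<otimes>h" using y(4)[of h] h by (simp add: A_assoc)
 then have hk: "h\<otimes>k=k\<otimes>h"
  using h(1) y(1) by (simp add: k_def alg_expand)
 have "h\<otimes>h\<oplus>k\<otimes>k=\<one>"
  using h(1) y(1,3) by (simp add: k_def nv.diff_conv nv.add_ac)
 then show ?thesis
  using that[of "h\<oplus>\<i>\<odot>k"] cartesian_sq[OF h(1) k(1) h(2) k(2) hk] h k by simp
qed

text \<open>The norm of the normal element \<open>a + i b\<close> is controlled by
  \<open>a a + b b\<close>, and \<open>a\<close> is its real part. Monotonicity of the norm on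
  positive elements is later derived from this.\<close>

lemma sq_sum_norm:
 assumes "a:carrier A" "b:carrier A" "adj A a=a" "adj A b=b" "a\<otimes>b=b\<otimes>a"
  "a\<otimes>a\<oplus>b\<otimes>b=complex_of_real c\<odot>\<one>" "0<=c"
 shows "(cnorm A a)\<^sup>2<=c"
proof -
 define u where "u=a\<oplus>\<i>\<odot>b"
 have u: "u:carrier A" using assms by (simp add: u_def)
 have "(cnorm A u)\<^sup>2<=c"
  using cartesian_sq(1)[OF assms(1-5)] cstar_identity[OF u] cnorm_one_le assms(6,7)
  by (simp add: u_def[symmetric] cnorm_smult) (metis mult_left_le)
 moreover have "cnorm A a<=cnorm A u"
 proof -
  have "cnorm A a=cnorm A (u\<oplus>adj A u) / 2"
   using arg_cong[OF cartesian_sq(3)[OF assms(1-5)], of "cnorm A"] u by (simp add: u_def[symmetric] cnorm_smult)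
  then show ?thesis using cnorm_add[of u "adj A u"] u by simp
 qed
 ultimately show ?thesis
  using power_mono[of "cnorm A a" "cnorm A u" 2] cnorm_nonneg assms(1) by force
qed

text \<open>Automatic contractivity: unitaries satisfy \<open>p u <= 1\<close> by the C*-identity,
  self-adjoint contractions are means of a unitary and its adjoint, and passing from
  \<open>x\<close> to \<open>adj A x \<otimes> x\<close> reduces the rest to the self-adjoint case.
  This is what keeps the supremum in \<open>max_norm\<close> finite.\<close>

lemma cstar_seminorm_le:
 assumes nonneg: "!!x. x:carrier A==>0<=p x"
  and smult: "!!x c. x:carrier A==>p (c\<odot>x)=cmod c * p x"
  and add: "!!x y. [|x:carrier A; y:carrier A|]==>p (x\<oplus>y)<=p x + p y"
  and mult: "!!x y. [|x:carrier A; y:carrier A|]==>p (x\<otimes>y)<=p x * p y"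
  and star: "!!x. x:carrier A==>p (adj A x\<otimes>x)=(p x)\<^sup>2"
  and x: "x:carrier A"
 shows "p x<=cnorm A x"
proof -
 have padj: "p (adj A x)<=p x" if "x:carrier A" for x
 proof (cases "p (adj A x)=0")
  case False
  have "p (adj A x) * p (adj A x)<=p x * p (adj A x)"
   using star[of "adj A x"] mult[of x "adj A x"] that by (simp add: power2_eq_square)
  then show ?thesis using False nonneg[of "adj A x"] that by (simp add: less_le)
 qed (use nonneg that in simp)
 have p1: "p \<one><=1"
  using star[of \<one>] nonneg[of \<one>] by (simp add: power2_eq_square) (metis mult_cancel_left1 order_refl zero_le_one)
 have contr: "p h<=1" if h: "h:carrier A" "adj A h=h" "cnorm A h<=1" for h
 proof -
  obtain u where u: "u:carrier A" "adj A u\<otimes>u=\<one>" "h=(1/2)\<odot>(u\<oplus>adj A u)"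
   using sa_unitary[OF h] by blast
  have "(p u)\<^sup>2<=1\<^sup>2" using star[of u] u p1 by simp
  then have "p u<=1" using nonneg u(1) by (simp only: power2_le_imp_le)
  moreover have "p h<=p u"
   using u smult[of "u\<oplus>adj A u" "1/2"] add[of u "adj A u"] padj[of u] by (simp add: norm_divide)
  ultimately show ?thesis by linarith
 qed
 have sa: "p h<=cnorm A h" if h: "h:carrier A" "adj A h=h" for h
 proof (cases "cnorm A h=0")
  case True
  then have "h=\<zero>" using cnorm_eq_0 h by blast
  then show ?thesis using smult[of \<zero> 0] by simp
 next
  case False
  define r where "r=cnorm A h"
  have r: "r > 0" using False cnorm_nonneg[OF h(1)] by (simp add: r_def)
  have "p (complex_of_real (1/r)\<odot>h)<=1"
  proof (rule contr)
   show "adj A (complex_of_real (1 / r)\<odot>h)=complex_of_real (1 / r)\<odot>h"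
    unfolding adj_smult[OF h(1)] h(2) complex_cnj_complex_of_real ..
   show "cnorm A (complex_of_real (1 / r)\<odot>h)<=1"
    using r h by (simp add: cnorm_smult norm_divide flip: r_def)
  qed (use h in simp)
  then have "p h / r<=1"
   using r smult[OF h(1), of "complex_of_real (1 / r)"] by (simp add: norm_divide)
  then show ?thesis using r by (simp add: r_def)
 qed
 have "(p x)\<^sup>2<=(cnorm A x)\<^sup>2"
  using sa[of "adj A x\<otimes>x"] star[OF x] cstar_identity[OF x] x by (simp add: adj_mult)
 then show ?thesis using cnorm_nonneg[OF x] by (rule power2_le_imp_le)
qed

text \<open>Positivity in terms of the norm: for real numbers, \<open>|t - a| <= t\<close> says
  \<open>0 <= a <= 2 t\<close>. In this form sums are immediate and square roots come from
  \<open>sqrt_one_minus\<close>; positivity of \<open>adj A x \<otimes> x\<close> becomes the hard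
  fact.\<close>

definition pos :: "'a=>bool" where
 "pos a\<longleftrightarrow>a:carrier A&adj A a=a&(\<exists>t\<ge>0. cnorm A (complex_of_real t\<odot>\<one>\<ominus>a)<=t)"

lemma pos_closed: "pos a==>a:carrier A" "pos a==>adj A a=a"
 by (simp_all add: pos_def)

lemma pos_add: assumes "pos a" "pos b" shows "pos (a\<oplus>b)"
proof -
 obtain s t where st: "s\<ge>0" "cnorm A (complex_of_real s\<odot>\<one>\<ominus>a)<=s"
  "t\<ge>0" "cnorm A (complex_of_real t\<odot>\<one>\<ominus>b)<=t"
  using assms by (auto simp: pos_def)
 have ab: "a:carrier A" "b:carrier A" using assms by (auto simp: pos_def)
 have "complex_of_real (s + t)\<odot>\<one>\<ominus>(a\<oplus>b)=(complex_of_real s\<odot>\<one>\<ominus>a)\<oplus>(complex_of_real t\<odot>\<one>\<ominus>b)"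
  using ab by (simp add: nv.sm_add_left nv.diff_add_add)
 then have "cnorm A (complex_of_real (s + t)\<odot>\<one>\<ominus>(a\<oplus>b))<=s + t"
  using cnorm_add[of "complex_of_real s\<odot>\<one>\<ominus>a" "complex_of_real t\<odot>\<one>\<ominus>b"] st ab by simp
 then show ?thesis
  using assms st unfolding pos_def by (intro conjI exI[of _ "s + t"]) (auto simp: adj_add)
qed

lemma pos_zero: "pos \<zero>"
 by (auto simp: pos_def nv.diff_conv intro!: exI[of _ 0])

text \<open>After division by \<open>t\<close> the element is \<open>1 - x\<close> with
  \<open>x\<close> a contraction, so its root is \<open>sqrt t\<close> times \<open>1 - y\<close>.
  The bound on \<open>y\<close> is just what makes this root positive again, with constant
  \<open>sqrt t\<close>.\<close>

lemma pos_sqrt: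
 assumes "pos a"
 obtains p where "pos p" "p\<otimes>p=a" "!!z. [|z:carrier A; z\<otimes>a=a\<otimes>z|]==>z\<otimes>p=p\<otimes>z"
proof -
 obtain t where t: "t\<ge>0" "cnorm A (complex_of_real t\<odot>\<one>\<ominus>a)<=t" and a: "a:carrier A" "adj A a=a"
  using assms by (auto simp: pos_def)
 show ?thesis
 proof (cases "t=0")
  \<comment> \<open>Here the bound in \<open>pos\<close> itself forces \<open>a\<close> to be zero,
    and division by \<open>t\<close> is avoided.\<close>
  case True
  then have "a=\<zero>"
   using t a cnorm_nonneg[of "\<zero>\<ominus>a"] cnorm_eq_0[of "\<zero>\<ominus>a"] nv.diff_eq_0[of \<zero> a] by auto
  then show ?thesis by (intro that[of \<zero>] pos_zero) auto
 next
  case False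
  then have t0: "t > 0" using t by simp
  define x where "x=\<one>\<ominus>complex_of_real (1/t)\<odot>a"
  have ta: "complex_of_real (1/t)\<odot>(complex_of_real t\<odot>\<one>\<ominus>a)=x"
   using a t0 by (simp add: x_def nv.sm_diff_right nv.sm_assoc)
  have x: "x:carrier A" "adj A x=x"
   using a by (simp_all add: x_def adj_diff adj_smult)
  have "cnorm A x<=1"
   using t0 t(2) a by (simp flip: ta add: cnorm_smult norm_divide)
  then obtain y where y: "y:carrier A" "adj A y=y" "cnorm A y<=1" "(\<one>\<ominus>y)\<otimes>(\<one>\<ominus>y)=\<one>\<ominus>x"
   "!!z. [|z:carrier A; z\<otimes>x=x\<otimes>z|]==>z\<otimes>y=y\<otimes>z"
   using sqrt_one_minus[OF x] by blast
  define p where "p=complex_of_real (sqrt t)\<odot>(\<one>\<ominus>y)"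
  have s: "complex_of_real (sqrt t)\<odot>\<one>\<ominus>p=complex_of_real (sqrt t)\<odot>y"
   using y by (simp add: p_def nv.diff_conv nv.sm_add_right nv.sm_assoc flip: nv.add_assoc)
    (simp add: nv.sm_add_left[symmetric])
  have p: "p:carrier A" "adj A p=p" "cnorm A (complex_of_real (sqrt t)\<odot>\<one>\<ominus>p)<=sqrt t"
   using y(1-3) t0 unfolding s by (simp_all add: p_def adj_smult adj_diff cnorm_smult mult_left_le)
  show ?thesis
  proof (rule that[of p])
   show "pos p"
    using p t0 unfolding pos_def by (intro conjI exI[of _ "sqrt t"]) auto
   have "\<one>\<ominus>x=complex_of_real (1/t)\<odot>a"
    using a by (simp add: x_def nv.diff_conv nv.sm_add_right nv.sm_assoc flip: nv.add_assoc)
   then show "p\<otimes>p=a"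
    using y t0 a by (simp add: p_def nv.sm_assoc flip: of_real_mult)
   show "z\<otimes>p=p\<otimes>z" if z: "z:carrier A" "z\<otimes>a=a\<otimes>z" for z
   proof -
    have "z\<otimes>x=x\<otimes>z" using z a by (simp add: x_def alg_expand)
    then have "z\<otimes>y=y\<otimes>z" using y z by blast
    then show ?thesis using z(1) y(1) by (simp add: p_def alg_expand)
   qed
  qed
 qed
qed

lemma pos_scalar_minus:
 assumes "c:carrier A" "adj A c=c" "cnorm A c<=t"
 shows "pos (complex_of_real t\<odot>\<one>\<ominus>c)"
proof -
 have "complex_of_real t\<odot>\<one>\<ominus>(complex_of_real t\<odot>\<one>\<ominus>c)=c"
  using assms by (simp add: nv.diff_conv nv.sm_add_right nv.sm_assoc flip: nv.add_assoc)
   (simp flip: nv.sm_add_left)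
 then show ?thesis
  using assms cnorm_nonneg[OF assms(1)] unfolding pos_def
  by (intro conjI exI[of _ t]) (auto simp: adj_diff adj_smult)
qed

text \<open>The roots \<open>p\<close> and \<open>q\<close> of \<open>a\<close> and
  \<open>t - a\<close> commute and satisfy \<open>p p + q q = t\<close>, so
  \<open>sq_sum_norm\<close> bounds \<open>p\<close>, and \<open>a = p p\<close>.\<close>

lemma pos_bounded_norm:
 assumes "pos a" "pos (complex_of_real t\<odot>\<one>\<ominus>a)" "0<=t"
 shows "cnorm A a<=t"
proof -
 note a = pos_closed[OF assms(1)]
 obtain p where p: "pos p" "p\<otimes>p=a" "!!z. [|z:carrier A; z\<otimes>a=a\<otimes>z|]==>z\<otimes>p=p\<otimes>z"
  using pos_sqrt[OF assms(1)] by blast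
 obtain q where q: "pos q" "q\<otimes>q=complex_of_real t\<odot>\<one>\<ominus>a"
  "!!z. [|z:carrier A; z\<otimes>(complex_of_real t\<odot>\<one>\<ominus>a)=(complex_of_real t\<odot>\<one>\<ominus>a)\<otimes>z|]==>z\<otimes>q=q\<otimes>z"
  using pos_sqrt[OF assms(2)] by blast
 note p' = pos_closed[OF p(1)] and q' = pos_closed[OF q(1)]
 have "p\<otimes>a=a\<otimes>p" using p' by (simp add: p(2)[symmetric] A_assoc)
 then have pq: "p\<otimes>q=q\<otimes>p"
  using p' a by (intro q(3)) (simp_all add: alg_expand)
 have "p\<otimes>p\<oplus>q\<otimes>q=complex_of_real t\<odot>\<one>"
  using a by (simp add: p q nv.diff_conv nv.add_ac)
 then have "(cnorm A p)\<^sup>2<=t"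
  using sq_sum_norm[OF p'(1) q'(1) p'(2) q'(2) pq] assms(3) by simp
 moreover have "cnorm A a=(cnorm A p)\<^sup>2"
  using cstar_identity[OF p'(1)] by (simp add: p' p)
 ultimately show ?thesis by simp
qed

text \<open>With \<open>t\<close> the norm of \<open>a + b\<close>, the element \<open>t - a\<close>
  is the sum of the positive elements \<open>t - (a + b)\<close> and \<open>b\<close>.\<close>

lemma pos_mono:
 assumes "pos a" "pos b" shows "cnorm A a<=cnorm A (a\<oplus>b)"
proof (rule pos_bounded_norm[OF assms(1)])
 note ab = pos_closed[OF assms(1)] pos_closed[OF assms(2)]
 have "complex_of_real (cnorm A (a\<oplus>b))\<odot>\<one>\<ominus>a=(complex_of_real (cnorm A (a\<oplus>b))\<odot>\<one>\<ominus>(a\<oplus>b))\<oplus>b"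
  using ab by (simp add: nv.diff_conv nv.sm_add_right nv.add_assoc)
 then show "pos (complex_of_real (cnorm A (a\<oplus>b))\<odot>\<one>\<ominus>a)"
  using pos_add[OF pos_scalar_minus assms(2)] ab by (simp add: adj_add)
qed (use assms in "auto simp: pos_closed intro: cnorm_nonneg")

text \<open>Rescale \<open>e\<close> to a contraction \<open>f\<close> and take \<open>k\<close>
  with \<open>k k + f f = 1\<close>. Then \<open>k\<close> is a contraction, and
  \<open>t - e e = t k k\<close> has norm at most \<open>t\<close>.\<close>

lemma pos_square:
 assumes e: "e:carrier A" "adj A e=e" shows "pos (e\<otimes>e)"
proof -
 \<comment> \<open>The added 1 keeps \<open>t\<close> positive when \<open>e\<close> is
   zero.\<close>
 define t where "t=(cnorm A e)\<^sup>2 + 1"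
 have t: "t > 0" by (simp add: t_def add_nonneg_pos)
 define f where "f=complex_of_real (1 / sqrt t)\<odot>e"
 have f: "f:carrier A" "adj A f=f"
  using e unfolding f_def by (simp_all add: adj_smult)
 have "(cnorm A f)\<^sup>2<=1"
  using e t by (simp add: f_def cnorm_smult norm_divide power_divide) (simp add: t_def)
 then have ff: "f\<otimes>f:carrier A" "adj A (f\<otimes>f)=f\<otimes>f" "cnorm A (f\<otimes>f)<=1"
  using f cstar_identity[of f] by (simp_all add: adj_mult)
 obtain y where y: "y:carrier A" "adj A y=y" "(\<one>\<ominus>y)\<otimes>(\<one>\<ominus>y)=\<one>\<ominus>f\<otimes>f"
  "!!z. [|z:carrier A; z\<otimes>(f\<otimes>f)=(f\<otimes>f)\<otimes>z|]==>z\<otimes>y=y\<otimes>z"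
  using sqrt_one_minus[OF ff] by blast
 define k where "k=\<one>\<ominus>y"
 have k: "k:carrier A" "adj A k=k" using y by (simp_all add: k_def adj_diff)
 have "f\<otimes>y=y\<otimes>f" using y(4)[of f] f by (simp add: A_assoc)
 then have kf: "k\<otimes>f=f\<otimes>k" using f(1) y(1) by (simp add: k_def alg_expand)
 have "k\<otimes>k\<oplus>f\<otimes>f=complex_of_real 1\<odot>\<one>"
  using f(1) y(1,3) by (simp add: k_def nv.diff_conv nv.add_ac)
 then have "(cnorm A k)\<^sup>2<=1"
  using sq_sum_norm[OF k(1) f(1) k(2) f(2) kf] by simp
 moreover have "complex_of_real t\<odot>\<one>\<ominus>e\<otimes>e=complex_of_real t\<odot>(k\<otimes>k)"
 proof -
  have "complex_of_real t\<odot>(f\<otimes>f)=e\<otimes>e"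
   using e t unfolding f_def by (simp add: nv.sm_assoc flip: of_real_mult)
  then show ?thesis using y(3) f by (simp add: k_def nv.sm_diff_right)
 qed
 ultimately have "cnorm A (complex_of_real t\<odot>\<one>\<ominus>e\<otimes>e)<=t"
  using t k cstar_identity[of k] by (simp add: cnorm_smult)
 then show ?thesis
  using e t unfolding pos_def by (auto simp: adj_mult intro!: exI[of _ t])
qed

end

context cstar_algebra
begin

lemma pos_norm_square:
 assumes "a:carrier A" "adj A a=a" shows "cnorm A (a\<otimes>a)=(cnorm A a)\<^sup>2"
 using cstar_identity[OF assms(1)] assms(2) by simp

text \<open>Split \<open>y = u + i v\<close> into self-adjoint parts: both products contain the same
  squares and opposite cross terms. This makes one of the products accessible once the other is
  known.\<close>

lemma cartesian_decomp:
 assumes y: "y:carrier A"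
 obtains u v where "u:carrier A" "v:carrier A" "adj A u=u" "adj A v=v"
  "adj A y\<otimes>y\<oplus>y\<otimes>adj A y=(u\<otimes>u\<oplus>u\<otimes>u)\<oplus>(v\<otimes>v\<oplus>v\<otimes>v)"
proof
 define u where "u=(1/2)\<odot>(y\<oplus>adj A y)"
 define v where "v=(\<i>/2)\<odot>(adj A y\<ominus>y)"
 show "u:carrier A" "v:carrier A" "adj A u=u" "adj A v=v"
  using y by (simp_all add: u_def v_def adj_smult adj_add adj_diff nv.diff_conv nv.sm_add_right nv.sm_assoc nv.add_comm)
 have h: "(1/2)\<odot>x\<oplus>(1/2)\<odot>x=x" "(1/4)\<odot>x\<oplus>(1/4)\<odot>x=(1/2)\<odot>x" if "x:carrier A" for x
  using that by (simp_all flip: nv.sm_add_left)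
 have h': "(1/2)\<odot>x\<oplus>((1/2)\<odot>x\<oplus>z)=x\<oplus>z" "(1/4)\<odot>x\<oplus>((1/4)\<odot>x\<oplus>z)=(1/2)\<odot>x\<oplus>z"
  if "x:carrier A" "z:carrier A" for x z
  using that by (simp_all add: h flip: nv.add_assoc)
 define a where "a=y\<otimes>y" define b where "b=y\<otimes>adj A y"
 define c where "c=adj A y\<otimes>y" define d where "d=adj A y\<otimes>adj A y"
 have cl: "a:carrier A" "b:carrier A" "c:carrier A" "d:carrier A"
  using y by (simp_all add: a_def b_def c_def d_def)
 have uu: "u\<otimes>u=(1/4)\<odot>((b\<oplus>c)\<oplus>(a\<oplus>d))"
  using y by (simp add: u_def alg_expand a_def b_def c_def d_def nv.add_ac)
 have vv: "v\<otimes>v=(1/4)\<odot>((b\<oplus>c)\<oplus>(- 1)\<odot>(a\<oplus>d))"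
  using y by (simp add: v_def alg_expand a_def b_def c_def d_def nv.add_ac)
 have sum: "(t\<oplus>s)\<oplus>(t\<oplus>(- 1)\<odot>s)=2\<odot>t" if "s:carrier A" "t:carrier A" for s t
 proof -
  have "(t\<oplus>s)\<oplus>(t\<oplus>(- 1)\<odot>s)=(t\<oplus>t)\<oplus>(s\<oplus>(- 1)\<odot>s)"
   using that by (simp add: nv.add_ac del: nv.cancel_left)
  then show ?thesis using that nv.sm_add_left[of t 1 1] by simp
 qed
 have "u\<otimes>u\<oplus>v\<otimes>v=(1/4)\<odot>(((b\<oplus>c)\<oplus>(a\<oplus>d))\<oplus>((b\<oplus>c)\<oplus>(- 1)\<odot>(a\<oplus>d)))"
  using cl by (subst nv.sm_add_right) (simp_all add: uu vv)
 also have "...=(1/4)\<odot>(2\<odot>(b\<oplus>c))"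
  using cl by (simp add: sum)
 finally have "u\<otimes>u\<oplus>v\<otimes>v=(1/2)\<odot>(c\<oplus>b)"
  using cl by (simp add: nv.sm_assoc nv.add_comm)
 then have "(u\<otimes>u\<oplus>v\<otimes>v)\<oplus>(u\<otimes>u\<oplus>v\<otimes>v)=c\<oplus>b"
  using cl by (simp add: h)
 then show "adj A y\<otimes>y\<oplus>y\<otimes>adj A y=(u\<otimes>u\<oplus>u\<otimes>u)\<oplus>(v\<otimes>v\<oplus>v\<otimes>v)"
  using \<open>u \<in> carrier A\<close> \<open>v \<in> carrier A\<close> by (simp add: b_def c_def nv.add_ac)
qed

text \<open>With \<open>m = y y\<^sup>*\<close> and \<open>N = \<parallel>m\<parallel> = \<parallel>k\<parallel>\<close>, the element \<open>z = y (N + y\<^sup>* y)\<close> has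
 \<open>\<parallel>z\<parallel>\<^sup>2 = \<parallel>k (N - k)\<^sup>2\<parallel> \<le> N\<^sup>3\<close> but also \<open>\<parallel>z\<parallel>\<^sup>2 = \<parallel>m (N + m)\<^sup>2\<parallel> \<ge> 2 N \<parallel>m\<^sup>2\<parallel> = 2 N\<^sup>3\<close>.\<close>

lemma minus_star_square_pos_imp_zero:
 assumes y: "y:carrier A" and k: "pos k" "adj A y\<otimes>y=(- 1)\<odot>k"
 shows "y=\<zero>"
proof -
 note kc = pos_closed[OF k(1)]
 define m where "m=y\<otimes>adj A y"
 obtain u v where uv: "u:carrier A" "v:carrier A" "adj A u=u" "adj A v=v"
  "adj A y\<otimes>y\<oplus>y\<otimes>adj A y=(u\<otimes>u\<oplus>u\<otimes>u)\<oplus>(v\<otimes>v\<oplus>v\<otimes>v)"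
  using cartesian_decomp[OF y] by blast
 have mc: "m:carrier A" "adj A m=m" using y by (simp_all add: m_def adj_mult)
 \<comment> \<open>The sum of both products is \<open>m - k\<close>, so \<open>m\<close> is a sum of
   squares and \<open>k\<close>, hence positive.\<close>
 have "m=((u\<otimes>u\<oplus>u\<otimes>u)\<oplus>(v\<otimes>v\<oplus>v\<otimes>v))\<oplus>k"
  using kc mc by (simp flip: uv(5) add: k m_def[symmetric] nv.add_assoc nv.add_comm[of m])
 then have mpos: "pos m"
  using uv k(1) by (simp add: pos_add pos_square)
 define N where "N=cnorm A k"
 have N0: "N\<ge>0" by (simp add: N_def cnorm_nonneg kc)
 have yN: "(cnorm A y)\<^sup>2=N"
  using cstar_identity[OF y] kc by (simp add: k cnorm_smult N_def)
 have mN: "cnorm A m=N"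
  using cstar_identity[of "adj A y"] y yN by (simp add: m_def)
 \<comment> \<open>The factor by which \<open>y\<close> is multiplied, written with
   \<open>k\<close>. Positivity of both \<open>g\<close> and \<open>k\<close> keeps its norm at most
   \<open>N\<close>.\<close>
 define g where "g=complex_of_real N\<odot>\<one>\<ominus>k"
 have g: "g:carrier A" "adj A g=g" "pos g"
  using kc by (simp_all add: g_def adj_diff adj_smult pos_scalar_minus N_def)
 have gN: "cnorm A g<=N"
 proof -
  have "cnorm A g<=cnorm A (g\<oplus>k)" using pos_mono g k by blast
  also have "g\<oplus>k=complex_of_real N\<odot>\<one>" using kc by (simp add: g_def nv.diff_add_cancel)
  finally show ?thesis using cnorm_one_le N0 by (simp add: cnorm_smult mult_left_le order_trans)
 qed
 define z where "z=y\<otimes>g"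
 have zc: "z:carrier A" using y g by (simp add: z_def)
 have "adj A z\<otimes>z=(- 1)\<odot>(g\<otimes>(k\<otimes>g))"
 proof -
  have "adj A z\<otimes>z=g\<otimes>((adj A y\<otimes>y)\<otimes>g)"
   using y g by (simp add: z_def adj_mult A_assoc)
  then show ?thesis using g kc by (simp add: k)
 qed
 then have "(cnorm A z)\<^sup>2=cnorm A (g\<otimes>(k\<otimes>g))"
  using cstar_identity[OF zc] g(1) kc(1) by (simp add: cnorm_smult)
 also have "...<=cnorm A g * (cnorm A k * cnorm A g)"
  using cnorm_mult[of g "k\<otimes>g"] mult_left_mono[OF cnorm_mult[of k g] cnorm_nonneg[OF g(1)]] g(1) kc(1)
  by simp
 also have "...<=N * (N * N)"
  using gN N0 cnorm_nonneg[OF g(1)] by (intro mult_mono) (auto simp: N_def)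
 finally have "(cnorm A z)\<^sup>2<=N * (N * N)" .
 moreover have "2 * N * (N * N)<=(cnorm A z)\<^sup>2"
 proof -
  obtain p where p: "pos p" "p\<otimes>p=m" "!!z. [|z:carrier A; z\<otimes>m=m\<otimes>z|]==>z\<otimes>p=p\<otimes>z"
   using pos_sqrt[OF mpos] by blast
  note pc = pos_closed[OF p(1)]
  have pm: "m\<otimes>p=p\<otimes>m" by (rule p(3)) (simp_all add: mc)
  \<comment> \<open>The cube of \<open>m\<close> is the square of \<open>p m\<close>, which is
    self-adjoint because the root \<open>p\<close> commutes with \<open>m\<close>.\<close>
  have "pos ((p\<otimes>m)\<otimes>(p\<otimes>m))"
   using pc mc pm by (intro pos_square) (simp_all add: adj_mult)
  also have "(p\<otimes>m)\<otimes>(p\<otimes>m)=m\<otimes>(m\<otimes>m)"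
  proof -
   have "(m\<otimes>p)\<otimes>(p\<otimes>m)=m\<otimes>((p\<otimes>p)\<otimes>m)"
    using pc(1) mc(1) by (simp add: A_assoc)
   then show ?thesis by (simp add: p(2) pm)
  qed
  finally have m3: "pos (m\<otimes>(m\<otimes>m))" .
  have m2: "pos (m\<otimes>m)" using pos_square mc by blast
  have scale: "pos (complex_of_real (r * r)\<odot>x)" if xp: "pos x" for x r
  proof -
   obtain q where q: "pos q" "q\<otimes>q=x" using pos_sqrt[OF xp] by blast
   show ?thesis
    using pos_square[of "complex_of_real r\<odot>q"] pos_closed[OF q(1)] q(2) pos_closed[OF xp]
    by (simp add: adj_smult nv.sm_assoc)
  qed
  have "adj A y\<otimes>y\<oplus>k=\<zero>" using k kc by simp
  then have gy: "g=complex_of_real N\<odot>\<one>\<oplus>adj A y\<otimes>y"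
   using kc k by (simp add: g_def nv.diff_conv)
  have "z=(complex_of_real N\<odot>\<one>\<oplus>m)\<otimes>y"
   using y by (simp add: z_def gy m_def A_l_distr A_r_distr A_assoc)
  then have "z\<otimes>adj A z=(complex_of_real N\<odot>\<one>\<oplus>m)\<otimes>(m\<otimes>(complex_of_real N\<odot>\<one>\<oplus>m))"
   using y mc by (simp add: adj_mult adj_add adj_smult A_assoc m_def)
  also have "...=(complex_of_real (2 * N)\<odot>(m\<otimes>m))\<oplus>((complex_of_real (N * N)\<odot>m)\<oplus>m\<otimes>(m\<otimes>m))"
  proof -
   have "complex_of_real (2 * N)\<odot>(m\<otimes>m)=complex_of_real N\<odot>(m\<otimes>m)\<oplus>complex_of_real N\<odot>(m\<otimes>m)"
    using mc by (simp flip: nv.sm_add_left)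
   then show ?thesis using mc by (simp add: alg_expand nv.add_ac)
  qed
  finally have e: "z\<otimes>adj A z=(complex_of_real (2 * N)\<odot>(m\<otimes>m))\<oplus>((complex_of_real (N * N)\<odot>m)\<oplus>m\<otimes>(m\<otimes>m))" .
  have "cnorm A (complex_of_real (2 * N)\<odot>(m\<otimes>m))<=cnorm A (z\<otimes>adj A z)"
   unfolding e using scale[OF m2, of "sqrt (2 * N)"] N0 scale[OF mpos, of N] m3
   by (intro pos_mono pos_add) simp_all
  also have "cnorm A (z\<otimes>adj A z)=(cnorm A z)\<^sup>2"
   using cstar_identity[of "adj A z"] zc by simp
  finally show ?thesis
   using N0 mc by (simp add: cnorm_smult pos_norm_square mN power2_eq_square)
 qed
 ultimately have "N * (N * N)<=0" by linarith
 then have "N=0" using N0 by (simp add: mult_le_0_iff)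
 then have "cnorm A y=0" using yN by simp
 then show ?thesis using cnorm_eq_0[OF y] by blast
qed

text \<open>Let \<open>c\<close> be the root of \<open>a a\<close>, so that \<open>e = c - a\<close>
  is morally twice the negative part of \<open>a\<close>. From \<open>a e = - c e\<close> it follows
  that \<open>adj A (x\<otimes>e) \<otimes> (x\<otimes>e)\<close> is \<open>- w w\<close> with
  \<open>w = r e\<close> and \<open>r r = c\<close>. The previous lemma kills \<open>x e\<close>,
  hence \<open>w\<close>, then \<open>c e\<close>, and finally \<open>e\<close>.\<close>

theorem pos_star_square:
 assumes x: "x:carrier A" shows "pos (adj A x\<otimes>x)"
proof -
 define a where "a=adj A x\<otimes>x"
 have a: "a:carrier A" "adj A a=a" using x by (simp_all add: a_def adj_mult)
 obtain c where c: "pos c" "c\<otimes>c=a\<otimes>a" "!!z. [|z:carrier A; z\<otimes>(a\<otimes>a)=(a\<otimes>a)\<otimes>z|]==>z\<otimes>c=c\<otimes>z"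
  using pos_sqrt[OF pos_square[OF a]] by blast
 note cc = pos_closed[OF c(1)]
 obtain r where r: "pos r" "r\<otimes>r=c" "!!z. [|z:carrier A; z\<otimes>c=c\<otimes>z|]==>z\<otimes>r=r\<otimes>z"
  using pos_sqrt[OF c(1)] by blast
 note rc = pos_closed[OF r(1)]
 have ac: "a\<otimes>c=c\<otimes>a" using c(3)[of a] a(1) by (simp add: A_assoc)
 define e where "e=c\<ominus>a"
 have e: "e:carrier A" "adj A e=e" using a cc by (simp_all add: e_def adj_diff)
 have "e\<otimes>c=c\<otimes>e" using ac a(1) cc(1) by (simp add: e_def alg_expand)
 then have er: "e\<otimes>r=r\<otimes>e" using r(3) e by blast
 have ae: "a\<otimes>e=(- 1)\<odot>(c\<otimes>e)"
  using ac a(1) cc(1) by (simp add: e_def alg_expand c(2) nv.add_comm)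
 define w where "w=r\<otimes>e"
 have w: "w:carrier A" "adj A w=w" using e rc er by (simp_all add: w_def adj_mult)
 have "adj A (x\<otimes>e)\<otimes>(x\<otimes>e)=e\<otimes>(a\<otimes>e)"
  using x e by (simp add: adj_mult A_assoc a_def)
 also have "...=(- 1)\<odot>(e\<otimes>((r\<otimes>r)\<otimes>e))"
  using e cc(1) by (simp add: ae r(2))
 also have "e\<otimes>((r\<otimes>r)\<otimes>e)=w\<otimes>w"
 proof -
  have "e\<otimes>((r\<otimes>r)\<otimes>e)=(e\<otimes>r)\<otimes>(r\<otimes>e)" using e(1) rc(1) by (simp add: A_assoc)
  then show ?thesis by (simp add: w_def er)
 qed
 finally have xe: "adj A (x\<otimes>e)\<otimes>(x\<otimes>e)=(- 1)\<odot>(w\<otimes>w)" .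
 then have "x\<otimes>e=\<zero>"
  using minus_star_square_pos_imp_zero[OF _ pos_square[OF w]] x e by simp
 then have "cnorm A (w\<otimes>w)=0"
  using arg_cong[OF xe, of "cnorm A"] w by (simp add: cnorm_smult)
 then have "w=\<zero>" using pos_norm_square[OF w] cnorm_eq_0[OF w(1)] by simp
 then have ce: "c\<otimes>e=\<zero>"
  using rc(1) e(1) by (simp add: w_def A_assoc flip: r(2))
 have "e\<otimes>e=c\<otimes>e\<oplus>(- 1)\<odot>(a\<otimes>e)"
  using e(1) a(1) cc(1) by (subst (1) e_def) (simp add: alg_expand)
 then have "e\<otimes>e=\<zero>" using cc(1) e(1) by (simp add: ae ce)
 then have "e=\<zero>" using pos_norm_square[OF e] cnorm_eq_0[OF e(1)] by simp
 then have "a=c" using nv.diff_eq_0 a cc by (simp add: e_def)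
 then show ?thesis using c(1) a_def by simp
qed

lemma pos_finsum:
 assumes "finite F" "!!i. i:F==>pos (f i)" shows "pos (finsum A f F)"
 using assms
proof (induction F)
 case (insert i F)
 then have "f:F \<rightarrow> carrier A" "f i:carrier A" by (auto simp: pos_closed)
 then show ?case using insert by (simp add: pos_add)
qed (simp add: pos_zero)

end

lemma (in cstar_algebra) cnorm_finsum_le:
 "(!!i. i < (n::nat)==>f i:carrier A)==>cnorm A (finsum A f {..<n})<=(\<Sum>i<n. cnorm A (f i))"
proof (induction n)
 case (Suc n)
 then have "f:{..<n} \<rightarrow> carrier A" "f n:carrier A" by auto
 then show ?case using Suc cnorm_add[of "finsum A f {..<n}" "f n"] by (auto simp: lessThan_Suc nv.add_comm)
qed simp

section \<open>Hilbert modules: Cauchy-Schwarz and the norm\<close>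

context hilbert_module
begin

abbreviation B_mult (infixl "\<otimes>\<^sub>B" 70) where "b\<otimes>\<^sub>B c\<equiv>b\<otimes>\<^bsub>B\<^esub> c"
abbreviation B_add (infixl "\<oplus>\<^sub>B" 65) where "b\<oplus>\<^sub>B c\<equiv>b\<oplus>\<^bsub>B\<^esub> c"
abbreviation B_minus (infixl "\<ominus>\<^sub>B" 65) where "b\<ominus>\<^sub>B c\<equiv>b\<ominus>\<^bsub>B\<^esub> c"
abbreviation B_smult (infixl "\<odot>\<^sub>B" 70) where "c\<odot>\<^sub>B b\<equiv>c\<odot>\<^bsub>B\<^esub> b"

declare right_closed [simp] ip_closed [simp]

lemma ip_add_left: "[|x:carrier X; y:carrier X; z:carrier X|]
==>hip X (x\<oplus>\<^bsub>X\<^esub> y) z=hip X x z\<oplus>\<^sub>B hip X y z"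
 using ip_adj[of z "x\<oplus>\<^bsub>X\<^esub> y"] ip_adj[of z x] ip_adj[of z y] ip_add[of z x y] B.adj_add by simp

lemma ip_smult_left: "[|x:carrier X; y:carrier X|]==>hip X (c\<odot>\<^bsub>X\<^esub> x) y=cnj c\<odot>\<^sub>B hip X x y"
 using ip_adj[of y "c\<odot>\<^bsub>X\<^esub> x"] ip_adj[of y x] ip_smult[of y x] B.adj_smult by simp

lemma ip_right_left: "[|x:carrier X; y:carrier X; b:carrier B|]
==>hip X (hright X x b) y=adj B b\<otimes>\<^sub>B hip X x y"
 using ip_adj[of y "hright X x b"] ip_adj[of y x] ip_right[of y x b] B.adj_mult by simp

lemma ip_zero [simp]: "x:carrier X==>hip X x \<zero>\<^bsub>X\<^esub>=\<zero>\<^bsub>B\<^esub>"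
 using ip_smult[of x x 0] X.smult_l_null[of x] by simp

lemma ip_zero_left [simp]: "x:carrier X==>hip X \<zero>\<^bsub>X\<^esub> x=\<zero>\<^bsub>B\<^esub>"
 using ip_adj[of x "\<zero>\<^bsub>X\<^esub>"] by simp

lemma pos_ip: "x:carrier X==>B.pos (hip X x x)"
 using ip_pos[of x] B.pos_star_square by auto

lemma hnorm_sq: "x:carrier X==>(hnorm B X x)\<^sup>2=cnorm B (hip X x x)"
 by (simp add: hnorm_def B.cnorm_nonneg)

lemma hnorm_nonneg: "x:carrier X==>0<=hnorm B X x"
 by (simp add: hnorm_def B.cnorm_nonneg)

lemma hnorm_smult: "x:carrier X==>hnorm B X (c\<odot>\<^bsub>X\<^esub> x)=cmod c * hnorm B X x"
 by (simp add: hnorm_def ip_smult ip_smult_left B.nv.sm_assoc B.cnorm_smult norm_mult real_sqrt_mult)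

lemma hnorm_eq_0: "x:carrier X==>hnorm B X x=0\<longleftrightarrow>x=\<zero>\<^bsub>X\<^esub>"
 using B.cnorm_eq_0[of "hip X x x"] ip_definite[of x] by (auto simp: hnorm_def)

text \<open>For \<open>\<parallel>\<langle>x, x\<rangle>\<parallel> \<le> 1\<close> and \<open>b = \<langle>x, y\<rangle>\<close>, write \<open>1 - \<langle>x, x\<rangle> = s\<^sup>2\<close>; then
 \<open>\<langle>y, y\<rangle> = b\<^sup>* b + (s b)\<^sup>* (s b) + \<langle>y - x b, y - x b\<rangle>\<close>.\<close>

lemma cauchy_schwarz:
 assumes x: "x:carrier X" and y: "y:carrier X"
 shows "cnorm B (hip X x y)<=hnorm B X x * hnorm B X y"
proof -
 have unit: "(cnorm B (hip X x y))\<^sup>2<=cnorm B (hip X y y)"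
  if x: "x:carrier X" and le: "cnorm B (hip X x x)<=1" for x
 proof -
  define a where "a=hip X x x" define b where "b=hip X x y"
  have ab: "a:carrier B" "b:carrier B" "adj B a=a" "adj B b=hip X y x"
   using x y by (simp_all add: a_def b_def ip_adj)
  have "B.pos (complex_of_real 1\<odot>\<^sub>B \<one>\<^bsub>B\<^esub>\<ominus>\<^sub>B a)"
   using B.pos_scalar_minus[of a 1] ab le by (simp add: a_def)
  then obtain s where s: "B.pos s" "s\<otimes>\<^sub>B s=complex_of_real 1\<odot>\<^sub>B \<one>\<^bsub>B\<^esub>\<ominus>\<^sub>B a"
   using B.pos_sqrt by blast
  note sc = B.pos_closed[OF s(1)]
  define v where "v=y\<oplus>\<^bsub>X\<^esub> (- 1)\<odot>\<^bsub>X\<^esub> hright X x b"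
  have v: "v:carrier X" using x y ab(1,2) by (simp add: v_def)
  define bb where "bb=adj B b\<otimes>\<^sub>B b"
  define bab where "bab=adj B b\<otimes>\<^sub>B (a\<otimes>\<^sub>B b)"
  have c: "bb:carrier B" "bab:carrier B" using ab(1,2) by (simp_all add: bb_def bab_def)
  have vv: "hip X v v=(hip X y y\<oplus>\<^sub>B (- 1)\<odot>\<^sub>B bb)\<oplus>\<^sub>B ((- 1)\<odot>\<^sub>B bb\<oplus>\<^sub>B bab)"
   using x y ab(1,2) unfolding v_def bb_def bab_def
   by (simp add: ip_add ip_add_left ip_smult ip_smult_left ip_right ip_right_left B.nv.sm_assoc
     B.nv.sm_add_right B.A_assoc B.A_l_distr flip: a_def b_def ab(4))
  have sb: "adj B (s\<otimes>\<^sub>B b)\<otimes>\<^sub>B (s\<otimes>\<^sub>B b)=bb\<oplus>\<^sub>B (- 1)\<odot>\<^sub>B bab"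
  proof -
   have "adj B (s\<otimes>\<^sub>B b)\<otimes>\<^sub>B (s\<otimes>\<^sub>B b)=adj B b\<otimes>\<^sub>B ((s\<otimes>\<^sub>B s)\<otimes>\<^sub>B b)"
    using sc ab(1,2) by (simp add: B.adj_mult B.A_assoc)
   then show ?thesis using ab(1,2) by (simp add: s(2) B.alg_expand bb_def bab_def)
  qed
  have "hip X y y=bb\<oplus>\<^sub>B (hip X v v\<oplus>\<^sub>B adj B (s\<otimes>\<^sub>B b)\<otimes>\<^sub>B (s\<otimes>\<^sub>B b))"
  proof -
   have "(p\<oplus>\<^sub>B (- 1)\<odot>\<^sub>B q)\<oplus>\<^sub>B ((- 1)\<odot>\<^sub>B q\<oplus>\<^sub>B r)\<oplus>\<^sub>B (q\<oplus>\<^sub>B (- 1)\<odot>\<^sub>B r)=p\<oplus>\<^sub>B (- 1)\<odot>\<^sub>B q"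
    if "p:carrier B" "q:carrier B" "r:carrier B" for p q r
   proof -
    have "(p\<oplus>\<^sub>B (- 1)\<odot>\<^sub>B q)\<oplus>\<^sub>B ((- 1)\<odot>\<^sub>B q\<oplus>\<^sub>B r)\<oplus>\<^sub>B (q\<oplus>\<^sub>B (- 1)\<odot>\<^sub>B r)
      =(p\<oplus>\<^sub>B (- 1)\<odot>\<^sub>B q)\<oplus>\<^sub>B (((- 1)\<odot>\<^sub>B q\<oplus>\<^sub>B q)\<oplus>\<^sub>B (r\<oplus>\<^sub>B (- 1)\<odot>\<^sub>B r))"
     using that by (simp add: B.nv.add_ac del: B.nv.cancel_left)
    then show ?thesis using that by simp
   qed
   from this[of "hip X y y" bb bab]
   have "hip X v v\<oplus>\<^sub>B adj B (s\<otimes>\<^sub>B b)\<otimes>\<^sub>B (s\<otimes>\<^sub>B b)=hip X y y\<ominus>\<^sub>B bb"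
    using y c by (simp add: vv sb B.nv.diff_conv)
   then show ?thesis
    using y c by (simp add: B.nv.diff_add_cancel B.nv.add_comm[of bb])
  qed
  then have "cnorm B bb<=cnorm B (hip X y y)"
   using B.pos_mono[OF B.pos_star_square[OF ab(2)] B.pos_add[OF pos_ip[OF v] B.pos_star_square[of "s\<otimes>\<^sub>B b"]]]
    sc ab(1,2) by (simp add: bb_def)
  then show ?thesis
   using B.cstar_identity[OF ab(2)] by (simp add: bb_def b_def)
 qed
 show ?thesis
 proof (cases "hnorm B X x=0")
  case True
  then show ?thesis using x y hnorm_eq_0[OF x] by simp
 next
  case False
  define r where "r=hnorm B X x"
  have r: "r > 0" using False hnorm_nonneg[OF x] by (simp add: r_def)
  have "cnorm B (hip X (complex_of_real (1/r)\<odot>\<^bsub>X\<^esub> x) (complex_of_real (1/r)\<odot>\<^bsub>X\<^esub> x))=(hnorm B X (complex_of_real (1/r)\<odot>\<^bsub>X\<^esub> x))\<^sup>2"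
   using x by (subst hnorm_sq) auto
  also have "...=1"
   using r unfolding hnorm_smult[OF x] by (simp add: norm_divide r_def[symmetric])
  finally have "(cnorm B (hip X (complex_of_real (1/r)\<odot>\<^bsub>X\<^esub> x) y))\<^sup>2<=(hnorm B X y)\<^sup>2"
   using unit[of "complex_of_real (1/r)\<odot>\<^bsub>X\<^esub> x"] x y by (simp add: hnorm_sq)
  then have "cnorm B (hip X (complex_of_real (1/r)\<odot>\<^bsub>X\<^esub> x) y)<=hnorm B X y"
   using hnorm_nonneg[OF y] by (rule power2_le_imp_le)
  then have "cnorm B (hip X x y) / r<=hnorm B X y"
   using x y r by (simp only: ip_smult_left B.cnorm_smult ip_closed) (simp add: norm_divide)
  then show ?thesis using r by (simp add: r_def field_simps)
 qed
qed

lemma hnorm_add: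
 assumes x: "x:carrier X" and y: "y:carrier X"
 shows "hnorm B X (x\<oplus>\<^bsub>X\<^esub> y)<=hnorm B X x + hnorm B X y"
proof (rule power2_le_imp_le)
 have "(hnorm B X (x\<oplus>\<^bsub>X\<^esub> y))\<^sup>2=cnorm B ((hip X x x\<oplus>\<^sub>B hip X x y)\<oplus>\<^sub>B (hip X y x\<oplus>\<^sub>B hip X y y))"
  using x y by (simp add: hnorm_sq ip_add ip_add_left B.nv.add_ac)
 also have "...<=(cnorm B (hip X x x) + cnorm B (hip X x y)) + (cnorm B (hip X y x) + cnorm B (hip X y y))"
  using x y by (intro order_trans[OF B.cnorm_add] add_mono B.cnorm_add) simp_all
 also have "...<=(hnorm B X x)\<^sup>2 + hnorm B X x * hnorm B X y + (hnorm B X y * hnorm B X x + (hnorm B X y)\<^sup>2)"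
  using cauchy_schwarz[OF x y] cauchy_schwarz[OF y x] hnorm_sq[OF x] hnorm_sq[OF y] by linarith
 also have "...=(hnorm B X x + hnorm B X y)\<^sup>2"
  by (simp add: power2_eq_square algebra_simps)
 finally show "(hnorm B X (x\<oplus>\<^bsub>X\<^esub> y))\<^sup>2<=(hnorm B X x + hnorm B X y)\<^sup>2" .
qed (use x y hnorm_nonneg in auto)

end

sublocale hilbert_module \<subseteq> Xn: cnormed X "hnorm B X"
 by unfold_locales
  (use hnorm_nonneg hnorm_eq_0 hnorm_add hnorm_smult hcomplete in "auto")

context hilbert_module
begin

lemma hnorm_right:
 assumes "x:carrier X" "b:carrier B" shows "hnorm B X (hright X x b)<=hnorm B X x * cnorm B b"
proof (rule power2_le_imp_le)
 have "(hnorm B X (hright X x b))\<^sup>2=cnorm B (adj B b\<otimes>\<^sub>B (hip X x x\<otimes>\<^sub>B b))"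
  using assms by (simp add: hnorm_sq ip_right ip_right_left B.A_assoc)
 also have "...<=cnorm B b * (cnorm B (hip X x x) * cnorm B b)"
  using assms B.cnorm_mult[of "adj B b" "hip X x x\<otimes>\<^sub>B b"]
   mult_left_mono[OF B.cnorm_mult[of "hip X x x" b] B.cnorm_nonneg[of b]] by simp
 also have "...=(hnorm B X x * cnorm B b)\<^sup>2"
  using assms by (simp add: power_mult_distrib hnorm_sq) (simp add: power2_eq_square)
 finally show "(hnorm B X (hright X x b))\<^sup>2<=(hnorm B X x * cnorm B b)\<^sup>2" .
qed (use assms in "simp add: hnorm_nonneg B.cnorm_nonneg")

lemma ip_diff_right: "[|x:carrier X; y:carrier X; z:carrier X|]
==>hip X x (y\<ominus>\<^bsub>X\<^esub> z)=hip X x y\<ominus>\<^sub>B hip X x z"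
 by (simp add: Xn.diff_conv B.nv.diff_conv ip_add ip_smult)

lemma ip_diff_left: "[|x:carrier X; y:carrier X; z:carrier X|]
==>hip X (y\<ominus>\<^bsub>X\<^esub> z) x=hip X y x\<ominus>\<^sub>B hip X z x"
 by (simp add: Xn.diff_conv B.nv.diff_conv ip_add_left ip_smult_left)

lemma lim_ip:
 assumes "Xn.lim_to s x" "Xn.lim_to s' x'" shows "B.nv.lim_to (%n. hip X (s n) (s' n)) (hip X x x')"
proof -
 note c [simp] = Xn.lim_toD(1,2)[OF assms(1)] Xn.lim_toD(1,2)[OF assms(2)]
 let ?e = "%n. hnorm B X (s n) * hnorm B X (s' n\<ominus>\<^bsub>X\<^esub> x') + hnorm B X (s n\<ominus>\<^bsub>X\<^esub> x) * hnorm B X x'"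
 show ?thesis
 proof (rule B.nv.lim_to_bound[where e = ?e])
  show "cnorm B (hip X (s n) (s' n)\<ominus>\<^sub>B hip X x x')<=?e n" for n
   using B.nv.N_diff_triangle[of "hip X (s n) (s' n)" "hip X (s n) x'" "hip X x x'"]
    cauchy_schwarz[of "s n" "s' n\<ominus>\<^bsub>X\<^esub> x'"] cauchy_schwarz[of "s n\<ominus>\<^bsub>X\<^esub> x" x']
   by (simp add: ip_diff_right ip_diff_left)
  have "?e \<leadsto> hnorm B X x * 0 + 0 * hnorm B X x'"
   using Xn.lim_to_N[OF assms(1)] Xn.lim_toD(3)[OF assms(1)] Xn.lim_toD(3)[OF assms(2)]
   by (intro tendsto_intros)
  then show "?e \<leadsto> 0" by simp
 qed simp_all
qed

lemma lim_right:
 assumes "Xn.lim_to s x" "b:carrier B" shows "Xn.lim_to (%n. hright X (s n) b) (hright X x b)"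
proof -
 note c [simp] = Xn.lim_toD(1,2)[OF assms(1)]
 have d: "hright X (s n) b\<ominus>\<^bsub>X\<^esub> hright X x b=hright X (s n\<ominus>\<^bsub>X\<^esub> x) b" for n
  using assms(2) by (simp add: Xn.diff_conv right_add right_smult)
 show ?thesis
  by (rule Xn.lim_to_bound[where e = "%n. hnorm B X (s n\<ominus>\<^bsub>X\<^esub> x) * cnorm B b"])
   (use assms(2) tendsto_mult_left_zero[OF Xn.lim_toD(3)[OF assms(1)]] in \<open>auto simp: d hnorm_right\<close>)
qed

text \<open>The remaining summands are positive, so omitting them does not raise the norm. Together
  with \<open>hnorm_finsum_le\<close> it makes convergence in a pair completion the same as
  convergence of each coordinate.\<close>

lemma component_norm_le:
 assumes "!!i. i < (n::nat)==>z i:carrier X" "j < n"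
 shows "(hnorm B X (z j))\<^sup>2<=cnorm B (finsum B (%i. hip X (z i) (z i)) {..<n})"
proof -
 let ?f = "%i. hip X (z i) (z i)"
 have pos: "B.pos (?f i)" if "i < n" for i using assms pos_ip that by blast
 have "finsum B ?f (insert j ({..<n} - {j}))=?f j\<oplus>\<^sub>B finsum B ?f ({..<n} - {j})"
  using assms by (simp del: insert_Diff_single add: Pi_def)
 moreover have "insert j ({..<n} - {j})={..<n}" using assms(2) by auto
 moreover have "B.pos (finsum B ?f ({..<n} - {j}))" by (rule B.pos_finsum) (auto simp: pos)
 ultimately show ?thesis
  using B.pos_mono[of "?f j" "finsum B ?f ({..<n} - {j})"] pos assms by (simp add: hnorm_sq)
qed

lemma hnorm_finsum_le:
 assumes "!!i. i < (n::nat)==>z i:carrier X"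
 shows "cnorm B (finsum B (%i. hip X (z i) (z i)) {..<n})<=(\<Sum>i<n. (hnorm B X (z i))\<^sup>2)"
 using B.cnorm_finsum_le[of n "%i. hip X (z i) (z i)"] assms by (simp add: hnorm_sq)

end

lemma id_corr_correspondence:
 fixes A :: "'a cstar" (structure)
 assumes "cstar_algebra A" shows "correspondence A A (id_corr A)"
proof -
 interpret cstar_algebra A by fact
 have g: "abelian_group (id_corr A)"
  by (rule abelian_groupI) (auto simp: id_corr_def nv.add_ac intro: bexI[of _ "\<ominus>x" for x])
 have m: "Module.module complex_alg (id_corr A)"
  by (rule moduleI[OF cring_complex_alg g])
   (auto simp: id_corr_def nv.sm_add_left nv.sm_add_right nv.sm_assoc)
 have a_minus: "a_minus (id_corr A) x y=x\<ominus>y" if "x:carrier A" "y:carrier A" for x y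
 proof -
  interpret I: abelian_group "id_corr A" by (rule g)
  interpret I: Module.module complex_alg "id_corr A" by (rule m)
  have *: "\<ominus>\<^bsub>id_corr A\<^esub> y =\<ominus>y"
   using that by (intro abelian_group.minus_equality[OF g]) (auto simp: id_corr_def nv.minus_conv)
  show ?thesis unfolding a_minus_def * by (simp add: id_corr_def)
 qed
 show ?thesis
 proof (intro correspondence.intro hilbert_module.intro correspondence_axioms.intro hilbert_module_axioms.intro
   cstar_algebra_axioms m)
  \<comment> \<open>By the C*-identity the two norms agree, so completeness is that of
    \<open>A\<close>.\<close>
  have [simp]: "hnorm A (id_corr A) x=cnorm A x" if "x:carrier A" for x
   using that cstar_identity[of x] cnorm_nonneg[of x] by (simp add: hnorm_def id_corr_def)
  show "\<exists>x\<in>carrier (id_corr A). (%n. hnorm A (id_corr A) (s n\<ominus>\<^bsub>id_corr A\<^esub> x)) \<leadsto> 0"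
   if "cauchy_in (carrier (id_corr A)) (%x y. hnorm A (id_corr A) (x\<ominus>\<^bsub>id_corr A\<^esub> y)) s" for s
  proof -
   have c: "carrier (id_corr A)=carrier A" by (simp add: id_corr_def)
   have sc: "s n:carrier A" for n using that by (simp add: cauchy_in_def c)
   have e: "hnorm A (id_corr A) (s n\<ominus>\<^bsub>id_corr A\<^esub> x)=cnorm A (s n\<ominus>x)" if "x:carrier A" for n x
    using sc that by (simp add: a_minus)
   have "cauchy_in (carrier A) (%x y. cnorm A (x\<ominus>y)) s"
    using that sc by (simp add: cauchy_in_def c e)
   from complete[OF this] show ?thesis
    by (simp add: c e cong: bex_cong)
  qed
  show "!!x. x:carrier (id_corr A)==>hip (id_corr A) x x=\<zero>==>x=\<zero>\<^bsub>id_corr A\<^esub>"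
   by (simp add: id_corr_def) (metis cstar_identity cnorm_eq_0 zero_eq_power2 nv.N_zero)
 qed (auto simp: id_corr_def A_assoc A_l_distr A_r_distr adj_mult)
qed

section \<open>Completions of quasi-metric spaces\<close>

text \<open>The factor \<open>C\<close> admits a distance that is only compared with coordinate
  norms: with \<open>n\<close> coordinates the triangle inequality is obtained up to the factor
  \<open>n\<close>.\<close>

locale quasi_metric =
 fixes L :: "'l set" and d :: "'l=>'l=>real" and C :: real
 assumes d_nonneg: "[|x:L; y:L|]==>0<=d x y"
  and d_refl: "x:L==>d x x=0"
  and d_sym: "[|x:L; y:L|]==>d x y=d y x"
  and d_triangle: "[|x:L; y:L; z:L|]==>d x z<=C * (d x y + d y z)"
begin

lemma cauchy_inD: "cauchy_in L d s==>s n:L"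
 by (simp add: cauchy_in_def)

lemma cauchy_const: "x:L==>cauchy_in L d (%n. x)"
 by (simp add: cauchy_in_def d_refl)

lemma null_sym: "[|!!n. s n:L; !!n. t n:L; (%n. d (s n) (t n)) \<leadsto> 0|]==>(%n. d (t n) (s n)) \<leadsto> 0"
 by (simp add: d_sym)

lemma null_trans:
 assumes L: "!!n. s n:L" "!!n. t n:L" "!!n. r n:L"
  and lim: "(%n. d (s n) (t n)) \<leadsto> 0" "(%n. d (t n) (r n)) \<leadsto> 0"
 shows "(%n. d (s n) (r n)) \<leadsto> 0"
proof (rule tendsto_sandwich[OF _ _ tendsto_const])
 show "(%n. C * (d (s n) (t n) + d (t n) (r n))) \<leadsto> 0"
  using tendsto_mult_right_zero[OF tendsto_add_zero[OF lim]] .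
qed (auto intro!: always_eventually d_nonneg d_triangle L)

lemma class_self: "cauchy_in L d s==>s:cauchy_class L d s"
 by (simp add: cauchy_class_def d_refl cauchy_inD)

lemma class_eq_iff:
 assumes "cauchy_in L d s" "cauchy_in L d t"
 shows "cauchy_class L d s=cauchy_class L d t\<longleftrightarrow>(%n. d (s n) (t n)) \<leadsto> 0"
proof
 assume "cauchy_class L d s=cauchy_class L d t"
 then show "(%n. d (s n) (t n)) \<leadsto> 0"
  using class_self[OF assms(2)] by (auto simp: cauchy_class_def)
next
 note c = cauchy_inD[OF assms(1)] cauchy_inD[OF assms(2)]
 assume lim: "(%n. d (s n) (t n)) \<leadsto> 0"
 show "cauchy_class L d s=cauchy_class L d t"
 proof -
  have "(%n. d (t n) (r n)) \<leadsto> 0\<longleftrightarrow>(%n. d (s n) (r n)) \<leadsto> 0" if "cauchy_in L d r" for r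
   using null_trans[where s = t and t = s and r = r] null_trans[where s = s and t = t and r = r]
    c cauchy_inD[OF that] null_sym[OF c lim] lim by blast
  then show ?thesis by (auto simp: cauchy_class_def)
 qed
qed

lemma rep_class:
 assumes "cauchy_in L d s"
 shows "cauchy_in L d (rep (cauchy_class L d s))" "(%n. d (s n) (rep (cauchy_class L d s) n)) \<leadsto> 0"
proof -
 have "rep (cauchy_class L d s):cauchy_class L d s"
  unfolding rep_def using class_self[OF assms] by (rule someI[where P = "%s'. s':cauchy_class L d s"])
 then show "cauchy_in L d (rep (cauchy_class L d s))" "(%n. d (s n) (rep (cauchy_class L d s) n)) \<leadsto> 0"
  by (simp_all add: cauchy_class_def)
qed

lemma class_in_completion: "cauchy_in L d s==>cauchy_class L d s:completion L d"
 by (simp add: completion_def)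

lemma rep_completion:
 assumes "u:completion L d"
 shows "cauchy_in L d (rep u)" "cauchy_class L d (rep u)=u"
proof -
 obtain s where s: "cauchy_in L d s" "u=cauchy_class L d s"
  using assms by (auto simp: completion_def)
 show "cauchy_in L d (rep u)" using rep_class(1)[OF s(1)] s by simp
 then show "cauchy_class L d (rep u)=u"
  using rep_class(2)[OF s(1)] class_eq_iff[OF s(1)] s(2) by metis
qed

lemma rep_in: "u:completion L d==>rep u n:L"
 using rep_completion cauchy_inD by blast

end

section \<open>Formal sums and the maximal tensor product\<close>

lemma pair_lists_simps [simp]:
 "[]:pair_lists X Y" "(x, y) # l:pair_lists X Y\<longleftrightarrow>x:carrier X&y:carrier Y&l:pair_lists X Y"
 "l @ l':pair_lists X Y\<longleftrightarrow>l:pair_lists X Y&l':pair_lists X Y"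
 by (auto simp: pair_lists_def)

lemma pair_lists_induct [consumes 1, case_names Nil Cons]:
 assumes "l:pair_lists X Y" "P []"
  "!!x y l. [|x:carrier X; y:carrier Y; l:pair_lists X Y; P l|]==>P ((x, y) # l)"
 shows "P l"
 using assms(1)
 by (induction l) (use assms in "auto simp: pair_lists_def")

lemma pair_scale_simps [simp]:
 "pair_scale X c []=[]" "pair_scale X c ((x, y) # l)=(c\<odot>\<^bsub>X\<^esub> x, y) # pair_scale X c l"
 "pair_scale X c (l @ l')=pair_scale X c l @ pair_scale X c l'"
 by (simp_all add: pair_scale_def)

lemma pair_mult_simps [simp]:
 "pair_mult A B [] m=[]"
 "pair_mult A B ((a, b) # l) m=map (%(a', b'). (a\<otimes>\<^bsub>A\<^esub> a', b\<otimes>\<^bsub>B\<^esub> b')) m @ pair_mult A B l m"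
 "pair_mult A B (l @ l') m=pair_mult A B l m @ pair_mult A B l' m"
 by (simp_all add: pair_mult_def)

lemma pair_adj_simps [simp]:
 "pair_adj A B []=[]" "pair_adj A B ((a, b) # l)=(adj A a, adj B b) # pair_adj A B l"
 "pair_adj A B (l @ l')=pair_adj A B l @ pair_adj A B l'"
 by (simp_all add: pair_adj_def)

text \<open>Any term can be brought to the front by \<open>commute\<close> inside
  \<open>append\<close>, so the order of terms is immaterial. Identities between formal sums can
  then be checked on multisets.\<close>

lemma alg_tensor_eq_mset: "mset l=mset l'==>alg_tensor_eq A B l l'"
proof (induction l arbitrary: l')
 case (Cons x l)
 then have "x:set l'" by (metis list.set_intros(1) set_mset_mset)
 then obtain ys zs where l': "l'=ys @ x # zs" by (meson split_list)
 then have "alg_tensor_eq A B l (ys @ zs)" using Cons by simp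
 then have 1: "alg_tensor_eq A B ([x] @ l) ([x] @ (ys @ zs))"
  by (intro alg_tensor_eq.append alg_tensor_eq.refl)
 have "alg_tensor_eq A B (([x] @ ys) @ zs) ((ys @ [x]) @ zs)"
  by (intro alg_tensor_eq.append alg_tensor_eq.refl alg_tensor_eq.commute)
 with 1 show ?case unfolding l' using alg_tensor_eq.trans by fastforce
qed (simp add: alg_tensor_eq.refl)

locale cstar_pair = A: cstar_algebra A + B: cstar_algebra B
 for A :: "'a cstar" and B :: "'b cstar"
begin

abbreviation "L\<equiv>pair_lists A B"
abbreviation teq (infix "\<doteq>" 50) where "l \<doteq> l'\<equiv>alg_tensor_eq A B l l'"
abbreviation "pscale\<equiv>pair_scale A"
abbreviation "pmult\<equiv>pair_mult A B"
abbreviation "padj\<equiv>pair_adj A B"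

lemma scale_closed [simp]: "l:L==>pscale c l:L"
 by (induction l rule: pair_lists_induct) auto

lemma map_closed [simp]: "[|m:L; a:carrier A; b:carrier B|]==>map (%(a', b'). (a\<otimes>\<^bsub>A\<^esub> a', b\<otimes>\<^bsub>B\<^esub> b')) m:L"
 by (induction m rule: pair_lists_induct) auto

lemma pmult_closed [simp]: "[|l:L; m:L|]==>pmult l m:L"
 by (induction l rule: pair_lists_induct) auto

lemma padj_closed [simp]: "l:L==>padj l:L"
 by (induction l rule: pair_lists_induct) auto

lemma scale_scale: "l:L==>pscale c (pscale d l)=pscale (c * d) l"
 by (induction l rule: pair_lists_induct) (auto simp: A.nv.sm_assoc)

lemma scale_one: "l:L==>pscale 1 l=l"
 by (induction l rule: pair_lists_induct) auto

lemma teq_mset: "mset l=mset l'==>l \<doteq> l'"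
 by (rule alg_tensor_eq_mset)

lemma teq_append: "l \<doteq> l'==>m \<doteq> m'==>l @ m \<doteq> l' @ m'"
 by (rule alg_tensor_eq.append)

lemma teq_trans [trans]: "l \<doteq> l'==>l' \<doteq> m==>l \<doteq> m"
 by (rule alg_tensor_eq.trans)

lemma teq_refl [simp]: "l \<doteq> l"
 by (rule alg_tensor_eq.refl)

lemma scale_add: "l:L==>pscale (c + d) l \<doteq> pscale c l @ pscale d l"
proof (induction l rule: pair_lists_induct)
 case (Cons x y l)
 have "pscale (c + d) ((x, y) # l)=[(c\<odot>\<^bsub>A\<^esub> x\<oplus>\<^bsub>A\<^esub> d\<odot>\<^bsub>A\<^esub> x, y)] @ pscale (c + d) l"
  using Cons(1) by (simp add: A.nv.sm_add_left)
 also have "... \<doteq> [(c\<odot>\<^bsub>A\<^esub> x, y), (d\<odot>\<^bsub>A\<^esub> x, y)] @ (pscale c l @ pscale d l)"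
  using Cons by (intro teq_append alg_tensor_eq.add_left) auto
 also have "... \<doteq> pscale c ((x, y) # l) @ pscale d ((x, y) # l)"
  by (rule teq_mset) simp
 finally show ?case .
qed simp

lemma scale_zero: "l:L==>pscale 0 l \<doteq> []"
proof (induction l rule: pair_lists_induct)
 case (Cons x y l)
 have "[(\<zero>\<^bsub>A\<^esub>, y)] @ pscale 0 l \<doteq> [] @ []"
  using Cons by (intro teq_append alg_tensor_eq.zero) auto
 then show ?case using Cons by simp
qed simp

lemma cancel: "l:L==>l @ pscale (- 1) l \<doteq> []" "l:L==>pscale (- 1) l @ l \<doteq> []"
 using scale_add[of l 1 "- 1"] scale_add[of l "- 1" 1] scale_zero[of l] alg_tensor_eq.sym alg_tensor_eq.trans
 by (fastforce simp: scale_one)+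

lemma pmult_scale_left: "[|l:L; m:L|]==>pmult (pscale c l) m=pscale c (pmult l m)"
proof (induction l rule: pair_lists_induct)
 case (Cons a b l)
 have "map (%(a', b'). ((c\<odot>\<^bsub>A\<^esub> a)\<otimes>\<^bsub>A\<^esub> a', b\<otimes>\<^bsub>B\<^esub> b')) m=pscale c (map (%(a', b'). (a\<otimes>\<^bsub>A\<^esub> a', b\<otimes>\<^bsub>B\<^esub> b')) m)"
  using Cons(5) by (induction m rule: pair_lists_induct) (use Cons(1) in auto)
 with Cons show ?case by simp
qed simp

lemma pmult_scale_right: "[|l:L; m:L|]==>pmult l (pscale c m)=pscale c (pmult l m)"
proof (induction l rule: pair_lists_induct)
 case (Cons a b l)
 have "map (%(a', b'). (a\<otimes>\<^bsub>A\<^esub> a', b\<otimes>\<^bsub>B\<^esub> b')) (pscale c m)=pscale c (map (%(a', b'). (a\<otimes>\<^bsub>A\<^esub> a', b\<otimes>\<^bsub>B\<^esub> b')) m)"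
  using Cons(5) by (induction m rule: pair_lists_induct) (use Cons(1) in auto)
 with Cons show ?case by simp
qed simp

lemma pmult_append_right: "pmult l (m @ m') \<doteq> pmult l m @ pmult l m'"
 by (rule teq_mset) (induction l, auto)

lemma pmult_assoc: "[|l:L; m:L; r:L|]==>pmult (pmult l m) r=pmult l (pmult m r)"
proof (induction l rule: pair_lists_induct)
 case (Cons a b l)
 have "pmult (map (%(a', b'). (a\<otimes>\<^bsub>A\<^esub> a', b\<otimes>\<^bsub>B\<^esub> b')) m) r=map (%(a', b'). (a\<otimes>\<^bsub>A\<^esub> a', b\<otimes>\<^bsub>B\<^esub> b')) (pmult m r)"
  using Cons(5)
 proof (induction m rule: pair_lists_induct)
  case (Cons a' b' m)
  have "map (%(x, y). ((a\<otimes>\<^bsub>A\<^esub> a')\<otimes>\<^bsub>A\<^esub> x, (b\<otimes>\<^bsub>B\<^esub> b')\<otimes>\<^bsub>B\<^esub> y)) r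
   =map (%(x, y). (a\<otimes>\<^bsub>A\<^esub> x, b\<otimes>\<^bsub>B\<^esub> y)) (map (%(x, y). (a'\<otimes>\<^bsub>A\<^esub> x, b'\<otimes>\<^bsub>B\<^esub> y)) r)"
   using \<open>r \<in> L\<close>
   by (induction r rule: pair_lists_induct)
    (use Cons(1,2) \<open>a \<in> carrier A\<close> \<open>b \<in> carrier B\<close> in \<open>auto simp: A.A_assoc B.A_assoc\<close>)
  with Cons show ?case by simp
 qed simp
 with Cons show ?case by simp
qed simp

lemma pmult_one: "l:L==>pmult [(\<one>\<^bsub>A\<^esub>, \<one>\<^bsub>B\<^esub>)] l=l" "l:L==>pmult l [(\<one>\<^bsub>A\<^esub>, \<one>\<^bsub>B\<^esub>)]=l"
 by (induction l rule: pair_lists_induct) auto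

lemma padj_padj: "l:L==>padj (padj l)=l"
 by (induction l rule: pair_lists_induct) auto

lemma padj_scale: "l:L==>padj (pscale c l)=pscale (cnj c) (padj l)"
 by (induction l rule: pair_lists_induct) (auto simp: A.adj_smult)

text \<open>Taking adjoints reverses the nesting of the double sum, hence equality only up to the
  order of terms.\<close>

lemma padj_pmult: "[|l:L; m:L|]==>padj (pmult l m) \<doteq> pmult (padj m) (padj l)"
proof (rule teq_mset, induction l rule: pair_lists_induct)
 case Nil
 show ?case by (induction m) auto
next
 case (Cons a b l)
 have 1: "mset (padj (map (%(a', b'). (a\<otimes>\<^bsub>A\<^esub> a', b\<otimes>\<^bsub>B\<^esub> b')) m)) + mset (pmult (padj m) k)=mset (pmult (padj m) ((adj A a, adj B b) # k))" for k
  using Cons(5) by (induction m rule: pair_lists_induct) (use Cons(1,2) in \<open>auto simp: A.adj_mult B.adj_mult\<close>)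
 show ?case using Cons 1[of "padj l"] by simp
qed

text \<open>On \<open>a \<otimes> 1\<close> and on \<open>1 \<otimes> b\<close> the function
  \<open>p\<close> is a C*-seminorm of a single algebra, so \<open>cstar_seminorm_le\<close> bounds
  it; submultiplicativity and the triangle inequality do the rest. The bound does not depend on
  \<open>p\<close>.\<close>

lemma seminorm_bound:
 assumes p: "cstar_seminorm A B p" and l: "l:L"
 shows "p l<=(\<Sum>(a, b)\<leftarrow>l. cnorm A a * cnorm B b)"
proof -
 note P = p[unfolded cstar_seminorm_def, rule_format]
 have p_teq: "p l=p l'" if "l:L" "l':L" "l \<doteq> l'" for l l' using P that by blast
 have p0: "0<=p l" if "l:L" for l using P that by blast
 have psc: "p (pscale c l)=cmod c * p l" if "l:L" for c l using P that by blast
 have papp: "p (l @ l')<=p l + p l'" if "l:L" "l':L" for l l' using P that by blast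
 have pmul: "p (pmult l l')<=p l * p l'" if "l:L" "l':L" for l l' using P that by blast
 have pstar: "p (pmult (padj l) l)=(p l)\<^sup>2" if "l:L" for l using P that by blast
 have pA: "p [(a, \<one>\<^bsub>B\<^esub>)]<=cnorm A a" if "a:carrier A" for a
 proof (rule A.cstar_seminorm_le[where p = "%a. p [(a, \<one>\<^bsub>B\<^esub>)]"])
  show "p [(c\<odot>\<^bsub>A\<^esub> x, \<one>\<^bsub>B\<^esub>)]=cmod c * p [(x, \<one>\<^bsub>B\<^esub>)]" if "x:carrier A" for x c
   using psc[of "[(x, \<one>\<^bsub>B\<^esub>)]" c] that by simp
  show "p [(x\<oplus>\<^bsub>A\<^esub> y, \<one>\<^bsub>B\<^esub>)]<=p [(x, \<one>\<^bsub>B\<^esub>)] + p [(y, \<one>\<^bsub>B\<^esub>)]" if "x:carrier A" "y:carrier A" for x y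
   using papp[of "[(x, \<one>\<^bsub>B\<^esub>)]" "[(y, \<one>\<^bsub>B\<^esub>)]"] p_teq[OF _ _ alg_tensor_eq.add_left, of x y "\<one>\<^bsub>B\<^esub>"] that by simp
  show "p [(x\<otimes>\<^bsub>A\<^esub> y, \<one>\<^bsub>B\<^esub>)]<=p [(x, \<one>\<^bsub>B\<^esub>)] * p [(y, \<one>\<^bsub>B\<^esub>)]" if "x:carrier A" "y:carrier A" for x y
   using pmul[of "[(x, \<one>\<^bsub>B\<^esub>)]" "[(y, \<one>\<^bsub>B\<^esub>)]"] that by simp
  show "p [(adj A x\<otimes>\<^bsub>A\<^esub> x, \<one>\<^bsub>B\<^esub>)]=(p [(x, \<one>\<^bsub>B\<^esub>)])\<^sup>2" if "x:carrier A" for x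
   using pstar[of "[(x, \<one>\<^bsub>B\<^esub>)]"] that by simp
 qed (use p0 that in auto)
 have pB: "p [(\<one>\<^bsub>A\<^esub>, b)]<=cnorm B b" if "b:carrier B" for b
 proof (rule B.cstar_seminorm_le[where p = "%b. p [(\<one>\<^bsub>A\<^esub>, b)]"])
  show "p [(\<one>\<^bsub>A\<^esub>, c\<odot>\<^bsub>B\<^esub> x)]=cmod c * p [(\<one>\<^bsub>A\<^esub>, x)]" if "x:carrier B" for x c
   using psc[of "[(\<one>\<^bsub>A\<^esub>, x)]" c] p_teq[OF _ _ alg_tensor_eq.scale[where a = "\<one>\<^bsub>A\<^esub>" and b = x and c = c]] that by simp
  show "p [(\<one>\<^bsub>A\<^esub>, x\<oplus>\<^bsub>B\<^esub> y)]<=p [(\<one>\<^bsub>A\<^esub>, x)] + p [(\<one>\<^bsub>A\<^esub>, y)]" if "x:carrier B" "y:carrier B" for x y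
   using papp[of "[(\<one>\<^bsub>A\<^esub>, x)]" "[(\<one>\<^bsub>A\<^esub>, y)]"] p_teq[OF _ _ alg_tensor_eq.add_right, of "\<one>\<^bsub>A\<^esub>" x y] that by simp
  show "p [(\<one>\<^bsub>A\<^esub>, x\<otimes>\<^bsub>B\<^esub> y)]<=p [(\<one>\<^bsub>A\<^esub>, x)] * p [(\<one>\<^bsub>A\<^esub>, y)]" if "x:carrier B" "y:carrier B" for x y
   using pmul[of "[(\<one>\<^bsub>A\<^esub>, x)]" "[(\<one>\<^bsub>A\<^esub>, y)]"] that by simp
  show "p [(\<one>\<^bsub>A\<^esub>, adj B x\<otimes>\<^bsub>B\<^esub> x)]=(p [(\<one>\<^bsub>A\<^esub>, x)])\<^sup>2" if "x:carrier B" for x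
   using pstar[of "[(\<one>\<^bsub>A\<^esub>, x)]"] that by simp
 qed (use p0 that in auto)
 have pAB: "p [(a, b)]<=cnorm A a * cnorm B b" if "a:carrier A" "b:carrier B" for a b
  using pmul[of "[(a, \<one>\<^bsub>B\<^esub>)]" "[(\<one>\<^bsub>A\<^esub>, b)]"] pA pB that p0
   mult_mono[of "p [(a, \<one>\<^bsub>B\<^esub>)]" "cnorm A a" "p [(\<one>\<^bsub>A\<^esub>, b)]" "cnorm B b"] A.cnorm_nonneg by force
 show ?thesis
  using l
 proof (induction l rule: pair_lists_induct)
  case Nil
  then show ?case using psc[of "[]" 0] by simp
 next
  case (Cons a b l)
  then show ?case using papp[of "[(a, b)]" l] pAB[of a b] by simp
 qed
qed

abbreviation "N\<equiv>max_norm A B"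

lemma le_max_norm: "[|cstar_seminorm A B p; l:L|]==>p l<=N l"
 unfolding max_norm_def using seminorm_bound
 by (intro cSup_upper bdd_aboveI[where M = "\<Sum>(a, b)\<leftarrow>l. cnorm A a * cnorm B b"]) auto

text \<open>The zero function is a C*-seminorm, so the supremum is over a nonempty set.\<close>

lemma max_norm_le: "(!!p. cstar_seminorm A B p==>p l<=r)==>N l<=r"
proof -
 have "cstar_seminorm A B (%l. 0)" by (simp add: cstar_seminorm_def)
 then show "(!!p. cstar_seminorm A B p==>p l<=r)==>N l<=r"
  unfolding max_norm_def by (intro cSup_least) auto
qed

lemma seminormD:
 assumes "cstar_seminorm A B p" "l:L" "l':L"
 shows "l \<doteq> l'==>p l=p l'" "0<=p l" "p (pscale c l)=cmod c * p l" "p (l @ l')<=p l + p l'"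
  "p (pmult l l')<=p l * p l'" "p (pmult (padj l) l)=(p l)\<^sup>2"
 using assms unfolding cstar_seminorm_def by blast+

lemma cstar_seminorm_max_norm: "cstar_seminorm A B N"
proof -
 have zero: "cstar_seminorm A B (%l. 0)" by (simp add: cstar_seminorm_def)
 have nonneg: "0<=N l" if "l:L" for l using le_max_norm[OF zero that] by simp
 have 1: "N l=N l'" if "l:L" "l':L" "l \<doteq> l'" for l l'
 proof -
  have "p l=p l'" if "cstar_seminorm A B p" for p
   using seminormD(1)[OF that \<open>l \<in> L\<close> \<open>l' \<in> L\<close> \<open>l \<doteq> l'\<close>] .
  then have "{p l |p. cstar_seminorm A B p}={p l' |p. cstar_seminorm A B p}" by metis
  then show ?thesis by (simp add: max_norm_def)
 qed
 have 2: "N (pscale c l)=cmod c * N l" if l: "l:L" for c l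
 proof (rule antisym)
  show "N (pscale c l)<=cmod c * N l"
   using seminormD(3)[OF _ l l] le_max_norm[OF _ l] by (intro max_norm_le) (metis mult_left_mono norm_ge_zero)
  show "cmod c * N l<=N (pscale c l)"
  proof (cases "c=0")
   case True
   then show ?thesis using nonneg[of "pscale c l"] l by simp
  next
   case False
   have "N l<=N (pscale c l) / cmod c"
   proof (rule max_norm_le)
    fix p assume "cstar_seminorm A B p"
    then show "p l<=N (pscale c l) / cmod c"
     using seminormD(3)[of p l l c] l le_max_norm[of p "pscale c l"] False
     by (simp add: pos_le_divide_eq mult.commute)
   qed
   then show ?thesis using False by (simp add: field_simps)
  qed
 qed
 have 3: "N (l @ l')<=N l + N l'" if "l:L" "l':L" for l l'
  using seminormD(4)[OF _ that] le_max_norm[OF _ that(1)] le_max_norm[OF _ that(2)]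
  by (intro max_norm_le) (meson add_mono order_trans)
 have 4: "N (pmult l l')<=N l * N l'" if "l:L" "l':L" for l l'
 proof (rule max_norm_le)
  fix p assume p: "cstar_seminorm A B p"
  have "p (pmult l l')<=p l * p l'" using seminormD(5)[OF p that] .
  also have "...<=N l * N l'"
   by (intro mult_mono le_max_norm p that nonneg seminormD(2)[OF p that(2,1)])
  finally show "p (pmult l l')<=N l * N l'" .
 qed
 have 5: "N (pmult (padj l) l)=(N l)\<^sup>2" if l: "l:L" for l
 proof (rule antisym)
  show "N (pmult (padj l) l)<=(N l)\<^sup>2"
  proof (rule max_norm_le)
   fix p assume p: "cstar_seminorm A B p"
   show "p (pmult (padj l) l)<=(N l)\<^sup>2"
    using seminormD(6)[OF p l l] power_mono[OF le_max_norm[OF p l] seminormD(2)[OF p l l], of 2] by simp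
  qed
  have "N l<=sqrt (N (pmult (padj l) l))"
  proof (rule max_norm_le)
   fix p assume p: "cstar_seminorm A B p"
   show "p l<=sqrt (N (pmult (padj l) l))"
    using seminormD(6)[OF p l l] le_max_norm[OF p, of "pmult (padj l) l"] l by (simp add: real_le_rsqrt)
  qed
  then show "(N l)\<^sup>2<=N (pmult (padj l) l)"
   using nonneg[OF l] nonneg[of "pmult (padj l) l"] power_mono[of "N l" "sqrt (N (pmult (padj l) l))" 2] l by simp
 qed
 show ?thesis
  unfolding cstar_seminorm_def by (intro ballI conjI impI allI 1 2 3 4 5 nonneg)
qed

end

context cstar_pair
begin

abbreviation "M\<equiv>max_tensor A B"
abbreviation M_mult (infixl "\<otimes>\<^sub>M" 70) where "u\<otimes>\<^sub>M v\<equiv>u\<otimes>\<^bsub>M\<^esub> v"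
abbreviation M_add (infixl "\<oplus>\<^sub>M" 65) where "u\<oplus>\<^sub>M v\<equiv>u\<oplus>\<^bsub>M\<^esub> v"
abbreviation M_minus (infixl "\<ominus>\<^sub>M" 65) where "u\<ominus>\<^sub>M v\<equiv>u\<ominus>\<^bsub>M\<^esub> v"
abbreviation M_smult (infixl "\<odot>\<^sub>M" 70) where "c\<odot>\<^sub>M u\<equiv>c\<odot>\<^bsub>M\<^esub> u"
abbreviation "D\<equiv>max_dist A B"
abbreviation "Q\<equiv>max_class A B"
abbreviation "cs\<equiv>cauchy_in L D"

lemmas N_teq = seminormD(1)[OF cstar_seminorm_max_norm]
lemmas N_scale = seminormD(3)[OF cstar_seminorm_max_norm]
lemmas N_append = seminormD(4)[OF cstar_seminorm_max_norm]
lemmas N_mult = seminormD(5)[OF cstar_seminorm_max_norm]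
lemmas N_star = seminormD(6)[OF cstar_seminorm_max_norm]

lemma N_nonneg: "l:L==>0<=N l"
 using seminormD(2)[OF cstar_seminorm_max_norm] by blast

lemma N_scale': "l:L==>N (pscale c l)=cmod c * N l"
 using N_scale by blast

lemma N_star': "l:L==>N (pmult (padj l) l)=(N l)\<^sup>2"
 using N_star by blast

lemma N_Nil [simp]: "N []=0"
 using N_scale[of "[]" "[]" 0] by simp

lemma N_padj: assumes "l:L" shows "N (padj l)=N l"
proof -
 have le: "N l<=N (padj l)" if "l:L" for l
 proof (cases "N l=0")
  case False
  have "N l * N l<=N (padj l) * N l"
   using N_star[of l l] N_mult[of "padj l" l] that by (simp add: power2_eq_square)
  then show ?thesis using False N_nonneg[OF that] by (simp add: less_le)
 qed (use N_nonneg that in simp)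
 show ?thesis using le[OF assms] le[of "padj l"] assms by (simp add: padj_padj)
qed

lemma D_def: "D l l'=N (l @ pscale (- 1) l')"
 by (simp add: max_dist_def)

lemma D_teq:
 assumes "l:L" "l':L" "m:L" "l @ pscale (- 1) l' \<doteq> m" shows "D l l'=N m"
 using N_teq[of "l @ pscale (- 1) l'" m] assms by (simp add: D_def)

lemma D_triangle1: assumes "l:L" "l':L" "l'':L" shows "D l l''<=D l l' + D l' l''"
proof -
 have "l @ pscale (- 1) l'' \<doteq> l @ (pscale (- 1) l' @ l') @ pscale (- 1) l''"
  using cancel(2)[OF assms(2)] teq_append[of l l "[] @ pscale (- 1) l''" "(pscale (- 1) l' @ l') @ pscale (- 1) l''"]
   teq_append[of "[]" "pscale (- 1) l' @ l'"] by (simp add: alg_tensor_eq.sym)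
 then have "D l l''=N ((l @ pscale (- 1) l') @ (l' @ pscale (- 1) l''))"
  using D_teq assms by simp
 then show ?thesis using N_append[of "l @ pscale (- 1) l'" "l' @ pscale (- 1) l''"] assms by (simp add: D_def)
qed

lemma D_sym1: assumes "l:L" "l':L" shows "D l l'=D l' l"
proof -
 have "D l' l=N (pscale (- 1) (l' @ pscale (- 1) l))"
  using N_scale[of "l' @ pscale (- 1) l" "[]" "- 1"] assms by (simp add: D_def)
 also have "pscale (- 1) (l' @ pscale (- 1) l)=pscale (- 1) l' @ l"
  using assms by (simp add: scale_scale scale_one)
 also have "N (pscale (- 1) l' @ l)=D l l'"
  using N_teq[of "pscale (- 1) l' @ l" "l @ pscale (- 1) l'"] assms by (simp add: D_def alg_tensor_eq.commute)
 finally show ?thesis by simp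
qed

sublocale q: quasi_metric L D 1
proof
 show "D l l=0" if "l:L" for l using D_teq[of l l "[]"] cancel[of l] that by simp
qed (use D_sym1 D_triangle1 in "auto simp: D_def N_nonneg")

lemma D_eq_0: assumes "l:L" "l':L" "l \<doteq> l'" shows "D l l'=0"
proof -
 have "l @ pscale (- 1) l' \<doteq> l' @ pscale (- 1) l'" using assms(3) by (simp add: teq_append)
 also have "l' @ pscale (- 1) l' \<doteq> []" using cancel assms(2) by simp
 finally show ?thesis using D_teq[of l l' "[]"] assms by simp
qed

lemma N_eq_D: "l:L==>D l []=N l"
 by (simp add: D_def)

lemma N_diff_D: assumes "l:L" "l':L" shows "\<bar>N l - N l'\<bar><=D l l'"
 using q.d_triangle[of l l' "[]"] q.d_triangle[of l' l "[]"] q.d_sym[OF assms] assms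
 by (simp add: N_eq_D abs_le_iff)

lemma D_append: assumes "l:L" "m:L" "l':L" "m':L" shows "D (l @ m) (l' @ m')<=D l l' + D m m'"
proof -
 have "D (l @ m) (l' @ m')=N ((l @ pscale (- 1) l') @ (m @ pscale (- 1) m'))"
  using assms by (intro D_teq teq_mset) auto
 then show ?thesis using N_append[of "l @ pscale (- 1) l'" "m @ pscale (- 1) m'"] assms by (simp add: D_def)
qed

lemma D_scale: assumes "l:L" "l':L" shows "D (pscale c l) (pscale c l')=cmod c * D l l'"
proof -
 have "pscale c l @ pscale (- 1) (pscale c l')=pscale c (l @ pscale (- 1) l')"
  using assms by (simp add: scale_scale)
 then show ?thesis using N_scale[of "l @ pscale (- 1) l'" "[]" c] assms by (simp add: D_def)
qed

lemma D_padj: assumes "l:L" "l':L" shows "D (padj l) (padj l')=D l l'"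
proof -
 have "padj l @ pscale (- 1) (padj l')=padj (l @ pscale (- 1) l')"
  using assms by (simp add: padj_scale)
 then show ?thesis using N_padj[of "l @ pscale (- 1) l'"] assms by (simp add: D_def)
qed

lemma D_mult: assumes "l:L" "m:L" "l':L" "m':L"
 shows "D (pmult l m) (pmult l' m')<=D l l' * N m + N l' * D m m'"
proof -
 have 1: "D (pmult l m) (pmult l' m)=N (pmult (l @ pscale (- 1) l') m)"
  using assms by (simp add: D_def pmult_scale_left)
 have 2: "D (pmult l' m) (pmult l' m')=N (pmult l' (m @ pscale (- 1) m'))"
  using assms pmult_append_right[of l' m "pscale (- 1) m'"]
  by (intro D_teq) (auto simp: pmult_scale_right alg_tensor_eq.sym)
 have "D (pmult l m) (pmult l' m)<=D l l' * N m"
  unfolding 1 D_def[of l l'] by (rule N_mult) (use assms in auto)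
 moreover have "D (pmult l' m) (pmult l' m')<=N l' * D m m'"
  unfolding 2 D_def[of m m'] by (rule N_mult) (use assms in auto)
 ultimately show ?thesis
  using q.d_triangle[of "pmult l m" "pmult l' m" "pmult l' m'"] assms by simp
qed

lemma csD: "cs s==>s n:L" "cs s==>e > 0==>\<exists>K. \<forall>m\<ge>K. \<forall>n\<ge>K. D (s m) (s n) < e"
 by (auto simp: cauchy_in_def)

text \<open>One criterion for all operations; products are the case in which two Cauchy sequences
  contribute at once.\<close>

lemma cs_bound:
 assumes s: "cs s" and t: "cs t" and c: "0<=c" "0<=d" and L: "!!n. r n:L"
  and le: "!!m n. D (r m) (r n)<=c * D (s m) (s n) + d * D (t m) (t n)"
 shows "cs r"
 unfolding cauchy_in_def
proof (intro conjI allI impI L)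
 fix e :: real assume e: "e > 0"
 \<comment> \<open>The added 1 guards against \<open>c = d = 0\<close>.\<close>
 define e' where "e'=e / (c + d + 1)"
 have e': "e' > 0" using e c by (simp add: e'_def)
 obtain K1 where K1: "\<forall>m\<ge>K1. \<forall>n\<ge>K1. D (s m) (s n) < e'" using csD(2)[OF s e'] by blast
 obtain K2 where K2: "\<forall>m\<ge>K2. \<forall>n\<ge>K2. D (t m) (t n) < e'" using csD(2)[OF t e'] by blast
 have "D (r m) (r n) < e" if "m\<ge>max K1 K2" "n\<ge>max K1 K2" for m n
 proof -
  have "D (r m) (r n)<=c * e' + d * e'"
   using le[of m n] K1 [rule_format, of m n] K2 [rule_format, of m n] that c
    mult_left_mono[of "D (s m) (s n)" e' c] mult_left_mono[of "D (t m) (t n)" e' d] by fastforce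
  also have "... < (c + d + 1) * e'" using e' by (simp add: algebra_simps)
  also have "...=e" using c by (simp add: e'_def)
  finally show ?thesis .
 qed
 then show "\<exists>K. \<forall>m\<ge>K. \<forall>n\<ge>K. D (r m) (r n) < e" by blast
qed

lemma cs_N_convergent: assumes "cs s" shows "convergent (%n. N (s n))"
proof (intro Cauchy_convergent CauchyI)
 fix e :: real assume "e > 0"
 then obtain K where "\<forall>m\<ge>K. \<forall>n\<ge>K. D (s m) (s n) < e" using csD(2)[OF assms] by blast
 moreover have "norm (N (s m) - N (s n))<=D (s m) (s n)" for m n
  using N_diff_D csD(1)[OF assms] by simp
 ultimately show "\<exists>K. \<forall>m\<ge>K. \<forall>n\<ge>K. norm (N (s m) - N (s n)) < e"
  by (meson order_le_less_trans)
qed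

lemma cs_N_bounded: assumes "cs s" obtains b where "0<=b" "!!n. N (s n)<=b"
proof -
 have "Bseq (%n. N (s n))" using cs_N_convergent[OF assms] convergent_imp_Bseq by blast
 then obtain b where "b > 0" "!!n. norm (N (s n))<=b" by (auto elim: BseqE)
 then show ?thesis by (intro that[of b]) (auto simp: abs_le_iff)
qed

lemma cs_append: "[|cs s; cs t|]==>cs (%n. s n @ t n)"
 by (rule cs_bound[where c = 1 and d = 1 and s = s and t = t]) (auto simp: csD(1) D_append)

lemma cs_scale: "cs s==>cs (%n. pscale c (s n))"
 by (rule cs_bound[where c = "cmod c" and d = 0 and s = s and t = s]) (auto simp: csD(1) D_scale)

lemma cs_padj: "cs s==>cs (%n. padj (s n))"
 by (rule cs_bound[where c = 1 and d = 0 and s = s and t = s]) (auto simp: csD(1) D_padj)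

lemma cs_mult: assumes s: "cs s" and t: "cs t" shows "cs (%n. pmult (s n) (t n))"
proof -
 obtain b where b: "0<=b" "!!n. N (s n)<=b" using cs_N_bounded[OF s] by blast
 obtain c where c: "0<=c" "!!n. N (t n)<=c" using cs_N_bounded[OF t] by blast
 have "D (pmult (s m) (t m)) (pmult (s n) (t n))<=c * D (s m) (s n) + b * D (t m) (t n)" for m n
  using D_mult[of "s m" "t m" "s n" "t n"] csD[OF s] csD[OF t]
   mult_left_mono[OF c(2)[of m] q.d_nonneg[of "s m" "s n"]]
   mult_right_mono[OF b(2)[of n] q.d_nonneg[of "t m" "t n"]]
  by (simp add: mult.commute)
 then show ?thesis
  by (intro cs_bound[OF s t c(1) b(1)]) (simp_all add: csD(1)[OF s] csD(1)[OF t])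
qed

lemma cs_const: "l:L==>cs (%n. l)"
 by (rule q.cauchy_const)

lemma carrier_M: "carrier M=completion L D"
 by (simp add: max_tensor_def)

lemma Q_closed: "cs s==>Q s:carrier M"
 by (simp add: carrier_M q.class_in_completion)

lemma M_cases: assumes "u:carrier M" obtains s where "cs s" "u=Q s"
 using q.rep_completion[of u] assms by (auto simp: carrier_M)

lemma Q_eqI: "[|cs s; cs t; (%n. D (s n) (t n)) \<leadsto> 0|]==>Q s=Q t"
 by (simp add: q.class_eq_iff)

lemma Q_teq: "[|cs s; cs t; !!n. s n \<doteq> t n|]==>Q s=Q t"
 by (rule Q_eqI) (auto simp: D_eq_0 csD)

lemma Q_add: assumes "cs s" "cs t" shows "Q s\<oplus>\<^sub>M Q t=Q (%n. s n @ t n)"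
proof -
 note s = assms(1) q.rep_class[OF assms(1)] and t = assms(2) q.rep_class[OF assms(2)]
 have "(%n. D (s n @ t n) (rep (Q s) n @ rep (Q t) n)) \<leadsto> 0"
  by (rule tendsto_sandwich[OF _ _ tendsto_const tendsto_add_zero[OF s(3) t(3)]])
   (auto intro!: always_eventually q.d_nonneg D_append simp: csD(1)[OF s(1)] csD(1)[OF s(2)] csD(1)[OF t(1)] csD(1)[OF t(2)])
 then show ?thesis
  using s t by (simp add: max_tensor_def) (intro Q_eqI[symmetric] cs_append)
qed

lemma Q_smult: assumes "cs s" shows "c\<odot>\<^sub>M Q s=Q (%n. pscale c (s n))"
proof -
 note s = assms(1) q.rep_class[OF assms(1)]
 have "(%n. D (pscale c (s n)) (pscale c (rep (Q s) n))) \<leadsto> 0"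
  using tendsto_mult_right_zero[OF s(3)] by (simp add: D_scale csD(1)[OF s(1)] csD(1)[OF s(2)])
 then show ?thesis
  using s by (simp add: max_tensor_def) (intro Q_eqI[symmetric] cs_scale)
qed

lemma Q_adj: assumes "cs s" shows "adj M (Q s)=Q (%n. padj (s n))"
proof -
 note s = assms(1) q.rep_class[OF assms(1)]
 have "(%n. D (padj (s n)) (padj (rep (Q s) n))) \<leadsto> 0"
  using s(3) by (simp add: D_padj csD(1)[OF s(1)] csD(1)[OF s(2)])
 then show ?thesis
  using s by (simp add: max_tensor_def) (intro Q_eqI[symmetric] cs_padj)
qed

lemma Q_mult: assumes "cs s" "cs t" shows "Q s\<otimes>\<^sub>M Q t=Q (%n. pmult (s n) (t n))"
proof -
 note s = assms(1) q.rep_class[OF assms(1)] and t = assms(2) q.rep_class[OF assms(2)]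
 note c = csD(1)[OF s(1)] csD(1)[OF s(2)] csD(1)[OF t(1)] csD(1)[OF t(2)]
 obtain b where b: "N (rep (Q s) n)<=b" for n using cs_N_bounded[OF s(2)] by blast
 obtain b' where b': "N (t n)<=b'" for n using cs_N_bounded[OF t(1)] by blast
 have "(%n. D (pmult (s n) (t n)) (pmult (rep (Q s) n) (rep (Q t) n))) \<leadsto> 0"
 proof (rule tendsto_sandwich[OF _ _ tendsto_const])
  show "(%n. D (s n) (rep (Q s) n) * b' + b * D (t n) (rep (Q t) n)) \<leadsto> 0"
   using tendsto_add_zero[OF tendsto_mult_left_zero[OF s(3)] tendsto_mult_right_zero[OF t(3)]] by simp
  show "\<forall>\<^sub>F n in sequentially. D (pmult (s n) (t n)) (pmult (rep (Q s) n) (rep (Q t) n))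
<=D (s n) (rep (Q s) n) * b' + b * D (t n) (rep (Q t) n)"
  proof (rule always_eventually, rule allI)
   fix n
   have "D (s n) (rep (Q s) n) * N (t n) + N (rep (Q s) n) * D (t n) (rep (Q t) n)
<=D (s n) (rep (Q s) n) * b' + b * D (t n) (rep (Q t) n)"
    by (intro add_mono mult_left_mono mult_right_mono b b' q.d_nonneg c)
   then show "D (pmult (s n) (t n)) (pmult (rep (Q s) n) (rep (Q t) n))
<=D (s n) (rep (Q s) n) * b' + b * D (t n) (rep (Q t) n)"
    using D_mult[OF c(1) c(3) c(2) c(4)] order_trans by blast
  qed
 qed (auto intro!: always_eventually q.d_nonneg simp: c)
 then show ?thesis
  using s t by (simp add: max_tensor_def) (intro Q_eqI[symmetric] cs_mult)
qed

lemma Q_norm: assumes "cs s" shows "(%n. N (s n)) \<leadsto> cnorm M (Q s)"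
proof -
 note s = assms(1) q.rep_class[OF assms(1)]
 note c = csD(1)[OF s(1)] csD(1)[OF s(2)]
 have "(%n. N (rep (Q s) n)) \<leadsto> cnorm M (Q s)"
  using cs_N_convergent[OF s(2)] by (simp add: max_tensor_def convergent_LIMSEQ_iff)
 moreover have "(%n. N (s n) - N (rep (Q s) n)) \<leadsto> 0"
  by (rule Lim_null_comparison[OF _ s(3)]) (auto intro!: always_eventually N_diff_D c)
 ultimately show ?thesis using tendsto_add by fastforce
qed

lemma Q_zero: "\<zero>\<^bsub>M\<^esub>=Q (%n. [])" and Q_one: "\<one>\<^bsub>M\<^esub>=Q (%n. [(\<one>\<^bsub>A\<^esub>, \<one>\<^bsub>B\<^esub>)])"
 by (simp_all add: max_tensor_def)

lemma abelian_group_M: "abelian_group M"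
proof (rule abelian_groupI)
 show "u\<oplus>\<^sub>M v:carrier M" if "u:carrier M" "v:carrier M" for u v
  using that by (auto elim!: M_cases simp: Q_add intro!: Q_closed cs_append)
 show "\<zero>\<^bsub>M\<^esub>:carrier M" by (simp add: Q_zero Q_closed cs_const)
 show "u\<oplus>\<^sub>M v\<oplus>\<^sub>M w=u\<oplus>\<^sub>M (v\<oplus>\<^sub>M w)" if "u:carrier M" "v:carrier M" "w:carrier M" for u v w
  using that by (auto elim!: M_cases simp: Q_add cs_append)
 show "u\<oplus>\<^sub>M v=v\<oplus>\<^sub>M u" if "u:carrier M" "v:carrier M" for u v
  using that by (elim M_cases, simp add: Q_add) (rule Q_teq; simp add: cs_append csD(1) alg_tensor_eq.commute)
 show "\<zero>\<^bsub>M\<^esub>\<oplus>\<^sub>M u=u" if "u:carrier M" for u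
  using that by (auto elim!: M_cases simp: Q_zero Q_add cs_const)
 show "\<exists>v\<in>carrier M. v\<oplus>\<^sub>M u=\<zero>\<^bsub>M\<^esub>" if u: "u:carrier M" for u
 proof -
  obtain s where s: "cs s" "u=Q s" using M_cases[OF u] .
  show ?thesis
   using s by (intro bexI[of _ "Q (%n. pscale (- 1) (s n))"])
    (simp_all add: Q_add Q_zero Q_closed cs_scale, rule Q_teq, simp_all add: cs_scale cs_append csD(1) cs_const[of "[]"] cancel)
 qed
qed

lemma ring_M: "ring M"
proof (rule ringI[OF abelian_group_M])
 show "monoid M"
 proof (rule monoidI)
  have one: "cs (%n. [(\<one>\<^bsub>A\<^esub>, \<one>\<^bsub>B\<^esub>)])" by (simp add: cs_const)
  show "\<one>\<^bsub>M\<^esub>:carrier M" by (simp add: Q_one Q_closed one)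
  show "u\<otimes>\<^sub>M v:carrier M" if "u:carrier M" "v:carrier M" for u v
   using that by (elim M_cases) (simp add: Q_mult cs_mult Q_closed)
  show "u\<otimes>\<^sub>M v\<otimes>\<^sub>M w=u\<otimes>\<^sub>M (v\<otimes>\<^sub>M w)" if "u:carrier M" "v:carrier M" "w:carrier M" for u v w
   using that by (elim M_cases) (simp add: Q_mult cs_mult csD(1) pmult_assoc)
  show "\<one>\<^bsub>M\<^esub>\<otimes>\<^sub>M u=u" "u\<otimes>\<^sub>M \<one>\<^bsub>M\<^esub>=u" if "u:carrier M" for u
   using that by (elim M_cases; simp add: Q_mult Q_one one csD(1) pmult_one del: pair_mult_simps)+
 qed
 show "(u\<oplus>\<^sub>M v)\<otimes>\<^sub>M w=u\<otimes>\<^sub>M w\<oplus>\<^sub>M v\<otimes>\<^sub>M w" if "u:carrier M" "v:carrier M" "w:carrier M" for u v w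
  using that by (auto elim!: M_cases simp: Q_add Q_mult cs_append cs_mult)
 show "w\<otimes>\<^sub>M (u\<oplus>\<^sub>M v)=w\<otimes>\<^sub>M u\<oplus>\<^sub>M w\<otimes>\<^sub>M v" if "u:carrier M" "v:carrier M" "w:carrier M" for u v w
  using that by (elim M_cases, simp add: Q_add Q_mult cs_append cs_mult) (rule Q_teq; simp add: Q_add Q_mult cs_append cs_mult csD(1) pmult_append_right)
qed

lemma module_M: "Module.module complex_alg M"
proof (rule moduleI[OF cring_complex_alg abelian_group_M])
 show "c\<odot>\<^sub>M u:carrier M" if "u:carrier M" for c u
  using that by (auto elim!: M_cases simp: Q_smult cs_scale Q_closed)
 show "(c\<oplus>\<^bsub>complex_alg\<^esub> d)\<odot>\<^sub>M u=c\<odot>\<^sub>M u\<oplus>\<^sub>M d\<odot>\<^sub>M u" if "u:carrier M" for c d u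
  using that by (elim M_cases, simp add: Q_smult Q_add cs_scale cs_append csD(1)) (rule Q_teq; simp add: Q_smult Q_add cs_scale cs_append csD(1) scale_add)
 show "c\<odot>\<^sub>M (u\<oplus>\<^sub>M v)=c\<odot>\<^sub>M u\<oplus>\<^sub>M c\<odot>\<^sub>M v" if "u:carrier M" "v:carrier M" for c u v
  using that by (auto elim!: M_cases simp: Q_smult Q_add cs_scale cs_append)
 show "(c\<otimes>\<^bsub>complex_alg\<^esub> d)\<odot>\<^sub>M u=c\<odot>\<^sub>M (d\<odot>\<^sub>M u)" if "u:carrier M" for c d u
  using that by (auto elim!: M_cases simp: Q_smult cs_scale csD(1) scale_scale)
 show "\<one>\<^bsub>complex_alg\<^esub>\<odot>\<^sub>M u=u" if "u:carrier M" for u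
  using that by (auto elim!: M_cases simp: Q_smult csD(1) scale_one)
qed

lemma Q_diff: assumes "cs s" "cs t" shows "Q s\<ominus>\<^sub>M Q t=Q (%n. s n @ pscale (- 1) (t n))"
proof -
 interpret M: abelian_group M by (rule abelian_group_M)
 have "\<ominus>\<^bsub>M\<^esub> Q t=Q (%n. pscale (- 1) (t n))"
 proof (rule M.minus_equality)
  show "Q (%n. pscale (- 1) (t n))\<oplus>\<^sub>M Q t=\<zero>\<^bsub>M\<^esub>"
   unfolding Q_add[OF cs_scale[OF assms(2)] assms(2)] Q_zero
   by (intro Q_teq cs_append cs_scale assms(2) cs_const cancel csD(1)[OF assms(2)] pair_lists_simps)
 qed (simp_all add: Q_closed cs_scale assms(2))
 then show ?thesis using assms by (simp add: a_minus_def Q_add cs_scale)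
qed

lemma Q_norm_diff: "[|cs s; cs t|]==>(%n. D (s n) (t n)) \<leadsto> cnorm M (Q s\<ominus>\<^sub>M Q t)"
 using Q_norm[of "%n. s n @ pscale (- 1) (t n)"] by (simp add: Q_diff cs_append cs_scale D_def)

text \<open>Single formal sums, seen as constant sequences, are dense: a class is the limit of the
  terms of any sequence representing it.\<close>

lemma Q_const_lim:
 assumes "cs s" shows "(%k. cnorm M (Q (%n. s k)\<ominus>\<^sub>M Q s)) \<leadsto> 0"
proof (rule LIMSEQ_I)
 fix e :: real assume "e > 0"
 then obtain K where K: "\<forall>m\<ge>K. \<forall>n\<ge>K. D (s m) (s n) < e / 2" using csD(2)[OF assms, of "e / 2"] by auto
 have "norm (cnorm M (Q (%n. s k)\<ominus>\<^sub>M Q s) - 0) < e" if "k\<ge>K" for k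
 proof -
  note l = Q_norm_diff[OF cs_const[OF csD(1)[OF assms, of k]] assms]
  have "cnorm M (Q (%n. s k)\<ominus>\<^sub>M Q s)<=e / 2"
   by (rule LIMSEQ_le_const2[OF l]) (use K that in "auto intro!: exI[of _ K] less_imp_le")
  moreover have "0<=cnorm M (Q (%n. s k)\<ominus>\<^sub>M Q s)"
   by (rule LIMSEQ_le_const[OF l]) (auto intro!: q.d_nonneg csD(1)[OF assms])
  ultimately show ?thesis using \<open>e > 0\<close> by simp
 qed
 then show "\<exists>K. \<forall>k\<ge>K. norm (cnorm M (Q (%n. s k)\<ominus>\<^sub>M Q s) - 0) < e" by blast
qed

theorem cstar_algebra_M: "cstar_algebra M"
proof (intro cstar_algebra.intro ring_M module_M cstar_algebra_axioms.intro)
 show "(c\<odot>\<^sub>M x)\<otimes>\<^sub>M y=c\<odot>\<^sub>M (x\<otimes>\<^sub>M y)" if "x:carrier M" "y:carrier M" for x y c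
  using that by (auto elim!: M_cases simp: Q_smult Q_mult cs_scale cs_mult csD(1) pmult_scale_left)
 show "x\<otimes>\<^sub>M (c\<odot>\<^sub>M y)=c\<odot>\<^sub>M (x\<otimes>\<^sub>M y)" if "x:carrier M" "y:carrier M" for x y c
  using that by (auto elim!: M_cases simp: Q_smult Q_mult cs_scale cs_mult csD(1) pmult_scale_right)
 show "adj M x:carrier M" if "x:carrier M" for x
  using that by (auto elim!: M_cases simp: Q_adj cs_padj Q_closed)
 show "adj M (adj M x)=x" if "x:carrier M" for x
  using that by (auto elim!: M_cases simp: Q_adj cs_padj csD(1) padj_padj)
 show "adj M (x\<oplus>\<^sub>M y)=adj M x\<oplus>\<^sub>M adj M y" if "x:carrier M" "y:carrier M" for x y
  using that by (auto elim!: M_cases simp: Q_adj Q_add cs_append cs_padj)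
 show "adj M (x\<otimes>\<^sub>M y)=adj M y\<otimes>\<^sub>M adj M x" if "x:carrier M" "y:carrier M" for x y
  using that by (elim M_cases, simp add: Q_adj Q_mult cs_mult cs_padj csD(1)) (rule Q_teq; simp add: Q_adj Q_mult cs_mult cs_padj csD(1) padj_pmult)
 show "adj M (c\<odot>\<^sub>M x)=cnj c\<odot>\<^sub>M adj M x" if "x:carrier M" for x c
  using that by (auto elim!: M_cases simp: Q_adj Q_smult cs_scale cs_padj csD(1) padj_scale)
 show "0<=cnorm M x" if "x:carrier M" for x
  using that by (auto elim!: M_cases intro!: LIMSEQ_le_const[OF Q_norm] N_nonneg csD(1))
 show "cnorm M x=0\<longleftrightarrow>x=\<zero>\<^bsub>M\<^esub>" if x: "x:carrier M" for x
 proof -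
  obtain s where s: "cs s" "x=Q s" using M_cases[OF x] .
  have "x=\<zero>\<^bsub>M\<^esub>\<longleftrightarrow>(%n. N (s n)) \<leadsto> 0"
   using s q.class_eq_iff[OF s(1) cs_const[of "[]"]] by (simp add: Q_zero N_eq_D csD(1))
  also have "...\<longleftrightarrow>cnorm M x=0"
   using Q_norm[OF s(1)] s(2) LIMSEQ_unique by metis
  finally show ?thesis by simp
 qed
 show "cnorm M (x\<oplus>\<^sub>M y)<=cnorm M x + cnorm M y" if x: "x:carrier M" and y: "y:carrier M" for x y
 proof -
  obtain s where s: "cs s" "x=Q s" using M_cases[OF x] .
  obtain t where t: "cs t" "y=Q t" using M_cases[OF y] .
  show ?thesis
   unfolding s t Q_add[OF s(1) t(1)]
   by (rule LIMSEQ_le[OF Q_norm[OF cs_append[OF s(1) t(1)]] tendsto_add[OF Q_norm[OF s(1)] Q_norm[OF t(1)]]])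
    (auto intro!: N_append csD(1)[OF s(1)] csD(1)[OF t(1)])
 qed
 show "cnorm M (c\<odot>\<^sub>M x)=cmod c * cnorm M x" if x: "x:carrier M" for x c
 proof -
  obtain s where s: "cs s" "x=Q s" using M_cases[OF x] .
  have "(%n. N (pscale c (s n))) \<leadsto> cmod c * cnorm M x"
   using tendsto_mult_left[OF Q_norm[OF s(1)]] s csD(1)[OF s(1)] by (simp add: N_scale')
  then show ?thesis using Q_norm[OF cs_scale[OF s(1)]] s Q_smult LIMSEQ_unique by metis
 qed
 show "cnorm M (x\<otimes>\<^sub>M y)<=cnorm M x * cnorm M y" if x: "x:carrier M" and y: "y:carrier M" for x y
 proof -
  obtain s where s: "cs s" "x=Q s" using M_cases[OF x] .
  obtain t where t: "cs t" "y=Q t" using M_cases[OF y] .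
  show ?thesis
   unfolding s t Q_mult[OF s(1) t(1)]
   by (rule LIMSEQ_le[OF Q_norm[OF cs_mult[OF s(1) t(1)]] tendsto_mult[OF Q_norm[OF s(1)] Q_norm[OF t(1)]]])
    (auto intro!: N_mult csD(1)[OF s(1)] csD(1)[OF t(1)])
 qed
 show "cnorm M (adj M x\<otimes>\<^sub>M x)=(cnorm M x)\<^sup>2" if x: "x:carrier M" for x
 proof -
  obtain s where s: "cs s" "x=Q s" using M_cases[OF x] .
  have "(%n. N (pmult (padj (s n)) (s n))) \<leadsto> (cnorm M x)\<^sup>2"
   using tendsto_power[OF Q_norm[OF s(1)], of 2] s csD(1)[OF s(1)] by (simp add: N_star')
  moreover have "(%n. N (pmult (padj (s n)) (s n))) \<leadsto> cnorm M (adj M x\<otimes>\<^sub>M x)"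
   using Q_norm[OF cs_mult[OF cs_padj[OF s(1)] s(1)]] s by (simp add: Q_adj Q_mult cs_padj)
  ultimately show ?thesis using LIMSEQ_unique by blast
 qed
 show "\<exists>x\<in>carrier M. (%n. cnorm M (u n\<ominus>\<^sub>M x)) \<leadsto> 0"
  if u: "cauchy_in (carrier M) (%x y. cnorm M (x\<ominus>\<^sub>M y)) u" for u
 proof -
  \<comment> \<open>Triangle inequality and symmetry are read off the formal sums, because the
    locale that would supply them is what is being established.\<close>
  have dtri: "cnorm M (x\<ominus>\<^sub>M z)<=cnorm M (x\<ominus>\<^sub>M y) + cnorm M (y\<ominus>\<^sub>M z)"
   if xyz: "x:carrier M" "y:carrier M" "z:carrier M" for x y z
  proof -
   obtain s where s: "cs s" "x=Q s" using M_cases[OF xyz(1)] .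
   obtain t where t: "cs t" "y=Q t" using M_cases[OF xyz(2)] .
   obtain r where r: "cs r" "z=Q r" using M_cases[OF xyz(3)] .
   show ?thesis
    unfolding s t r
    using q.d_triangle csD(1)[OF s(1)] csD(1)[OF t(1)] csD(1)[OF r(1)]
    by (intro LIMSEQ_le[OF Q_norm_diff[OF s(1) r(1)] tendsto_add[OF Q_norm_diff[OF s(1) t(1)] Q_norm_diff[OF t(1) r(1)]]])
     auto
  qed
  have dsym: "cnorm M (x\<ominus>\<^sub>M y)=cnorm M (y\<ominus>\<^sub>M x)" if xyz: "x:carrier M" "y:carrier M" for x y
  proof -
   obtain s where s: "cs s" "x=Q s" using M_cases[OF xyz(1)] .
   obtain t where t: "cs t" "y=Q t" using M_cases[OF xyz(2)] .
   have "(%n. D (t n) (s n)) \<leadsto> cnorm M (x\<ominus>\<^sub>M y)"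
    using Q_norm_diff[OF s(1) t(1)] q.d_sym csD(1)[OF s(1)] csD(1)[OF t(1)] s t by simp
   then show ?thesis using Q_norm_diff[OF t(1) s(1)] s t LIMSEQ_unique by blast
  qed
  have uc: "u n:carrier M" for n using u by (simp add: cauchy_in_def)
  \<comment> \<open>One formal sum \<open>l k\<close> is chosen within \<open>1 / (k + 1)\<close> of
    the term \<open>u k\<close>. These sums form a Cauchy sequence themselves, and its class is the
    limit.\<close>
  have "\<exists>l\<in>L. cnorm M (Q (%n. l)\<ominus>\<^sub>M u k) < inverse (real (Suc k))" for k
  proof -
   obtain s where s: "cs s" "u k=Q s" using M_cases[OF uc] .
   have "\<forall>\<^sub>F j in sequentially. cnorm M (Q (%n. s j)\<ominus>\<^sub>M Q s) < inverse (real (Suc k))"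
    by (rule order_tendstoD[OF Q_const_lim[OF s(1)]]) simp
   then obtain j where "cnorm M (Q (%n. s j)\<ominus>\<^sub>M Q s) < inverse (real (Suc k))"
    by (auto simp: eventually_sequentially)
   then show ?thesis using s csD(1)[OF s(1)] by auto
  qed
  then obtain l where l: "l k:L" "cnorm M (Q (%n. l k)\<ominus>\<^sub>M u k) < inverse (real (Suc k))" for k
   by metis
  have lc: "Q (%n. l k):carrier M" for k using l(1) by (intro Q_closed cs_const)
  have Dl: "D (l k) (l j)=cnorm M (Q (%n. l k)\<ominus>\<^sub>M Q (%n. l j))" for k j
   using Q_norm_diff[OF cs_const cs_const, of "l k" "l j"] l(1) by (simp add: LIMSEQ_const_iff)
  have inv0: "(%k. inverse (real (Suc k))) \<leadsto> 0" by (rule LIMSEQ_inverse_real_of_nat)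
  have "cs l"
   unfolding cauchy_in_def
  proof (intro conjI allI impI l(1))
   fix e :: real assume e: "e > 0"
   obtain K1 where K1: "\<forall>m\<ge>K1. \<forall>n\<ge>K1. cnorm M (u m\<ominus>\<^sub>M u n) < e / 3"
    using u e by (auto simp: cauchy_in_def elim!: allE[of _ "e / 3"])
   have "\<forall>\<^sub>F k in sequentially. inverse (real (Suc k)) < e / 3"
    by (rule order_tendstoD[OF inv0]) (use e in simp)
   then obtain K2 where K2: "!!k. k\<ge>K2==>inverse (real (Suc k)) < e / 3"
    by (auto simp: eventually_sequentially)
   have "D (l m) (l n) < e" if "m\<ge>max K1 K2" "n\<ge>max K1 K2" for m n
   proof -
    have "D (l m) (l n)<=cnorm M (Q (%n. l m)\<ominus>\<^sub>M u m) + (cnorm M (u m\<ominus>\<^sub>M u n) + cnorm M (u n\<ominus>\<^sub>M Q (%k. l n)))"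
     using dtri[OF lc[of m] uc[of m] lc[of n]] dtri[OF uc[of m] uc[of n] lc[of n]] by (simp add: Dl)
    moreover have "cnorm M (u m\<ominus>\<^sub>M u n) < e / 3" using K1 that by auto
    moreover have "cnorm M (Q (%n. l m)\<ominus>\<^sub>M u m) < e / 3" "cnorm M (u n\<ominus>\<^sub>M Q (%k. l n)) < e / 3"
     using l(2)[of m] l(2)[of n] K2[of m] K2[of n] that dsym[OF uc lc, of n n] by auto
    ultimately show ?thesis by linarith
   qed
   then show "\<exists>K. \<forall>m\<ge>K. \<forall>n\<ge>K. D (l m) (l n) < e" by blast
  qed
  have "(%n. cnorm M (u n\<ominus>\<^sub>M Q l)) \<leadsto> 0"
  proof (rule tendsto_sandwich[OF _ _ tendsto_const])
   show "(%k. inverse (real (Suc k)) + cnorm M (Q (%n. l k)\<ominus>\<^sub>M Q l)) \<leadsto> 0"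
    using tendsto_add_zero[OF inv0 Q_const_lim[OF \<open>cs l\<close>]] .
   show "\<forall>\<^sub>F k in sequentially. cnorm M (u k\<ominus>\<^sub>M Q l)<=inverse (real (Suc k)) + cnorm M (Q (%n. l k)\<ominus>\<^sub>M Q l)"
   proof (rule always_eventually, rule allI)
    fix k
    show "cnorm M (u k\<ominus>\<^sub>M Q l)<=inverse (real (Suc k)) + cnorm M (Q (%n. l k)\<ominus>\<^sub>M Q l)"
     using dtri[OF uc[of k] lc[of k] Q_closed[OF \<open>cs l\<close>]] l(2)[of k] dsym[OF uc[of k] lc[of k]] by linarith
   qed
   show "\<forall>\<^sub>F k in sequentially. 0<=cnorm M (u k\<ominus>\<^sub>M Q l)"
   proof (rule always_eventually, rule allI)
    fix k
    obtain s where s: "cs s" "u k=Q s" using M_cases[OF uc] .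
    show "0<=cnorm M (u k\<ominus>\<^sub>M Q l)"
     unfolding s(2) by (rule LIMSEQ_le_const[OF Q_norm_diff[OF s(1) \<open>cs l\<close>]])
      (auto intro!: q.d_nonneg csD(1)[OF s(1)] csD(1)[OF \<open>cs l\<close>])
   qed
  qed
  then show ?thesis using Q_closed[OF \<open>cs l\<close>] by blast
 qed
qed

sublocale M: cstar_algebra M
 by (rule cstar_algebra_M)

end

section \<open>Quotients by closed ideals\<close>

locale cstar_closed_ideal = cstar_algebra A for A :: "'a cstar" (structure) +
 fixes I assumes closed_ideal: "closed_ideal A I"
begin

abbreviation "R\<equiv>cstar_quot A I"
abbreviation "\<pi> x\<equiv>I +> x"

lemma ideal_I: "ideal I A"
 using closed_ideal by (simp add: closed_ideal_def)

lemma abelian_subgroup_I: "abelian_subgroup I A"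
 by (rule abelian_subgroupI3[OF ideal.axioms(1)[OF ideal_I] ring.is_abelian_group[OF ring_A]])

lemma I_closed: "x:I==>x:carrier A"
 by (rule additive_subgroup.a_Hcarr[OF ideal.axioms(1)[OF ideal_I]])

lemma I_add: "[|x:I; y:I|]==>x\<oplus>y:I"
 by (rule additive_subgroup.a_closed[OF ideal.axioms(1)[OF ideal_I]])

lemma I_zero: "\<zero>:I"
 by (rule additive_subgroup.zero_closed[OF ideal.axioms(1)[OF ideal_I]])

lemma I_mult_left: "[|x:carrier A; y:I|]==>x\<otimes>y:I"
 by (rule ideal.I_l_closed[OF ideal_I])

lemma I_smult: "x:I==>c\<odot>x:I"
 using I_mult_left[of "c\<odot>\<one>" x] I_closed[of x] by simp

lemma I_lim: "[|nv.lim_to s x; !!n. s n:I|]==>x:I"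
 using closed_ideal by (auto simp: closed_ideal_def nv.lim_to_def)

lemma mem_pi: "z:\<pi> x\<longleftrightarrow>(\<exists>i\<in>I. z=i\<oplus>x)"
 by (auto simp: a_r_coset_def' ring.is_abelian_group[OF ring_A])

lemma pi_self: "x:carrier A==>x:\<pi> x"
 by (rule abelian_subgroup.a_rcos_self[OF abelian_subgroup_I])

lemma mem_pi_carrier: "[|z:\<pi> x; x:carrier A|]==>z:carrier A"
 using mem_pi I_closed by auto

lemma mem_pi_iff: assumes "x:carrier A" "z:carrier A" shows "z:\<pi> x\<longleftrightarrow>z\<ominus>x:I"
 unfolding mem_pi
proof
 assume "\<exists>i\<in>I. z=i\<oplus>x"
 then show "z\<ominus>x:I" using assms I_closed by (auto simp: nv.diff_conv nv.add_assoc)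
next
 assume "z\<ominus>x:I"
 then show "\<exists>i\<in>I. z=i\<oplus>x" using assms by (metis nv.diff_add_cancel)
qed

lemma pi_eq: assumes "x:carrier A" "y:carrier A" shows "\<pi> x=\<pi> y\<longleftrightarrow>x\<ominus>y:I"
proof
 assume "\<pi> x=\<pi> y"
 then show "x\<ominus>y:I" using pi_self mem_pi_iff assms by blast
next
 assume "x\<ominus>y:I"
 then have "x:\<pi> y" using mem_pi_iff assms by blast
 then show "\<pi> x=\<pi> y"
  using abelian_subgroup.a_repr_independence'[OF abelian_subgroup_I, of x y] assms by simp
qed

lemma pi_closed [simp]: "x:carrier A==>\<pi> x:carrier R"
 by (simp add: cstar_quot_def FactRing_def abelian_group.a_rcosetsI[OF ring.is_abelian_group[OF ring_A]] I_closed subsetI)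

lemma R_cases: assumes "X:carrier R" obtains x where "x:carrier A" "X=\<pi> x"
 using assms by (auto simp: cstar_quot_def FactRing_simps)

lemma pi_add: "[|x:carrier A; y:carrier A|]==>\<pi> x\<oplus>\<^bsub>R\<^esub> \<pi> y=\<pi> (x\<oplus>y)"
 by (simp add: cstar_quot_def FactRing_def ideal.a_rcos_sum[OF ideal_I])

lemma pi_mult: "[|x:carrier A; y:carrier A|]==>\<pi> x\<otimes>\<^bsub>R\<^esub> \<pi> y=\<pi> (x\<otimes>y)"
 by (simp add: cstar_quot_def FactRing_def ideal.rcoset_mult_add[OF ideal_I])

lemma pi_one: "\<one>\<^bsub>R\<^esub>=\<pi> \<one>"
 by (simp add: cstar_quot_def FactRing_def)

lemma pi_zero: "\<zero>\<^bsub>R\<^esub>=\<pi> \<zero>"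
 by (simp add: cstar_quot_def FactRing_def ring.a_rcos_zero[OF ring_A ideal_I I_zero])

lemma pi_smult: assumes "x:carrier A" shows "c\<odot>\<^bsub>R\<^esub> \<pi> x=\<pi> (c\<odot>x)"
proof -
 have "\<pi> (c\<odot>z)=\<pi> (c\<odot>x)" if "z:\<pi> x" for z
 proof -
  have z: "z:carrier A" using mem_pi_carrier[OF that assms] .
  then have "c\<odot>(z\<ominus>x):I" using I_smult mem_pi_iff[OF assms z] that by blast
  then show ?thesis using z assms by (simp add: pi_eq nv.sm_diff_right)
 qed
 then have "(\<Union>z\<in>\<pi> x. \<pi> (c\<odot>z))=(\<Union>z\<in>\<pi> x. \<pi> (c\<odot>x))" by (rule SUP_cong[OF HOL.refl])
 also have "...=\<pi> (c\<odot>x)" using pi_self[OF assms] by blast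
 finally show ?thesis by (simp add: cstar_quot_def)
qed

lemma pi_norm_le: assumes "x:carrier A" shows "cnorm R (\<pi> x)<=cnorm A x"
 unfolding cstar_quot_def
 using pi_self[OF assms] mem_pi_carrier assms
 by (auto intro!: cInf_lower bdd_belowI[where m = 0] cnorm_nonneg)

lemma pi_norm_geI: assumes "x:carrier A" "!!i. i:I==>r<=cnorm A (i\<oplus>x)" shows "r<=cnorm R (\<pi> x)"
proof -
 have "cnorm A ` \<pi> x\<noteq>{}" using pi_self[OF assms(1)] by blast
 moreover have "r<=y" if "y:cnorm A ` \<pi> x" for y using that assms(2) mem_pi by auto
 ultimately show ?thesis by (simp add: cstar_quot_def cInf_greatest)
qed

text \<open>The adjoint of a coset is its pointwise image. That this is again a coset is clear when
  the ideal is self-adjoint, which is a hypothesis here and is checked later by identifying the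
  ideal with a kernel.\<close>

lemma pi_adj: assumes "!!x. x:I==>adj A x:I" "x:carrier A" shows "adj R (\<pi> x)=\<pi> (adj A x)"
proof -
 have "adj A ` \<pi> x=\<pi> (adj A x)"
 proof (intro subset_antisym subsetI)
  fix z assume "z:adj A ` \<pi> x"
  then show "z:\<pi> (adj A x)"
   using assms I_closed by (auto simp: mem_pi adj_add)
 next
  fix z assume "z:\<pi> (adj A x)"
  then obtain i where i: "i:I" "z=i\<oplus>adj A x" by (auto simp: mem_pi)
  then have "z=adj A (adj A i\<oplus>x)" using assms I_closed by (simp add: adj_add)
  moreover have "adj A i\<oplus>x:\<pi> x" using i assms(1) mem_pi by blast
  ultimately show "z:adj A ` \<pi> x" by blast
 qed
 then show ?thesis by (simp add: cstar_quot_def)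
qed

text \<open>If the quotient is already known to be a C*-algebra, its closure under
  \<open>adj\<close> says that the pointwise image is a coset, and this coset contains
  \<open>adj A x\<close>. Self-adjointness of the ideal is bypassed.\<close>

lemma pi_adj': assumes "cstar_algebra R" "x:carrier A" shows "adj R (\<pi> x)=\<pi> (adj A x)"
proof -
 interpret R: cstar_algebra R by fact
 have "adj R (\<pi> x):carrier R" using R.adj_closed[OF pi_closed[OF assms(2)]] .
 then obtain y where y: "y:carrier A" "adj R (\<pi> x)=\<pi> y" by (rule R_cases)
 moreover have "adj A x:adj R (\<pi> x)" using pi_self assms(2) by (auto simp: cstar_quot_def)
 ultimately show ?thesis
  using abelian_subgroup.a_repr_independence'[OF abelian_subgroup_I, of "adj A x" y] by simp
qed

end

lemma (in cstar_algebra) ideal_carrier: "ideal (carrier A) A"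
 by (rule ring.oneideal[OF ring_A])

lemma closed_ideal_gen:
 assumes "cstar_algebra A" "G\<subseteq>carrier A" shows "closed_ideal A (closed_ideal_gen A G)"
proof -
 interpret cstar_algebra A by fact
 have "closed_ideal A (carrier A)" by (simp add: closed_ideal_def ideal_carrier)
 then have "carrier A:{J. closed_ideal A J&G\<subseteq>J}" using assms by simp
 then have "ideal (closed_ideal_gen A G) A"
  unfolding closed_ideal_gen_def
  by (intro ring.i_Intersect[OF ring_A]) (auto simp: closed_ideal_def)
 moreover have "x:closed_ideal_gen A G"
  if "x:carrier A" "\<forall>n. s n:closed_ideal_gen A G" "(%n. cnorm A (s n\<ominus>\<^bsub>A\<^esub> x)) \<leadsto> 0" for s x
  unfolding closed_ideal_gen_def
 proof (intro InterI)
  fix J assume "J:{J. closed_ideal A J&G\<subseteq>J}"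
  moreover from this have "\<forall>n. s n:J" using that(2) by (auto simp: closed_ideal_gen_def)
  ultimately show "x:J" using that(1,3) by (auto simp: closed_ideal_def)
 qed
 ultimately show ?thesis unfolding closed_ideal_def by blast
qed

lemma closed_ideal_gen_subset: "G\<subseteq>closed_ideal_gen A G"
 by (auto simp: closed_ideal_gen_def)

lemma closed_ideal_gen_least: "[|closed_ideal A J; G\<subseteq>J|]==>closed_ideal_gen A G\<subseteq>J"
 by (auto simp: closed_ideal_gen_def)

context cstar_pair
begin

abbreviation "elt\<equiv>max_elem A B"

lemma elem_closed [simp]: "[|a:carrier A; b:carrier B|]==>elt a b:carrier M"
 unfolding max_elem_def by (intro Q_closed cs_const) simp

lemma elem_add_left: "[|a:carrier A; a':carrier A; b:carrier B|]
==>elt (a\<oplus>\<^bsub>A\<^esub> a') b=elt a b\<oplus>\<^sub>M elt a' b"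
 unfolding max_elem_def
 by (simp add: Q_add cs_const) (intro Q_teq cs_const alg_tensor_eq.add_left; simp)

lemma elem_add_right: "[|a:carrier A; b:carrier B; b':carrier B|]
==>elt a (b\<oplus>\<^bsub>B\<^esub> b')=elt a b\<oplus>\<^sub>M elt a b'"
 unfolding max_elem_def
 by (simp add: Q_add cs_const) (intro Q_teq cs_const alg_tensor_eq.add_right; simp)

lemma elem_smult_left: "[|a:carrier A; b:carrier B|]==>elt (c\<odot>\<^bsub>A\<^esub> a) b=c\<odot>\<^sub>M elt a b"
 unfolding max_elem_def by (simp add: Q_smult cs_const)

lemma elem_smult_right: "[|a:carrier A; b:carrier B|]==>elt a (c\<odot>\<^bsub>B\<^esub> b)=c\<odot>\<^sub>M elt a b"
 unfolding max_elem_def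
 by (simp add: Q_smult cs_const) (intro Q_teq cs_const alg_tensor_eq.scale[THEN alg_tensor_eq.sym]; simp)

lemma elem_mult: "[|a:carrier A; b:carrier B; a':carrier A; b':carrier B|]
==>elt a b\<otimes>\<^sub>M elt a' b'=elt (a\<otimes>\<^bsub>A\<^esub> a') (b\<otimes>\<^bsub>B\<^esub> b')"
 unfolding max_elem_def by (simp add: Q_mult cs_const)

lemma elem_adj: "[|a:carrier A; b:carrier B|]==>adj M (elt a b)=elt (adj A a) (adj B b)"
 unfolding max_elem_def by (simp add: Q_adj cs_const)

lemma elem_one: "\<one>\<^bsub>M\<^esub>=elt \<one>\<^bsub>A\<^esub> \<one>\<^bsub>B\<^esub>"
 by (simp add: Q_one max_elem_def)

lemma elem_norm_le: assumes "a:carrier A" "b:carrier B" shows "cnorm M (elt a b)<=cnorm A a * cnorm B b"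
 unfolding max_elem_def
 by (rule LIMSEQ_le_const2[OF Q_norm]) (use assms seminorm_bound[OF cstar_seminorm_max_norm, of "[(a, b)]"] in \<open>auto intro!: cs_const\<close>)

lemma Q_lim: assumes "cs s" shows "M.nv.lim_to (%k. Q (%n. s k)) (Q s)"
 using Q_const_lim[OF assms] csD(1)[OF assms] by (auto simp: M.nv.lim_to_def intro!: Q_closed cs_const assms)

lemma Q_const_Cons:
 assumes "a:carrier A" "b:carrier B" "l:L"
 shows "Q (%n. (a, b) # l)=elt a b\<oplus>\<^sub>M Q (%n. l)"
 using assms by (simp add: max_elem_def Q_add cs_const)

end

section \<open>The C*-algebra of continuous functions\<close>

lemma continuous_map_mult_complex:
 fixes f g :: "'t=>complex"
 shows "[|continuous_map X euclidean f; continuous_map X euclidean g|]==>continuous_map X euclidean (%x. f x * g x)"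
 by (simp add: continuous_map_atin tendsto_mult)

lemma continuous_map_cnj: "continuous_map X euclidean f==>continuous_map X euclidean (%x. cnj (f x))"
 by (simp add: continuous_map_atin tendsto_cnj)

lemma continuous_map_restrict_iff [simp]:
 "continuous_map T Y (restrict f (topspace T))\<longleftrightarrow>continuous_map T Y f"
 using continuous_map_eq[of T Y f "restrict f (topspace T)"] continuous_map_eq[of T Y "restrict f (topspace T)" f]
 by (auto simp: restrict_def)

lemma cfun_alg_simps [simp]:
 "mult (cfun_alg T)=(%f g. \<lambda>t\<in>topspace T. f t * g t)" "one (cfun_alg T)=(\<lambda>t\<in>topspace T. 1)"
 "zero (cfun_alg T)=(\<lambda>t\<in>topspace T. 0)" "add (cfun_alg T)=(%f g. \<lambda>t\<in>topspace T. f t + g t)"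
 "smult (cfun_alg T)=(%c f. \<lambda>t\<in>topspace T. c * f t)" "adj (cfun_alg T)=(%f. \<lambda>t\<in>topspace T. cnj (f t))"
 by (simp_all add: cfun_alg_def)

lemma cfun_carrier: "f:carrier (cfun_alg T)\<longleftrightarrow>f:extensional (topspace T)&continuous_map T euclidean f"
 by (simp add: cfun_alg_def)

lemma cfun_restrict_closed: "continuous_map T euclidean f==>restrict f (topspace T):carrier (cfun_alg T)"
 by (simp add: cfun_carrier)

lemma cfun_eqI: "[|f:carrier (cfun_alg T); g:carrier (cfun_alg T); !!t. t:topspace T==>f t=g t|]==>f=g"
 by (auto simp: cfun_carrier intro: extensionalityI)

lemma cfun_restrict [simp]: "f:carrier (cfun_alg T)==>restrict f (topspace T)=f"
 by (simp add: cfun_carrier extensional_restrict)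

context
 fixes T :: "'t topology"
begin

lemma abelian_group_cfun: "abelian_group (cfun_alg T)"
proof (rule abelian_groupI)
 show "\<exists>g\<in>carrier (cfun_alg T). g\<oplus>\<^bsub>cfun_alg T\<^esub> f=\<zero>\<^bsub>cfun_alg T\<^esub>" if "f:carrier (cfun_alg T)" for f
  using that by (intro bexI[of _ "\<lambda>t\<in>topspace T. - f t"]) (auto simp: cfun_carrier)
qed (auto simp: cfun_carrier fun_eq_iff algebra_simps extensional_def intro!: continuous_map_add)

lemma ring_cfun: "ring (cfun_alg T)"
proof (rule ringI[OF abelian_group_cfun])
 show "Group.monoid (cfun_alg T)"
  by (rule monoidI) (auto simp: cfun_carrier fun_eq_iff extensional_def intro!: continuous_map_mult_complex)
qed (auto simp: fun_eq_iff algebra_simps)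

lemma module_cfun: "Module.module complex_alg (cfun_alg T)"
 by (rule moduleI[OF cring_complex_alg abelian_group_cfun])
  (auto simp: cfun_carrier fun_eq_iff algebra_simps extensional_def intro!: continuous_map_mult_complex)

lemma cfun_minus:
 assumes "f:carrier (cfun_alg T)" "g:carrier (cfun_alg T)"
 shows "f\<ominus>\<^bsub>cfun_alg T\<^esub> g=(\<lambda>t\<in>topspace T. f t - g t)"
proof -
 have "\<ominus>\<^bsub>cfun_alg T\<^esub> g=(\<lambda>t\<in>topspace T. - g t)"
  using assms(2) by (intro abelian_group.minus_equality[OF abelian_group_cfun]) (auto simp: cfun_carrier)
 then show ?thesis by (simp add: a_minus_def cong: restrict_cong)
qed

context
 assumes T: "compact_space T"
begin

lemma cfun_bounded: assumes "f:carrier (cfun_alg T)" shows "bdd_above (insert 0 ((%t. cmod (f t)) ` topspace T))"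
proof -
 have "compactin euclidean (f ` topspace T)"
  using assms T by (intro image_compactin[of T]) (simp_all add: cfun_carrier compact_space_def)
 then have "bounded (f ` topspace T)" by (simp add: compact_imp_bounded)
 then obtain b where b: "\<forall>x\<in>f ` topspace T. cmod x<=b" by (auto simp: bounded_iff)
 then show ?thesis by (intro bdd_aboveI[where M = "max 0 b"]) auto
qed

lemma cfun_norm_ge: assumes "f:carrier (cfun_alg T)" "t:topspace T" shows "cmod (f t)<=cnorm (cfun_alg T) f"
 unfolding cfun_alg_def cstar.select_convs using assms(2) by (intro cSup_upper[OF _ cfun_bounded[OF assms(1)]]) blast

lemma cfun_norm_nonneg: assumes "f:carrier (cfun_alg T)" shows "0<=cnorm (cfun_alg T) f"
 unfolding cfun_alg_def cstar.select_convs by (rule cSup_upper[OF insertI1 cfun_bounded[OF assms]])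

text \<open>\<open>0 <= r\<close> matters for empty \<open>T\<close>, where the second condition is
  void and the norm is 0.\<close>

lemma cfun_norm_le: "[|0<=r; !!t. t:topspace T==>cmod (f t)<=r|]==>cnorm (cfun_alg T) f<=r"
 unfolding cfun_alg_def cstar.select_convs by (rule cSup_least) auto

lemma cfun_adj_closed: "f:carrier (cfun_alg T)==>adj (cfun_alg T) f:carrier (cfun_alg T)"
 by (simp add: cfun_carrier continuous_map_cnj)

lemma cstar_algebra_cfun: "cstar_algebra (cfun_alg T)"
proof (intro cstar_algebra.intro ring_cfun module_cfun cstar_algebra_axioms.intro)
 let ?C = "cfun_alg T"
 show "0<=cnorm ?C f" if "f:carrier ?C" for f
  by (rule cfun_norm_nonneg[OF that])
 show "cnorm ?C f=0\<longleftrightarrow>f=\<zero>\<^bsub>?C\<^esub>" if f: "f:carrier ?C" for f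
 proof
  assume "cnorm ?C f=0"
  then have "f t=0" if "t:topspace T" for t using cfun_norm_ge[OF f that] by simp
  then show "f=\<zero>\<^bsub>?C\<^esub>" using f by (intro cfun_eqI) (auto simp: cfun_carrier)
 next
  assume "f=\<zero>\<^bsub>?C\<^esub>"
  then show "cnorm ?C f=0" using cfun_norm_nonneg[OF f] cfun_norm_le[of 0 f] by auto
 qed
 show "cnorm ?C (f\<oplus>\<^bsub>?C\<^esub> g)<=cnorm ?C f + cnorm ?C g"
  if "f:carrier ?C" "g:carrier ?C" for f g
  using cfun_norm_ge that by (intro cfun_norm_le add_nonneg_nonneg cfun_norm_nonneg)
   (auto intro!: order_trans[OF norm_triangle_ineq] add_mono)
 show "cnorm ?C (f\<otimes>\<^bsub>?C\<^esub> g)<=cnorm ?C f * cnorm ?C g"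
  if "f:carrier ?C" "g:carrier ?C" for f g
  using cfun_norm_ge that by (intro cfun_norm_le mult_nonneg_nonneg cfun_norm_nonneg)
   (auto simp: norm_mult intro!: mult_mono cfun_norm_nonneg)
 show sm: "cnorm ?C (c\<odot>\<^bsub>?C\<^esub> f)=cmod c * cnorm ?C f"
  if f: "f:carrier ?C" for f c
 proof (rule antisym)
  have le: "cnorm ?C (c\<odot>\<^bsub>?C\<^esub> f)<=cmod c * cnorm ?C f"
   if f: "f:carrier ?C" for f c
   using cfun_norm_ge[OF f] cfun_norm_nonneg[OF f]
   by (intro cfun_norm_le) (auto simp: norm_mult intro!: mult_left_mono)
  show "cnorm ?C (c\<odot>\<^bsub>?C\<^esub> f)<=cmod c * cnorm ?C f" by (rule le[OF f])
  \<comment> \<open>The reverse inequality is \<open>le\<close> applied to the scalar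
    \<open>inverse c\<close>.\<close>
  show "cmod c * cnorm ?C f<=cnorm ?C (c\<odot>\<^bsub>?C\<^esub> f)"
  proof (cases "c=0")
   case True
   then show ?thesis using cfun_norm_nonneg[of "c\<odot>\<^bsub>?C\<^esub> f"] f by (auto simp: cfun_carrier)
  next
   case False
   have c: "c\<odot>\<^bsub>?C\<^esub> f:carrier ?C"
    using f by (auto simp: cfun_carrier intro!: continuous_map_mult_complex)
   have "inverse c\<odot>\<^bsub>?C\<^esub> (c\<odot>\<^bsub>?C\<^esub> f)=f"
    using f False by (auto simp: cfun_carrier extensional_def fun_eq_iff)
   then have "cnorm ?C f<=cmod (inverse c) * cnorm ?C (c\<odot>\<^bsub>?C\<^esub> f)"
    using le[OF c, of "inverse c"] by simp
   from mult_left_mono[OF this, of "cmod c"] show ?thesis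
    using False by (simp add: norm_inverse del: cfun_alg_simps flip: mult.assoc)
  qed
 qed
 show "cnorm ?C (adj ?C f\<otimes>\<^bsub>?C\<^esub> f)=(cnorm ?C f)\<^sup>2"
  if f: "f:carrier ?C" for f
 proof (rule antisym)
  let ?g = "adj ?C f\<otimes>\<^bsub>?C\<^esub> f"
  have g: "?g:carrier ?C"
   by (intro ring.ring_simprules(5)[OF ring_cfun] cfun_adj_closed f)
  have gt: "cmod (?g t)=(cmod (f t))\<^sup>2" if "t:topspace T" for t
   using that by (simp add: norm_mult power2_eq_square)
  show "cnorm ?C ?g<=(cnorm ?C f)\<^sup>2"
   using cfun_norm_ge[OF f] by (intro cfun_norm_le) (auto simp: norm_mult power2_eq_square intro!: mult_mono cfun_norm_nonneg f)
  have "cnorm ?C f<=sqrt (cnorm ?C ?g)"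
   by (rule cfun_norm_le) (use cfun_norm_nonneg[OF g] cfun_norm_ge[OF g] gt in "auto intro!: real_le_rsqrt simp del: cfun_alg_simps")
  then show "(cnorm ?C f)\<^sup>2<=cnorm ?C ?g"
   using power_mono[OF _ cfun_norm_nonneg[OF f], of "sqrt (cnorm ?C ?g)" 2] cfun_norm_nonneg[OF g]
   by (simp del: cfun_alg_simps)
 qed
 show "\<exists>f\<in>carrier ?C. (%n. cnorm ?C (s n\<ominus>\<^bsub>?C\<^esub> f)) \<leadsto> 0"
  if s: "cauchy_in (carrier ?C) (%f g. cnorm ?C (f\<ominus>\<^bsub>?C\<^esub> g)) s" for s
 proof -
  have sc: "s n:carrier ?C" for n using s by (simp add: cauchy_in_def)
  have dc: "s m\<ominus>\<^bsub>?C\<^esub> s n:carrier ?C" for m n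
   using sc by (simp add: cfun_minus) (auto simp: cfun_carrier intro!: continuous_map_diff)
  have pt: "cmod (s m t - s n t)<=cnorm ?C (s m\<ominus>\<^bsub>?C\<^esub> s n)" if "t:topspace T" for m n t
   using cfun_norm_ge[OF dc that, of m n] sc that by (simp add: cfun_minus)
  have C: "\<exists>K. \<forall>m\<ge>K. \<forall>n\<ge>K. cnorm ?C (s m\<ominus>\<^bsub>?C\<^esub> s n) < e" if "e > 0" for e
   using s that by (simp add: cauchy_in_def)
  define f where "f=(\<lambda>t\<in>topspace T. lim (%n. s n t))"
  have lim: "(%n. s n t) \<leadsto> f t" if t: "t:topspace T" for t
  proof -
   have "Cauchy (%n. s n t)"
   proof (rule CauchyI)
    fix e :: real assume "e > 0"
    then obtain K where "\<forall>m\<ge>K. \<forall>n\<ge>K. cnorm ?C (s m\<ominus>\<^bsub>?C\<^esub> s n) < e" using C by blast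
    then show "\<exists>K. \<forall>m\<ge>K. \<forall>n\<ge>K. cmod (s m t - s n t) < e" using pt[OF t] by (meson order_le_less_trans)
   qed
   then show ?thesis using t by (simp add: f_def Cauchy_convergent_iff convergent_LIMSEQ_iff)
  qed
  have unif: "\<exists>K. \<forall>n\<ge>K. \<forall>t\<in>topspace T. cmod (s n t - f t)<=e" if e: "e > 0" for e
  proof -
   obtain K where K: "\<forall>m\<ge>K. \<forall>n\<ge>K. cnorm ?C (s m\<ominus>\<^bsub>?C\<^esub> s n) < e" using C[OF e] by blast
   have "cmod (s n t - f t)<=e" if n: "n\<ge>K" and t: "t:topspace T" for n t
   proof (rule LIMSEQ_le_const2)
    show "(%m. cmod (s n t - s m t)) \<leadsto> cmod (s n t - f t)"
     by (intro tendsto_intros lim t)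
    show "\<exists>N. \<forall>m\<ge>N. cmod (s n t - s m t)<=e"
     using K n pt[OF t] by (meson less_imp_le order_trans)
   qed
   then show ?thesis by blast
  qed
  have "continuous_map T Met_TC.mtopology f"
  proof (rule Met_TC.continuous_map_uniform_limit[where F = sequentially])
   show "\<forall>\<^sub>F n in sequentially. continuous_map T Met_TC.mtopology (s n)"
    using sc by (simp add: cfun_carrier)
   show "\<forall>\<^sub>F n in sequentially. \<forall>t\<in>topspace T. f t:UNIV&dist (s n t) (f t) < e" if "e > 0" for e
    using unif[of "e / 2"] that by (force simp: eventually_sequentially dist_norm)
  qed (rule trivial_limit_sequentially)
  moreover have "f:extensional (topspace T)" unfolding f_def by (rule restrict_extensional)
  ultimately have fc: "f:carrier ?C" by (simp add: cfun_carrier)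
  have "(%n. cnorm ?C (s n\<ominus>\<^bsub>?C\<^esub> f)) \<leadsto> 0"
  proof (rule LIMSEQ_I)
   fix e :: real assume e: "e > 0"
   obtain K where K: "\<forall>n\<ge>K. \<forall>t\<in>topspace T. cmod (s n t - f t)<=e / 2" using unif[of "e / 2"] e by auto
   have "cnorm ?C (s n\<ominus>\<^bsub>?C\<^esub> f)<=e / 2" if "n\<ge>K" for n
    using K that e sc fc by (intro cfun_norm_le) (auto simp: cfun_minus)
   moreover have "0<=cnorm ?C (s n\<ominus>\<^bsub>?C\<^esub> f)" for n
    using sc fc by (intro cfun_norm_nonneg) (simp add: cfun_minus, auto simp: cfun_carrier intro!: continuous_map_diff)
   ultimately show "\<exists>K. \<forall>n\<ge>K. norm (cnorm ?C (s n\<ominus>\<^bsub>?C\<^esub> f) - 0) < e"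
    using e by (intro exI[of _ K]) (force simp del: cfun_alg_simps)
  qed
  with fc show ?thesis by blast
 qed
qed (auto simp: cfun_carrier fun_eq_iff algebra_simps extensional_def intro!: continuous_map_cnj)

end

end

section \<open>Sums over lists and balanced tensor products\<close>

text \<open>Lists instead of finite index sets, because a formal sum may contain the same pair
  repeatedly.\<close>

definition lsum :: "('x, 'm) ring_scheme=>('p=>'x)=>'p list=>'x" where
 "lsum G f l=foldr (%p s. f p\<oplus>\<^bsub>G\<^esub> s) l \<zero>\<^bsub>G\<^esub>"

lemma lsum_simps [simp]: "lsum G f []=\<zero>\<^bsub>G\<^esub>" "lsum G f (p # l)=f p\<oplus>\<^bsub>G\<^esub> lsum G f l"
 by (simp_all add: lsum_def)

lemma lsum_cong: "(!!p. p:set l==>f p=g p)==>lsum G f l=lsum G g l"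
 by (induction l) auto

lemma lsum_map: "lsum G f (map g l)=lsum G (%p. f (g p)) l"
 by (induction l) auto

context cnormed
begin

lemma lsum_closed [simp]: "(!!p. p:set l==>f p:carrier X)==>lsum X f l:carrier X"
 by (induction l) auto

lemma lsum_append: "[|!!p. p:set l==>f p:carrier X; !!p. p:set l'==>f p:carrier X|]
==>lsum X f (l @ l')=lsum X f l\<oplus>lsum X f l'"
 by (induction l) (auto simp: add_assoc)

lemma lsum_hom:
 assumes "h \<zero>=\<zero>\<^bsub>G\<^esub>" "!!x y. [|x:carrier X; y:carrier X|]==>h (x\<oplus>y)=h x\<oplus>\<^bsub>G\<^esub> h y"
  "!!p. p:set l==>f p:carrier X"
 shows "h (lsum X f l)=lsum G (%p. h (f p)) l"
 using assms(3) by (induction l) (auto simp: assms(1,2))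

lemma lsum_smult: "(!!p. p:set l==>f p:carrier X)==>c\<odot>lsum X f l=lsum X (%p. c\<odot>f p) l"
 by (rule lsum_hom) (auto simp: sm_add_right)

lemma lsum_zero: "lsum X (%p. \<zero>) l=\<zero>"
 by (induction l) auto

lemma lsum_finsum:
 assumes "finite F" "!!p i. [|p:set l; i:F|]==>f i p:carrier X"
 shows "lsum X (%p. finsum X (%i. f i p) F) l=finsum X (%i. lsum X (f i) l) F"
 using assms(2)
proof (induction l)
 case (Cons p l)
 then show ?case
  by (simp add: finsum_addf Pi_def lsum_closed)
qed (simp add: finsum_zero)

end

lemma (in cstar_algebra) lsum_mult_left:
 "[|a:carrier A; !!p. p:set l==>f p:carrier A|]==>a\<otimes>lsum A f l=lsum A (%p. a\<otimes>f p) l"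
 by (rule nv.lsum_hom) (auto simp: A_r_distr)

lemma (in cstar_algebra) lsum_mult_right:
 "[|a:carrier A; !!p. p:set l==>f p:carrier A|]==>lsum A f l\<otimes>a=lsum A (%p. f p\<otimes>a) l"
 by (rule nv.lsum_hom) (auto simp: A_l_distr)

lemma pair_listsD: "[|l:pair_lists X Y; p:set l|]==>fst p:carrier X&snd p:carrier Y"
 by (auto simp: pair_lists_def)

lemma centerD: "z:center A==>z:carrier A" "[|z:center A; a:carrier A|]==>z\<otimes>\<^bsub>A\<^esub> a=a\<otimes>\<^bsub>A\<^esub> z"
 by (auto simp: center_def)

locale bal_pair = cstar_pair "alg U" "alg V"
 for U :: "('s, 't, 'a) one_mor" and V :: "('t, 'u, 'b) one_mor" +
 fixes T :: "'t topology"
 assumes rmap_center: "f:carrier (cfun_alg T)==>rmap U f:center (alg U)"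
  and lmap_center: "f:carrier (cfun_alg T)==>lmap V f:center (alg V)"
begin

abbreviation "gens\<equiv>{elt (a\<otimes>\<^bsub>alg U\<^esub> rmap U f) b\<ominus>\<^bsub>M\<^esub> elt a (lmap V f\<otimes>\<^bsub>alg V\<^esub> b) |a b f.
   a:carrier (alg U)&b:carrier (alg V)&f:carrier (cfun_alg T)}"

lemma rmap_closed [simp]: "f:carrier (cfun_alg T)==>rmap U f:carrier (alg U)"
 by (rule centerD(1)[OF rmap_center])

lemma lmap_closed [simp]: "f:carrier (cfun_alg T)==>lmap V f:carrier (alg V)"
 by (rule centerD(1)[OF lmap_center])

lemma gens_closed: "gens\<subseteq>carrier M"
 by auto

sublocale bi: cstar_closed_ideal M "bal_ideal T U V"
 by unfold_locales (unfold bal_ideal_def, rule closed_ideal_gen[OF cstar_algebra_M gens_closed])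

abbreviation "be\<equiv>bal_elem T U V"
abbreviation "BT\<equiv>bal_tensor T U V"

lemma bal_tensor_eq: "BT=cstar_quot M (bal_ideal T U V)"
 by (simp add: bal_tensor_def)

lemma be_def: "be a b=bi.\<pi> (elt a b)"
 by (simp add: bal_elem_def)

lemma be_closed [simp]: "[|a:carrier (alg U); b:carrier (alg V)|]==>be a b:carrier BT"
 by (simp add: be_def bal_tensor_eq)

lemma be_add_left: "[|a:carrier (alg U); a':carrier (alg U); b:carrier (alg V)|]
==>be (a\<oplus>\<^bsub>alg U\<^esub> a') b=be a b\<oplus>\<^bsub>BT\<^esub> be a' b"
 by (simp add: be_def bal_tensor_eq bi.pi_add elem_add_left)

lemma be_add_right: "[|a:carrier (alg U); b:carrier (alg V); b':carrier (alg V)|]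
==>be a (b\<oplus>\<^bsub>alg V\<^esub> b')=be a b\<oplus>\<^bsub>BT\<^esub> be a b'"
 by (simp add: be_def bal_tensor_eq bi.pi_add elem_add_right)

lemma be_smult_left: "[|a:carrier (alg U); b:carrier (alg V)|]==>be (c\<odot>\<^bsub>alg U\<^esub> a) b=c\<odot>\<^bsub>BT\<^esub> be a b"
 by (simp add: be_def bal_tensor_eq bi.pi_smult elem_smult_left)

lemma be_smult_right: "[|a:carrier (alg U); b:carrier (alg V)|]==>be a (c\<odot>\<^bsub>alg V\<^esub> b)=c\<odot>\<^bsub>BT\<^esub> be a b"
 by (simp add: be_def bal_tensor_eq bi.pi_smult elem_smult_right)

lemma be_mult: "[|a:carrier (alg U); b:carrier (alg V); a':carrier (alg U); b':carrier (alg V)|]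
==>be a b\<otimes>\<^bsub>BT\<^esub> be a' b'=be (a\<otimes>\<^bsub>alg U\<^esub> a') (b\<otimes>\<^bsub>alg V\<^esub> b')"
 by (simp add: be_def bal_tensor_eq bi.pi_mult elem_mult)

lemma be_one: "\<one>\<^bsub>BT\<^esub>=be \<one>\<^bsub>alg U\<^esub> \<one>\<^bsub>alg V\<^esub>"
 by (simp add: be_def bal_tensor_eq bi.pi_one elem_one)

lemma be_balanced: "[|a:carrier (alg U); b:carrier (alg V); f:carrier (cfun_alg T)|]
==>be (a\<otimes>\<^bsub>alg U\<^esub> rmap U f) b=be a (lmap V f\<otimes>\<^bsub>alg V\<^esub> b)"
 unfolding be_def
 by (subst bi.pi_eq) (auto simp: bal_ideal_def intro!: subsetD[OF closed_ideal_gen_subset])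

lemma be_rmap: "f:carrier (cfun_alg T)==>be (rmap U f) \<one>\<^bsub>alg V\<^esub>=be \<one>\<^bsub>alg U\<^esub> (lmap V f)"
 using be_balanced[of "\<one>\<^bsub>alg U\<^esub>" "\<one>\<^bsub>alg V\<^esub>" f] by simp

abbreviation "bsum\<equiv>lsum BT (%(a, b). be a b)"

lemma bsum_eq: "l:L==>bsum l=bi.\<pi> (Q (%n. l))"
proof (induction l rule: pair_lists_induct)
 case Nil
 then show ?case by (simp add: bal_tensor_eq bi.pi_zero Q_zero)
next
 case (Cons a b l)
 then show ?case by (simp add: be_def Q_const_Cons bal_tensor_eq bi.pi_add Q_closed cs_const)
qed

end

text \<open>That the quotient is a C*-algebra is assumed: it is supplied by
  \<open>cstar_algebra_BT\<close> when the second factor is \<open>C(T)\<close>, and otherwise by a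
  correspondence that has this quotient as its left algebra.\<close>

locale bal_alg = bal_pair +
 assumes cstar_BT: "cstar_algebra (bal_tensor T U V)"
begin

sublocale BT: cstar_algebra BT
 by (rule cstar_BT)

lemma be_adj: "[|a:carrier (alg U); b:carrier (alg V)|]==>adj BT (be a b)=be (adj (alg U) a) (adj (alg V) b)"
 using bi.pi_adj'[of "elt a b"] cstar_BT by (simp add: be_def bal_tensor_eq elem_adj)

text \<open>Two choices are involved, an element of the coset and a Cauchy sequence in its class.
  The quotient map is contractive, so convergence in the maximal tensor product passes to the
  quotient.\<close>

lemma bal_rep:
 assumes u: "u:carrier BT"
 shows "bal_rep u n:L" "BT.nv.lim_to (%n. bsum (bal_rep u n)) u"
proof -
 obtain x where x: "x:carrier M" "u=bi.\<pi> x" using u unfolding bal_tensor_eq by (rule bi.R_cases)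
 have "rep u:u"
  unfolding rep_def using bi.pi_self[OF x(1)] x(2) by (metis someI)
 then have r: "rep u:carrier M" "u=bi.\<pi> (rep u)"
  using x bi.mem_pi_carrier bi.mem_pi_iff[OF x(1)] bi.pi_eq by blast+
 have cs: "cs (bal_rep u)" and Q: "Q (bal_rep u)=rep u"
  using q.rep_completion[of "rep u"] r(1) by (simp_all add: bal_rep_def carrier_M)
 show L: "bal_rep u n:L" for n using csD(1)[OF cs] .
 have c: "Q (%k. bal_rep u n):carrier M" for n by (intro Q_closed cs_const L)
 define v where "v=rep u"
 have v: "v:carrier M" "u=bi.\<pi> v" using r by (simp_all add: v_def)
 have bc: "bsum (bal_rep u n):carrier BT" for n
  unfolding bsum_eq[OF L] unfolding bal_tensor_eq by (rule bi.pi_closed[OF c])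
 have "bsum (bal_rep u n)\<ominus>\<^bsub>BT\<^esub> u=bi.\<pi> (Q (%k. bal_rep u n)\<ominus>\<^bsub>M\<^esub> v)" for n
  unfolding BT.nv.diff_conv[OF bc u] M.nv.diff_conv[OF c v(1)] unfolding bsum_eq[OF L]
  using bi.pi_add[OF c, of "(- 1)\<odot>\<^bsub>M\<^esub> v" n] bi.pi_smult[OF v(1), of "- 1"] v(1)
  by (simp only: v(2) bal_tensor_eq M.nv.sm_closed)
 then have "bsum (bal_rep u n)\<ominus>\<^bsub>BT\<^esub> u=bi.\<pi> (Q (%k. bal_rep u n)\<ominus>\<^bsub>M\<^esub> rep u)" for n
  by (simp only: v_def)
 then have "cnorm BT (bsum (bal_rep u n)\<ominus>\<^bsub>BT\<^esub> u)<=cnorm M (Q (%k. bal_rep u n)\<ominus>\<^bsub>M\<^esub> rep u)" for n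
  using bi.pi_norm_le c r(1) by (simp add: bal_tensor_eq)
 then show "BT.nv.lim_to (%n. bsum (bal_rep u n)) u"
  using M.nv.lim_toD(3)[OF Q_lim[OF cs]] unfolding Q
  by (rule BT.nv.lim_to_bound[OF bc u])
qed

end

text \<open>Every axiom, completeness included, pulls back along \<open>h\<close>; definiteness of
  the norm on \<open>R\<close> uses that \<open>h\<close> preserves norms.\<close>

lemma cstar_algebra_transfer:
 assumes A: "cstar_algebra A"
  and closed: "!!x. x:carrier A==>h x:carrier R"
  and surj: "!!y. y:carrier R==>\<exists>x\<in>carrier A. y=h x"
  and norm: "!!x. x:carrier A==>cnorm R (h x)=cnorm A x"
  and add: "!!x y. [|x:carrier A; y:carrier A|]==>h x\<oplus>\<^bsub>R\<^esub> h y=h (x\<oplus>\<^bsub>A\<^esub> y)"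
  and mult: "!!x y. [|x:carrier A; y:carrier A|]==>h x\<otimes>\<^bsub>R\<^esub> h y=h (x\<otimes>\<^bsub>A\<^esub> y)"
  and smult: "!!x c. x:carrier A==>c\<odot>\<^bsub>R\<^esub> h x=h (c\<odot>\<^bsub>A\<^esub> x)"
  and adj: "!!x. x:carrier A==>adj R (h x)=h (adj A x)"
  and one: "\<one>\<^bsub>R\<^esub>=h \<one>\<^bsub>A\<^esub>" and zero: "\<zero>\<^bsub>R\<^esub>=h \<zero>\<^bsub>A\<^esub>"
 shows "cstar_algebra (R :: 'b cstar)"
proof -
 interpret A: cstar_algebra A by fact
 have surjE: "P" if "y:carrier R" "!!x. [|x:carrier A; y=h x|]==>P" for y P
  using surj[OF that(1)] that(2) by (elim bexE)
 have g: "abelian_group R"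
 proof (rule abelian_groupI)
  fix u assume "u:carrier R"
  then obtain x where x: "x:carrier A" "u=h x" by (rule surjE)
  then have "h (\<ominus>\<^bsub>A\<^esub> x):carrier R" "h (\<ominus>\<^bsub>A\<^esub> x)\<oplus>\<^bsub>R\<^esub> u=\<zero>\<^bsub>R\<^esub>"
   by (simp_all add: closed add zero A.nv.minus_conv)
  then show "\<exists>v\<in>carrier R. v\<oplus>\<^bsub>R\<^esub> u=\<zero>\<^bsub>R\<^esub>" by blast
 qed ((elim surjE)?, simp add: closed add zero A.nv.add_ac)+
 have r: "ring R"
 proof (rule ringI[OF g])
  show "Group.monoid R" by (rule monoidI; (elim surjE)?; simp add: closed mult one A.A_assoc)
 qed (elim surjE, simp add: closed mult add A.A_l_distr A.A_r_distr)+
 have m: "Module.module complex_alg R"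
  by (rule moduleI[OF cring_complex_alg g]; elim surjE)
   (simp_all add: closed smult add A.nv.sm_add_left A.nv.sm_add_right A.nv.sm_assoc)
 have diff: "h x\<ominus>\<^bsub>R\<^esub> h y=h (x\<ominus>\<^bsub>A\<^esub> y)" if "x:carrier A" "y:carrier A" for x y
 proof -
  have "\<ominus>\<^bsub>R\<^esub> h y=h (\<ominus>\<^bsub>A\<^esub> y)"
   using that by (intro abelian_group.minus_equality[OF g]) (simp_all add: closed add zero A.nv.minus_conv)
  then show ?thesis using that by (simp add: a_minus_def add)
 qed
 show ?thesis
 proof (intro cstar_algebra.intro r m cstar_algebra_axioms.intro)
  show "cnorm R u=0\<longleftrightarrow>u=\<zero>\<^bsub>R\<^esub>" if uR: "u:carrier R" for u
  proof -
   obtain x where x: "x:carrier A" "u=h x" using surj[OF uR] by (elim bexE)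
   have "x=\<zero>\<^bsub>A\<^esub>" if "h x=h \<zero>\<^bsub>A\<^esub>"
    using norm[OF x(1)] norm[of "\<zero>\<^bsub>A\<^esub>"] A.cnorm_eq_0[OF x(1)] that by simp
   then show ?thesis using x A.cnorm_eq_0[OF x(1)] norm zero by auto
  qed
  show "\<exists>u\<in>carrier R. (%n. cnorm R (s n\<ominus>\<^bsub>R\<^esub> u)) \<leadsto> 0"
   if "cauchy_in (carrier R) (%x y. cnorm R (x\<ominus>\<^bsub>R\<^esub> y)) s" for s
  proof -
   have "\<forall>n. \<exists>x\<in>carrier A. s n=h x" using that surj by (simp add: cauchy_in_def)
   then obtain t where t: "!!n. t n:carrier A" "!!n. s n=h (t n)" by metis
   have "cauchy_in (carrier A) (%x y. cnorm A (x\<ominus>\<^bsub>A\<^esub> y)) t"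
    using that t by (simp add: cauchy_in_def diff norm)
   from A.complete[OF this] obtain x where x: "x:carrier A" "(%n. cnorm A (t n\<ominus>\<^bsub>A\<^esub> x)) \<leadsto> 0"
    by blast
   then show ?thesis using t by (intro bexI[of _ "h x"]) (simp_all add: diff norm closed)
  qed
 qed (elim surjE, simp add: closed add mult smult adj norm A.cnorm_nonneg A.adj_add A.adj_mult A.adj_smult
   A.cnorm_add A.cnorm_mult A.cnorm_smult A.cstar_identity)+
qed

lemma unital_star_homD:
 assumes "unital_star_hom A B f" "x:carrier A" "y:carrier A"
 shows "f x:carrier B" "f (x\<otimes>\<^bsub>A\<^esub> y)=f x\<otimes>\<^bsub>B\<^esub> f y" "f (x\<oplus>\<^bsub>A\<^esub> y)=f x\<oplus>\<^bsub>B\<^esub> f y" "f \<one>\<^bsub>A\<^esub>=\<one>\<^bsub>B\<^esub>"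
  "f (c\<odot>\<^bsub>A\<^esub> x)=c\<odot>\<^bsub>B\<^esub> f x" "f (adj A x)=adj B (f x)"
 using assms by (auto simp: unital_star_hom_def ring_hom_def)

lemma (in bal_pair) gens_mem: "[|a:carrier (alg U); b:carrier (alg V); f:carrier (cfun_alg T)|]
==>elt (a\<otimes>\<^bsub>alg U\<^esub> rmap U f) b\<ominus>\<^bsub>M\<^esub> elt a (lmap V f\<otimes>\<^bsub>alg V\<^esub> b):bal_ideal T U V"
 unfolding bal_ideal_def by (rule subsetD[OF closed_ideal_gen_subset]) blast

section \<open>Balancing with \<open>C(T)\<close> gives the algebra back\<close>

text \<open>Multiplication, \<open>a \<otimes> f \<mapsto> a (rmap U f)\<close>, is inverse to
  \<open>a \<mapsto> a \<otimes> 1\<close>. Extending it to a contraction on the maximal tensor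
  product identifies the balancing ideal with its kernel and the quotient with
  \<open>alg U\<close>.\<close>

locale bal_unit = bal_pair U "mor1_id T" T for U :: "('s, 't, 'a) one_mor" and T :: "'t topology" +
 assumes rmap_hom: "unital_star_hom (cfun_alg T) (alg U) (rmap U)"
begin

abbreviation "CT\<equiv>alg (mor1_id T)"

lemma CT_eq: "cfun_alg T=CT"
 by (simp add: mor1_id_def)

lemma mor1_id_maps [simp]: "lmap (mor1_id T)=(%f. f)" "rmap (mor1_id T)=(%f. f)"
 by (simp_all add: mor1_id_def)

lemmas rm = unital_star_homD[OF rmap_hom[unfolded CT_eq]]

lemma rm_closed [simp]: "f:carrier CT==>rmap U f:carrier (alg U)"
 using rmap_closed[of f] by (simp add: CT_eq)

lemma rm_comm: "[|f:carrier CT; a:carrier (alg U)|]==>rmap U f\<otimes>\<^bsub>alg U\<^esub> a=a\<otimes>\<^bsub>alg U\<^esub> rmap U f"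
 using centerD(2)[OF rmap_center[unfolded CT_eq]] .

abbreviation "mu1\<equiv>%(a, f). a\<otimes>\<^bsub>alg U\<^esub> rmap U f"
abbreviation "mu\<equiv>lsum (alg U) mu1"

lemma mu_closed [simp]: "l:L==>mu l:carrier (alg U)"
 by (induction l rule: pair_lists_induct) auto

lemma mu_append: "[|l:L; m:L|]==>mu (l @ m)=mu l\<oplus>\<^bsub>alg U\<^esub> mu m"
 by (induction l rule: pair_lists_induct) (auto simp: A.nv.add_assoc)

lemma mu_scale: "l:L==>mu (pscale c l)=c\<odot>\<^bsub>alg U\<^esub> mu l"
 by (induction l rule: pair_lists_induct) (auto simp: A.nv.sm_add_right)

lemma mu_mult: "[|l:L; m:L|]==>mu (pmult l m)=mu l\<otimes>\<^bsub>alg U\<^esub> mu m"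
proof (induction l rule: pair_lists_induct)
 case (Cons a f l)
 have "mu (map (%(a', b'). (a\<otimes>\<^bsub>alg U\<^esub> a', f\<otimes>\<^bsub>CT\<^esub> b')) m)=(a\<otimes>\<^bsub>alg U\<^esub> rmap U f)\<otimes>\<^bsub>alg U\<^esub> mu m"
  using Cons(5)
 proof (induction m rule: pair_lists_induct)
  case (Cons a' g m)
  have "(a\<otimes>\<^bsub>alg U\<^esub> a')\<otimes>\<^bsub>alg U\<^esub> rmap U (f\<otimes>\<^bsub>CT\<^esub> g)=(a\<otimes>\<^bsub>alg U\<^esub> (a'\<otimes>\<^bsub>alg U\<^esub> rmap U f))\<otimes>\<^bsub>alg U\<^esub> rmap U g"
   using Cons(1,2) \<open>a \<in> carrier (alg U)\<close> \<open>f \<in> carrier CT\<close> rm(2)[of f g] by (simp add: A.A_assoc)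
  also have "...=(a\<otimes>\<^bsub>alg U\<^esub> rmap U f)\<otimes>\<^bsub>alg U\<^esub> (a'\<otimes>\<^bsub>alg U\<^esub> rmap U g)"
   using Cons(1,2) \<open>a \<in> carrier (alg U)\<close> \<open>f \<in> carrier CT\<close> rm_comm[of f a', symmetric] by (simp add: A.A_assoc)
  finally show ?case
   using Cons \<open>a \<in> carrier (alg U)\<close> \<open>f \<in> carrier CT\<close> by (simp add: A.A_r_distr)
 qed (use Cons in simp)
 then show ?case using Cons by (simp add: mu_append A.A_l_distr)
qed simp

lemma mu_adj: "l:L==>mu (padj l)=adj (alg U) (mu l)"
proof (induction l rule: pair_lists_induct)
 case (Cons a f l)
 then show ?case
  using rm(6)[of f] rm_comm[of "adj CT f" "adj (alg U) a"] B.adj_closed[of f]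
  by (simp add: A.adj_add A.adj_mult)
qed simp

lemma mu_teq: "alg_tensor_eq (alg U) CT l l'==>(l:L\<longleftrightarrow>l':L)&(l:L\<longrightarrow>mu l=mu l')"
proof (induction rule: alg_tensor_eq.induct)
 case (commute l m)
 then show ?case by (auto simp: mu_append A.nv.add_comm)
next
 case (append l l' m m')
 then show ?case by (auto simp: mu_append)
next
 case (add_left a a' b)
 then show ?case by (simp add: A.A_l_distr)
next
 case (add_right a b b')
 then show ?case using rm(3)[of b b'] by (simp add: A.A_r_distr)
next
 case (scale a b c)
 then show ?case using rm(5)[of b b c] by simp
qed auto

text \<open>The norm of \<open>alg U\<close> pulled back along the multiplicative map
  \<open>mu\<close> is a C*-seminorm, and \<open>max_norm\<close> is the largest of these.\<close>

lemma mu_le: assumes "l:L" shows "cnorm (alg U) (mu l)<=N l"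
proof (rule le_max_norm[OF _ assms])
 show "cstar_seminorm (alg U) (alg (mor1_id T)) (%l. cnorm (alg U) (mu l))"
  unfolding cstar_seminorm_def
 proof (intro ballI conjI allI impI)
  fix l l' assume l: "l:L" "l':L"
  show "cnorm (alg U) (mu l)=cnorm (alg U) (mu l')" if "alg_tensor_eq (alg U) CT l l'" using mu_teq[OF that] l by simp
  show "cnorm (alg U) (mu (l @ l'))<=cnorm (alg U) (mu l) + cnorm (alg U) (mu l')"
   using l A.cnorm_add by (simp add: mu_append)
  show "cnorm (alg U) (mu (pmult l l'))<=cnorm (alg U) (mu l) * cnorm (alg U) (mu l')"
   using l A.cnorm_mult by (simp add: mu_mult)
  show "cnorm (alg U) (mu (pmult (padj l) l))=(cnorm (alg U) (mu l))\<^sup>2"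
   using l A.cstar_identity by (simp add: mu_mult mu_adj)
 qed (simp_all add: A.cnorm_nonneg mu_scale A.cnorm_smult)
qed

lemma mu_diff_le: assumes "l:L" "l':L" shows "cnorm (alg U) (mu l\<ominus>\<^bsub>alg U\<^esub> mu l')<=D l l'"
 using mu_le[of "l @ pscale (- 1) l'"] assms by (simp add: mu_append mu_scale D_def A.nv.diff_conv)

text \<open>The continuous extension of \<open>mu\<close> to the completion; \<open>mbar_lim\<close>
  makes it independent of the representing sequence.\<close>

definition mbar :: "(nat=>('a\<times>('t=>complex)) list) set=>'a" where
 "mbar u=(SOME a. A.nv.lim_to (%n. mu (rep u n)) a)"

lemma mbar_lim: assumes "cs s" shows "A.nv.lim_to (%n. mu (s n)) (mbar (Q s))"
proof -
 note r = q.rep_class[OF assms]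
 have "\<exists>a. A.nv.lim_to (%n. mu (rep (Q s) n)) a"
 proof (rule A.nv.cauchy_lim)
  fix e :: real assume "e > 0"
  then obtain K where "\<forall>m\<ge>K. \<forall>n\<ge>K. D (rep (Q s) m) (rep (Q s) n) < e" using csD(2)[OF r(1)] by blast
  then show "\<exists>K. \<forall>m\<ge>K. \<forall>n\<ge>K. cnorm (alg U) (mu (rep (Q s) m)\<ominus>\<^bsub>alg U\<^esub> mu (rep (Q s) n)) < e"
   using mu_diff_le[OF csD(1)[OF r(1)] csD(1)[OF r(1)]] by (meson order_le_less_trans)
 qed (use csD(1)[OF r(1)] in simp)
 then have l: "A.nv.lim_to (%n. mu (rep (Q s) n)) (mbar (Q s))" unfolding mbar_def by (rule someI_ex)
 note lc = A.nv.lim_toD[OF l]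
 show ?thesis
 proof (rule A.nv.lim_to_bound[where e = "%n. D (s n) (rep (Q s) n) + cnorm (alg U) (mu (rep (Q s) n)\<ominus>\<^bsub>alg U\<^esub> mbar (Q s))"])
  show "cnorm (alg U) (mu (s n)\<ominus>\<^bsub>alg U\<^esub> mbar (Q s))<=D (s n) (rep (Q s) n) + cnorm (alg U) (mu (rep (Q s) n)\<ominus>\<^bsub>alg U\<^esub> mbar (Q s))" for n
   using A.nv.N_diff_triangle[of "mu (s n)" "mu (rep (Q s) n)" "mbar (Q s)"]
    mu_diff_le[OF csD(1)[OF assms, of n] csD(1)[OF r(1), of n]] csD(1)[OF assms, of n] lc by simp
  show "(%n. D (s n) (rep (Q s) n) + cnorm (alg U) (mu (rep (Q s) n)\<ominus>\<^bsub>alg U\<^esub> mbar (Q s))) \<leadsto> 0"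
   using tendsto_add_zero[OF r(2) lc(3)] .
 qed (use csD(1)[OF assms] lc in auto)
qed

lemma mbar_eqI: "[|cs s; A.nv.lim_to (%n. mu (s n)) a|]==>mbar (Q s)=a"
 using mbar_lim A.nv.lim_to_unique by blast

lemma mbar_closed: assumes "u:carrier M" shows "mbar u:carrier (alg U)"
 using assms by (elim M_cases) (use mbar_lim A.nv.lim_toD in blast)

lemma mbar_elt: assumes "a:carrier (alg U)" "f:carrier CT" shows "mbar (elt a f)=a\<otimes>\<^bsub>alg U\<^esub> rmap U f"
 unfolding max_elem_def
 by (rule mbar_eqI) (use assms A.nv.lim_to_const[of "a\<otimes>\<^bsub>alg U\<^esub> rmap U f"] in "auto intro!: cs_const")

lemma mbar_add: assumes "u:carrier M" "v:carrier M" shows "mbar (u\<oplus>\<^bsub>M\<^esub> v)=mbar u\<oplus>\<^bsub>alg U\<^esub> mbar v"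
proof -
 obtain s where s: "cs s" "u=Q s" using M_cases[OF assms(1)] .
 obtain t where t: "cs t" "v=Q t" using M_cases[OF assms(2)] .
 show ?thesis
  unfolding s t Q_add[OF s(1) t(1)]
  using A.nv.lim_to_add[OF mbar_lim[OF s(1)] mbar_lim[OF t(1)]] csD(1)[OF s(1)] csD(1)[OF t(1)]
  by (intro mbar_eqI cs_append s t) (simp add: mu_append)
qed

lemma mbar_mult: assumes "u:carrier M" "v:carrier M" shows "mbar (u\<otimes>\<^bsub>M\<^esub> v)=mbar u\<otimes>\<^bsub>alg U\<^esub> mbar v"
proof -
 obtain s where s: "cs s" "u=Q s" using M_cases[OF assms(1)] .
 obtain t where t: "cs t" "v=Q t" using M_cases[OF assms(2)] .
 show ?thesis
  unfolding s t Q_mult[OF s(1) t(1)]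
  using A.lim_mult[OF mbar_lim[OF s(1)] mbar_lim[OF t(1)]] csD(1)[OF s(1)] csD(1)[OF t(1)]
  by (intro mbar_eqI cs_mult s t) (simp add: mu_mult)
qed

lemma mbar_smult: assumes "u:carrier M" shows "mbar (c\<odot>\<^bsub>M\<^esub> u)=c\<odot>\<^bsub>alg U\<^esub> mbar u"
proof -
 obtain s where s: "cs s" "u=Q s" using M_cases[OF assms] .
 show ?thesis
  unfolding s Q_smult[OF s(1)]
  using A.nv.lim_to_smult[OF mbar_lim[OF s(1)]] csD(1)[OF s(1)]
  by (intro mbar_eqI cs_scale s) (simp add: mu_scale)
qed

lemma mbar_adj: assumes "u:carrier M" shows "mbar (adj M u)=adj (alg U) (mbar u)"
proof -
 obtain s where s: "cs s" "u=Q s" using M_cases[OF assms] .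
 show ?thesis
  unfolding s Q_adj[OF s(1)]
  using A.lim_adj[OF mbar_lim[OF s(1)]] csD(1)[OF s(1)]
  by (intro mbar_eqI cs_padj s) (simp add: mu_adj)
qed

lemma mbar_norm_le: assumes "u:carrier M" shows "cnorm (alg U) (mbar u)<=cnorm M u"
proof -
 obtain s where s: "cs s" "u=Q s" using M_cases[OF assms] .
 show ?thesis
  unfolding s(2) by (rule LIMSEQ_le[OF A.nv.lim_to_N[OF mbar_lim[OF s(1)]] Q_norm[OF s(1)]])
   (auto intro!: mu_le csD(1)[OF s(1)])
qed

lemma mbar_diff: "[|u:carrier M; v:carrier M|]==>mbar (u\<ominus>\<^bsub>M\<^esub> v)=mbar u\<ominus>\<^bsub>alg U\<^esub> mbar v"
 by (simp add: M.nv.diff_conv A.nv.diff_conv mbar_add mbar_smult mbar_closed)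

abbreviation "I\<equiv>bal_ideal T U (mor1_id T)"

text \<open>Multiplicativity makes the kernel an ideal, contractivity makes it closed.\<close>

lemma closed_ideal_ker: "closed_ideal M {u:carrier M. mbar u=\<zero>\<^bsub>alg U\<^esub>}"
 unfolding closed_ideal_def
proof (intro conjI allI ballI impI)
 let ?K = "{u:carrier M. mbar u=\<zero>\<^bsub>alg U\<^esub>}"
 have 0: "mbar \<zero>\<^bsub>M\<^esub>=\<zero>\<^bsub>alg U\<^esub>" using mbar_smult[of "\<zero>\<^bsub>M\<^esub>" 0] mbar_closed[of "\<zero>\<^bsub>M\<^esub>"] by simp
 show "ideal ?K M"
 proof (rule idealI[OF ring_M])
  show "subgroup ?K (add_monoid M)"
  proof (rule group.subgroupI[OF abelian_group.a_group[OF abelian_group_M]])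
   have "\<zero>\<^bsub>M\<^esub>:?K" using 0 by simp
   then show "?K\<noteq>{}" by blast
  qed (use 0 in "auto simp: mbar_add mbar_smult M.nv.minus_conv simp flip: a_inv_def")
 qed (auto simp: mbar_mult mbar_closed)
 fix s x assume x: "x:carrier M" and s: "(\<forall>n. s n:?K)&(%n. cnorm M (s n\<ominus>\<^bsub>M\<^esub> x)) \<leadsto> 0"
 have "cnorm (alg U) (mbar x)<=cnorm M (s n\<ominus>\<^bsub>M\<^esub> x)" for n
 proof -
  have sn: "s n:carrier M" "mbar (s n)=\<zero>\<^bsub>alg U\<^esub>" using s by auto
  then have "mbar (x\<ominus>\<^bsub>M\<^esub> s n)=mbar x" using x mbar_closed[OF x] by (simp add: mbar_diff A.nv.diff_conv)
  then show ?thesis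
   using mbar_norm_le[of "x\<ominus>\<^bsub>M\<^esub> s n"] sn(1) x M.nv.N_diff_commute[of x "s n"] by simp
 qed
 then have "cnorm (alg U) (mbar x)<=0" using s by (meson LIMSEQ_le_const)
 then show "x:?K" using x A.cnorm_nonneg[of "mbar x"] A.cnorm_eq_0[of "mbar x"] mbar_closed[OF x] by auto
qed

lemma I_subset_ker: "u:I==>mbar u=\<zero>\<^bsub>alg U\<^esub>"
proof -
 have "gens\<subseteq>{u:carrier M. mbar u=\<zero>\<^bsub>alg U\<^esub>}"
 proof clarify
  fix a b f assume *: "a:carrier (alg U)" "b:carrier CT" "f:carrier (cfun_alg T)"
  then have f: "f:carrier CT" by (simp add: CT_eq)
  show "elt (a\<otimes>\<^bsub>alg U\<^esub> rmap U f) b\<ominus>\<^bsub>M\<^esub> elt a (lmap (mor1_id T) f\<otimes>\<^bsub>CT\<^esub> b):carrier M &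
   mbar (elt (a\<otimes>\<^bsub>alg U\<^esub> rmap U f) b\<ominus>\<^bsub>M\<^esub> elt a (lmap (mor1_id T) f\<otimes>\<^bsub>CT\<^esub> b))=\<zero>\<^bsub>alg U\<^esub>"
   using * f rm(2)[of f b] by (simp add: mbar_diff mbar_elt A.A_assoc)
 qed
 then show "u:I==>mbar u=\<zero>\<^bsub>alg U\<^esub>"
  using closed_ideal_gen_least[OF closed_ideal_ker] unfolding bal_ideal_def by blast
qed

text \<open>For an elementary tensor the difference is minus a balancing generator with second entry
  1; sums and limits stay in the closed ideal.\<close>

lemma diff_elt_mem: assumes "u:carrier M" shows "u\<ominus>\<^bsub>M\<^esub> elt (mbar u) \<one>\<^bsub>CT\<^esub>:I"
proof -
 obtain s where s: "cs s" "u=Q s" using M_cases[OF assms] .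
 have list: "Q (%n. l)\<ominus>\<^bsub>M\<^esub> elt (mu l) \<one>\<^bsub>CT\<^esub>:I" if "l:L" for l
  using that
 proof (induction l rule: pair_lists_induct)
  case Nil
  have "elt \<zero>\<^bsub>alg U\<^esub> \<one>\<^bsub>CT\<^esub>=\<zero>\<^bsub>M\<^esub>" using elem_smult_left[of "\<zero>\<^bsub>alg U\<^esub>" "\<one>\<^bsub>CT\<^esub>" 0] by simp
  then show ?case using bi.I_zero by (simp flip: Q_zero)
 next
  case (Cons a f l)
  have "elt (a\<otimes>\<^bsub>alg U\<^esub> rmap U f) \<one>\<^bsub>CT\<^esub>\<ominus>\<^bsub>M\<^esub> elt a (f\<otimes>\<^bsub>CT\<^esub> \<one>\<^bsub>CT\<^esub>):I"
   using gens_mem[of a "\<one>\<^bsub>CT\<^esub>" f] Cons by (simp add: CT_eq)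
  then have "(- 1)\<odot>\<^bsub>M\<^esub> (elt (a\<otimes>\<^bsub>alg U\<^esub> rmap U f) \<one>\<^bsub>CT\<^esub>\<ominus>\<^bsub>M\<^esub> elt a f):I"
   using bi.I_smult Cons by simp
  then have "elt a f\<ominus>\<^bsub>M\<^esub> elt (a\<otimes>\<^bsub>alg U\<^esub> rmap U f) \<one>\<^bsub>CT\<^esub>:I"
   using Cons by (simp add: M.nv.diff_conv M.nv.sm_add_right M.nv.sm_assoc M.nv.add_comm)
  from bi.I_add[OF this Cons(4)] show ?case
   using Cons Q_closed[OF cs_const[of l]]
   by (simp add: Q_const_Cons elem_add_left M.nv.diff_add_add)
 qed
 have "M.nv.lim_to (%k. elt (mu (s k)) \<one>\<^bsub>CT\<^esub>) (elt (mbar u) \<one>\<^bsub>CT\<^esub>)"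
 proof (rule M.nv.lim_to_bound[where e = "%k. cnorm (alg U) (mu (s k)\<ominus>\<^bsub>alg U\<^esub> mbar u) * cnorm CT \<one>\<^bsub>CT\<^esub>"])
  note m = mbar_lim[OF s(1), folded s(2)]
  show "cnorm M (elt (mu (s k)) \<one>\<^bsub>CT\<^esub>\<ominus>\<^bsub>M\<^esub> elt (mbar u) \<one>\<^bsub>CT\<^esub>)<=cnorm (alg U) (mu (s k)\<ominus>\<^bsub>alg U\<^esub> mbar u) * cnorm CT \<one>\<^bsub>CT\<^esub>" for k
   using elem_norm_le[of "mu (s k)\<ominus>\<^bsub>alg U\<^esub> mbar u" "\<one>\<^bsub>CT\<^esub>"] A.nv.lim_toD[OF m]
   by (simp add: M.nv.diff_conv A.nv.diff_conv elem_add_left elem_smult_left)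
  show "(%k. cnorm (alg U) (mu (s k)\<ominus>\<^bsub>alg U\<^esub> mbar u) * cnorm CT \<one>\<^bsub>CT\<^esub>) \<leadsto> 0"
   by (rule tendsto_mult_left_zero[OF A.nv.lim_toD(3)[OF m]])
 qed (use mbar_closed[OF assms] csD(1)[OF s(1)] in auto)
 from M.nv.lim_to_diff[OF Q_lim[OF s(1)] this] show ?thesis
  unfolding s(2) by (rule bi.I_lim) (rule list[OF csD(1)[OF s(1)]])
qed

text \<open>The kernel is a closed ideal containing the generators, which is one inclusion;
  \<open>diff_elt_mem\<close> is the other. As the kernel of a map that preserves adjoints, the
  ideal is self-adjoint.\<close>

lemma I_iff: "u:I\<longleftrightarrow>u:carrier M&mbar u=\<zero>\<^bsub>alg U\<^esub>"
proof
 assume "u:carrier M&mbar u=\<zero>\<^bsub>alg U\<^esub>"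
 moreover have "elt \<zero>\<^bsub>alg U\<^esub> \<one>\<^bsub>CT\<^esub>=\<zero>\<^bsub>M\<^esub>" using elem_smult_left[of "\<zero>\<^bsub>alg U\<^esub>" "\<one>\<^bsub>CT\<^esub>" 0] by simp
 ultimately show "u:I" using diff_elt_mem[of u] by (simp add: M.nv.diff_conv)
qed (use I_subset_ker bi.I_closed in auto)

lemma be_unit_surj: assumes "x:carrier BT" obtains a where "a:carrier (alg U)" "x=be a \<one>\<^bsub>CT\<^esub>"
proof -
 obtain u where u: "u:carrier M" "x=bi.\<pi> u" using assms unfolding bal_tensor_eq by (rule bi.R_cases)
 have "bi.\<pi> u=bi.\<pi> (elt (mbar u) \<one>\<^bsub>CT\<^esub>)"
  using diff_elt_mem[OF u(1)] u mbar_closed[OF u(1)] by (simp add: bi.pi_eq)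
 then show ?thesis using that[of "mbar u"] u mbar_closed[OF u(1)] by (simp add: be_def)
qed

text \<open>The quotient norm is an infimum, so the lower bound has to treat every representative:
  \<open>mbar\<close> is contractive and sends each of them to \<open>a\<close>.\<close>

lemma be_unit_norm: assumes "a:carrier (alg U)" shows "cnorm BT (be a \<one>\<^bsub>CT\<^esub>)=cnorm (alg U) a"
proof (rule antisym)
 have "cnorm BT (be a \<one>\<^bsub>CT\<^esub>)<=cnorm M (elt a \<one>\<^bsub>CT\<^esub>)"
  using bi.pi_norm_le[of "elt a \<one>\<^bsub>CT\<^esub>"] assms by (simp add: be_def bal_tensor_eq)
 also have "...<=cnorm (alg U) a * cnorm CT \<one>\<^bsub>CT\<^esub>" using elem_norm_le assms by simp
 also have "...<=cnorm (alg U) a" using B.cnorm_one_le A.cnorm_nonneg[OF assms] by (simp add: mult_left_le)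
 finally show "cnorm BT (be a \<one>\<^bsub>CT\<^esub>)<=cnorm (alg U) a" .
 show "cnorm (alg U) a<=cnorm BT (be a \<one>\<^bsub>CT\<^esub>)"
  unfolding be_def bal_tensor_eq
 proof (rule bi.pi_norm_geI)
  fix i assume i: "i:I"
  have "mbar (i\<oplus>\<^bsub>M\<^esub> elt a \<one>\<^bsub>CT\<^esub>)=a"
   using i assms rm(4)[of "\<one>\<^bsub>CT\<^esub>" "\<one>\<^bsub>CT\<^esub>"] bi.I_closed[OF i] by (simp add: mbar_add I_subset_ker mbar_elt)
  then show "cnorm (alg U) a<=cnorm M (i\<oplus>\<^bsub>M\<^esub> elt a \<one>\<^bsub>CT\<^esub>)"
   using mbar_norm_le[of "i\<oplus>\<^bsub>M\<^esub> elt a \<one>\<^bsub>CT\<^esub>"] bi.I_closed[OF i] assms by simp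
 qed (use assms in simp)
qed

lemma be_unit_adj: assumes "a:carrier (alg U)" shows "adj BT (be a \<one>\<^bsub>CT\<^esub>)=be (adj (alg U) a) \<one>\<^bsub>CT\<^esub>"
 unfolding be_def bal_tensor_eq
 by (subst bi.pi_adj) (use assms in "auto simp: I_iff mbar_adj elem_adj")

theorem cstar_algebra_BT: "cstar_algebra BT"
proof (rule cstar_algebra_transfer[where h = "%a. be a \<one>\<^bsub>CT\<^esub>", OF A.cstar_algebra_axioms])
 show "\<exists>a\<in>carrier (alg U). x=be a \<one>\<^bsub>CT\<^esub>" if "x:carrier BT" for x
  using be_unit_surj[OF that] by metis
 show "\<zero>\<^bsub>BT\<^esub>=be \<zero>\<^bsub>alg U\<^esub> \<one>\<^bsub>CT\<^esub>"
  using elem_smult_left[of "\<zero>\<^bsub>alg U\<^esub>" "\<one>\<^bsub>CT\<^esub>" 0] by (simp add: be_def bal_tensor_eq bi.pi_zero)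
qed (simp_all add: be_unit_norm be_add_left be_mult be_smult_left be_unit_adj be_one)

lemma be_unit_center: assumes "z:center (alg U)" shows "be z \<one>\<^bsub>CT\<^esub>:center BT"
proof -
 have "be z \<one>\<^bsub>CT\<^esub>\<otimes>\<^bsub>BT\<^esub> x=x\<otimes>\<^bsub>BT\<^esub> be z \<one>\<^bsub>CT\<^esub>" if "x:carrier BT" for x
  using that centerD[OF assms] by (elim be_unit_surj) (simp add: be_mult)
 then show ?thesis using centerD(1)[OF assms] by (simp add: center_def)
qed

text \<open>Centrality of the right map of the composite is what the next balanced tensor product
  requires.\<close>

lemma be_rmap_center: assumes "f:carrier CT" shows "be \<one>\<^bsub>alg U\<^esub> f:center BT"
 using be_unit_center[OF rmap_center[of f]] be_rmap[of f] assms by (simp add: CT_eq)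

end

section \<open>Pair completions in coordinates\<close>

lemma (in cnormed) lim_to_finsum:
 "(!!i. i < (n::nat)==>lim_to (s i) (f i)) ==>
  lim_to (%m. finsum X (%i. s i m) {..<n}) (finsum X f {..<n})"
proof (induction n)
 case (Suc n)
 then have *: "lim_to (s i) (f i)" if "i < Suc n" for i using that by blast
 note c = lim_toD[OF *]
 have "finsum X f {..<Suc n}=f n\<oplus>finsum X f {..<n}"
  using c(2) by (simp add: lessThan_Suc Pi_def)
 moreover have "finsum X (%i. s i m) {..<Suc n}=s n m\<oplus>finsum X (%i. s i m) {..<n}" for m
  using c(1) by (simp add: lessThan_Suc Pi_def)
 ultimately show ?case using Suc * by (simp add: lim_to_add)
qed (simp add: lim_to_const)

lemma (in cnormed) fs_cong:
 "[|F=G; !!i. i:G==>g i:carrier X; !!i. i:G==>f i=g i|]==>finsum X f F=finsum X g G"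
 by (rule finsum_cong') auto

lemma (in cnormed) fs_addf:
 "[|!!i. i:F==>f i:carrier X; !!i. i:F==>g i:carrier X|]
==>finsum X (%i. f i\<oplus>g i) F=finsum X f F\<oplus>finsum X g F"
 by (rule finsum_addf) auto

lemma (in cnormed) finsum_closed' [simp]: "(!!i. i:F==>f i:carrier X)==>finsum X f F:carrier X"
 by (rule finsum_closed) auto

lemma (in cnormed) finsum_hom:
 assumes "finite F" "h \<zero>=\<zero>\<^bsub>G\<^esub>" "!!x y. [|x:carrier X; y:carrier X|]==>h (x\<oplus>y)=h x\<oplus>\<^bsub>G\<^esub> h y"
  "!!i. i:F==>f i:carrier X" "!!x. x:carrier X==>h x:carrier G" "abelian_group G"
 shows "h (finsum X f F)=finsum G (%i. h (f i)) F"
proof -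
 interpret G: abelian_group G by fact
 show ?thesis
  using assms(1,4)
 proof (induction F)
  case (insert i F)
  then show ?case by (simp add: Pi_def assms(3,5))
 qed (simp add: assms(2))
qed

lemma (in cnormed) lsum_concat:
 "\<forall>l\<in>set ls. \<forall>c\<in>set l. f c:carrier X==>lsum X f (concat ls)=lsum X (lsum X f) ls"
proof (induction ls)
 case (Cons a ls)
 have "lsum X f (a @ concat ls)=lsum X f a\<oplus>lsum X f (concat ls)"
  by (rule lsum_append) (use Cons.prems in auto)
 then show ?case using Cons by simp
qed simp

lemma concat_pairs_lsum:
 fixes G :: "'z cstar" (structure)
 assumes "cstar_algebra G" "!!p q. [|p:set l; q:set m|]==>k p q:carrier G"
 shows "pair_ip G k l m=lsum G (%p. lsum G (k p) m) l"
proof -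
 interpret cstar_algebra G by fact
 have e: "pair_ip G k l m=lsum G (%c. c) [k p q. p \<leftarrow> l, q \<leftarrow> m]"
  by (simp add: pair_ip_def lsum_def)
 have "lsum G (%c. c) [k p q. p \<leftarrow> l, q \<leftarrow> m]=lsum G (lsum G (%c. c)) (map (%p. map (k p) m) l)"
  using assms(2) by (intro nv.lsum_concat) auto
 then show ?thesis by (simp add: e lsum_map)
qed

text \<open>A pair completion whose kernel is a sum of \<open>n\<close> pulled-back inner products of a Hilbert module
 \<open>Z\<close>; it embeds isometrically into \<open>Z\<^sup>n\<close> through the coordinates \<open>R z i\<close>.\<close>

locale realization = hilbert_module C Z
 for C :: "'c cstar" and Z :: "('z0, 'c, 'z) corr" +
 fixes k :: "'x\<times>'y=>'x\<times>'y=>'c" and X1 :: "('a, 'b, 'x) corr" and Y1 :: "('a', 'b', 'y) corr"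
  and lf :: "'l=>nat=>('x\<times>'y) list=>('x\<times>'y) list"
  and rg :: "'c=>nat=>('x\<times>'y) list=>('x\<times>'y) list"
  and tau :: "nat=>'x\<times>'y=>'z" and n :: nat
 assumes smult_X1: "x:carrier X1==>c\<odot>\<^bsub>X1\<^esub> x:carrier X1"
  and tau_closed: "[|x:carrier X1; y:carrier Y1; i < n|]==>tau i (x, y):carrier Z"
  and tau_smult: "[|x:carrier X1; y:carrier Y1; i < n|]==>tau i (c\<odot>\<^bsub>X1\<^esub> x, y)=c\<odot>\<^bsub>Z\<^esub> tau i (x, y)"
  and kernel: "[|x:carrier X1; y:carrier Y1; x':carrier X1; y':carrier Y1|]
==>k (x, y) (x', y')=finsum C (%i. hip Z (tau i (x, y)) (tau i (x', y'))) {..<n}"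
begin

abbreviation "W\<equiv>pair_completion C k X1 Y1 lf rg"
abbreviation "L\<equiv>pair_lists X1 Y1"
abbreviation "d\<equiv>pair_dist C k X1"
abbreviation "q\<equiv>cauchy_class L d"
abbreviation "J l i\<equiv>lsum Z (tau i) l"

lemma W_simps:
 "carrier W=completion L d" "z\<oplus>\<^bsub>W\<^esub> w=q (%m. rep z m @ rep w m)"
 "c\<odot>\<^bsub>W\<^esub> z=q (%m. pair_scale X1 c (rep z m))" "hleft W a z=q (%m. lf a m (rep z m))"
 "hright W z b=q (%m. rg b m (rep z m))" "hip W z w=cstar_lim C (%m. pair_ip C k (rep z m) (rep w m))"
 by (simp_all add: pair_completion_def Let_def)

lemma tau_mem: "[|l:L; p:set l; i < n|]==>tau i p:carrier Z"
 using tau_closed[of "fst p" "snd p"] pair_listsD by fastforce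

lemma J_closed [simp]: "[|l:L; i < n|]==>J l i:carrier Z"
 using tau_mem by (intro Xn.lsum_closed) blast

lemma J_append: "[|l:L; l':L; i < n|]==>J (l @ l') i=J l i\<oplus>\<^bsub>Z\<^esub> J l' i"
 using tau_mem by (intro Xn.lsum_append) blast+

lemma scale_L [simp]: "l:L==>pair_scale X1 c l:L"
 by (induction l rule: pair_lists_induct) (auto simp: smult_X1)

lemma J_scale: "[|l:L; i < n|]==>J (pair_scale X1 c l) i=c\<odot>\<^bsub>Z\<^esub> J l i"
 by (induction l rule: pair_lists_induct) (auto simp: tau_smult tau_closed Xn.sm_add_right)

text \<open>Because the kernel is a sum of pulled-back inner products, the form on formal sums only
  depends on the coordinate sums \<open>J\<close>; it remains to exchange finite sums.\<close>

lemma pair_ip_J: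
 assumes l: "l:L" and m: "m:L"
 shows "pair_ip C k l m=finsum C (%i. hip Z (J l i) (J m i)) {..<n}"
proof -
 have kf: "k p p'=finsum C (%i. hip Z (tau i p) (tau i p')) {..<n}" if "p:set l" "p':set m" for p p'
  using kernel[of "fst p" "snd p" "fst p'" "snd p'"] pair_listsD[OF l that(1)] pair_listsD[OF m that(2)] by simp
 have kc: "k p p':carrier C" if "p:set l" "p':set m" for p p'
  unfolding kf[OF that] using tau_mem[OF l that(1)] tau_mem[OF m that(2)] by (intro B.nv.finsum_closed') auto
 have "lsum C (k p) m=finsum C (%i. hip Z (tau i p) (J m i)) {..<n}" if p: "p:set l" for p
 proof -
  have "lsum C (k p) m=lsum C (%p'. finsum C (%i. hip Z (tau i p) (tau i p')) {..<n}) m"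
   using kf p by (intro lsum_cong) auto
  also have "...=finsum C (%i. lsum C (%p'. hip Z (tau i p) (tau i p')) m) {..<n}"
   using tau_mem[OF l p] tau_mem[OF m] by (intro B.nv.lsum_finsum) auto
  also have "...=finsum C (%i. hip Z (tau i p) (J m i)) {..<n}"
   using tau_mem[OF l p] tau_mem[OF m]
   by (intro B.nv.fs_cong HOL.refl) (auto intro!: Xn.lsum_hom[symmetric, where G = C] simp: ip_add)
  finally show ?thesis .
 qed
 then have "pair_ip C k l m=lsum C (%p. finsum C (%i. hip Z (tau i p) (J m i)) {..<n}) l"
  using concat_pairs_lsum[OF B.cstar_algebra_axioms, of l m k] kc by (simp cong: lsum_cong)
 also have "...=finsum C (%i. lsum C (%p. hip Z (tau i p) (J m i)) l) {..<n}"
  using tau_mem[OF l] m by (intro B.nv.lsum_finsum) auto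
 also have "...=finsum C (%i. hip Z (J l i) (J m i)) {..<n}"
  using tau_mem[OF l] m
  by (intro B.nv.fs_cong HOL.refl)
   (auto intro!: Xn.lsum_hom[symmetric, where G = C and h = "%x. hip Z x (J m i)" for i] simp: ip_add_left)
 finally show ?thesis .
qed

lemma d_eq: assumes "l:L" "m:L"
 shows "d l m=sqrt (cnorm C (finsum C (%i. hip Z (J l i\<ominus>\<^bsub>Z\<^esub> J m i) (J l i\<ominus>\<^bsub>Z\<^esub> J m i)) {..<n}))"
proof -
 have J: "J (l @ pair_scale X1 (- 1) m) i=J l i\<ominus>\<^bsub>Z\<^esub> J m i" if "i < n" for i
  using assms that by (simp add: J_append J_scale Xn.diff_conv)
 have "pair_ip C k (l @ pair_scale X1 (- 1) m) (l @ pair_scale X1 (- 1) m)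
   =finsum C (%i. hip Z (J l i\<ominus>\<^bsub>Z\<^esub> J m i) (J l i\<ominus>\<^bsub>Z\<^esub> J m i)) {..<n}"
  using assms by (subst pair_ip_J) (auto intro!: B.nv.fs_cong simp: J)
 then show ?thesis by (simp add: pair_dist_def Let_def)
qed

lemma component_le_d: assumes "l:L" "m:L" "i < n" shows "hnorm C Z (J l i\<ominus>\<^bsub>Z\<^esub> J m i)<=d l m"
 unfolding d_eq[OF assms(1,2)]
 using component_norm_le[of n "%i. J l i\<ominus>\<^bsub>Z\<^esub> J m i" i] assms by (intro real_le_rsqrt) simp

lemma d_le_sum: assumes "l:L" "m:L" shows "d l m<=(\<Sum>i<n. hnorm C Z (J l i\<ominus>\<^bsub>Z\<^esub> J m i))"
proof -
 have "d l m<=sqrt (\<Sum>i<n. (hnorm C Z (J l i\<ominus>\<^bsub>Z\<^esub> J m i))\<^sup>2)"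
  unfolding d_eq[OF assms] using hnorm_finsum_le[of n "%i. J l i\<ominus>\<^bsub>Z\<^esub> J m i"] assms by simp
 also have "...<=(\<Sum>i<n. hnorm C Z (J l i\<ominus>\<^bsub>Z\<^esub> J m i))"
  using L2_set_le_sum[of "{..<n}" "%i. hnorm C Z (J l i\<ominus>\<^bsub>Z\<^esub> J m i)"] assms
  by (simp add: L2_set_def hnorm_nonneg)
 finally show ?thesis .
qed

sublocale qm: quasi_metric L d "real n"
proof
 show "d l m\<ge>0" if "l:L" "m:L" for l m
  unfolding d_eq[OF that] using that by (auto intro!: B.cnorm_nonneg B.nv.finsum_closed')
 show "d l l=0" if "l:L" for l
 proof -
  have "d l l<=0" using d_le_sum[OF that that] that by simp
  then show ?thesis using \<open>\<And>l m. l \<in> L \<Longrightarrow> m \<in> L \<Longrightarrow> d l m \<ge> 0\<close>[OF that that] by simp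
 qed
 show "d l m=d m l" if "l:L" "m:L" for l m
 proof -
  have "hip Z (J l i\<ominus>\<^bsub>Z\<^esub> J m i) (J l i\<ominus>\<^bsub>Z\<^esub> J m i)=hip Z (J m i\<ominus>\<^bsub>Z\<^esub> J l i) (J m i\<ominus>\<^bsub>Z\<^esub> J l i)" if "i < n" for i
  proof -
   have "J m i\<ominus>\<^bsub>Z\<^esub> J l i=(- 1)\<odot>\<^bsub>Z\<^esub> (J l i\<ominus>\<^bsub>Z\<^esub> J m i)"
    using that \<open>l \<in> L\<close> \<open>m \<in> L\<close> by (simp add: Xn.diff_conv Xn.sm_add_right Xn.sm_assoc Xn.add_comm)
   then show ?thesis using that \<open>l \<in> L\<close> \<open>m \<in> L\<close> by (simp add: ip_smult ip_smult_left B.nv.sm_assoc)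
  qed
  then show ?thesis
   unfolding d_eq[OF that] d_eq[OF that(2,1)] using that
   by (intro arg_cong[where f = "%x. sqrt (cnorm C x)"] B.nv.fs_cong) auto
 qed
 \<comment> \<open>Each of the \<open>n\<close> coordinate differences is at most
   \<open>d x y + d y z\<close>, which is the source of the factor \<open>n\<close>.\<close>
 show "d x z<=real n * (d x y + d y z)" if "x:L" "y:L" "z:L" for x y z
 proof -
  have "d x z<=(\<Sum>i<n. hnorm C Z (J x i\<ominus>\<^bsub>Z\<^esub> J z i))" using d_le_sum that by blast
  also have "...<=(\<Sum>i<n. d x y + d y z)"
  proof (rule sum_mono)
   fix i assume "i:{..<n}"
   then show "hnorm C Z (J x i\<ominus>\<^bsub>Z\<^esub> J z i)<=d x y + d y z"
    using Xn.N_diff_triangle[of "J x i" "J y i" "J z i"] component_le_d[OF that(1,2), of i] component_le_d[OF that(2,3), of i] that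
    by simp
  qed
  finally show ?thesis by simp
 qed
qed

definition R :: "(nat=>('x\<times>'y) list) set=>nat=>'z" where
 "R z i=(SOME \<zeta>. Xn.lim_to (%m. J (rep z m) i) \<zeta>)"

text \<open>\<open>R\<close> is defined with the chosen representative; a distance tending to 0
  carries the limit over to any other sequence of the class.\<close>

lemma lim_rep: assumes "cauchy_in L d s" "i < n" shows "Xn.lim_to (%m. J (s m) i) (R (q s) i)"
proof -
 note r = qm.rep_class[OF assms(1)]
 note sL = qm.cauchy_inD[OF assms(1)] and rL = qm.cauchy_inD[OF r(1)]
 have "\<exists>\<zeta>. Xn.lim_to (%m. J (rep (q s) m) i) \<zeta>"
 proof (rule Xn.cauchy_lim)
  fix e :: real assume "e > 0"
  then obtain K where "\<forall>m\<ge>K. \<forall>m'\<ge>K. d (rep (q s) m) (rep (q s) m') < e"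
   using r(1) by (auto simp: cauchy_in_def)
  then show "\<exists>K. \<forall>m\<ge>K. \<forall>m'\<ge>K. hnorm C Z (J (rep (q s) m) i\<ominus>\<^bsub>Z\<^esub> J (rep (q s) m') i) < e"
   using component_le_d[OF rL rL assms(2)] by (meson order_le_less_trans)
 qed (use rL assms in simp)
 then have l: "Xn.lim_to (%m. J (rep (q s) m) i) (R (q s) i)" unfolding R_def by (rule someI_ex)
 note lc = Xn.lim_toD[OF l]
 show ?thesis
 proof (rule Xn.lim_to_bound[where e = "%m. d (s m) (rep (q s) m) + hnorm C Z (J (rep (q s) m) i\<ominus>\<^bsub>Z\<^esub> R (q s) i)"])
  show "hnorm C Z (J (s m) i\<ominus>\<^bsub>Z\<^esub> R (q s) i)<=d (s m) (rep (q s) m) + hnorm C Z (J (rep (q s) m) i\<ominus>\<^bsub>Z\<^esub> R (q s) i)" for m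
   using Xn.N_diff_triangle[of "J (s m) i" "J (rep (q s) m) i" "R (q s) i"]
    component_le_d[OF sL rL assms(2), of m m] sL rL assms(2) lc(2) by fastforce
  show "(%m. d (s m) (rep (q s) m) + hnorm C Z (J (rep (q s) m) i\<ominus>\<^bsub>Z\<^esub> R (q s) i)) \<leadsto> 0"
   using tendsto_add_zero[OF r(2) lc(3)] .
 qed (use sL assms(2) lc in auto)
qed

lemma carrier_rep: assumes "z:carrier W" shows "cauchy_in L d (rep z)" "q (rep z)=z" "rep z m:L"
 using assms qm.rep_completion[of z] qm.rep_in[of z] by (simp_all add: W_simps)

lemma R_lim: "[|z:carrier W; i < n|]==>Xn.lim_to (%m. J (rep z m) i) (R z i)"
 using lim_rep[OF carrier_rep(1)] carrier_rep(2) by simp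

lemma R_closed [simp]: "[|z:carrier W; i < n|]==>R z i:carrier Z"
 using Xn.lim_toD(2)[OF R_lim] .

text \<open>The device by which elements of the completion are constructed: finitely many
  coordinates control the distance, so their convergence is enough for the Cauchy property.\<close>

lemma R_seq:
 assumes s: "!!m. s m:L" and lim: "!!i. i < n==>Xn.lim_to (%m. J (s m) i) (\<zeta> i)"
 shows "q s:carrier W" "!!i. i < n==>R (q s) i=\<zeta> i"
proof -
 have cs: "cauchy_in L d s"
  unfolding cauchy_in_def
 proof (intro conjI allI impI s)
  fix e :: real assume e: "e > 0"
  define e' where "e'=e / (real n + 1)"
  have e': "e' > 0" using e by (simp add: e'_def)
  have "\<forall>i<n. \<exists>K. \<forall>m\<ge>K. \<forall>m'\<ge>K. hnorm C Z (J (s m) i\<ominus>\<^bsub>Z\<^esub> J (s m') i) < e'"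
   using Xn.lim_cauchy[OF lim e'] by blast
  then obtain K where K: "!!i m m'. [|i < n; m\<ge>K i; m'\<ge>K i|]==>hnorm C Z (J (s m) i\<ominus>\<^bsub>Z\<^esub> J (s m') i) < e'"
   by metis
  define K0 where "K0=Max (insert 0 (K ` {..<n}))"
  have K0: "K i<=K0" if "i < n" for i using that by (simp add: K0_def)
  have "d (s m) (s m') < e" if "m\<ge>K0" "m'\<ge>K0" for m m'
  proof -
   have "d (s m) (s m')<=(\<Sum>i<n. hnorm C Z (J (s m) i\<ominus>\<^bsub>Z\<^esub> J (s m') i))" using d_le_sum s by blast
   also have "...<=(\<Sum>i<n. e')"
    using K K0 that by (intro sum_mono less_imp_le) (meson lessThan_iff order_trans)
   also have "... < (real n + 1) * e'" using e' by (simp add: algebra_simps)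
   also have "...=e" by (simp add: e'_def)
   finally show ?thesis .
  qed
  then show "\<exists>K. \<forall>m\<ge>K. \<forall>m'\<ge>K. d (s m) (s m') < e" by blast
 qed
 show "q s:carrier W" using qm.class_in_completion[OF cs] by (simp add: W_simps)
 show "R (q s) i=\<zeta> i" if "i < n" for i
  using Xn.lim_to_unique[OF lim_rep[OF cs that] lim[OF that]] .
qed

lemma R_inj: assumes "z:carrier W" "w:carrier W" "!!i. i < n==>R z i=R w i" shows "z=w"
proof -
 note z = carrier_rep[OF assms(1)]
 note w = carrier_rep[OF assms(2)]
 have "(%m. \<Sum>i<n. hnorm C Z (J (rep z m) i\<ominus>\<^bsub>Z\<^esub> J (rep w m) i)) \<leadsto> (\<Sum>i<n. 0)"
 proof (rule tendsto_sum)
  fix i assume "i:{..<n}"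
  then have "Xn.lim_to (%m. J (rep z m) i\<ominus>\<^bsub>Z\<^esub> J (rep w m) i) \<zero>\<^bsub>Z\<^esub>"
   using Xn.lim_to_diff[OF R_lim[OF assms(1)] R_lim[OF assms(2)], of i i] assms by simp
  then show "(%m. hnorm C Z (J (rep z m) i\<ominus>\<^bsub>Z\<^esub> J (rep w m) i)) \<leadsto> 0"
   using Xn.lim_to_N[of _ "\<zero>\<^bsub>Z\<^esub>"] by simp
 qed
 then have "(%m. d (rep z m) (rep w m)) \<leadsto> 0"
 proof (intro tendsto_sandwich[where f = "%m. 0" and g = "%m. d (rep z m) (rep w m)"
    and h = "%m. \<Sum>i<n. hnorm C Z (J (rep z m) i\<ominus>\<^bsub>Z\<^esub> J (rep w m) i)"] always_eventually allI)
  show "0<=d (rep z m) (rep w m)" for m by (rule qm.d_nonneg[OF z(3) w(3)])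
  show "d (rep z m) (rep w m)<=(\<Sum>i<n. hnorm C Z (J (rep z m) i\<ominus>\<^bsub>Z\<^esub> J (rep w m) i))" for m
   by (rule d_le_sum[OF z(3) w(3)])
 qed simp_all
 then show ?thesis using qm.class_eq_iff[OF z(1) w(1)] z(2) w(2) by simp
qed

lemma hip_W: assumes "z:carrier W" "w:carrier W"
 shows "hip W z w=finsum C (%i. hip Z (R z i) (R w i)) {..<n}"
proof -
 note z = carrier_rep(3)[OF assms(1)]
 note w = carrier_rep(3)[OF assms(2)]
 have "B.nv.lim_to (%m. pair_ip C k (rep z m) (rep w m)) (finsum C (%i. hip Z (R z i) (R w i)) {..<n})"
  unfolding pair_ip_J[OF z w] using R_lim assms by (intro B.nv.lim_to_finsum lim_ip) auto
 then show ?thesis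
  unfolding W_simps cstar_lim_def
  by (intro the_equality) (use B.nv.lim_to_unique in "auto simp: B.nv.lim_to_def")
qed

lemma smult_W: assumes "z:carrier W"
 shows "c\<odot>\<^bsub>W\<^esub> z:carrier W" "!!i. i < n==>R (c\<odot>\<^bsub>W\<^esub> z) i=c\<odot>\<^bsub>Z\<^esub> R z i"
proof -
 note z = carrier_rep(3)[OF assms]
 have *: "Xn.lim_to (%m. J (pair_scale X1 c (rep z m)) i) (c\<odot>\<^bsub>Z\<^esub> R z i)" if "i < n" for i
  using Xn.lim_to_smult[OF R_lim[OF assms that]] z that by (simp add: J_scale)
 show "c\<odot>\<^bsub>W\<^esub> z:carrier W" "!!i. i < n==>R (c\<odot>\<^bsub>W\<^esub> z) i=c\<odot>\<^bsub>Z\<^esub> R z i"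
  unfolding W_simps(3) using R_seq[OF _ *] z by (simp_all add: W_simps)
qed

text \<open>Operations on completions are defined on the lists of a chosen representative. If they
  act on each coordinate of a pair through one continuous additive map, they do the same in the
  completion.\<close>

lemma map_W:
 assumes z: "z:carrier W"
  and cl: "!!x y. [|x:carrier X1; y:carrier Y1|]==>m (x, y):carrier X1\<times>carrier Y1"
  and tau: "!!x y i. [|x:carrier X1; y:carrier Y1; i < n|]==>tau i (m (x, y))=\<Lambda> (tau i (x, y))"
  and zero: "\<Lambda> \<zero>\<^bsub>Z\<^esub>=\<zero>\<^bsub>Z\<^esub>" and add: "!!x y. [|x:carrier Z; y:carrier Z|]==>\<Lambda> (x\<oplus>\<^bsub>Z\<^esub> y)=\<Lambda> x\<oplus>\<^bsub>Z\<^esub> \<Lambda> y"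
  and cont: "!!s x. Xn.lim_to s x==>Xn.lim_to (%j. \<Lambda> (s j)) (\<Lambda> x)"
 shows "q (%j. map m (rep z j)):carrier W" "!!i. i < n==>R (q (%j. map m (rep z j))) i=\<Lambda> (R z i)"
proof -
 note zL = carrier_rep(3)[OF z]
 have mL: "map m l:L" if "l:L" for l
  using that by (induction l rule: pair_lists_induct) (use cl in "force simp: pair_lists_def")+
 have J: "J (map m l) i=\<Lambda> (J l i)" if "l:L" "i < n" for l i
  using that by (induction l rule: pair_lists_induct) (auto simp: zero add tau tau_closed)
 have *: "Xn.lim_to (%j. J (map m (rep z j)) i) (\<Lambda> (R z i))" if "i < n" for i
  using cont[OF R_lim[OF z that]] by (simp add: J zL that)
 show "q (%j. map m (rep z j)):carrier W" "!!i. i < n==>R (q (%j. map m (rep z j))) i=\<Lambda> (R z i)"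
  using R_seq[OF mL[OF zL] *] by auto
qed

lemma single_W:
 assumes "x:carrier X1" "y:carrier Y1"
 shows "q (%j. [(x, y)]):carrier W" "!!i. i < n==>R (q (%j. [(x, y)])) i=tau i (x, y)"
proof -
 have *: "Xn.lim_to (%j. J [(x, y)] i) (tau i (x, y))" if "i < n" for i
  using tau_closed[OF assms that] by (simp add: Xn.lim_to_const)
 show "q (%j. [(x, y)]):carrier W" "!!i. i < n==>R (q (%j. [(x, y)])) i=tau i (x, y)"
  using R_seq[of "%j. [(x, y)]" "%i. tau i (x, y)"] * assms by auto
qed

text \<open>A linear relation between the coordinates of pairs extends to formal sums by additivity
  and to the completion by continuity. It serves to keep track of the Gram matrix of a frame, which
  fixes the coordinates.\<close>

lemma relation_W:
 assumes z: "z:carrier W" and i: "i < n"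
  and tau: "!!x y. [|x:carrier X1; y:carrier Y1|]==>tau i (x, y)=finsum Z (%j. \<Lambda> j (tau j (x, y))) {..<n}"
  and closed: "!!x j. [|x:carrier Z; j < n|]==>\<Lambda> j x:carrier Z"
  and zero: "!!j. j < n==>\<Lambda> j \<zero>\<^bsub>Z\<^esub>=\<zero>\<^bsub>Z\<^esub>"
  and add: "!!x y j. [|x:carrier Z; y:carrier Z; j < n|]==>\<Lambda> j (x\<oplus>\<^bsub>Z\<^esub> y)=\<Lambda> j x\<oplus>\<^bsub>Z\<^esub> \<Lambda> j y"
  and cont: "!!s x j. [|Xn.lim_to s x; j < n|]==>Xn.lim_to (%m. \<Lambda> j (s m)) (\<Lambda> j x)"
 shows "R z i=finsum Z (%j. \<Lambda> j (R z j)) {..<n}"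
proof -
 note zL = carrier_rep(3)[OF z]
 have J: "J l i=finsum Z (%j. \<Lambda> j (J l j)) {..<n}" if "l:L" for l
  using that
 proof (induction l rule: pair_lists_induct)
  case Nil
  have "finsum Z (%j. \<Lambda> j \<zero>\<^bsub>Z\<^esub>) {..<n}=finsum Z (%j. \<zero>\<^bsub>Z\<^esub>) {..<n}"
   by (intro Xn.fs_cong) (auto simp: zero)
  then show ?case by simp
 next
  case (Cons x y l)
  have "finsum Z (%j. \<Lambda> j (J ((x, y) # l) j)) {..<n}=finsum Z (%j. \<Lambda> j (tau j (x, y))\<oplus>\<^bsub>Z\<^esub> \<Lambda> j (J l j)) {..<n}"
   using Cons by (intro Xn.fs_cong) (auto simp: add tau_closed closed)
  also have "...=finsum Z (%j. \<Lambda> j (tau j (x, y))) {..<n}\<oplus>\<^bsub>Z\<^esub> finsum Z (%j. \<Lambda> j (J l j)) {..<n}"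
   using Cons by (intro Xn.fs_addf) (auto simp: tau_closed closed)
  finally show ?case using Cons tau by simp
 qed
 have "Xn.lim_to (%m. J (rep z m) i) (finsum Z (%j. \<Lambda> j (R z j)) {..<n})"
  unfolding J[OF zL] using R_lim[OF z] cont by (intro Xn.lim_to_finsum) auto
 then show ?thesis using Xn.lim_to_unique R_lim[OF z i] by blast
qed

end

section \<open>Positivity of the interior tensor product\<close>

text \<open>With \<open>delta\<close> the length of a vector this yields Cauchy-Schwarz; with small
  \<open>delta\<close> it says that an almost shortest vector is almost orthogonal.\<close>

lemma quadratic_bound:
 fixes b :: complex
 assumes d: "0<=delta" and g: "0<=\<gamma>"
  and min: "!!s. 0<=delta\<^sup>2 + 2 * Re (s * b) + (cmod s)\<^sup>2 * \<gamma>\<^sup>2"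
 shows "cmod b<=delta * \<gamma>"
proof (cases "b=0")
 case True
 then show ?thesis using d g by simp
next
 case False
 define \<beta> where "\<beta>=cmod b"
 have b: "\<beta> > 0" using False by (simp add: \<beta>_def)
 have key: "- delta\<^sup>2<=- 2 * r * \<beta> + r\<^sup>2 * \<gamma>\<^sup>2" if "r\<ge>0" for r
 proof -
  \<comment> \<open>The phase of \<open>s\<close> is chosen to turn \<open>s * b\<close> into
    \<open>- r * \<beta>\<close>.\<close>
  define s where "s=- (complex_of_real r * cnj b / complex_of_real \<beta>)"
  have "cnj b * b=complex_of_real (\<beta>\<^sup>2)"
   unfolding \<beta>_def by (metis complex_norm_square mult.commute)
  then have "s * b=- (complex_of_real (r / \<beta>) * complex_of_real (\<beta>\<^sup>2))"
   by (simp add: s_def)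
  also have "...=complex_of_real (- r * \<beta>)" using b by (simp add: power2_eq_square)
  finally have "s * b=complex_of_real (- r * \<beta>)" .
  moreover have "cmod s=r" using b that by (simp add: s_def norm_mult norm_divide \<beta>_def)
  ultimately show ?thesis using min[of s] by simp
 qed
 show ?thesis
 proof (cases "\<gamma>=0")
  case True
  \<comment> \<open>Without the quadratic term a large \<open>r\<close> violates the bound, so this
    case is contradictory.\<close>
  then have "2 * ((delta\<^sup>2 + 1) / \<beta>) * \<beta><=delta\<^sup>2" using key[of "(delta\<^sup>2 + 1) / \<beta>"] b by simp
  then show ?thesis using b by (simp add: add_nonneg_pos) (smt (verit) zero_le_power2)
 next
  case False
  then have g: "\<gamma> > 0" using g by simp
  \<comment> \<open>The chosen \<open>r\<close> is the minimiser of the right-hand side of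
    \<open>key\<close>.\<close>
  have "- delta\<^sup>2<=- 2 * (\<beta> / \<gamma>\<^sup>2) * \<beta> + (\<beta> / \<gamma>\<^sup>2)\<^sup>2 * \<gamma>\<^sup>2"
   using key[of "\<beta> / \<gamma>\<^sup>2"] b by simp
  also have "...=- (\<beta> / \<gamma>)\<^sup>2" using g by (simp add: power2_eq_square field_simps)
  finally have "(\<beta> / \<gamma>)\<^sup>2<=delta\<^sup>2" by simp
  then have "\<beta> / \<gamma><=delta" using d by (rule power2_le_imp_le)
  then show ?thesis using g by (simp add: \<beta>_def field_simps)
 qed
qed

text \<open>The situation at one point \<open>t\<close>: \<open>V\<close> is a correspondence whose
  inner products are evaluated at \<open>t\<close>. The form may be degenerate and \<open>V\<close>
  incomplete for it, so orthogonal projections are not at hand.\<close>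

locale star_form = cstar_algebra D + V: Module.module complex_alg V
 for D :: "'d cstar" (structure) and V :: "(complex, 'v, 'm) module_scheme" +
 fixes act :: "'d=>'v=>'v" and S :: "'v=>'v=>complex"
 assumes act_closed: "[|a:carrier D; x:carrier V|]==>act a x:carrier V"
  and act_add: "[|a:carrier D; b:carrier D; x:carrier V|]==>act (a\<oplus>b) x=act a x\<oplus>\<^bsub>V\<^esub> act b x"
  and act_smult: "[|a:carrier D; x:carrier V|]==>act (c\<odot>a) x=c\<odot>\<^bsub>V\<^esub> act a x"
  and act_mult: "[|a:carrier D; b:carrier D; x:carrier V|]==>act (a\<otimes>b) x=act a (act b x)"
  and S_add: "[|x:carrier V; y:carrier V; z:carrier V|]==>S x (y\<oplus>\<^bsub>V\<^esub> z)=S x y + S x z"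
  and S_smult: "[|x:carrier V; y:carrier V|]==>S x (c\<odot>\<^bsub>V\<^esub> y)=c * S x y"
  and S_herm: "[|x:carrier V; y:carrier V|]==>S y x=cnj (S x y)"
  and S_pos: "x:carrier V==>0<=Re (S x x)"
  and S_act: "[|a:carrier D; x:carrier V; y:carrier V|]==>S (act a x) y=S x (act (adj D a) y)"
begin

abbreviation V_add (infixl "\<oplus>\<^sub>V" 65) where "x\<oplus>\<^sub>V y\<equiv>x\<oplus>\<^bsub>V\<^esub> y"
abbreviation V_smult (infixl "\<odot>\<^sub>V" 70) where "c\<odot>\<^sub>V x\<equiv>c\<odot>\<^bsub>V\<^esub> x"
abbreviation V_minus (infixl "\<ominus>\<^sub>V" 65) where "x\<ominus>\<^sub>V y\<equiv>x\<oplus>\<^bsub>V\<^esub> (- 1)\<odot>\<^bsub>V\<^esub> y"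

declare act_closed [simp]

lemma S_add_left: "[|x:carrier V; y:carrier V; z:carrier V|]==>S (x\<oplus>\<^sub>V y) z=S x z + S y z"
 using S_herm[of z "x\<oplus>\<^sub>V y"] S_herm[of z x] S_herm[of z y] by (simp add: S_add)

lemma S_smult_left: "[|x:carrier V; y:carrier V|]==>S (c\<odot>\<^sub>V x) y=cnj c * S x y"
 using S_herm[of y "c\<odot>\<^sub>V x"] S_herm[of y x] by (simp add: S_smult)

definition nu :: "'v=>real" where "nu x=sqrt (Re (S x x))"

lemma nu_sq: "x:carrier V==>(nu x)\<^sup>2=Re (S x x)"
 by (simp add: nu_def S_pos)

lemma nu_nonneg: "x:carrier V==>0<=nu x"
 by (simp add: nu_def S_pos)

lemma expand:
 assumes "x:carrier V" "y:carrier V"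
 shows "Re (S (x\<oplus>\<^sub>V c\<odot>\<^sub>V y) (x\<oplus>\<^sub>V c\<odot>\<^sub>V y))=(nu x)\<^sup>2 + 2 * Re (c * S x y) + (cmod c)\<^sup>2 * (nu y)\<^sup>2"
proof -
 have "S (x\<oplus>\<^sub>V c\<odot>\<^sub>V y) (x\<oplus>\<^sub>V c\<odot>\<^sub>V y)=S x x + (c * S x y + cnj (c * S x y)) + (cnj c * c) * S y y"
  using assms S_herm[OF assms] by (simp add: S_add S_add_left S_smult S_smult_left algebra_simps)
 moreover have "cnj c * c=complex_of_real ((cmod c)\<^sup>2)"
  by (metis complex_norm_square mult.commute)
 ultimately show ?thesis by (simp add: nu_sq assms)
qed

lemma almost_orthogonal:
 assumes x: "x:carrier V" and y: "y:carrier V" and d: "delta\<ge>0"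
  and min: "!!s. (nu x)\<^sup>2 - delta\<^sup>2<=(nu (x\<oplus>\<^sub>V s\<odot>\<^sub>V y))\<^sup>2"
 shows "cmod (S x y)<=delta * nu y"
proof (rule quadratic_bound[OF d nu_nonneg[OF y]])
 show "0<=delta\<^sup>2 + 2 * Re (s * S x y) + (cmod s)\<^sup>2 * (nu y)\<^sup>2" for s
  using min[of s] nu_sq[of "x\<oplus>\<^sub>V s\<odot>\<^sub>V y"] expand[OF x y, of s] x y by simp
qed

text \<open>The choice \<open>delta = nu x\<close> makes the minimality condition trivial.\<close>

lemma form_cauchy_schwarz:
 assumes x: "x:carrier V" and y: "y:carrier V" shows "cmod (S x y)<=nu x * nu y"
 by (rule almost_orthogonal[OF x y nu_nonneg[OF x]]) simp

lemma nu_triangle: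
 assumes x: "x:carrier V" and y: "y:carrier V" shows "nu (x\<oplus>\<^sub>V y)<=nu x + nu y"
proof (rule power2_le_imp_le)
 have "1\<odot>\<^sub>V y=y" using V.smult_one y by simp
 then have "(nu (x\<oplus>\<^sub>V y))\<^sup>2=(nu x)\<^sup>2 + 2 * Re (S x y) + (nu y)\<^sup>2"
  using expand[OF x y, of 1] nu_sq[of "x\<oplus>\<^sub>V y"] x y by simp
 also have "...<=(nu x)\<^sup>2 + 2 * (nu x * nu y) + (nu y)\<^sup>2"
  using form_cauchy_schwarz[OF x y] complex_Re_le_cmod[of "S x y"] by simp
 also have "...=(nu x + nu y)\<^sup>2" by (simp add: power2_eq_square algebra_simps)
 finally show "(nu (x\<oplus>\<^sub>V y))\<^sup>2<=(nu x + nu y)\<^sup>2" .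
qed (use nu_nonneg assms in simp)

lemma nu_smult: "x:carrier V==>nu (c\<odot>\<^sub>V x)=cmod c * nu x"
proof -
 assume x: "x:carrier V"
 have "cnj c * c=complex_of_real ((cmod c)\<^sup>2)" by (metis complex_norm_square mult.commute)
 moreover have "S (c\<odot>\<^sub>V x) (c\<odot>\<^sub>V x)=cnj c * c * S x x"
  using x by (simp add: S_smult S_smult_left)
 ultimately have "S (c\<odot>\<^sub>V x) (c\<odot>\<^sub>V x)=complex_of_real ((cmod c)\<^sup>2) * S x x" by simp
 then show ?thesis by (simp add: nu_def real_sqrt_mult)
qed

text \<open>The unit of \<open>D\<close> acts as a projection, but not necessarily as the identity.\<close>

lemma nu_one: assumes "x:carrier V" shows "Re (S x (act \<one> x))<=(nu x)\<^sup>2"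
proof -
 define p where "p=act \<one> x"
 have p: "p:carrier V" "act \<one> p=p" using assms act_mult[of \<one> \<one> x] by (simp_all add: p_def)
 have "S x p=S p p" using S_act[of \<one> x p] assms p by (simp add: p_def)
 then have "Re (S (x\<ominus>\<^sub>V p) (x\<ominus>\<^sub>V p))=(nu x)\<^sup>2 - Re (S x p)"
  using expand[OF assms p(1), of "- 1"] nu_sq[OF p(1)] by simp
 then show ?thesis using S_pos[of "x\<ominus>\<^sub>V p"] assms p by (simp add: p_def)
qed

text \<open>Boundedness comes from the algebra: for unitary \<open>u\<close> the vector
  \<open>act u x\<close> is no longer than \<open>x\<close> by \<open>nu_one\<close>, self-adjoint
  contractions are means of unitaries, and Cauchy-Schwarz with \<open>adj D a \<otimes> a\<close>
  handles the general case.\<close>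

lemma nu_act: assumes a: "a:carrier D" and x: "x:carrier V" shows "nu (act a x)<=cnorm D a * nu x"
proof -
 have contr: "nu (act h x)<=nu x" if h: "h:carrier D" "adj D h=h" "cnorm D h<=1" for h
 proof -
  obtain u where u: "u:carrier D" "adj D u\<otimes>u=\<one>" "u\<otimes>adj D u=\<one>" "h=(1/2)\<odot>(u\<oplus>adj D u)"
   using sa_unitary[OF h] by blast
  have iso: "nu (act w x)<=nu x" if w: "w:carrier D" "adj D w\<otimes>w=\<one>" for w
  proof (rule power2_le_imp_le)
   have "S (act w x) (act w x)=S x (act \<one> x)"
    using S_act[of w x "act w x"] act_mult[of "adj D w" w x] w x by simp
   then show "(nu (act w x))\<^sup>2<=(nu x)\<^sup>2" using nu_one[OF x] nu_sq w x by simp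
  qed (use nu_nonneg x in simp)
  have "act h x=(1/2)\<odot>\<^sub>V (act u x\<oplus>\<^sub>V act (adj D u) x)"
   using u x by (simp add: act_smult act_add)
  then have "nu (act h x)<=(1/2) * (nu (act u x) + nu (act (adj D u) x))"
   using nu_triangle[of "act u x" "act (adj D u) x"] u(1) x by (simp add: nu_smult)
  then show ?thesis using iso[of u] iso[of "adj D u"] u by simp
 qed
 have sa: "nu (act h x)<=cnorm D h * nu x" if h: "h:carrier D" "adj D h=h" for h
 proof (cases "cnorm D h=0")
  case True
  then have "h=0\<odot>h" using cnorm_eq_0 h by simp
  then have "nu (act h x)=0" using act_smult[of h x 0] nu_smult[of "act h x" 0] h x by simp
  then show ?thesis using True by simp
 next
  case False
  define r where "r=cnorm D h"
  have r: "r > 0" using False cnorm_nonneg[OF h(1)] by (simp add: r_def)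
  have "nu (act (complex_of_real (1/r)\<odot>h) x)<=nu x"
  proof (rule contr)
   show "adj D (complex_of_real (1 / r)\<odot>h)=complex_of_real (1 / r)\<odot>h"
    unfolding adj_smult[OF h(1)] h(2) complex_cnj_complex_of_real ..
   show "cnorm D (complex_of_real (1 / r)\<odot>h)<=1"
    using r h by (simp add: cnorm_smult norm_divide flip: r_def)
  qed (use h in simp)
  then have "nu (act h x) / r<=nu x"
   using r h x by (simp only: act_smult nu_smult act_closed) (simp add: norm_divide)
  then show ?thesis using r by (simp add: r_def field_simps)
 qed
 show ?thesis
 proof (rule power2_le_imp_le)
  have "(nu (act a x))\<^sup>2=Re (S x (act (adj D a\<otimes>a) x))"
   using a x by (simp add: nu_sq S_act act_mult)
  also have "...<=nu x * nu (act (adj D a\<otimes>a) x)"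
   using form_cauchy_schwarz[OF x, of "act (adj D a\<otimes>a) x"] complex_Re_le_cmod[of "S x (act (adj D a\<otimes>a) x)"] a x by simp
  also have "...<=nu x * (cnorm D (adj D a\<otimes>a) * nu x)"
   using sa[of "adj D a\<otimes>a"] a nu_nonneg[OF x] by (intro mult_left_mono) (simp_all add: adj_mult)
  also have "...=(cnorm D a * nu x)\<^sup>2"
   using cstar_identity[OF a] by (simp add: power2_eq_square)
  finally show "(nu (act a x))\<^sup>2<=(cnorm D a * nu x)\<^sup>2" .
 qed (use cnorm_nonneg[OF a] nu_nonneg[OF x] in simp)
qed

text \<open>Replaces the projection of \<open>y\<close> to the vectors \<open>act a x\<close>: if
  the squared distance is within the square of \<open>delta\<close> of its infimum, the remainder is
  almost orthogonal to all of them. Comparison with the coefficient zero bounds the length of the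
  remainder.\<close>

lemma almost_minimal:
 assumes x: "x:carrier V" and y: "y:carrier V" and delta: "delta > 0"
 obtains a where "a:carrier D" "nu (y\<ominus>\<^sub>V act a x)<=nu y + delta"
  "!!b. b:carrier D==>cmod (S (y\<ominus>\<^sub>V act a x) (act b x))<=delta * nu (act b x)"
proof -
 let ?F = "%a. (nu (y\<ominus>\<^sub>V act a x))\<^sup>2"
 define m where "m=Inf (?F ` carrier D)"
 have bdd: "bdd_below (?F ` carrier D)" by (rule bdd_belowI[of _ 0]) auto
 have ne: "?F ` carrier D\<noteq>{}" by auto
 have "m < m + delta\<^sup>2" using delta by simp
 then obtain a where a: "a:carrier D" "?F a < m + delta\<^sup>2"
  using cInf_lessD[OF ne, of "m + delta\<^sup>2"] by (auto simp: m_def)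
 have low: "m<=?F b" if "b:carrier D" for b
  unfolding m_def by (rule cInf_lower[OF _ bdd]) (use that in blast)
 have az: "act \<zero> x=\<zero>\<^bsub>V\<^esub>"
  using act_smult[of \<zero> x 0] V.smult_l_null[of "act \<zero> x"] x by simp
 have "y\<ominus>\<^sub>V act \<zero> x=y"
  using y V.smult_r_null[of "- 1"] by (simp add: az)
 then have "m<=(nu y)\<^sup>2" using low[of \<zero>] by simp
 then have "?F a<=(nu y + delta)\<^sup>2"
  using a(2) mult_nonneg_nonneg[OF nu_nonneg[OF y] less_imp_le[OF delta]] by (simp add: power2_sum)
 then have 1: "nu (y\<ominus>\<^sub>V act a x)<=nu y + delta"
  by (rule power2_le_imp_le) (use nu_nonneg[OF y] delta in simp)
 have 2: "cmod (S (y\<ominus>\<^sub>V act a x) (act b x))<=delta * nu (act b x)" if b: "b:carrier D" for b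
 proof (rule almost_orthogonal)
  fix s
  have "(y\<ominus>\<^sub>V act a x)\<oplus>\<^sub>V s\<odot>\<^sub>V act b x=y\<ominus>\<^sub>V act (a\<oplus>(- s)\<odot>b) x"
   using a(1) b x y V.smult_assoc1[of "- 1" "- s" "act b x"] V.smult_r_distr[of "- 1" "act a x" "- s\<odot>\<^sub>V act b x"]
   by (simp add: act_add act_smult V.a_assoc)
  moreover have "m<=?F (a\<oplus>(- s)\<odot>b)" using a b by (intro low) simp
  ultimately show "(nu (y\<ominus>\<^sub>V act a x))\<^sup>2 - delta\<^sup>2
<=(nu ((y\<ominus>\<^sub>V act a x)\<oplus>\<^sub>V s\<odot>\<^sub>V act b x))\<^sup>2"
   using a(2) by simp
 qed (use x y a(1) b delta in simp_all)
 show ?thesis using that[OF a(1) 1 2] .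
qed

text \<open>By induction, the vectors \<open>y j\<close>
 are split into parts in \<open>D (y n)\<close>, for which positivity is that of one element of \<open>X\<close>, and
 almost orthogonal remainders.\<close>

lemma interior_kernel_pos:
 fixes X :: "('a, 'd, 'x) corr" and n :: nat
 assumes X: "hilbert_module D X"
  and xs: "!!i. i < n==>xs i:carrier X" and ys: "!!i. i < n==>ys i:carrier V"
 shows "0<=Re (\<Sum>i<n. \<Sum>j<n. S (ys i) (act (hip X (xs i) (xs j)) (ys j)))"
proof -
 interpret X: hilbert_module D X by fact
 define kk where "kk=(%(x, y) (x', y'). S y (act (hip X x x') y'))"
 have kk_herm: "kk (x', y') (x, y)=cnj (kk (x, y) (x', y'))"
  if "x:carrier X" "y:carrier V" "x':carrier X" "y':carrier V" for x y x' y'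
  using that S_act[of "hip X x x'" y' y] S_herm[of y "act (hip X x x') y'"] X.ip_adj[of x x'] by (simp add: kk_def)
 have kk_add1: "kk (x1\<oplus>\<^bsub>X\<^esub> x2, y) (x', y')=kk (x1, y) (x', y') + kk (x2, y) (x', y')"
  if "x1:carrier X" "x2:carrier X" "y:carrier V" "x':carrier X" "y':carrier V" for x1 x2 y x' y'
  using that by (simp add: kk_def X.ip_add_left act_add S_add)
 have kk_add2: "kk (x, y1\<oplus>\<^sub>V y2) (x', y')=kk (x, y1) (x', y') + kk (x, y2) (x', y')"
  if "x:carrier X" "y1:carrier V" "y2:carrier V" "x':carrier X" "y':carrier V" for x y1 y2 x' y'
  using that by (simp add: kk_def S_add_left)
 have kk_bal: "kk (x, act a y) (x', y')=kk (hright X x a, y) (x', y')"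
  if "a:carrier D" "x:carrier X" "y:carrier V" "x':carrier X" "y':carrier V" for a x y x' y'
  using that by (simp add: kk_def S_act act_mult X.ip_right_left)
 have kk_pos: "0<=Re (kk (x, y) (x, y))" if x: "x:carrier X" and y: "y:carrier V" for x y
 proof -
  obtain b where "b:carrier D" "hip X x x=adj D b\<otimes>\<^bsub>D\<^esub> b" using X.ip_pos[OF x] by blast
  then have "kk (x, y) (x, y)=S (act b y) (act b y)" using y by (simp add: kk_def act_mult S_act)
  then show ?thesis using S_pos[of "act b y"] \<open>b \<in> carrier D\<close> y by simp
 qed
 have "0<=Re (\<Sum>i<n. \<Sum>j<n. kk (xs i, ys i) (xs j, ys j))"
  using xs ys
 proof (induction n arbitrary: ys)
  case (Suc n)
  have xc: "xs i:carrier X" if "i<=n" for i using Suc.prems that by simp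
  have yc: "ys i:carrier V" if "i<=n" for i using Suc.prems that by simp
  let ?T = "Re (\<Sum>i<Suc n. \<Sum>j<Suc n. kk (xs i, ys i) (xs j, ys j))"
  \<comment> \<open>\<open>delta * c i\<close> will bound the cross term between the collected
    vector and the remainder at \<open>i\<close>. It must not involve the coefficients
    \<open>a j\<close>, which depend on \<open>delta\<close>; \<open>2 * nu (ys j) + 1\<close>
    stands in for the length of \<open>act (a j) (ys n)\<close>.\<close>
  define c where "c i=cnorm D (hip X (xs i) (xs n)) * nu (ys n) + (\<Sum>j<n. cnorm D (hip X (xs i) (xs j)) * (2 * nu (ys j) + 1))" for i
  have step: "- delta * (2 * (\<Sum>i<n. c i))<=?T" if delta: "0 < delta" "delta<=1" for delta
  proof -
   have "\<forall>j<n. \<exists>a. a:carrier D&nu (ys j\<ominus>\<^sub>V act a (ys n))<=nu (ys j) + delta &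
    (\<forall>b\<in>carrier D. cmod (S (ys j\<ominus>\<^sub>V act a (ys n)) (act b (ys n)))<=delta * nu (act b (ys n)))"
   proof (intro allI impI)
    fix j assume "j < n"
    then show "\<exists>a. a:carrier D&nu (ys j\<ominus>\<^sub>V act a (ys n))<=nu (ys j) + delta &
     (\<forall>b\<in>carrier D. cmod (S (ys j\<ominus>\<^sub>V act a (ys n)) (act b (ys n)))<=delta * nu (act b (ys n)))"
     using almost_minimal[OF yc yc delta(1), of n j] by (metis less_imp_le_nat order_refl)
   qed
   then obtain a where a: "!!j. j < n==>a j:carrier D"
    "!!j. j < n==>nu (ys j\<ominus>\<^sub>V act (a j) (ys n))<=nu (ys j) + delta"
    "!!j b. [|j < n; b:carrier D|]==>cmod (S (ys j\<ominus>\<^sub>V act (a j) (ys n)) (act b (ys n)))<=delta * nu (act b (ys n))"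
    by metis
   define r where "r j=ys j\<ominus>\<^sub>V act (a j) (ys n)" for j
   have rc: "r j:carrier V" if "j < n" for j using that a(1) yc by (simp add: r_def)
   have yr: "ys j=act (a j) (ys n)\<oplus>\<^sub>V r j" if "j < n" for j
   proof -
    define u where "u=act (a j) (ys n)"
    have u: "u:carrier V" "ys j:carrier V" using that a(1) yc by (simp_all add: u_def)
    have "u\<ominus>\<^sub>V u=\<zero>\<^bsub>V\<^esub>"
     using V.smult_l_distr[of 1 "- 1" u] V.smult_one[of u] V.smult_l_null[of u] u by simp
    then have "u\<oplus>\<^sub>V (ys j\<ominus>\<^sub>V u)=ys j"
     using u V.a_lcomm[of u "ys j" "(- 1)\<odot>\<^sub>V u"] by simp
    then show ?thesis by (simp add: r_def u_def)
   qed
   \<comment> \<open>Balancing moves each \<open>a j\<close> to the left factor, so the parts along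
     \<open>ys n\<close> add up to a single tensor of \<open>x'\<close> and
     \<open>ys n\<close>.\<close>
   define x' where "x'=xs n\<oplus>\<^bsub>X\<^esub> finsum X (%j. hright X (xs j) (a j)) {..<n}"
   have xac: "hright X (xs j) (a j):carrier X" if "j < n" for j using that a(1) xc by simp
   have x'c: "x':carrier X" using xac xc by (simp add: x'_def)
   have kkE: "kk (x', ys n) (z, w)=kk (xs n, ys n) (z, w) + (\<Sum>j<n. kk (hright X (xs j) (a j), ys n) (z, w))"
    if zw: "z:carrier X" "w:carrier V" for z w
   proof -
    have "kk (finsum X f {..<m}, ys n) (z, w)=(\<Sum>j<m. kk (f j, ys n) (z, w))" if "!!j. j < m==>f j:carrier X" for f and m :: nat
     using that
    proof (induction m)
     case 0
     have "act \<zero>\<^bsub>D\<^esub> w=\<zero>\<^bsub>V\<^esub>" "S (ys n) \<zero>\<^bsub>V\<^esub>=0"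
      using act_smult[of "\<zero>\<^bsub>D\<^esub>" w 0] V.smult_l_null[of "act \<zero>\<^bsub>D\<^esub> w"] zw S_smult[of "ys n" "\<zero>\<^bsub>V\<^esub>" 0] yc
       V.smult_l_null[of "\<zero>\<^bsub>V\<^esub>"] by simp_all
     then show ?case using zw by (simp add: kk_def)
    next
     case (Suc m)
     then show ?case using zw yc by (simp add: lessThan_Suc Pi_def kk_add1 add.commute)
    qed
    from this[of n "%j. hright X (xs j) (a j)"] show ?thesis
     unfolding x'_def using zw xac xc yc by (subst kk_add1) (auto intro: X.Xn.finsum_closed')
   qed
   have split: "kk (xs j, ys j) (z, w)=kk (hright X (xs j) (a j), ys n) (z, w) + kk (xs j, r j) (z, w)"
    if "j < n" "z:carrier X" "w:carrier V" for j z w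
    using that kk_add2[of "xs j" "act (a j) (ys n)" "r j" z w] kk_bal[of "a j" "xs j" "ys n" z w] a(1) xc yc rc
    by (simp flip: yr)
   have sum1: "(\<Sum>i<Suc n. kk (xs i, ys i) (z, w))=kk (x', ys n) (z, w) + (\<Sum>i<n. kk (xs i, r i) (z, w))"
    if "z:carrier X" "w:carrier V" for z w
    using split that kkE[OF that] by (simp add: sum.distrib add.commute)
   have sum2: "(\<Sum>j<Suc n. kk (z, w) (xs j, ys j))=kk (z, w) (x', ys n) + (\<Sum>j<n. kk (z, w) (xs j, r j))"
    if "z:carrier X" "w:carrier V" for z w
   proof -
    have "(\<Sum>j<Suc n. kk (z, w) (xs j, ys j))=cnj (\<Sum>j<Suc n. kk (xs j, ys j) (z, w))"
     unfolding cnj_sum using that xc yc by (intro sum.cong kk_herm) auto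
    also have "...=cnj (kk (x', ys n) (z, w)) + (\<Sum>i<n. cnj (kk (xs i, r i) (z, w)))"
     unfolding sum1[OF that] by (simp add: cnj_sum)
    also have "...=kk (z, w) (x', ys n) + (\<Sum>j<n. kk (z, w) (xs j, r j))"
     using that x'c xc yc rc
     by (intro arg_cong2[where f = "(+)"] sum.cong HOL.refl kk_herm[symmetric]) auto
    finally show ?thesis .
   qed
   \<comment> \<open>The double sum splits into the square of the collected tensor, two cross terms,
     and the form of the remainders. The latter has only \<open>n\<close> entries and falls under
     the induction hypothesis.\<close>
   have "(\<Sum>i<Suc n. \<Sum>j<Suc n. kk (xs i, ys i) (xs j, ys j))=(\<Sum>i<Suc n. kk (xs i, ys i) (x', ys n) + (\<Sum>j<n. kk (xs i, ys i) (xs j, r j)))"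
    using xc yc by (intro sum.cong HOL.refl sum2) auto
   also have "...=(\<Sum>i<Suc n. kk (xs i, ys i) (x', ys n)) + (\<Sum>j<n. \<Sum>i<Suc n. kk (xs i, ys i) (xs j, r j))"
    unfolding sum.distrib by (simp only: sum.swap[of _ "{..<n}"])
   also have "...=(kk (x', ys n) (x', ys n) + (\<Sum>i<n. kk (xs i, r i) (x', ys n)))
     + ((\<Sum>j<n. kk (x', ys n) (xs j, r j)) + (\<Sum>j<n. \<Sum>i<n. kk (xs i, r i) (xs j, r j)))"
    using sum1 x'c xc yc rc by (simp add: sum.distrib)
   finally have T: "?T=Re (kk (x', ys n) (x', ys n)) + (\<Sum>i<n. Re (kk (xs i, r i) (x', ys n)))
     + ((\<Sum>j<n. Re (kk (x', ys n) (xs j, r j))) + Re (\<Sum>j<n. \<Sum>i<n. kk (xs i, r i) (xs j, r j)))"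
    by (simp add: Re_sum)
   have IH: "0<=Re (\<Sum>j<n. \<Sum>i<n. kk (xs i, r i) (xs j, r j))"
    using Suc.IH[of r] Suc.prems(1) rc by (subst sum.swap) simp
   have nu_a: "nu (act (a m) (ys n))<=2 * nu (ys m) + 1" if m: "m < n" for m
   proof -
    have "r m\<ominus>\<^sub>V r m=\<zero>\<^bsub>V\<^esub>"
     using V.smult_l_distr[of 1 "- 1" "r m"] V.smult_one[of "r m"] V.smult_l_null[of "r m"] rc[OF m] by simp
    then have "act (a m) (ys n)=ys m\<ominus>\<^sub>V r m"
     using yr[OF m] rc[OF m] a(1)[OF m] yc by (simp add: V.a_assoc)
    then have "nu (act (a m) (ys n))<=nu (ys m) + nu (r m)"
     using nu_triangle[of "ys m" "(- 1)\<odot>\<^sub>V r m"] nu_smult[of "r m" "- 1"] yc rc[OF m] m by simp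
    then show ?thesis using a(2)[OF m] delta by (simp add: r_def)
   qed
   have small: "cmod (kk (z, ys n) (xs i, r i))<=delta * nu (act (hip X (xs i) z) (ys n))" if "i < n" "z:carrier X" for i z
   proof -
    have "kk (z, ys n) (xs i, r i)=cnj (S (r i) (act (hip X (xs i) z) (ys n)))"
     using kk_herm[of "xs i" "r i" z "ys n"] that xc yc rc by (simp add: kk_def)
    then show ?thesis using a(3)[OF that(1), of "hip X (xs i) z"] that xc by (simp add: r_def)
   qed
   have cross: "cmod (kk (x', ys n) (xs i, r i))<=delta * c i" if i: "i < n" for i
   proof -
    have i': "xs i:carrier X" "i<=n" using i xc by simp_all
    have "cmod (kk (x', ys n) (xs i, r i))<=cmod (kk (xs n, ys n) (xs i, r i)) + (\<Sum>j<n. cmod (kk (hright X (xs j) (a j), ys n) (xs i, r i)))"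
     unfolding kkE[OF i'(1) rc[OF i]] by (intro order_trans[OF norm_triangle_ineq] add_left_mono norm_sum)
    also have "...<=delta * (cnorm D (hip X (xs i) (xs n)) * nu (ys n)) + (\<Sum>j<n. delta * (cnorm D (hip X (xs i) (xs j)) * (2 * nu (ys j) + 1)))"
    proof (intro add_mono sum_mono)
     show "cmod (kk (xs n, ys n) (xs i, r i))<=delta * (cnorm D (hip X (xs i) (xs n)) * nu (ys n))"
      by (rule order_trans[OF small[OF i] mult_left_mono[OF nu_act]]) (use delta i' xc yc in simp_all)
     fix j assume "j:{..<n}"
     then have j: "j < n" by simp
     have "nu (act (hip X (xs i) (hright X (xs j) (a j))) (ys n))=nu (act (hip X (xs i) (xs j)) (act (a j) (ys n)))"
      using i' j xc yc a(1)[OF j] by (simp add: X.ip_right act_mult)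
     also have "...<=cnorm D (hip X (xs i) (xs j)) * nu (act (a j) (ys n))"
      using i' j xc yc a(1)[OF j] by (intro nu_act) auto
     also have "...<=cnorm D (hip X (xs i) (xs j)) * (2 * nu (ys j) + 1)"
      using i' j xc by (intro mult_left_mono nu_a) (simp_all add: cnorm_nonneg)
     finally show "cmod (kk (hright X (xs j) (a j), ys n) (xs i, r i))<=delta * (cnorm D (hip X (xs i) (xs j)) * (2 * nu (ys j) + 1))"
      using small[OF i xac[OF j]] delta by (meson less_imp_le mult_left_mono order_trans)
    qed
    also have "...=delta * c i" by (simp add: c_def sum_distrib_left distrib_left)
    finally show ?thesis .
   qed
   have Re2: "- (delta * c i)<=Re (kk (x', ys n) (xs i, r i))" if "i < n" for i
    using cross[OF that] abs_Re_le_cmod[of "kk (x', ys n) (xs i, r i)"] by linarith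
   have Re1: "- (delta * c i)<=Re (kk (xs i, r i) (x', ys n))" if "i < n" for i
    using Re2[OF that] kk_herm[of x' "ys n" "xs i" "r i"] that x'c xc yc rc by simp
   have "(\<Sum>i<n. - (delta * c i))<=(\<Sum>i<n. Re (kk (xs i, r i) (x', ys n)))"
    "(\<Sum>i<n. - (delta * c i))<=(\<Sum>i<n. Re (kk (x', ys n) (xs i, r i)))"
    using Re1 Re2 by (auto intro!: sum_mono)
   then show ?thesis
    unfolding T using IH kk_pos[OF x'c yc[of n]] by (simp add: sum_negf sum_distrib_left[symmetric])
  qed
  show ?case
  proof (rule ccontr)
   assume neg: "\<not> 0<=?T"
   define C where "C=2 * (\<Sum>i<n. c i)"
   \<comment> \<open>Small enough that the error \<open>delta * C\<close> is at most half of
     \<open>- ?T\<close>. The cap at 1 is the range of \<open>step\<close>, and the added 1 avoids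
     division by zero.\<close>
   define delta where "delta=min 1 (- ?T / (2 * (\<bar>C\<bar> + 1)))"
   have delta: "0 < delta" "delta<=1" using neg by (auto simp: delta_def divide_neg_pos)
   have "delta * C<=delta * (\<bar>C\<bar> + 1)" using delta by (intro mult_left_mono) auto
   also have "...<=(- ?T / (2 * (\<bar>C\<bar> + 1))) * (\<bar>C\<bar> + 1)" by (intro mult_right_mono) (auto simp: delta_def)
   also have "...=- ?T / 2" by (simp add: field_simps)
   finally show False using step[OF delta] neg by (simp add: C_def)
  qed
 qed simp
 then show ?thesis by (simp add: kk_def)
qed

end

section \<open>The pairing of \<open>Y'\<close> with \<open>Y\<close>\<close>

lemma foldr_cfun: "t:topspace T ==>
  foldr (%c s. c\<oplus>\<^bsub>cfun_alg T\<^esub> s) cs z t=(\<Sum>c\<leftarrow>cs. c t) + z t"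
 by (induction cs) (simp_all add: add.assoc)

lemma lsum_cfun: "t:topspace T==>lsum (cfun_alg T) f l t=(\<Sum>p\<leftarrow>l. f p t)"
 by (simp add: lsum_def foldr_map[symmetric] o_def foldr_cfun flip: foldr_map) (induction l; simp)

lemma pair_ip_cfun: "t:topspace T==>pair_ip (cfun_alg T) k l m t=(\<Sum>p\<leftarrow>l. \<Sum>r\<leftarrow>m. k p r t)"
 unfolding pair_ip_def by (subst foldr_cfun) (induction l; simp add: o_def)+

lemma continuous_map_inverse_complex:
 fixes f :: "'a=>complex"
 assumes "continuous_map X euclidean f" "!!x. x:topspace X==>f x\<noteq>0"
 shows "continuous_map X euclidean (%x. inverse (f x))"
proof -
 have "continuous_map X (top_of_set (- {0})) f"
  using assms by (auto simp: continuous_map_in_subtopology)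
 moreover have "continuous_map (top_of_set (- {0 :: complex})) euclidean inverse"
  by (simp add: continuous_map_iff_continuous continuous_intros)
 ultimately have "continuous_map X euclidean (inverse\<circ>f)" by (rule continuous_map_compose)
 then show ?thesis by (simp add: o_def)
qed

lemma iso3_adjoint:
 assumes "iso3 A B X Z u v"
 shows "\<exists>w. (\<forall>z\<in>carrier Z. w z:carrier X)&(\<forall>x\<in>carrier X. \<forall>z\<in>carrier Z. hip Z (u x) z=hip X x (w z))"
  and "\<exists>w. (\<forall>x\<in>carrier X. w x:carrier Z)&(\<forall>z\<in>carrier Z. \<forall>x\<in>carrier X. hip X (v z) x=hip Z z (w x))"
 using assms unfolding iso3_def mor3_def image_subset_iff by blast+

locale pairing = Y: correspondence D "cfun_alg T" Y + Y': correspondence "cfun_alg T" D Y'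
 for T :: "'t topology" and D :: "'d cstar" and Y :: "('d, 't=>complex, 'y) corr"
  and Y' :: "('t=>complex, 'd, 'z) corr" +
 fixes u :: "(nat=>('z\<times>'y) list) set=>'t=>complex" and v
 assumes T: "compact_space T"
  and iso: "iso3 (cfun_alg T) (cfun_alg T) (rel_tensor (cfun_alg T) Y' Y) (id_corr (cfun_alg T)) u v"
begin

abbreviation "C\<equiv>cfun_alg T"
abbreviation "k\<equiv>rel_kernel Y' Y"
abbreviation "Q\<equiv>rel_tensor C Y' Y"
abbreviation "L\<equiv>pair_lists Y' Y"
abbreviation "d\<equiv>pair_dist C k Y'"
abbreviation "q\<equiv>cauchy_class L d"
abbreviation "ip\<equiv>pair_ip C k"
abbreviation "P\<equiv>carrier Y'\<times>carrier Y"

lemma kernel_eq: "k (y', y) (z', z)=hip Y y (hleft Y (hip Y' y' z') z)"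
 by (simp add: rel_kernel_def)

lemma kernel_closed [simp]: "[|p:P; r:P|]==>k p r:carrier C"
 by (cases p; cases r) (simp add: kernel_eq Y.ip_closed Y.left_closed Y'.ip_closed del: cfun_alg_simps)

lemma hip_herm: "[|y:carrier Y; z:carrier Y; t:topspace T|]==>hip Y z y t=cnj (hip Y y z t)"
 using Y.ip_adj[of y z, symmetric] by simp

lemma kernel_herm: "[|p:P; r:P; t:topspace T|]==>k r p t=cnj (k p r t)"
proof (cases p; cases r)
 fix y' y z' z assume a: "p:P" "r:P" "t:topspace T" "p=(y', y)" "r=(z', z)"
 then show ?thesis
  using hip_herm[of y "hleft Y (hip Y' y' z') z" t] Y.left_adj[of "hip Y' y' z'" z y] Y'.ip_adj[of y' z']
  by (simp add: kernel_eq Y.left_closed Y'.ip_closed del: cfun_alg_simps)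
qed

text \<open>Evaluation at \<open>t\<close> turns the function-valued inner product into a scalar
  form, so that \<open>interior_kernel_pos\<close> applies point by point.\<close>

lemma form: assumes t: "t:topspace T" shows "star_form D Y (hleft Y) (%y z. hip Y y z t)"
proof
 show "0<=Re (hip Y x x t)" if "x:carrier Y" for x
  using Y.ip_pos[OF that] t by auto
 show "hip Y y x t=cnj (hip Y x y t)" if "x:carrier Y" "y:carrier Y" for x y
  using hip_herm[OF that t] .
qed (use t in "simp_all add: Y.left_closed Y.left_add' Y.left_smult Y.left_mult Y.ip_add Y.ip_smult Y.left_adj")

definition F :: "('z\<times>'y) list=>('z\<times>'y) list=>'t=>complex" where
 "F l m t=(\<Sum>p\<leftarrow>l. \<Sum>r\<leftarrow>m. k p r t)"

lemma pair_ip_F: "t:topspace T==>ip l m t=F l m t"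
 by (simp add: F_def pair_ip_cfun)

lemma list_mem: "[|l:L; p:set l|]==>p:P"
 by (auto simp: pair_lists_def)

lemma ip_closed [simp]: "[|l:L; m:L|]==>ip l m:carrier C"
 by (subst concat_pairs_lsum[OF Y.B.cstar_algebra_axioms])
  (auto intro!: Y.B.nv.lsum_closed kernel_closed dest: list_mem simp del: cfun_alg_simps)

lemma F_index: "F l m t=(\<Sum>i<length l. \<Sum>j<length m. k (l ! i) (m ! j) t)"
 by (simp add: F_def sum_list_sum_nth atLeast0LessThan)

lemma F_append: "F (l @ l') m t=F l m t + F l' m t" "F l (m @ m') t=F l m t + F l m' t"
 by (simp_all add: F_def sum_list_addf)

lemma F_herm: assumes "l:L" "m:L" "t:topspace T" shows "F m l t=cnj (F l m t)"
proof -
 have "k (m ! j) (l ! i) t=cnj (k (l ! i) (m ! j) t)" if "i < length l" "j < length m" for i j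
  by (rule kernel_herm[OF list_mem[OF assms(1) nth_mem[OF that(1)]] list_mem[OF assms(2) nth_mem[OF that(2)]] assms(3)])
 then show ?thesis unfolding F_index by (subst sum.swap) (simp add: cnj_sum)
qed

lemma F_pos: assumes l: "l:L" and t: "t:topspace T" shows "0<=Re (F l l t)"
proof -
 have "0<=Re (\<Sum>i<length l. \<Sum>j<length l. hip Y (snd (l ! i)) (hleft Y (hip Y' (fst (l ! i)) (fst (l ! j))) (snd (l ! j))) t)"
  by (rule star_form.interior_kernel_pos[OF form[OF t] Y'.hilbert_module_axioms])
   (use list_mem[OF l] in "auto simp: mem_Times_iff")
 then show ?thesis by (simp add: F_index rel_kernel_def case_prod_unfold)
qed

lemma scale_L [simp]: "l:L==>pair_scale Y' c l:L"
 by (induction l rule: pair_lists_induct) auto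

lemma F_scale_right:
 assumes l: "l:L" and m: "m:L" and t: "t:topspace T"
 shows "F l (pair_scale Y' c m) t=c * F l m t"
proof -
 have k: "k p (c\<odot>\<^bsub>Y'\<^esub> z', z) t=c * k p (z', z) t" if "p:P" "z':carrier Y'" "z:carrier Y" for p z' z
  using that t by (cases p) (simp add: kernel_eq Y'.ip_smult Y'.ip_closed Y.left_smult Y.ip_smult Y.left_closed)
 have mk: "map (%p. k p (c\<odot>\<^bsub>Y'\<^esub> z', z) t) l=map (%p. c * k p (z', z) t) l" if "z':carrier Y'" "z:carrier Y" for z' z
  by (rule map_cong[OF HOL.refl k[OF list_mem[OF l] that]])
 have s: "(\<Sum>p\<leftarrow>l. k p (c\<odot>\<^bsub>Y'\<^esub> z', z) t)=c * (\<Sum>p\<leftarrow>l. k p (z', z) t)" if "z':carrier Y'" "z:carrier Y" for z' z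
  by (simp only: mk[OF that] sum_list_const_mult)
 show ?thesis using m
 proof (induction m rule: pair_lists_induct)
  case (Cons z' z m)
  then show ?case using s[of z' z] by (simp add: F_def sum_list_addf distrib_left)
 qed (simp add: F_def)
qed

lemma F_scale_left: "[|l:L; m:L; t:topspace T|]==>F (pair_scale Y' c l) m t=cnj c * F l m t"
 using F_herm[of m "pair_scale Y' c l" t] F_herm[of m l t] F_scale_right[of m l t c] by simp

lemma F_self: "[|l:L; t:topspace T|]==>F l l t=complex_of_real (Re (F l l t))"
 using F_herm[of l l t] by (simp add: complex_eq_iff)

definition nu :: "('z\<times>'y) list=>real" where "nu l=sqrt (cnorm C (ip l l))"

lemma nu_nonneg: "l:L==>0<=nu l"
 using cfun_norm_nonneg[OF T ip_closed[of l l]] by (simp add: nu_def del: cfun_alg_simps)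

lemma F_le_nu: assumes "l:L" "t:topspace T" shows "Re (F l l t)<=(nu l)\<^sup>2"
proof -
 have "Re (F l l t)<=cmod (ip l l t)" using assms by (simp add: pair_ip_F complex_Re_le_cmod)
 also have "...<=cnorm C (ip l l)" using cfun_norm_ge[OF T ip_closed] assms by blast
 also have "...=(nu l)\<^sup>2" using cfun_norm_nonneg[OF T ip_closed[of l l]] assms by (simp add: nu_def del: cfun_alg_simps)
 finally show ?thesis .
qed

lemma nu_leI: assumes "l:L" "0<=r" "!!t. t:topspace T==>Re (F l l t)<=r\<^sup>2" shows "nu l<=r"
proof -
 have "cmod (ip l l t)<=r\<^sup>2" if "t:topspace T" for t
 proof -
  have "cmod (F l l t)=Re (F l l t)"
   using F_pos[OF assms(1) that] by (subst F_self[OF assms(1) that]) simp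
  then show ?thesis using assms(3)[OF that] that by (simp add: pair_ip_F)
 qed
 then have "cnorm C (ip l l)<=r\<^sup>2" by (intro cfun_norm_le[OF T]) auto
 then show ?thesis unfolding nu_def using assms(2) by (rule real_le_lsqrt [rotated])
qed

text \<open>The bound uses the global lengths \<open>nu\<close>, hence is uniform in
  \<open>t\<close>, as convergence in \<open>C(T)\<close> demands.\<close>

lemma F_cauchy_schwarz:
 assumes l: "l:L" and m: "m:L" and t: "t:topspace T" shows "cmod (F l m t)<=nu l * nu m"
proof (rule quadratic_bound[OF nu_nonneg[OF l] nu_nonneg[OF m]])
 fix s
 have "0<=Re (F (l @ pair_scale Y' s m) (l @ pair_scale Y' s m) t)"
  using l m t by (intro F_pos) auto
 also have "...=Re (F l l t + (s * F l m t + cnj (s * F l m t)) + cnj s * (s * F m m t))"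
  using l m t F_herm[of l m t] by (simp add: F_append F_scale_left F_scale_right algebra_simps)
 also have "cnj s * (s * F m m t)=complex_of_real ((cmod s)\<^sup>2 * Re (F m m t))"
  by (subst F_self[OF m t]) (simp only: of_real_mult complex_norm_square mult_ac)
 also have "Re (F l l t + (s * F l m t + cnj (s * F l m t)) + complex_of_real ((cmod s)\<^sup>2 * Re (F m m t)))
<=(nu l)\<^sup>2 + 2 * Re (s * F l m t) + (cmod s)\<^sup>2 * (nu m)\<^sup>2"
  using F_le_nu[OF l t] mult_left_mono[OF F_le_nu[OF m t], of "(cmod s)\<^sup>2"] by simp
 finally show "0<=(nu l)\<^sup>2 + 2 * Re (s * F l m t) + (cmod s)\<^sup>2 * (nu m)\<^sup>2" .
qed

abbreviation "df l m\<equiv>l @ pair_scale Y' (- 1) m"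

lemma d_nu: "d l m=nu (df l m)"
 by (simp add: pair_dist_def nu_def Let_def)

lemma F_df: "[|l:L; m:L; n:L; t:topspace T|]==>F (df l m) n t=F l n t - F m n t"
 "[|l:L; m:L; n:L; t:topspace T|]==>F n (df l m) t=F n l t - F n m t"
 by (simp_all add: F_append F_scale_left F_scale_right)

text \<open>Formulated by pairings: \<open>x\<close> need only behave like the sum of
  \<open>l\<close> and \<open>m\<close> against all formal sums. The same lemma then covers the
  triangle inequality and the comparison of lengths without rewriting lists.\<close>

lemma nu_triangle:
 assumes x: "x:L" and l: "l:L" and m: "m:L"
  and e: "!!t n. [|t:topspace T; n:L|]==>F x n t=F l n t + F m n t"
 shows "nu x<=nu l + nu m"
proof (rule nu_leI[OF x])
 fix t assume t: "t:topspace T"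
 have e': "F n x t=F n l t + F n m t" if "n:L" for n
  using F_herm[of x n t] F_herm[of l n t] F_herm[of m n t] e[OF t that] that x l m t by simp
 have "F x x t=F l l t + (F l m t + cnj (F l m t)) + F m m t"
  using e e' F_herm[of l m t] x l m t by simp
 then have "Re (F x x t)=Re (F l l t) + 2 * Re (F l m t) + Re (F m m t)" by simp
 also have "...<=(nu l)\<^sup>2 + 2 * (nu l * nu m) + (nu m)\<^sup>2"
  using F_le_nu[OF l t] F_le_nu[OF m t] F_cauchy_schwarz[OF l m t] complex_Re_le_cmod[of "F l m t"] by linarith
 also have "...=(nu l + nu m)\<^sup>2" by (simp add: power2_sum)
 finally show "Re (F x x t)<=(nu l + nu m)\<^sup>2" .
qed (use nu_nonneg l m in simp)

sublocale qm: quasi_metric L d 1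
proof
 show "0<=d l m" if "l:L" "m:L" for l m using that by (simp add: d_nu nu_nonneg)
 show "d l l=0" if "l:L" for l
 proof -
  have "nu (df l l)<=0" by (rule nu_leI) (use that in "simp_all add: F_df")
  then show ?thesis using nu_nonneg[of "df l l"] that by (simp add: d_nu)
 qed
 show "d l m=d m l" if "l:L" "m:L" for l m
 proof -
  have "F (df l m) (df l m) t=F (df m l) (df m l) t" if "t:topspace T" for t
   using that \<open>l \<in> L\<close> \<open>m \<in> L\<close> by (simp add: F_df)
  then have "ip (df l m) (df l m)=ip (df m l) (df m l)"
   using that by (intro cfun_eqI[OF ip_closed ip_closed]) (auto simp: pair_ip_F)
  then show ?thesis by (simp add: pair_dist_def Let_def)
 qed
 show "d x z<=1 * (d x y + d y z)" if "x:L" "y:L" "z:L" for x y z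
  unfolding d_nu mult_1 by (rule nu_triangle) (use that in "simp_all add: F_df")
qed

lemma nu_diff: assumes "l:L" "m:L" shows "\<bar>nu l - nu m\<bar><=d l m"
proof -
 have "nu l<=d l m + nu m" if "l:L" "m:L" for l m
  unfolding d_nu by (rule nu_triangle) (use that in "simp_all add: F_df")
 from this[OF assms] this[OF assms(2,1)] show ?thesis using qm.d_sym[OF assms] by simp
qed

lemma nu_bounded: assumes "cauchy_in L d s" shows "\<exists>M>0. \<forall>n. nu (s n)<=M"
proof -
 have "Cauchy (%n. nu (s n))"
  unfolding Cauchy_def dist_real_def
  using assms nu_diff[OF qm.cauchy_inD[OF assms] qm.cauchy_inD[OF assms]]
  by (simp add: cauchy_in_def) (meson order_le_less_trans)
 then have "Bseq (%n. nu (s n))" using Cauchy_Bseq by blast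
 then obtain M where "M > 0" "\<forall>n. norm (nu (s n))<=M" by (auto elim: BseqE)
 then show ?thesis using nu_nonneg[OF qm.cauchy_inD[OF assms]] by auto
qed

lemma ip_diff: assumes "l:L" "l':L" "m:L" "m':L"
 shows "cnorm C (ip l m\<ominus>\<^bsub>C\<^esub> ip l' m')<=d l l' * nu m + nu l' * d m m'"
proof (rule cfun_norm_le[OF T])
 fix t assume t: "t:topspace T"
 have "(ip l m\<ominus>\<^bsub>C\<^esub> ip l' m') t=F (df l l') m t + F l' (df m m') t"
  using assms t by (simp add: cfun_minus pair_ip_F F_df del: cfun_alg_simps)
 then show "cmod ((ip l m\<ominus>\<^bsub>C\<^esub> ip l' m') t)<=d l l' * nu m + nu l' * d m m'"
  using norm_triangle_ineq[of "F (df l l') m t" "F l' (df m m') t"]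
   F_cauchy_schwarz[of "df l l'" m t] F_cauchy_schwarz[of l' "df m m'" t] assms t by (simp add: d_nu)
qed (use assms nu_nonneg in "simp add: d_nu")

lemma ip_lim: assumes s: "cauchy_in L d s" and r: "cauchy_in L d r"
 shows "\<exists>x. Y.B.nv.lim_to (%n. ip (s n) (r n)) x"
proof (rule Y.B.nv.cauchy_lim)
 note sL = qm.cauchy_inD[OF s] and rL = qm.cauchy_inD[OF r]
 show "ip (s n) (r n):carrier C" for n using sL rL by simp
 obtain M where M: "M > 0" "!!n. nu (s n)<=M" using nu_bounded[OF s] by blast
 obtain K where K: "K > 0" "!!n. nu (r n)<=K" using nu_bounded[OF r] by blast
 fix e :: real assume "e > 0"
 then have e: "e / (2 * K) > 0" "e / (2 * M) > 0" using M K by auto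
 obtain N1 where N1: "\<forall>m\<ge>N1. \<forall>n\<ge>N1. d (s m) (s n) < e / (2 * K)" using s e by (auto simp: cauchy_in_def)
 obtain N2 where N2: "\<forall>m\<ge>N2. \<forall>n\<ge>N2. d (r m) (r n) < e / (2 * M)" using r e by (auto simp: cauchy_in_def)
 have "cnorm C (ip (s m) (r m)\<ominus>\<^bsub>C\<^esub> ip (s n) (r n)) < e" if "m\<ge>max N1 N2" "n\<ge>max N1 N2" for m n
 proof -
  have "cnorm C (ip (s m) (r m)\<ominus>\<^bsub>C\<^esub> ip (s n) (r n))<=d (s m) (s n) * nu (r m) + nu (s n) * d (r m) (r n)"
   using ip_diff sL rL by blast
  also have "...<=d (s m) (s n) * K + M * d (r m) (r n)"
   using sL rL M K by (intro add_mono mult_left_mono mult_right_mono qm.d_nonneg) auto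
  also have "... < e / (2 * K) * K + M * (e / (2 * M))"
   using N1 N2 that M K by (intro add_strict_mono mult_strict_right_mono mult_strict_left_mono) auto
  also have "...=e" using M K by simp
  finally show ?thesis .
 qed
 then show "\<exists>N. \<forall>m\<ge>N. \<forall>n\<ge>N. cnorm C (ip (s m) (r m)\<ominus>\<^bsub>C\<^esub> ip (s n) (r n)) < e" by blast
qed

lemma Q_simps: "carrier Q=completion L d" "hip Q z w=cstar_lim C (%n. ip (rep z n) (rep w n))"
 by (simp_all add: rel_tensor_def pair_completion_def Let_def)

lemma hip_lim: assumes s: "cauchy_in L d s" and r: "cauchy_in L d r"
 shows "Y.B.nv.lim_to (%n. ip (s n) (r n)) (hip Q (q s) (q r))"
proof -
 note s' = qm.rep_class[OF s] and r' = qm.rep_class[OF r]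
 note sL = qm.cauchy_inD[OF s] and rL = qm.cauchy_inD[OF r]
 note sL' = qm.cauchy_inD[OF s'(1)] and rL' = qm.cauchy_inD[OF r'(1)]
 obtain x where x: "Y.B.nv.lim_to (%n. ip (rep (q s) n) (rep (q r) n)) x" using ip_lim[OF s'(1) r'(1)] by blast
 have h: "hip Q (q s) (q r)=x"
  unfolding Q_simps cstar_lim_def using x Y.B.nv.lim_to_unique[OF x]
  by (intro the_equality) (auto simp: Y.B.nv.lim_to_def)
 obtain M where M: "M > 0" "!!n. nu (rep (q s) n)<=M" using nu_bounded[OF s'(1)] by blast
 obtain K where K: "K > 0" "!!n. nu (r n)<=K" using nu_bounded[OF r] by blast
 note xl = Y.B.nv.lim_toD[OF x]
 show ?thesis
  unfolding h
 proof (rule Y.B.nv.lim_to_bound)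
  show "ip (s n) (r n):carrier C" for n using sL rL by simp
  show "x:carrier C" using xl by blast
  show "cnorm C (ip (s n) (r n)\<ominus>\<^bsub>C\<^esub> x)<=(d (s n) (rep (q s) n) * K + M * d (r n) (rep (q r) n)) + cnorm C (ip (rep (q s) n) (rep (q r) n)\<ominus>\<^bsub>C\<^esub> x)" for n
  proof -
   have "cnorm C (ip (s n) (r n)\<ominus>\<^bsub>C\<^esub> ip (rep (q s) n) (rep (q r) n))<=d (s n) (rep (q s) n) * nu (r n) + nu (rep (q s) n) * d (r n) (rep (q r) n)"
    using ip_diff sL rL sL' rL' by blast
   also have "...<=d (s n) (rep (q s) n) * K + M * d (r n) (rep (q r) n)"
    using sL rL sL' rL' M K by (intro add_mono mult_left_mono mult_right_mono qm.d_nonneg) auto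
   finally show ?thesis
    using Y.B.nv.N_diff_triangle[of "ip (s n) (r n)" "ip (rep (q s) n) (rep (q r) n)" x] sL rL sL' rL' xl(2)
    by (simp del: cfun_alg_simps)
  qed
  show "(%n. (d (s n) (rep (q s) n) * K + M * d (r n) (rep (q r) n)) + cnorm C (ip (rep (q s) n) (rep (q r) n)\<ominus>\<^bsub>C\<^esub> x)) \<leadsto> 0"
   by (intro tendsto_add_zero tendsto_mult_left_zero tendsto_mult_right_zero s'(2) r'(2) xl(3))
 qed
qed

lemma cfun_lim_at: assumes "Y.B.nv.lim_to s x" "t:topspace T" shows "(%n. s n t) \<leadsto> x t"
proof -
 note l = Y.B.nv.lim_toD[OF assms(1)]
 have "cmod (s n t - x t)<=cnorm C (s n\<ominus>\<^bsub>C\<^esub> x)" for n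
  using cfun_norm_ge[OF T Y.B.nv.diff_closed[OF l(1) l(2)] assms(2), of n] l assms(2) by (simp add: cfun_minus del: cfun_alg_simps)
 then have "(%n. s n t - x t) \<leadsto> 0"
  by (intro Lim_null_comparison[OF _ l(3)] always_eventually) simp
 then show ?thesis by (simp add: LIM_zero_iff)
qed

abbreviation "pt p\<equiv>q (%n. [p])"

lemma single_cauchy: "p:P==>cauchy_in L d (%n. [p])"
 by (intro qm.cauchy_const) (auto simp: pair_lists_def)

lemma hip_pt: assumes "p:P" "r:P" shows "hip Q (pt p) (pt r)=k p r"
proof -
 have "ip [p] [r]=k p r"
  using Y.B.r_zero[OF kernel_closed[OF assms]] by (simp add: pair_ip_def del: cfun_alg_simps)
 then show ?thesis
  using Y.B.nv.lim_to_unique[OF hip_lim[OF single_cauchy[OF assms(1)] single_cauchy[OF assms(2)]], of "k p r"]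
   Y.B.nv.lim_to_const[OF kernel_closed[OF assms]] by simp
qed

lemma hip_facts:
 assumes z: "z:carrier Q" and w: "w:carrier Q"
 shows "hip Q z w:carrier C" "t:topspace T==>hip Q w z t=cnj (hip Q z w t)"
  "t:topspace T==>0<=Re (hip Q z z t)"
  "t:topspace T==>(%n. F (rep z n) (rep w n) t) \<leadsto> hip Q z w t"
proof -
 have l: "Y.B.nv.lim_to (%n. ip (rep z n) (rep w n)) (hip Q z w)" if "z:carrier Q" "w:carrier Q" for z w
  using hip_lim[of "rep z" "rep w"] qm.rep_completion that by (simp add: Q_simps(1))
 show "hip Q z w:carrier C" using Y.B.nv.lim_toD[OF l[OF z w]] by blast
 have f: "(%n. F (rep z n) (rep w n) t) \<leadsto> hip Q z w t" if "z:carrier Q" "w:carrier Q" "t:topspace T" for z w t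
  using cfun_lim_at[OF l[OF that(1,2)] that(3)] that(3) by (simp add: pair_ip_F)
 show "t:topspace T==>(%n. F (rep z n) (rep w n) t) \<leadsto> hip Q z w t" using f z w by blast
 have rL: "rep z n:L" "rep w n:L" for n using qm.rep_in z w by (simp_all add: Q_simps(1))
 show "hip Q w z t=cnj (hip Q z w t)" if t: "t:topspace T"
 proof (rule LIMSEQ_unique[OF f[OF w z t]])
  show "(%n. F (rep w n) (rep z n) t) \<leadsto> cnj (hip Q z w t)"
   using tendsto_cnj[OF f[OF z w t]] by (simp add: F_herm[OF rL t])
 qed
 show "0<=Re (hip Q z z t)" if t: "t:topspace T"
  by (rule LIMSEQ_le_const[OF tendsto_Re[OF f[OF z z t]]]) (use F_pos[OF rL(1) t] in blast)
qed

text \<open>\<open>e1\<close> corresponds to the unit of \<open>C(T)\<close>; its squared length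
  \<open>\<epsilon>\<close> measures how far the 3-isomorphism is from being unitary.\<close>

definition "e1=v \<one>\<^bsub>C\<^esub>"
definition "\<epsilon>=hip Q e1 e1"

lemma uv: "z:carrier Q==>u z:carrier C" "f:carrier C==>v f:carrier Q"
 "z:carrier Q==>v (u z)=z" "f:carrier C==>u (v f)=f"
 using iso by (auto simp: iso3_def mor3_def id_corr_def simp del: cfun_alg_simps)

lemma e1_closed: "e1:carrier Q"
 unfolding e1_def by (intro uv(2)) (rule Y.B.one_closed)

text \<open>The adjoint of \<open>v\<close> pulls \<open>f\<close> out of the first argument, and
  hermitian symmetry pulls \<open>g\<close> out of the second, so only the inner product of
  \<open>e1\<close> with itself remains.\<close>

lemma hip_v: assumes f: "f:carrier C" and g: "g:carrier C" and t: "t:topspace T"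
 shows "hip Q (v f) (v g) t=cnj (f t) * g t * \<epsilon> t"
proof -
 obtain w where "\<forall>z\<in>carrier Q. w z:carrier (id_corr C)"
  "\<forall>f\<in>carrier (id_corr C). \<forall>z\<in>carrier Q. hip Q (v f) z=hip (id_corr C) f (w z)"
  using iso3_adjoint(2)[OF iso] by blast
 then have w: "!!z. z:carrier Q==>w z:carrier C"
  "!!f z. [|f:carrier C; z:carrier Q|]==>hip Q (v f) z=adj C f\<otimes>\<^bsub>C\<^esub> w z"
  by (simp_all add: id_corr_def del: cfun_alg_simps)
 have *: "hip Q (v f) z t=cnj (f t) * hip Q e1 z t" if "f:carrier C" "z:carrier Q" for f z
  using w(2)[OF that] w(2)[OF Y.B.one_closed that(2)] t by (simp add: e1_def)
 have "hip Q (v f) (v g) t=cnj (f t) * cnj (hip Q (v g) e1 t)"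
  using *[OF f uv(2)[OF g]] hip_facts(2)[OF uv(2)[OF g] e1_closed t] by simp
 then show ?thesis using *[OF g e1_closed] hip_facts(2)[OF e1_closed e1_closed t] by (simp add: \<epsilon>_def)
qed

text \<open>The adjoint of \<open>u\<close>, applied to 1, yields \<open>g\<close> with
  \<open>g * \<epsilon> = 1\<close>, so \<open>\<epsilon>\<close> has no zeros; its sign is
  positivity of the kernel.\<close>

lemma \<epsilon>_pos: assumes t: "t:topspace T" shows "0 < Re (\<epsilon> t)" "\<epsilon> t=complex_of_real (Re (\<epsilon> t))"
proof -
 show r: "\<epsilon> t=complex_of_real (Re (\<epsilon> t))"
  using hip_facts(2)[OF e1_closed e1_closed t] by (simp add: \<epsilon>_def complex_eq_iff)
 obtain w where "\<forall>f\<in>carrier (id_corr C). w f:carrier Q"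
  "\<forall>z\<in>carrier Q. \<forall>f\<in>carrier (id_corr C). hip (id_corr C) (u z) f=hip Q z (w f)"
  using iso3_adjoint(1)[OF iso] by blast
 then have w: "!!f. f:carrier C==>w f:carrier Q"
  "!!f z. [|f:carrier C; z:carrier Q|]==>adj C (u z)\<otimes>\<^bsub>C\<^esub> f=hip Q z (w f)"
  by (simp_all add: id_corr_def del: cfun_alg_simps)
 define g where "g=u (w \<one>\<^bsub>C\<^esub>)"
 have g: "g:carrier C" "v g=w \<one>\<^bsub>C\<^esub>" using uv(1,3)[OF w(1)[OF Y.B.one_closed]] by (simp_all only: g_def)
 have "adj C (u e1)\<otimes>\<^bsub>C\<^esub> \<one>\<^bsub>C\<^esub>=hip Q (v \<one>\<^bsub>C\<^esub>) (v g)"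
  using w(2)[OF Y.B.one_closed e1_closed] g(2) by (simp only: e1_def)
 moreover have "u e1=\<one>\<^bsub>C\<^esub>" unfolding e1_def by (rule uv(4)[OF Y.B.one_closed])
 ultimately have "(adj C \<one>\<^bsub>C\<^esub>\<otimes>\<^bsub>C\<^esub> \<one>\<^bsub>C\<^esub>) t=hip Q (v \<one>\<^bsub>C\<^esub>) (v g) t" by simp
 then have "1=g t * \<epsilon> t" using hip_v[OF Y.B.one_closed g(1) t] t by simp
 then have "\<epsilon> t\<noteq>0" by auto
 then have "Re (\<epsilon> t)\<noteq>0" using r by auto
 then show "0 < Re (\<epsilon> t)" using hip_facts(3)[OF e1_closed e1_closed t] by (simp add: \<epsilon>_def)
qed

text \<open>As \<open>v\<close> scales inner products by \<open>\<epsilon>\<close>, multiplying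
  \<open>u\<close> by the square root of \<open>\<epsilon>\<close> makes it isometric. Thus
  \<open>W\<close> factors the kernel through scalars and takes over the role of the interior tensor
  product.\<close>

definition W :: "'z\<times>'y=>'t=>complex" where
 "W p=(\<lambda>t\<in>topspace T. complex_of_real (sqrt (Re (\<epsilon> t))) * u (pt p) t)"

lemma pt_closed: "p:P==>pt p:carrier Q"
 unfolding Q_simps by (intro qm.class_in_completion single_cauchy)

lemma W_closed [simp]: assumes p: "p:P" shows "W p:carrier C"
proof -
 have "continuous_map T euclidean \<epsilon>" "continuous_map T euclidean (u (pt p))"
  using hip_facts(1)[OF e1_closed e1_closed] uv(1)[OF pt_closed[OF p]]
  by (simp_all add: \<epsilon>_def cfun_carrier del: cfun_alg_simps)
 moreover have "continuous_map euclidean euclidean (%z. complex_of_real (sqrt (Re z)))"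
  by (simp add: continuous_map_iff_continuous2 continuous_intros)
 ultimately have "continuous_map T euclidean (%t. complex_of_real (sqrt (Re (\<epsilon> t))) * u (pt p) t)"
  using continuous_map_compose[of T euclidean \<epsilon> euclidean "%z. complex_of_real (sqrt (Re z))"]
  by (intro continuous_map_mult_complex) (auto simp: o_def)
 then show ?thesis unfolding W_def by (rule cfun_restrict_closed)
qed

lemma W_kernel: assumes p: "p:P" and r: "r:P" and t: "t:topspace T"
 shows "cnj (W p t) * W r t=k p r t"
proof -
 have "k p r t=cnj (u (pt p) t) * u (pt r) t * \<epsilon> t"
  using hip_v[OF uv(1) uv(1) t, OF pt_closed[OF p] pt_closed[OF r]] uv(3)[OF pt_closed[OF p]] uv(3)[OF pt_closed[OF r]]
   hip_pt[OF p r] by simp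
 moreover have "complex_of_real (sqrt (Re (\<epsilon> t))) * complex_of_real (sqrt (Re (\<epsilon> t)))=\<epsilon> t"
  using \<epsilon>_pos[OF t] by (metis less_imp_le of_real_mult real_sqrt_mult_self abs_of_nonneg)
 moreover have "cnj (complex_of_real a * x) * (complex_of_real a * y)
   =cnj x * y * (complex_of_real a * complex_of_real a)" for a x y
  by (simp only: complex_cnj_mult complex_cnj_complex_of_real mult_ac)
 ultimately show ?thesis using t by (simp only: W_def restrict_apply')
qed

lemma lsum_W_closed [simp]: "l:L==>lsum C W l:carrier C"
 by (intro Y.B.nv.lsum_closed W_closed) (rule list_mem)

lemma lsum_W_kernel: assumes l: "l:L" and m: "m:L" and t: "t:topspace T"
 shows "cnj (lsum C W l t) * lsum C W m t=F l m t"
proof -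
 have "F l m t=(\<Sum>p\<leftarrow>l. cnj (W p t) * (\<Sum>r\<leftarrow>m. W r t))"
  unfolding F_def sum_list_const_mult[symmetric]
  by (intro arg_cong[where f = sum_list] map_cong HOL.refl W_kernel[symmetric] list_mem[OF l] list_mem[OF m] t)
 also have "...=cnj (\<Sum>p\<leftarrow>l. W p t) * (\<Sum>r\<leftarrow>m. W r t)"
  by (induction l) (simp_all add: distrib_right)
 finally show ?thesis by (simp add: lsum_cfun t)
qed

text \<open>By \<open>lsum_W_kernel\<close> the passage from a formal sum to its sum of
  \<open>W\<close> is isometric. Along a sequence representing \<open>e1\<close> these sums
  converge, and a zero of the limit would be a zero of \<open>\<epsilon>\<close>.\<close>

lemma W_lim: "\<exists>w. Y.B.nv.lim_to (%n. lsum C W (rep e1 n)) w&(\<forall>t\<in>topspace T. w t\<noteq>0)"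
proof -
 define s where "s=rep e1"
 have s: "cauchy_in L d s" using qm.rep_completion(1) e1_closed by (simp add: s_def Q_simps(1))
 note sL = qm.cauchy_inD[OF s]
 have "cnorm C (lsum C W (s m)\<ominus>\<^bsub>C\<^esub> lsum C W (s n))<=d (s m) (s n)" for m n
 proof (rule cfun_norm_le[OF T])
  fix t assume t: "t:topspace T"
  let ?a = "lsum C W (s m) t" and ?b = "lsum C W (s n) t"
  have "complex_of_real ((cmod (?a - ?b))\<^sup>2)=cnj (?a - ?b) * (?a - ?b)"
   by (metis complex_norm_square mult.commute)
  also have "...=F (df (s m) (s n)) (df (s m) (s n)) t"
  proof -
   have "F (df (s m) (s n)) (df (s m) (s n)) t=F (s m) (s m) t - F (s m) (s n) t - (F (s n) (s m) t - F (s n) (s n) t)"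
    using sL t by (simp add: F_df)
   then show ?thesis unfolding lsum_W_kernel[OF sL sL t, symmetric] by (simp add: algebra_simps)
  qed
  finally have "(cmod (?a - ?b))\<^sup>2=Re (F (df (s m) (s n)) (df (s m) (s n)) t)" by (metis Re_complex_of_real)
  also have "...<=(d (s m) (s n))\<^sup>2" unfolding d_nu using sL t by (intro F_le_nu) auto
  finally have "cmod (?a - ?b)<=d (s m) (s n)" by (rule power2_le_imp_le) (rule qm.d_nonneg[OF sL sL])
  then show "cmod ((lsum C W (s m)\<ominus>\<^bsub>C\<^esub> lsum C W (s n)) t)<=d (s m) (s n)"
   using t by (simp add: cfun_minus[OF lsum_W_closed[OF sL] lsum_W_closed[OF sL]])
 qed (rule qm.d_nonneg[OF sL sL])
 note le = this
 have ex: "\<exists>M. \<forall>m\<ge>M. \<forall>n\<ge>M. cnorm C (lsum C W (s m)\<ominus>\<^bsub>C\<^esub> lsum C W (s n)) < e" if "e > 0" for e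
 proof -
  obtain M where "\<forall>m\<ge>M. \<forall>n\<ge>M. d (s m) (s n) < e" using s \<open>e > 0\<close> by (auto simp: cauchy_in_def)
  then show ?thesis using order_le_less_trans[OF le] by blast
 qed
 have "\<exists>w. Y.B.nv.lim_to (%n. lsum C W (s n)) w"
  by (rule Y.B.nv.cauchy_lim) (use lsum_W_closed[OF sL] ex in blast)+
 then obtain w where w: "Y.B.nv.lim_to (%n. lsum C W (s n)) w" ..
 have "w t\<noteq>0" if t: "t:topspace T" for t
 proof
  assume "w t=0"
  then have "(%n. F (s n) (s n) t) \<leadsto> 0"
   using tendsto_mult[OF tendsto_cnj[OF cfun_lim_at[OF w t]] cfun_lim_at[OF w t]]
   by (simp add: lsum_W_kernel[OF sL sL t])
  then have "\<epsilon> t=0"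
   using LIMSEQ_unique[OF hip_facts(4)[OF e1_closed e1_closed t]] by (simp add: s_def \<epsilon>_def)
  then show False using \<epsilon>_pos(1)[OF t] by simp
 qed
 then show ?thesis using w by (auto simp: s_def)
qed

text \<open>Some \<open>W p\<close> is nonzero at \<open>t\<close>, because sums of such values
  approach the nonzero limit of \<open>W_lim\<close>.\<close>

lemma W_separating:
 assumes t: "t:topspace T" and z: "!!p. p:P==>cnj (W p t) * delta=cnj (W p t) * delta'"
 shows "delta=delta'"
proof -
 obtain w where w: "Y.B.nv.lim_to (%n. lsum C W (rep e1 n)) w" "w t\<noteq>0" using W_lim t by blast
 have rL: "rep e1 n:L" for n using qm.rep_in e1_closed by (simp add: Q_simps(1))
 have sep: "cnj (\<Sum>p\<leftarrow>l. W p t) * delta=cnj (\<Sum>p\<leftarrow>l. W p t) * delta'" if "set l\<subseteq>P" for l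
  using that
 proof (induction l)
  case (Cons p l)
  then have "p:P" "set l\<subseteq>P" by auto
  then show ?case by (simp only: list.map sum_list.Cons complex_cnj_add distrib_right z Cons.IH)
 qed simp
 have "cnj (lsum C W (rep e1 n) t) * delta=cnj (lsum C W (rep e1 n) t) * delta'" for n
  unfolding lsum_cfun[OF t] by (rule sep) (use list_mem[OF rL] in blast)
 then have eq: "(%n. cnj (lsum C W (rep e1 n) t) * delta)=(%n. cnj (lsum C W (rep e1 n) t) * delta')" by blast
 have lim: "(%n. cnj (lsum C W (rep e1 n) t) * x) \<leadsto> cnj (w t) * x" for x
  by (intro tendsto_intros tendsto_cnj cfun_lim_at[OF w(1) t])
 have "cnj (w t) * delta=cnj (w t) * delta'"
  by (rule LIMSEQ_unique[OF lim[of delta, unfolded eq] lim])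
 then show ?thesis using w(2) by simp
qed

text \<open>Linearity and balancing of \<open>W\<close> are not read off its construction but tested
  against all \<open>W r\<close>, where they become properties of the kernel.\<close>

lemma W_eqI:
 assumes "W p:carrier C" "f:carrier C"
  and "!!r t. [|r:P; t:topspace T|]==>cnj (W r t) * W p t=cnj (W r t) * f t"
 shows "W p=f"
 by (rule cfun_eqI[OF assms(1,2)], rule W_separating, assumption, rule assms(3))

lemma W_add_left: "[|x:carrier Y'; x':carrier Y'; y:carrier Y|]
==>W (x\<oplus>\<^bsub>Y'\<^esub> x', y)=W (x, y)\<oplus>\<^bsub>C\<^esub> W (x', y)"
 by (rule W_eqI)
  (use Y.B.a_closed[of "W (x, y)" "W (x', y)"] in
   \<open>auto simp: distrib_left W_kernel kernel_eq Y'.ip_add Y'.ip_closed Y.left_add' Y.left_closed Y.ip_add\<close>)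

lemma W_smult_left: "[|x:carrier Y'; y:carrier Y|]==>W (c\<odot>\<^bsub>Y'\<^esub> x, y)=c\<odot>\<^bsub>C\<^esub> W (x, y)"
 by (rule W_eqI)
  (use Y.B.nv.sm_closed[of "W (x, y)" c] in
   \<open>auto simp: mult.left_commute[of _ c] W_kernel kernel_eq Y'.ip_smult Y'.ip_closed Y.left_smult Y.left_closed Y.ip_smult\<close>)

lemma W_balanced: "[|x:carrier Y'; a:carrier D; y:carrier Y|]==>W (hright Y' x a, y)=W (x, hleft Y a y)"
 by (intro W_eqI) (auto simp: W_kernel kernel_eq Y'.ip_right Y'.right_closed Y.left_closed Y'.ip_closed Y.left_mult)

lemma W_right: "[|x:carrier Y'; y:carrier Y; f:carrier C|]==>W (x, hright Y y f)=W (x, y)\<otimes>\<^bsub>C\<^esub> f"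
 by (rule W_eqI)
  (use Y.B.m_closed[of "W (x, y)" f] in
   \<open>auto simp: mult.assoc[symmetric] W_kernel kernel_eq Y.ip_right Y.right_closed Y.left_closed Y'.ip_closed Y.left_right\<close>)

text \<open>Multiplying second entries on the right by the inverse of the limit in
  \<open>W_lim\<close> normalises that limit to 1. These formal sums later provide preimages under
  the coordinate map.\<close>

lemma W_dense: "\<exists>s. (\<forall>n. s n:L)&Y.B.nv.lim_to (%n. lsum C W (s n)) \<one>\<^bsub>C\<^esub>"
proof -
 obtain w where w: "Y.B.nv.lim_to (%n. lsum C W (rep e1 n)) w" "!!t. t:topspace T==>w t\<noteq>0"
  using W_lim by blast
 have rL: "rep e1 n:L" for n using qm.rep_in e1_closed by (simp add: Q_simps(1))
 have wc: "w:carrier C" using Y.B.nv.lim_toD[OF w(1)] by blast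
 define g where "g=(\<lambda>t\<in>topspace T. inverse (w t))"
 have "continuous_map T euclidean (%t. inverse (w t))"
  using wc w(2) by (intro continuous_map_inverse_complex) (auto simp: cfun_carrier)
 then have g: "g:carrier C" unfolding g_def by (rule cfun_restrict_closed)
 define m :: "('z\<times>'y) list=>_" where "m=map (%(x, y). (x, hright Y y g))"
 have mL: "m l:L" if "l:L" for l
  using that g by (induction l rule: pair_lists_induct) (auto simp: m_def Y.right_closed)
 have "lsum C W (m l)=lsum C W l\<otimes>\<^bsub>C\<^esub> g" if "l:L" for l
 proof -
  have "W (case p of (x, y)=>(x, hright Y y g))=W p\<otimes>\<^bsub>C\<^esub> g" if "p:P" for p
   using that g W_right by (auto simp del: cfun_alg_simps)
  then show ?thesis
   using Y.B.lsum_mult_right[OF g, of l W] list_mem[OF \<open>l \<in> L\<close>] lsum_cong[of l "%p. W (case p of (x, y)=>(x, hright Y y g))" "%p. W p\<otimes>\<^bsub>C\<^esub> g" C]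
   by (simp only: m_def lsum_map W_closed)
 qed
 then have "(%n. lsum C W (m (rep e1 n)))=(%n. lsum C W (rep e1 n)\<otimes>\<^bsub>C\<^esub> g)" using rL by blast
 moreover have "w\<otimes>\<^bsub>C\<^esub> g=\<one>\<^bsub>C\<^esub>" by (simp add: g_def w(2) cong: restrict_cong)
 ultimately have "Y.B.nv.lim_to (%n. lsum C W (m (rep e1 n))) \<one>\<^bsub>C\<^esub>"
  using Y.B.lim_mult[OF w(1) Y.B.nv.lim_to_const[OF g]] by (simp only:)
 then show ?thesis using mL[OF rL] by (intro exI[of _ "%n. m (rep e1 n)"] conjI allI)
qed

end

section \<open>Coordinates in a C*-algebra\<close>

lemma id_corr_simps [simp]:
 "carrier (id_corr A)=carrier A" "x\<oplus>\<^bsub>id_corr A\<^esub> y=x\<oplus>\<^bsub>A\<^esub> y" "\<zero>\<^bsub>id_corr A\<^esub>=\<zero>\<^bsub>A\<^esub>"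
 "c\<odot>\<^bsub>id_corr A\<^esub> x=c\<odot>\<^bsub>A\<^esub> x" "hleft (id_corr A) a x=a\<otimes>\<^bsub>A\<^esub> x" "hright (id_corr A) x a=x\<otimes>\<^bsub>A\<^esub> a"
 "hip (id_corr A) x y=adj A x\<otimes>\<^bsub>A\<^esub> y"
 by (simp_all add: id_corr_def)

lemma lsum_id_corr [simp]: "lsum (id_corr A) f l=lsum A f l"
 by (induction l) simp_all

lemma (in cstar_algebra) A_abelian: "abelian_group A"
 using ring_A by (rule ring.is_abelian_group)

lemma
 fixes A :: "'a cstar" (structure)
 assumes "cstar_algebra A"
 shows lim_to_id_corr: "cnormed.lim_to (id_corr A) (hnorm A (id_corr A))=cnormed.lim_to A (cnorm A)"
  and finsum_id_corr: "(!!i. i < (n::nat)==>f i:carrier A)==>finsum (id_corr A) f {..<n}=finsum A f {..<n}"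
proof -
 interpret cstar_algebra A by fact
 interpret ID: correspondence A A "id_corr A"
  by (rule id_corr_correspondence[OF cstar_algebra_axioms])
 have *: "hnorm A (id_corr A) (x\<ominus>\<^bsub>id_corr A\<^esub> y)=cnorm A (x\<ominus>y)" if "x:carrier A" "y:carrier A" for x y
 proof -
  have "x\<ominus>\<^bsub>id_corr A\<^esub> y=x\<ominus>y" using that ID.Xn.diff_conv[of x y] by (simp add: nv.diff_conv)
  then show ?thesis using that cstar_identity[of "x\<ominus>y"] cnorm_nonneg[of "x\<ominus>y"] by (simp add: hnorm_def)
 qed
 show "ID.Xn.lim_to=nv.lim_to"
  by (intro ext) (auto simp: ID.Xn.lim_to_def nv.lim_to_def *)
 show "finsum (id_corr A) f {..<n}=finsum A f {..<n}" if "!!i. i < (n::nat)==>f i:carrier A"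
  using ID.Xn.finsum_hom[of "{..<n}" "%x. x" A f] A_abelian that by auto
qed

lemma (in cstar_algebra) lsum_prod:
 assumes h: "!!p p'. [|p:set l; p':set m|]==>h (g p p')=\<alpha> p\<otimes>\<beta> p'"
  and c: "!!p. p:set l==>\<alpha> p:carrier A" "!!p. p:set m==>\<beta> p:carrier A"
 shows "lsum A h [g p p'. p \<leftarrow> l, p' \<leftarrow> m]=lsum A \<alpha> l\<otimes>lsum A \<beta> m"
proof -
 have "lsum A h [g p p'. p \<leftarrow> l, p' \<leftarrow> m]=lsum A (lsum A h) (map (%p. map (g p) m) l)"
  using c by (intro nv.lsum_concat) (auto simp: h)
 also have "...=lsum A (%p. \<alpha> p\<otimes>lsum A \<beta> m) l"
  unfolding lsum_map using c by (intro lsum_cong) (auto simp: lsum_map lsum_mult_left h cong: lsum_cong)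
 also have "...=lsum A \<alpha> l\<otimes>lsum A \<beta> m"
  using c by (intro lsum_mult_right[symmetric]) auto
 finally show ?thesis .
qed

lemma mor1_comp_simps [simp]: "alg (mor1_comp T M N)=bal_tensor T M N"
 "lmap (mor1_comp T M N) f=bal_elem T M N (lmap M f) \<one>\<^bsub>alg N\<^esub>"
 "rmap (mor1_comp T M N) g=bal_elem T M N \<one>\<^bsub>alg M\<^esub> (rmap N g)"
 by (simp_all add: mor1_comp_def)

lemma mor1_id_simps [simp]: "alg (mor1_id T)=cfun_alg T" "lmap (mor1_id T) f=f" "rmap (mor1_id T) f=f"
 by (simp_all add: mor1_id_def)

lemma (in bal_alg) be_finsum_left:
 assumes "!!i. i < (n::nat)==>f i:carrier (alg U)" "b:carrier (alg V)"
 shows "be (finsum (alg U) f {..<n}) b=finsum BT (%i. be (f i) b) {..<n}"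
proof (rule A.nv.finsum_hom)
 have "be (0\<odot>\<^bsub>alg U\<^esub> \<zero>\<^bsub>alg U\<^esub>) b=0\<odot>\<^bsub>BT\<^esub> be \<zero>\<^bsub>alg U\<^esub> b"
  by (rule be_smult_left) (simp_all add: assms)
 then show "be \<zero>\<^bsub>alg U\<^esub> b=\<zero>\<^bsub>BT\<^esub>" using assms(2) by simp
 show "abelian_group BT" by (rule BT.A_abelian)
 show "be (x\<oplus>\<^bsub>alg U\<^esub> y) b=be x b\<oplus>\<^bsub>BT\<^esub> be y b" if "x:carrier (alg U)" "y:carrier (alg U)" for x y
  using be_add_left that assms(2) .
qed (use assms in simp_all)

text \<open>The external products and the last relative product have coordinates in the algebra
  itself; only the product with \<open>Y'\<close> in between needs coordinates in a genuine
  module.\<close>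

locale alg_realization = realization C "id_corr C" k X1 Y1 lf rg tau n
 for C :: "'c cstar" and k :: "'x\<times>'y=>'x\<times>'y=>'c" and X1 :: "('a, 'b, 'x) corr" and Y1 :: "('a', 'b', 'y) corr"
  and lf :: "'l=>nat=>('x\<times>'y) list=>('x\<times>'y) list"
  and rg :: "'c=>nat=>('x\<times>'y) list=>('x\<times>'y) list"
  and tau :: "nat=>'x\<times>'y=>'c" and n :: nat
begin

lemmas Z_lim = lim_to_id_corr[OF B.cstar_algebra_axioms]
lemmas alg_R_closed [simp] = R_closed[unfolded id_corr_simps]
lemmas alg_hip = hip_W[unfolded id_corr_simps]
lemmas alg_smult = smult_W[unfolded id_corr_simps]
lemmas alg_lim = R_lim[unfolded lsum_id_corr Z_lim]
lemmas alg_seq = R_seq[unfolded lsum_id_corr Z_lim]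

lemma alg_tau: "[|x:carrier X1; y:carrier Y1; i < n|]==>tau i (x, y):carrier C"
 using tau_closed by simp

lemma alg_map:
 assumes "z:carrier W" and c: "c:carrier C"
  and "!!x y. [|x:carrier X1; y:carrier Y1|]==>m (x, y):carrier X1\<times>carrier Y1"
  and "!!x y i. [|x:carrier X1; y:carrier Y1; i < n|]==>tau i (m (x, y))=c\<otimes>\<^bsub>C\<^esub> tau i (x, y)"
 shows "q (%j. map m (rep z j)):carrier W" "!!i. i < n==>R (q (%j. map m (rep z j))) i=c\<otimes>\<^bsub>C\<^esub> R z i"
proof -
 have z: "c\<otimes>\<^bsub>C\<^esub> \<zero>\<^bsub>id_corr C\<^esub>=\<zero>\<^bsub>id_corr C\<^esub>"
  and a: "!!x y. [|x:carrier (id_corr C); y:carrier (id_corr C)|]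
==>c\<otimes>\<^bsub>C\<^esub> (x\<oplus>\<^bsub>id_corr C\<^esub> y)=c\<otimes>\<^bsub>C\<^esub> x\<oplus>\<^bsub>id_corr C\<^esub> c\<otimes>\<^bsub>C\<^esub> y"
  using c by (simp_all add: B.A_r_distr)
 have l: "!!s x. Xn.lim_to s x==>Xn.lim_to (%j. c\<otimes>\<^bsub>C\<^esub> s j) (c\<otimes>\<^bsub>C\<^esub> x)"
  unfolding Z_lim using B.lim_mult[OF B.nv.lim_to_const[OF c]] .
 note mw = map_W[of z m "%x. c\<otimes>\<^bsub>C\<^esub> x", OF assms(1,3,4) z a l]
 show "q (%j. map m (rep z j)):carrier W" by (rule mw(1))
 show "R (q (%j. map m (rep z j))) i=c\<otimes>\<^bsub>C\<^esub> R z i" if "i < n" for i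
  by (rule mw(2)) (assumption | rule that)+
qed

lemma alg_relation:
 assumes z: "z:carrier W" and i: "i < n" and c: "!!j. j < n==>c j:carrier C"
  and tau: "!!x y. [|x:carrier X1; y:carrier Y1|]==>tau i (x, y)=finsum C (%j. c j\<otimes>\<^bsub>C\<^esub> tau j (x, y)) {..<n}"
 shows "R z i=finsum C (%j. c j\<otimes>\<^bsub>C\<^esub> R z j) {..<n}"
proof -
 have "R z i=finsum (id_corr C) (%j. c j\<otimes>\<^bsub>C\<^esub> R z j) {..<n}"
 proof (rule relation_W[OF z i, where \<Lambda> = "%j x. c j\<otimes>\<^bsub>C\<^esub> x"])
  show "tau i (x, y)=finsum (id_corr C) (%j. c j\<otimes>\<^bsub>C\<^esub> tau j (x, y)) {..<n}" if "x:carrier X1" "y:carrier Y1" for x y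
   using tau[OF that] c alg_tau[OF that] by (simp add: finsum_id_corr[OF B.cstar_algebra_axioms])
  show "Xn.lim_to (%m. c j\<otimes>\<^bsub>C\<^esub> s m) (c j\<otimes>\<^bsub>C\<^esub> x)" if "Xn.lim_to s x" "j < n" for s x j
   using B.lim_mult[OF B.nv.lim_to_const[OF c[OF that(2)]]] that(1) unfolding Z_lim .
 qed (use c in "simp_all add: B.A_r_distr")
 then show ?thesis using c z by (simp add: finsum_id_corr[OF B.cstar_algebra_axioms])
qed

text \<open>An element of a balanced tensor product acts through formal sums that approximate it,
  simultaneously with those representing \<open>w\<close>. A coordinate of the resulting double sum
  is a product of two convergent factors.\<close>

lemma alg_left:
 assumes w: "w:carrier W" and lim: "B.nv.lim_to (%m. lsum C \<alpha> (lu m)) e"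
  and \<alpha>: "!!m p. p:set (lu m)==>\<alpha> p:carrier C"
  and g: "!!m p x y. [|p:set (lu m); x:carrier X1; y:carrier Y1|]==>g p (x, y):carrier X1\<times>carrier Y1"
  and tau: "!!m p x y i. [|p:set (lu m); x:carrier X1; y:carrier Y1; i < n|]==>tau i (g p (x, y))=\<alpha> p\<otimes>\<^bsub>C\<^esub> tau i (x, y)"
 shows "q (%m. [g p p'. p \<leftarrow> lu m, p' \<leftarrow> rep w m]):carrier W"
  "!!i. i < n==>R (q (%m. [g p p'. p \<leftarrow> lu m, p' \<leftarrow> rep w m])) i=e\<otimes>\<^bsub>C\<^esub> R w i"
proof -
 let ?l = "%m. [g p p'. p \<leftarrow> lu m, p' \<leftarrow> rep w m]"
 note rw = carrier_rep(3)[OF w]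
 have lL: "?l m:L" for m
 proof -
  have "g p p':carrier X1\<times>carrier Y1" if "p:set (lu m)" "p':set (rep w m)" for p p'
   using g[OF that(1), of "fst p'" "snd p'"] pair_listsD[OF rw that(2)] by simp
  then show ?thesis by (auto simp: pair_lists_def in_lists_conv_set)
 qed
 have prod: "lsum C (tau i) (?l m)=lsum C \<alpha> (lu m)\<otimes>\<^bsub>C\<^esub> lsum C (tau i) (rep w m)" if i: "i < n" for i m
 proof (rule B.lsum_prod)
  show "tau i (g p p')=\<alpha> p\<otimes>\<^bsub>C\<^esub> tau i p'" if "p:set (lu m)" "p':set (rep w m)" for p p'
   using tau[OF that(1), of "fst p'" "snd p'" i] i pair_listsD[OF rw that(2)] by simp
  show "tau i p':carrier C" if "p':set (rep w m)" for p'
   using tau_mem[OF rw that i] by simp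
 qed (rule \<alpha>)
 have *: "B.nv.lim_to (%m. lsum C (tau i) (?l m)) (e\<otimes>\<^bsub>C\<^esub> R w i)" if "i < n" for i
  using B.lim_mult[OF lim alg_lim[OF w that]] by (simp only: prod[OF that])
 show "q ?l:carrier W" "!!i. i < n==>R (q ?l) i=e\<otimes>\<^bsub>C\<^esub> R w i"
  using alg_seq[OF lL *] by blast+
qed

end

lemma alg_realizationI:
 fixes tau :: "nat=>'x\<times>'y=>'c"
 assumes "cstar_algebra C" "!!x c. x:carrier X1==>c\<odot>\<^bsub>X1\<^esub> x:carrier X1"
  "!!x y i. [|x:carrier X1; y:carrier Y1; i < n|]==>tau i (x, y):carrier C"
  "!!x y i c. [|x:carrier X1; y:carrier Y1; i < n|]==>tau i (c\<odot>\<^bsub>X1\<^esub> x, y)=c\<odot>\<^bsub>C\<^esub> tau i (x, y)"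
  "!!x y x' y'. [|x:carrier X1; y:carrier Y1; x':carrier X1; y':carrier Y1|]
==>k (x, y) (x', y')=finsum C (%i. adj C (tau i (x, y))\<otimes>\<^bsub>C\<^esub> tau i (x', y')) {..<n}"
 shows "alg_realization C k X1 Y1 tau n"
 using assms id_corr_correspondence[OF assms(1)]
 by (intro alg_realization.intro realization.intro realization_axioms.intro)
  (simp_all add: correspondence_def)

lemma mor1D:
 assumes "mor1 S T M"
 shows "cstar_algebra (alg M)" "unital_star_hom (cfun_alg S) (alg M) (lmap M)" "unital_star_hom (cfun_alg T) (alg M) (rmap M)"
  and "f:carrier (cfun_alg S)==>lmap M f:center (alg M)" "g:carrier (cfun_alg T)==>rmap M g:center (alg M)"
 using assms unfolding mor1_def image_subset_iff by blast+

lemma (in hilbert_module) hright_finsum: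
 assumes y: "y:carrier X" and f: "!!i. i < (m::nat)==>f i:carrier B"
 shows "hright X y (finsum B f {..<m})=finsum X (%i. hright X y (f i)) {..<m}"
proof (rule B.nv.finsum_hom)
 have "hright X y (0\<odot>\<^bsub>B\<^esub> \<zero>\<^bsub>B\<^esub>)=0\<odot>\<^bsub>X\<^esub> hright X y \<zero>\<^bsub>B\<^esub>"
  by (rule right_smult') (use y in simp_all)
 then show "hright X y \<zero>\<^bsub>B\<^esub>=\<zero>\<^bsub>X\<^esub>" using y right_closed by simp
 show "abelian_group X" by (rule X.abelian_group_axioms)
qed (use y f right_add' right_closed in simp_all)

lemma cfun_finsum:
 assumes "compact_space T"
 shows "[|!!i. i < (m::nat)==>f i:carrier (cfun_alg T); t:topspace T|]==>finsum (cfun_alg T) f {..<m} t=(\<Sum>i<m. f i t)"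
proof -
 interpret C: cstar_algebra "cfun_alg T" by (rule cstar_algebra_cfun[OF assms])
 show "[|!!i. i < (m::nat)==>f i:carrier (cfun_alg T); t:topspace T|]==>finsum (cfun_alg T) f {..<m} t=(\<Sum>i<m. f i t)"
 proof (induction m)
  case (Suc m)
  have "finsum (cfun_alg T) f {..<Suc m}=f m\<oplus>\<^bsub>cfun_alg T\<^esub> finsum (cfun_alg T) f {..<m}"
   unfolding lessThan_Suc by (rule abelian_monoid.finsum_insert[OF abelian_group.axioms(1)[OF C.A_abelian]]) (use Suc.prems in auto)
  moreover have "finsum (cfun_alg T) f {..<m} t=(\<Sum>i<m. f i t)" by (rule Suc.IH) (use Suc.prems in auto)
  ultimately show ?case using Suc.prems(2) by (simp add: add.commute)
 qed simp
qed

section \<open>The conjugate of a correspondence with a frame\<close>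

text \<open>\<open>twist\<close> is what remains of the 2-isomorphism between \<open>A\<close> and
  the product of the two generators; \<open>twisted_center\<close> provides it.\<close>

locale conjugation =
 fixes T :: "'t topology" and Phi Phiinv :: "'t=>'t"
  and A :: "('t, 't, 'm) one_mor" and N :: "('t, 't, 'n) one_mor"
  and Y :: "((('m, 't=>complex) bal, 'n) bal, 't=>complex, 'y) corr"
  and Y' :: "('t=>complex, (('m, 't=>complex) bal, 'n) bal, 'z) corr"
  and u v and X :: "('t=>complex, 't=>complex, 'x) corr" and xi :: "nat=>'x" and n :: nat
 assumes T: "compact_space T" and hom: "homeomorphic_maps T T Phi Phiinv"
  and A: "mor1 T T A" and N: "mor1 T T N"
  and Y: "mor2 T T (conj_mor1 T A N) (mor1_id T) Y" and Y': "mor2 T T (mor1_id T) (conj_mor1 T A N) Y'"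
  and iso: "iso3 (cfun_alg T) (cfun_alg T) (rel_tensor (cfun_alg T) Y' Y) (id_corr (cfun_alg T)) u v"
  and twist: "f:carrier (cfun_alg T)==>rmap A f=lmap A (\<lambda>t\<in>topspace T. f (Phiinv t))"
  and X: "mor2 T T (mor1_id T) (mor1_id T) X"
  and frame_closed: "i < n==>xi i:carrier X"
  and frame: "x:carrier X==>finsum X (%i. hright X (xi i) (hip X (xi i) x)) {..<n}=x"
begin

declare cfun_alg_simps [simp del]

abbreviation "C\<equiv>cfun_alg T"
abbreviation "I\<equiv>mor1_id T"
abbreviation "B1\<equiv>mor1_comp T A I"
abbreviation "D1\<equiv>bal_tensor T A I"
abbreviation "D\<equiv>bal_tensor T B1 N"
abbreviation "be1\<equiv>bal_elem T A I"
abbreviation "be2\<equiv>bal_elem T B1 N"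
abbreviation "tw f\<equiv>\<lambda>t\<in>topspace T. f (Phiinv t)"

sublocale C: cstar_algebra C by (rule cstar_algebra_cfun[OF T])
sublocale A: cstar_algebra "alg A" using A by (simp add: mor1_def)
sublocale N: cstar_algebra "alg N" using N by (simp add: mor1_def)
sublocale X: correspondence C C X using X by (simp add: mor2_def)

lemma X_sym: "[|f:carrier C; x:carrier X|]==>hleft X f x=hright X x f"
 using X by (simp add: mor2_def)

sublocale p1: bal_unit A T
proof (intro bal_unit.intro bal_pair.intro cstar_pair.intro bal_pair_axioms.intro bal_unit_axioms.intro)
 show "f:carrier C==>lmap I f:center (alg I)" for f
  by (simp add: center_def cfun_alg_simps mult.commute cong: restrict_cong)
 show "cstar_algebra (alg I)" using C.cstar_algebra_axioms by simp
qed (rule mor1D[OF A], assumption?)+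

sublocale q1: bal_alg A I T
 by (intro bal_alg.intro bal_alg_axioms.intro p1.bal_pair_axioms p1.cstar_algebra_BT)

sublocale Yc: correspondence D C Y using Y by (simp add: mor2_def)
sublocale Yc': correspondence C D Y' using Y' by (simp add: mor2_def)
sublocale pr: pairing T D Y Y' u v
 by (intro pairing.intro pairing_axioms.intro Yc.correspondence_axioms Yc'.correspondence_axioms T iso)

sublocale q2: bal_alg B1 N T
proof (intro bal_alg.intro bal_alg_axioms.intro bal_pair.intro cstar_pair.intro bal_pair_axioms.intro)
 show "f:carrier C==>rmap B1 f:center (alg B1)" for f
  using p1.be_rmap_center[of f] by simp
 show "f:carrier C==>lmap N f:center (alg N)" for f
  by (rule mor1D[OF N])
 show "cstar_algebra (alg B1)" using q1.BT.cstar_algebra_axioms by simp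
qed (rule N.cstar_algebra_axioms Yc.A.cstar_algebra_axioms)+

lemma tw_closed [simp]: "f:carrier C==>tw f:carrier C"
 using hom continuous_map_compose[of T T Phiinv euclidean f]
 by (auto simp: homeomorphic_maps_def cfun_carrier o_def)

lemma C_comm: "[|f:carrier C; g:carrier C|]==>f\<otimes>\<^bsub>C\<^esub> g=g\<otimes>\<^bsub>C\<^esub> f"
 by (simp add: cfun_alg_simps mult.commute cong: restrict_cong)

text \<open>The element \<open>1 \<otimes> f \<otimes> 1\<close> of the threefold product, through
  which the scalars of \<open>X\<close> act.\<close>

definition "rho f=be2 (be1 \<one>\<^bsub>alg A\<^esub> f) \<one>\<^bsub>alg N\<^esub>"

text \<open>Balancing moves the middle function to the right map of \<open>A\<close>, and
  \<open>twist\<close> turns this into the left map at \<open>tw f\<close>. Here the homeomorphism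
  enters the computation.\<close>

lemma rho_lmap: "f:carrier C==>rho f=lmap (conj_mor1 T A N) (tw f)"
 using p1.be_rmap[of f] twist[of f] by (simp add: rho_def)

lemma be1_closed [simp]: "[|a:carrier (alg A); f:carrier C|]==>be1 a f:carrier D1"
 using p1.be_closed by simp

lemma rho_closed [simp]: "f:carrier C==>rho f:carrier D"
 by (simp add: rho_def)

lemma rho_left: "[|f:carrier C; y:carrier Y|]==>hleft Y (rho f) y=hright Y y (tw f)"
 using Y by (simp add: rho_lmap mor2_def)

lemma rho_right: "[|f:carrier C; y:carrier Y'|]==>hright Y' y (rho f)=hleft Y' (tw f) y"
 using Y' by (simp add: rho_lmap mor2_def)

definition "tau1 i=(%(a, x). be1 a (hip X (xi i) x))"

abbreviation "W1\<equiv>ext_tensor T A I (id_corr (alg A)) X"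

text \<open>The Parseval identity, obtained by pairing the reconstruction formula with
  \<open>x\<close>.\<close>

lemma frame_ip: assumes "x:carrier X" "y:carrier X"
 shows "finsum C (%i. hip X x (xi i)\<otimes>\<^bsub>C\<^esub> hip X (xi i) y) {..<n}=hip X x y"
proof -
 have "hip X x (finsum X (%i. hright X (xi i) (hip X (xi i) y)) {..<n})
   =finsum C (%i. hip X x (hright X (xi i) (hip X (xi i) y))) {..<n}"
  using assms frame_closed C.A_abelian
  by (intro X.Xn.finsum_hom) (auto simp: X.ip_add X.right_closed X.ip_closed)
 also have "...=finsum C (%i. hip X x (xi i)\<otimes>\<^bsub>C\<^esub> hip X (xi i) y) {..<n}"
  using assms frame_closed by (intro C.nv.fs_cong) (auto simp: X.ip_right X.ip_closed)
 finally show ?thesis using frame assms by simp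
qed

lemma be1_finsum:
 assumes b: "b:carrier (alg A)" and f: "!!i. i < (m::nat)==>f i:carrier C"
 shows "be1 b (finsum C f {..<m})=finsum D1 (%i. be1 b (f i)) {..<m}"
proof (rule C.nv.finsum_hom)
 have "be1 b (0\<odot>\<^bsub>C\<^esub> \<zero>\<^bsub>C\<^esub>)=0\<odot>\<^bsub>D1\<^esub> be1 b \<zero>\<^bsub>C\<^esub>"
  using p1.be_smult_right[of b "\<zero>\<^bsub>C\<^esub>" 0] b by (simp del: C.nv.sm_0 C.nv.sm_zero q1.BT.nv.sm_0)
 then show "be1 b \<zero>\<^bsub>C\<^esub>=\<zero>\<^bsub>D1\<^esub>" using b by simp
 show "abelian_group D1" by (rule q1.BT.A_abelian)
 show "be1 b (x\<oplus>\<^bsub>C\<^esub> y)=be1 b x\<oplus>\<^bsub>D1\<^esub> be1 b y" if "x:carrier C" "y:carrier C" for x y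
  using p1.be_add_right[OF b] that by simp
qed (use b f in simp_all)

text \<open>Inserting the Parseval identity in the second factor splits the kernel into a sum over
  the frame, the shape that a realization needs.\<close>

lemma ext1_kernel:
 assumes "a:carrier (alg A)" "a':carrier (alg A)" "x:carrier X" "x':carrier X"
 shows "ext_kernel T A I (id_corr (alg A)) X (a, x) (a', x')
  =finsum D1 (%i. adj D1 (tau1 i (a, x))\<otimes>\<^bsub>D1\<^esub> tau1 i (a', x')) {..<n}"
proof -
 let ?b = "adj (alg A) a\<otimes>\<^bsub>alg A\<^esub> a'"
 have b: "?b:carrier (alg A)" using assms A.adj_closed by simp
 have "be1 ?b (hip X x x')=be1 ?b (finsum C (%i. hip X x (xi i)\<otimes>\<^bsub>C\<^esub> hip X (xi i) x') {..<n})"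
  by (simp only: frame_ip assms)
 also have "...=finsum D1 (%i. be1 ?b (hip X x (xi i)\<otimes>\<^bsub>C\<^esub> hip X (xi i) x')) {..<n}"
  using b assms frame_closed by (simp add: be1_finsum X.ip_closed)
 also have "...=finsum D1 (%i. adj D1 (tau1 i (a, x))\<otimes>\<^bsub>D1\<^esub> tau1 i (a', x')) {..<n}"
  using assms frame_closed
  by (intro q1.BT.nv.fs_cong)
   (auto simp: tau1_def q1.be_adj[simplified] p1.be_mult[simplified] X.ip_closed X.ip_adj A.adj_closed C.adj_closed q1.BT.adj_closed)
 finally show ?thesis by (simp add: ext_kernel_def)
qed

sublocale s1: alg_realization D1 "ext_kernel T A I (id_corr (alg A)) X" "id_corr (alg A)" X
 "%u n l. [(hleft (id_corr (alg A)) a x, hleft X b y). (a, b) \<leftarrow> bal_rep u n, (x, y) \<leftarrow> l]"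
 "%u n l. [(hright (id_corr (alg A)) x c, hright X y d). (x, y) \<leftarrow> l, (c, d) \<leftarrow> bal_rep u n]"
 tau1 n
proof (rule alg_realizationI)
 show "tau1 i (c\<odot>\<^bsub>id_corr (alg A)\<^esub> x, y)=c\<odot>\<^bsub>D1\<^esub> tau1 i (x, y)"
  if "x:carrier (id_corr (alg A))" "y:carrier X" "i < n" for x y i c
  using that frame_closed p1.be_smult_left[of x "hip X (xi i) y" c] by (simp add: tau1_def X.ip_closed)
qed (use frame_closed ext1_kernel q1.BT.cstar_algebra_axioms in "auto simp: tau1_def X.ip_closed")

lemma W1_eq: "s1.W=W1"
 by (simp only: ext_tensor_def)

abbreviation "R1\<equiv>s1.R"

lemmas R1_closed [simp] = s1.alg_R_closed[unfolded W1_eq]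

lemma W1_left: assumes d: "d:carrier D1" and w: "w:carrier W1"
 shows "hleft W1 d w:carrier W1" "!!i. i < n==>R1 (hleft W1 d w) i=d\<otimes>\<^bsub>D1\<^esub> R1 w i"
proof -
 define g where "g=(%(a, b) (x, y). (hleft (id_corr (alg A)) a x, hleft X b y))"
 have eq: "hleft W1 d w=s1.q (%m. [g p p'. p \<leftarrow> bal_rep d m, p' \<leftarrow> rep w m])"
  unfolding s1.W_simps(4)[unfolded W1_eq] by (simp add: g_def case_prod_unfold)
 have mem: "fst p:carrier (alg A)&snd p:carrier C" if "p:set (bal_rep d m)" for p m
  using pair_listsD[OF q1.bal_rep(1)[OF d] that] by simp
 have tau: "tau1 i (g p (x, y))=(case p of (a, b)=>be1 a b)\<otimes>\<^bsub>D1\<^esub> tau1 i (x, y)"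
  if "p:set (bal_rep d m)" "x:carrier (id_corr (alg A))" "y:carrier X" "i < n" for i p m x y
  using that frame_closed mem[OF that(1)] C_comm[of "hip X (xi i) y" "snd p"] p1.be_mult[of "fst p" "snd p" x "hip X (xi i) y"]
  by (simp add: g_def tau1_def X_sym X.ip_right X.ip_closed case_prod_unfold)
 have c: "(case p of (a, b)=>be1 a b):carrier D1" if "p:set (bal_rep d m)" for p m
  using mem[OF that] by (simp add: case_prod_unfold)
 have gc: "g p (x, y):carrier (id_corr (alg A))\<times>carrier X"
  if "p:set (bal_rep d m)" "x:carrier (id_corr (alg A))" "y:carrier X" for p m x y
  using mem[OF that(1)] that by (simp add: g_def case_prod_unfold X.left_closed)
 note l = s1.alg_left[OF w [folded W1_eq] q1.bal_rep(2)[OF d] c gc tau, folded eq]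
 show "hleft W1 d w:carrier W1" using l(1) unfolding W1_eq .
 show "R1 (hleft W1 d w) i=d\<otimes>\<^bsub>D1\<^esub> R1 w i" if "i < n" for i
  by (rule l(2)) (assumption | rule that)+
qed

abbreviation "mu i j\<equiv>hip X (xi i) (xi j)"

lemma mu_closed [simp]: "[|i < n; j < n|]==>mu i j:carrier C"
 by (simp add: X.ip_closed frame_closed)

text \<open>A frame need not be a basis, so its coordinates are constrained: the Gram matrix
  \<open>mu\<close> fixes them. The relation is carried through all four stages because it is what
  lets \<open>frame_J\<close> recover the coordinates.\<close>

lemma R1_relation: assumes w: "w:carrier W1" and i: "i < n"
 shows "R1 w i=finsum D1 (%j. be1 \<one>\<^bsub>alg A\<^esub> (mu i j)\<otimes>\<^bsub>D1\<^esub> R1 w j) {..<n}"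
proof (rule s1.alg_relation[OF w [folded W1_eq] i])
 show "tau1 i (a, x)=finsum D1 (%j. be1 \<one>\<^bsub>alg A\<^esub> (mu i j)\<otimes>\<^bsub>D1\<^esub> tau1 j (a, x)) {..<n}"
  if "a:carrier (id_corr (alg A))" "x:carrier X" for a x
 proof -
  have a: "a:carrier (alg A)" using that by simp
  have "be1 a (hip X (xi i) x)=be1 a (finsum C (%j. mu i j\<otimes>\<^bsub>C\<^esub> hip X (xi j) x) {..<n})"
   using frame_ip[OF frame_closed[OF i] that(2)] by simp
  also have "...=finsum D1 (%j. be1 a (mu i j\<otimes>\<^bsub>C\<^esub> hip X (xi j) x)) {..<n}"
   using be1_finsum[OF a] i that frame_closed by (simp add: X.ip_closed)
  also have "...=finsum D1 (%j. be1 \<one>\<^bsub>alg A\<^esub> (mu i j)\<otimes>\<^bsub>D1\<^esub> be1 a (hip X (xi j) x)) {..<n}"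
   using a i that frame_closed by (intro q1.BT.nv.fs_cong) (auto simp: p1.be_mult[simplified] X.ip_closed)
  finally show ?thesis by (simp add: tau1_def)
 qed
qed (use i in simp)

end

context conjugation
begin

declare cfun_alg_simps [simp del]

abbreviation "W2\<equiv>ext_tensor T B1 N W1 (id_corr (alg N))"

definition "tau2 i=(%(w, b). be2 (R1 w i) b)"

lemma ext2_kernel:
 assumes "w:carrier W1" "w':carrier W1" "b:carrier (alg N)" "b':carrier (alg N)"
 shows "ext_kernel T B1 N W1 (id_corr (alg N)) (w, b) (w', b')
  =finsum D (%i. adj D (tau2 i (w, b))\<otimes>\<^bsub>D\<^esub> tau2 i (w', b')) {..<n}"
proof -
 let ?c = "adj (alg N) b\<otimes>\<^bsub>alg N\<^esub> b'"
 have "be2 (hip W1 w w') ?c=be2 (finsum D1 (%i. adj D1 (R1 w i)\<otimes>\<^bsub>D1\<^esub> R1 w' i) {..<n}) ?c"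
  using s1.alg_hip[unfolded W1_eq] assms by simp
 also have "...=finsum D (%i. be2 (adj D1 (R1 w i)\<otimes>\<^bsub>D1\<^esub> R1 w' i) ?c) {..<n}"
  using q2.be_finsum_left[of n "%i. adj D1 (R1 w i)\<otimes>\<^bsub>D1\<^esub> R1 w' i" ?c] assms
  by (simp add: N.adj_closed q1.BT.adj_closed)
 also have "...=finsum D (%i. adj D (tau2 i (w, b))\<otimes>\<^bsub>D\<^esub> tau2 i (w', b')) {..<n}"
  using assms
  by (intro Yc.A.nv.fs_cong)
   (auto simp: tau2_def q2.be_adj[simplified] q2.be_mult[simplified] N.adj_closed q1.BT.adj_closed Yc.A.adj_closed)
 finally show ?thesis by (simp add: ext_kernel_def)
qed

sublocale s2: alg_realization D "ext_kernel T B1 N W1 (id_corr (alg N))" W1 "id_corr (alg N)"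
 "%u n l. [(hleft W1 a x, hleft (id_corr (alg N)) b y). (a, b) \<leftarrow> bal_rep u n, (x, y) \<leftarrow> l]"
 "%u n l. [(hright W1 x c, hright (id_corr (alg N)) y d). (x, y) \<leftarrow> l, (c, d) \<leftarrow> bal_rep u n]"
 tau2 n
proof (rule alg_realizationI)
 show "tau2 i (c\<odot>\<^bsub>W1\<^esub> x, y)=c\<odot>\<^bsub>D\<^esub> tau2 i (x, y)"
  if "x:carrier W1" "y:carrier (id_corr (alg N))" "i < n" for x y i c
  using that s1.alg_smult(2)[unfolded W1_eq] q2.be_smult_left[of "R1 x i" y c] by (simp add: tau2_def)
 show "c\<odot>\<^bsub>W1\<^esub> x:carrier W1" if "x:carrier W1" for x c
  using s1.alg_smult(1)[unfolded W1_eq] that .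
qed (use ext2_kernel Yc.A.cstar_algebra_axioms in "auto simp: tau2_def")

lemma W2_eq: "s2.W=W2"
 by (simp only: ext_tensor_def mor1_comp_simps)

abbreviation "R2\<equiv>s2.R"

lemmas R2_closed [simp] = s2.alg_R_closed[unfolded W2_eq]

lemma W2_left: assumes d: "d:carrier D" and w: "w:carrier W2"
 shows "hleft W2 d w:carrier W2" "!!i. i < n==>R2 (hleft W2 d w) i=d\<otimes>\<^bsub>D\<^esub> R2 w i"
proof -
 define g where "g=(%(a, b) (x, y). (hleft W1 a x, hleft (id_corr (alg N)) b y))"
 have eq: "hleft W2 d w=s2.q (%m. [g p p'. p \<leftarrow> bal_rep d m, p' \<leftarrow> rep w m])"
  unfolding s2.W_simps(4)[unfolded W2_eq] by (simp add: g_def case_prod_unfold)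
 have mem: "fst p:carrier D1&snd p:carrier (alg N)" if "p:set (bal_rep d m)" for p m
  using pair_listsD[OF q2.bal_rep(1)[OF d] that] by simp
 have tau: "tau2 i (g p (x, y))=(case p of (a, b)=>be2 a b)\<otimes>\<^bsub>D\<^esub> tau2 i (x, y)"
  if "p:set (bal_rep d m)" "x:carrier W1" "y:carrier (id_corr (alg N))" "i < n" for i p m x y
  using that mem[OF that(1)] q2.be_mult[of "fst p" "snd p" "R1 x i" y] W1_left
  by (simp add: g_def tau2_def case_prod_unfold)
 have c: "(case p of (a, b)=>be2 a b):carrier D" if "p:set (bal_rep d m)" for p m
  using mem[OF that] by (simp add: case_prod_unfold)
 have gc: "g p (x, y):carrier W1\<times>carrier (id_corr (alg N))"
  if "p:set (bal_rep d m)" "x:carrier W1" "y:carrier (id_corr (alg N))" for p m x y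
  using mem[OF that(1)] that W1_left(1) by (simp add: g_def case_prod_unfold)
 note l = s2.alg_left[OF w [folded W2_eq] q2.bal_rep(2)[OF d] c gc tau, folded eq]
 show "hleft W2 d w:carrier W2" using l(1) unfolding W2_eq .
 show "R2 (hleft W2 d w) i=d\<otimes>\<^bsub>D\<^esub> R2 w i" if "i < n" for i
  by (rule l(2)) (assumption | rule that)+
qed

lemma R2_relation: assumes w: "w:carrier W2" and i: "i < n"
 shows "R2 w i=finsum D (%j. rho (mu i j)\<otimes>\<^bsub>D\<^esub> R2 w j) {..<n}"
proof (rule s2.alg_relation[OF w [folded W2_eq] i])
 show "tau2 i (x, b)=finsum D (%j. rho (mu i j)\<otimes>\<^bsub>D\<^esub> tau2 j (x, b)) {..<n}"
  if "x:carrier W1" "b:carrier (id_corr (alg N))" for x b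
 proof -
  have b: "b:carrier (alg N)" using that by simp
  have "be2 (R1 x i) b=be2 (finsum D1 (%j. be1 \<one>\<^bsub>alg A\<^esub> (mu i j)\<otimes>\<^bsub>D1\<^esub> R1 x j) {..<n}) b"
   by (simp only: R1_relation[OF that(1) i, symmetric])
  also have "...=finsum D (%j. be2 (be1 \<one>\<^bsub>alg A\<^esub> (mu i j)\<otimes>\<^bsub>D1\<^esub> R1 x j) b) {..<n}"
   using q2.be_finsum_left[of n "%j. be1 \<one>\<^bsub>alg A\<^esub> (mu i j)\<otimes>\<^bsub>D1\<^esub> R1 x j" b] b i that by simp
  also have "...=finsum D (%j. rho (mu i j)\<otimes>\<^bsub>D\<^esub> be2 (R1 x j) b) {..<n}"
   using b i that by (intro Yc.A.nv.fs_cong) (auto simp: rho_def q2.be_mult[simplified])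
  finally show ?thesis by (simp add: tau2_def)
 qed
qed (use i in simp)

abbreviation "W3\<equiv>rel_tensor D Y' W2"

text \<open>At this stage the coordinates become vectors of \<open>Y'\<close>, on which the
  \<open>D\<close>-valued coordinates of \<open>W2\<close> act from the right.\<close>

definition "tau3 i=(%(y, q). hright Y' y (R2 q i))"

lemma rel3_kernel:
 assumes "y:carrier Y'" "y':carrier Y'" "w:carrier W2" "w':carrier W2"
 shows "rel_kernel Y' W2 (y, w) (y', w')=finsum D (%i. hip Y' (tau3 i (y, w)) (tau3 i (y', w'))) {..<n}"
proof -
 have "hip W2 w (hleft W2 (hip Y' y y') w')=finsum D (%i. adj D (R2 w i)\<otimes>\<^bsub>D\<^esub> R2 (hleft W2 (hip Y' y y') w') i) {..<n}"
  using assms W2_left(1) Yc'.ip_closed by (intro s2.alg_hip[unfolded W2_eq]) auto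
 also have "...=finsum D (%i. hip Y' (tau3 i (y, w)) (tau3 i (y', w'))) {..<n}"
  using assms
  by (intro Yc.A.nv.fs_cong)
   (auto simp: tau3_def W2_left Yc'.ip_closed Yc'.ip_right Yc'.ip_right_left Yc'.right_closed Yc.A.A_assoc Yc.A.adj_closed)
 finally show ?thesis by (simp add: rel_kernel_def)
qed

sublocale s3: realization D Y' "rel_kernel Y' W2" Y' W2
 "%a n. map (%(x, y). (hleft Y' a x, y))" "%c n. map (%(x, y). (x, hright W2 y c))" tau3 n
proof (intro realization.intro realization_axioms.intro Yc'.hilbert_module_axioms)
 show "tau3 i (c\<odot>\<^bsub>Y'\<^esub> x, y)=c\<odot>\<^bsub>Y'\<^esub> tau3 i (x, y)"
  if "x:carrier Y'" "y:carrier W2" "i < n" for x y i c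
  using that by (simp add: tau3_def Yc'.right_smult)
qed (use rel3_kernel in "auto simp: tau3_def Yc'.right_closed")

lemma W3_eq: "s3.W=W3"
 by (simp only: rel_tensor_def)

abbreviation "R3\<equiv>s3.R"

lemmas R3_closed [simp] = s3.R_closed[unfolded W3_eq]

text \<open>Continuity is inherited from the right action of \<open>rho f\<close>, with which this
  left action agrees.\<close>

lemma lim_left_tw: assumes "f:carrier C" "Yc'.Xn.lim_to s x"
 shows "Yc'.Xn.lim_to (%m. hleft Y' (tw f) (s m)) (hleft Y' (tw f) x)"
 using Yc'.lim_right[OF assms(2) rho_closed[OF assms(1)]] Yc'.Xn.lim_toD[OF assms(2)]
 by (simp add: rho_right[OF assms(1)])

lemma hleft_Y'_zero: "f:carrier C==>hleft Y' (tw f) \<zero>\<^bsub>Y'\<^esub>=\<zero>\<^bsub>Y'\<^esub>"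
 using rho_right[of f "\<zero>\<^bsub>Y'\<^esub>"] Yc'.right_smult[of "\<zero>\<^bsub>Y'\<^esub>" "rho f" 0] Yc'.right_closed[of "\<zero>\<^bsub>Y'\<^esub>" "rho f"] by simp

lemma R3_relation: assumes w: "w:carrier W3" and i: "i < n"
 shows "R3 w i=finsum Y' (%j. hleft Y' (tw (mu i j)) (R3 w j)) {..<n}"
proof (rule s3.relation_W[OF w [folded W3_eq] i, where \<Lambda> = "%j. hleft Y' (tw (mu i j))"])
 show "tau3 i (y, q)=finsum Y' (%j. hleft Y' (tw (mu i j)) (tau3 j (y, q))) {..<n}"
  if "y:carrier Y'" "q:carrier W2" for y q
 proof -
  have "hright Y' y (R2 q i)=hright Y' y (finsum D (%j. rho (mu i j)\<otimes>\<^bsub>D\<^esub> R2 q j) {..<n})"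
   by (simp only: R2_relation[OF that(2) i, symmetric])
  also have "...=finsum Y' (%j. hright Y' y (rho (mu i j)\<otimes>\<^bsub>D\<^esub> R2 q j)) {..<n}"
   using that i by (intro Yc'.hright_finsum) auto
  also have "...=finsum Y' (%j. hleft Y' (tw (mu i j)) (hright Y' y (R2 q j))) {..<n}"
   using that i
   by (intro Yc'.Xn.fs_cong) (auto simp: Yc'.right_mult rho_right Yc'.left_right Yc'.left_closed Yc'.right_closed)
  finally show ?thesis by (simp add: tau3_def)
 qed
qed (use i lim_left_tw hleft_Y'_zero in "simp_all add: Yc'.left_closed Yc'.left_add")

lemma W3_map:
 assumes f: "f:carrier C" and z: "z:carrier W3"
  and m: "!!x y. [|x:carrier Y'; y:carrier W2|]==>m (x, y):carrier Y'\<times>carrier W2"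
   "!!x y i. [|x:carrier Y'; y:carrier W2; i < n|]==>tau3 i (m (x, y))=hleft Y' (tw f) (tau3 i (x, y))"
 shows "s3.q (%j. map m (rep z j)):carrier W3"
  "!!i. i < n==>R3 (s3.q (%j. map m (rep z j))) i=hleft Y' (tw f) (R3 z i)"
proof -
 have "s3.q (%j. map m (rep z j)):carrier s3.W&(\<forall>i<n. R3 (s3.q (%j. map m (rep z j))) i=hleft Y' (tw f) (R3 z i))"
  using s3.map_W[OF z [folded W3_eq] m hleft_Y'_zero[OF f] Yc'.left_add[OF tw_closed[OF f]] lim_left_tw[OF f]] by blast
 then show "s3.q (%j. map m (rep z j)):carrier W3"
  "!!i. i < n==>R3 (s3.q (%j. map m (rep z j))) i=hleft Y' (tw f) (R3 z i)"
  unfolding W3_eq by blast+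
qed

text \<open>Stated for \<open>tw f\<close>, the form in which \<open>rho_right\<close> controls left
  actions; by \<open>tw_un\<close> every function has it.\<close>

lemma W3_left: assumes f: "f:carrier C" and z: "z:carrier W3"
 shows "hleft W3 (tw f) z:carrier W3" "!!i. i < n==>R3 (hleft W3 (tw f) z) i=hleft Y' (tw f) (R3 z i)"
proof -
 have eq: "hleft W3 (tw f) z=s3.q (%j. map (%(x, y). (hleft Y' (tw f) x, y)) (rep z j))"
  by (rule s3.W_simps(4)[unfolded W3_eq])
 show "hleft W3 (tw f) z:carrier W3" "!!i. i < n==>R3 (hleft W3 (tw f) z) i=hleft Y' (tw f) (R3 z i)"
  unfolding eq by (rule W3_map[OF f z]; use f in "simp add: tau3_def Yc'.left_closed Yc'.left_right")+
qed

text \<open>Inverse to \<open>tw\<close>: it carries coordinates of the conjugate back to scalars of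
  \<open>X\<close>.\<close>

definition "un f=(\<lambda>t\<in>topspace T. f (Phi t))" for f :: "'t=>complex"

lemma un_apply [simp]: "t:topspace T==>un f t=f (Phi t)"
 by (simp add: un_def)

lemma hom_facts: "t:topspace T==>Phi t:topspace T" "t:topspace T==>Phiinv t:topspace T"
 "t:topspace T==>Phiinv (Phi t)=t" "t:topspace T==>Phi (Phiinv t)=t"
 using hom by (auto simp: homeomorphic_maps_def continuous_map_def)

lemma un_closed [simp]: "f:carrier C==>un f:carrier C"
 using hom continuous_map_compose[of T T Phi euclidean f]
 by (auto simp: homeomorphic_maps_def cfun_carrier o_def un_def)

lemma tw_un: assumes f: "f:carrier C" shows "tw (un f)=f"
 by (rule cfun_eqI[OF tw_closed[OF un_closed[OF f]] f]) (simp add: hom_facts)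

lemma un_tw: assumes f: "f:carrier C" shows "un (tw f)=f"
 by (rule cfun_eqI[OF un_closed[OF tw_closed[OF f]] f]) (simp add: hom_facts)

abbreviation "W4\<equiv>rel_tensor C W3 Y"

definition "tau4 i=(%(z, y). pr.W (R3 z i, y))"

lemma hleft_finsum:
 assumes y: "y:carrier Y" "y':carrier Y" and f: "!!i. i < (m::nat)==>f i:carrier D"
 shows "hip Y y (hleft Y (finsum D f {..<m}) y')=finsum C (%i. hip Y y (hleft Y (f i) y')) {..<m}"
proof (rule Yc.A.nv.finsum_hom[where h = "%a. hip Y y (hleft Y a y')"])
 have "hleft Y (0\<odot>\<^bsub>D\<^esub> \<zero>\<^bsub>D\<^esub>) y'=0\<odot>\<^bsub>Y\<^esub> hleft Y \<zero>\<^bsub>D\<^esub> y'"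
  by (rule Yc.left_smult) (use y in simp_all)
 then have "hleft Y \<zero>\<^bsub>D\<^esub> y'=\<zero>\<^bsub>Y\<^esub>" using y Yc.left_closed by simp
 then show "hip Y y (hleft Y \<zero>\<^bsub>D\<^esub> y')=\<zero>\<^bsub>C\<^esub>" using y by simp
 show "abelian_group C" by (rule C.A_abelian)
qed (use y f Yc.left_add' Yc.left_closed Yc.ip_add Yc.ip_closed in simp_all)

lemma rel4_kernel:
 assumes z: "z:carrier W3" "z':carrier W3" and y: "y:carrier Y" "y':carrier Y"
 shows "rel_kernel W3 Y (z, y) (z', y')=finsum C (%i. adj C (tau4 i (z, y))\<otimes>\<^bsub>C\<^esub> tau4 i (z', y')) {..<n}"
proof -
 have "hip Y y (hleft Y (hip W3 z z') y')=hip Y y (hleft Y (finsum D (%i. hip Y' (R3 z i) (R3 z' i)) {..<n}) y')"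
  using s3.hip_W[unfolded W3_eq] z by simp
 also have "...=finsum C (%i. hip Y y (hleft Y (hip Y' (R3 z i) (R3 z' i)) y')) {..<n}"
  using z y by (intro hleft_finsum) (auto simp: Yc'.ip_closed)
 also have "...=finsum C (%i. adj C (tau4 i (z, y))\<otimes>\<^bsub>C\<^esub> tau4 i (z', y')) {..<n}"
 proof (intro C.nv.fs_cong HOL.refl)
  fix i assume i: "i:{..<n}"
  have c: "pr.W (R3 z i, y):carrier C" "pr.W (R3 z' i, y'):carrier C" using z y i by auto
  show cl: "adj C (tau4 i (z, y))\<otimes>\<^bsub>C\<^esub> tau4 i (z', y'):carrier C"
   using c by (simp add: tau4_def C.adj_closed)
  show "hip Y y (hleft Y (hip Y' (R3 z i) (R3 z' i)) y')=adj C (tau4 i (z, y))\<otimes>\<^bsub>C\<^esub> tau4 i (z', y')"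
  proof (rule cfun_eqI[OF _ cl])
   show "hip Y y (hleft Y (hip Y' (R3 z i) (R3 z' i)) y'):carrier C"
    using z y i by (simp add: Yc.ip_closed Yc.left_closed Yc'.ip_closed)
   show "hip Y y (hleft Y (hip Y' (R3 z i) (R3 z' i)) y') t=(adj C (tau4 i (z, y))\<otimes>\<^bsub>C\<^esub> tau4 i (z', y')) t"
    if t: "t:topspace T" for t
    using pr.W_kernel[of "(R3 z i, y)" "(R3 z' i, y')" t] z y i t
    by (simp add: tau4_def cfun_alg_simps pr.kernel_eq)
  qed
 qed
 finally show ?thesis by (simp add: rel_kernel_def)
qed

sublocale s4: alg_realization C "rel_kernel W3 Y" W3 Y
 "%a n. map (%(x, y). (hleft W3 a x, y))" "%c n. map (%(x, y). (x, hright Y y c))" tau4 n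
proof (rule alg_realizationI)
 show "tau4 i (c\<odot>\<^bsub>W3\<^esub> x, y)=c\<odot>\<^bsub>C\<^esub> tau4 i (x, y)"
  if "x:carrier W3" "y:carrier Y" "i < n" for x y i c
  using that s3.smult_W(2)[unfolded W3_eq, of x i c] by (simp add: tau4_def pr.W_smult_left)
 show "c\<odot>\<^bsub>W3\<^esub> x:carrier W3" if "x:carrier W3" for x c
  using s3.smult_W(1)[unfolded W3_eq] that .
qed (use rel4_kernel C.cstar_algebra_axioms in "auto simp: tau4_def")

lemma W4_eq: "s4.W=W4"
 by (simp only: rel_tensor_def)

abbreviation "R4\<equiv>s4.R"

lemmas R4_closed [simp] = s4.alg_R_closed[unfolded W4_eq]

text \<open>The function travels from the left of \<open>Y'\<close> through \<open>D\<close> to the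
  right of \<open>Y\<close>: by \<open>rho_right\<close>, then balancing, then
  \<open>rho_left\<close>. This is why both actions on the conjugate agree in coordinates.\<close>

lemma W_tw: assumes "f:carrier C" "x:carrier Y'" "y:carrier Y"
 shows "pr.W (hleft Y' (tw f) x, y)=tw f\<otimes>\<^bsub>C\<^esub> pr.W (x, y)"
proof -
 have "pr.W (hleft Y' (tw f) x, y)=pr.W (hright Y' x (rho f), y)" using assms by (simp add: rho_right)
 also have "...=pr.W (x, y)\<otimes>\<^bsub>C\<^esub> tw f" using assms by (simp add: pr.W_balanced rho_left pr.W_right)
 also have "...=tw f\<otimes>\<^bsub>C\<^esub> pr.W (x, y)" using assms by (intro C_comm) auto
 finally show ?thesis .
qed

lemma W_finsum:
 assumes y: "y:carrier Y" and f: "!!i. i < (m::nat)==>f i:carrier Y'"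
 shows "pr.W (finsum Y' f {..<m}, y)=finsum C (%i. pr.W (f i, y)) {..<m}"
proof (rule Yc'.Xn.finsum_hom[where h = "%x. pr.W (x, y)"])
 have "pr.W (0\<odot>\<^bsub>Y'\<^esub> \<zero>\<^bsub>Y'\<^esub>, y)=0\<odot>\<^bsub>C\<^esub> pr.W (\<zero>\<^bsub>Y'\<^esub>, y)"
  by (rule pr.W_smult_left) (use y in simp_all)
 then show "pr.W (\<zero>\<^bsub>Y'\<^esub>, y)=\<zero>\<^bsub>C\<^esub>" using y by simp
 show "abelian_group C" by (rule C.A_abelian)
qed (use y f pr.W_add_left in simp_all)

lemma R4_relation: assumes w: "w:carrier W4" and i: "i < n"
 shows "R4 w i=finsum C (%j. tw (mu i j)\<otimes>\<^bsub>C\<^esub> R4 w j) {..<n}"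
proof (rule s4.alg_relation[OF w [folded W4_eq] i])
 show "tau4 i (x, y)=finsum C (%j. tw (mu i j)\<otimes>\<^bsub>C\<^esub> tau4 j (x, y)) {..<n}"
  if "x:carrier W3" "y:carrier Y" for x y
 proof -
  have "pr.W (R3 x i, y)=pr.W (finsum Y' (%j. hleft Y' (tw (mu i j)) (R3 x j)) {..<n}, y)"
   by (simp only: R3_relation[OF that(1) i, symmetric])
  also have "...=finsum C (%j. pr.W (hleft Y' (tw (mu i j)) (R3 x j), y)) {..<n}"
   using that i by (intro W_finsum) (auto simp: Yc'.left_closed)
  also have "...=finsum C (%j. tw (mu i j)\<otimes>\<^bsub>C\<^esub> pr.W (R3 x j, y)) {..<n}"
   using that i by (intro C.nv.fs_cong HOL.refl W_tw C.m_closed tw_closed mu_closed pr.W_closed) auto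
  finally show ?thesis by (simp add: tau4_def)
 qed
qed (use i in simp)

lemma W4_left: assumes f: "f:carrier C" and z: "z:carrier W4"
 shows "hleft W4 (tw f) z:carrier W4" "!!i. i < n==>R4 (hleft W4 (tw f) z) i=tw f\<otimes>\<^bsub>C\<^esub> R4 z i"
proof -
 have eq: "hleft W4 (tw f) z=s4.q (%j. map (%(x, y). (hleft W3 (tw f) x, y)) (rep z j))"
  by (rule s4.W_simps(4)[unfolded W4_eq])
 show "hleft W4 (tw f) z:carrier W4" "!!i. i < n==>R4 (hleft W4 (tw f) z) i=tw f\<otimes>\<^bsub>C\<^esub> R4 z i"
  unfolding eq
  by (rule s4.alg_map[OF z [folded W4_eq] tw_closed[OF f], unfolded W4_eq];
    use f W3_left in "simp add: tau4_def W_tw")+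
qed

lemma W4_right: assumes f: "f:carrier C" and z: "z:carrier W4"
 shows "hright W4 z f:carrier W4" "!!i. i < n==>R4 (hright W4 z f) i=f\<otimes>\<^bsub>C\<^esub> R4 z i"
proof -
 have eq: "hright W4 z f=s4.q (%j. map (%(x, y). (x, hright Y y f)) (rep z j))"
  by (rule s4.W_simps(5)[unfolded W4_eq])
 show "hright W4 z f:carrier W4" "!!i. i < n==>R4 (hright W4 z f) i=f\<otimes>\<^bsub>C\<^esub> R4 z i"
  unfolding eq
  by (rule s4.alg_map[OF z [folded W4_eq] f, unfolded W4_eq];
    use f in "simp add: tau4_def pr.W_right Yc.right_closed C_comm")+
qed

text \<open>Frame reconstruction applied to the coordinates after undoing the twist.\<close>

definition "J z=finsum X (%i. hright X (xi i) (un (R4 z i))) {..<n}"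

lemma J_closed [simp]: "z:carrier W4==>J z:carrier X"
 unfolding J_def by (intro X.Xn.finsum_closed') (simp add: X.right_closed frame_closed)

lemma ip_J: assumes x: "x:carrier X" and z: "z:carrier W4"
 shows "hip X x (J z)=finsum C (%i. hip X x (xi i)\<otimes>\<^bsub>C\<^esub> un (R4 z i)) {..<n}"
proof -
 have "hip X x (J z)=finsum C (%i. hip X x (hright X (xi i) (un (R4 z i)))) {..<n}"
  unfolding J_def using x z frame_closed C.A_abelian
  by (intro X.Xn.finsum_hom) (auto simp: X.ip_add X.right_closed X.ip_closed)
 also have "...=finsum C (%i. hip X x (xi i)\<otimes>\<^bsub>C\<^esub> un (R4 z i)) {..<n}"
  using x z frame_closed by (intro C.nv.fs_cong) (auto simp: X.ip_right X.ip_closed)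
 finally show ?thesis .
qed

text \<open>By \<open>R4_relation\<close> the twisted Gram matrix fixes the coordinates, so
  reconstructing a vector and pairing it with the frame again returns them.\<close>

lemma frame_J: assumes i: "i < n" and z: "z:carrier W4" shows "hip X (xi i) (J z)=un (R4 z i)"
proof (rule cfun_eqI)
 fix t assume t: "t:topspace T"
 have "hip X (xi i) (J z) t=(\<Sum>j<n. mu i j t * R4 z j (Phi t))"
  unfolding ip_J[OF frame_closed[OF i] z] using t z i frame_closed
  by (subst cfun_finsum[OF T]) (auto simp: X.ip_closed, simp add: cfun_alg_simps)
 also have "...=finsum C (%j. tw (mu i j)\<otimes>\<^bsub>C\<^esub> R4 z j) {..<n} (Phi t)"
  using t z i by (subst cfun_finsum[OF T]) (auto simp: hom_facts, simp add: cfun_alg_simps hom_facts)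
 also have "...=un (R4 z i) t" using t by (simp add: R4_relation[OF z i, symmetric])
 finally show "hip X (xi i) (J z) t=un (R4 z i) t" .
qed (use assms frame_closed in "auto simp: X.ip_closed")

text \<open>Parseval for \<open>X\<close> at \<open>Phiinv t\<close> meets the coordinate formula
  for the inner product of \<open>W4\<close> at \<open>t\<close>.\<close>

lemma J_hip: assumes z: "z:carrier W4" and w: "w:carrier W4" and t: "t:topspace T"
 shows "hip W4 z w t=hip X (J z) (J w) (Phiinv t)"
proof -
 have "hip X (J z) (J w) (Phiinv t)=finsum C (%i. hip X (J z) (xi i)\<otimes>\<^bsub>C\<^esub> hip X (xi i) (J w)) {..<n} (Phiinv t)"
  using frame_ip[OF J_closed[OF z] J_closed[OF w]] by simp
 also have "...=(\<Sum>i<n. cnj (R4 z i t) * R4 w i t)"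
 proof -
  have "(hip X (J z) (xi i)\<otimes>\<^bsub>C\<^esub> hip X (xi i) (J w)) (Phiinv t)=cnj (R4 z i t) * R4 w i t" if i: "i < n" for i
   using X.ip_adj[OF frame_closed[OF i] J_closed[OF z], symmetric] frame_J[OF i z] frame_J[OF i w] t
   by (simp add: cfun_alg_simps hom_facts)
  then show ?thesis
   using t z w frame_closed by (subst cfun_finsum[OF T]) (auto simp: X.ip_closed hom_facts)
 qed
 also have "...=hip W4 z w t"
  using s4.alg_hip[unfolded W4_eq, OF z w] t z w
  by (simp add: cfun_finsum[OF T] C.adj_closed) (simp add: cfun_alg_simps)
 finally show ?thesis by simp
qed

text \<open>Covers both actions of \<open>C(T)\<close> at once, since they have the same effect on
  coordinates.\<close>

lemma J_smult_right:
 assumes f: "f:carrier C" and z: "z:carrier W4" and w: "w:carrier W4"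
  and R: "!!i. i < n==>R4 w i=f\<otimes>\<^bsub>C\<^esub> R4 z i"
 shows "J w=hright X (J z) (un f)"
proof -
 have u: "un (R4 w i)=un (R4 z i)\<otimes>\<^bsub>C\<^esub> un f" if i: "i < n" for i
 proof (rule cfun_eqI)
  show "un (R4 w i) t=(un (R4 z i)\<otimes>\<^bsub>C\<^esub> un f) t" if "t:topspace T" for t
   using that by (simp add: R[OF i] cfun_alg_simps hom_facts)
 qed (use i f z w in simp_all)
 have "hright X (J z) (un f)=finsum X (%i. hright X (hright X (xi i) (un (R4 z i))) (un f)) {..<n}"
  unfolding J_def
 proof (rule X.Xn.finsum_hom[where h = "%x. hright X x (un f)"])
  have "hright X (0\<odot>\<^bsub>X\<^esub> \<zero>\<^bsub>X\<^esub>) (un f)=0\<odot>\<^bsub>X\<^esub> hright X \<zero>\<^bsub>X\<^esub> (un f)"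
   by (rule X.right_smult) (use f in simp_all)
  then show "hright X \<zero>\<^bsub>X\<^esub> (un f)=\<zero>\<^bsub>X\<^esub>" using f X.right_closed by simp
  show "abelian_group X" by (rule X.X.abelian_group_axioms)
 qed (use f z frame_closed X.right_add X.right_closed in simp_all)
 also have "...=J w"
  unfolding J_def using f z frame_closed
  by (intro X.Xn.fs_cong) (auto simp: u X.right_mult X.right_closed)
 finally show ?thesis by simp
qed

lemma J_right: "[|f:carrier C; z:carrier W4|]==>J (hright W4 z f)=hright X (J z) (un f)"
 by (rule J_smult_right[OF _ _ W4_right])

lemma J_left: assumes f: "f:carrier C" and z: "z:carrier W4" shows "J (hleft W4 f z)=hright X (J z) (un f)"
 using J_smult_right[OF f z W4_left[OF un_closed[OF f] z, unfolded tw_un[OF f]]] .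

lemma left_closed_W4: "[|f:carrier C; z:carrier W4|]==>hleft W4 f z:carrier W4"
 using W4_left(1)[OF un_closed] by (simp only: tw_un)

lemma J_inj: assumes "z:carrier W4" "w:carrier W4" "J z=J w" shows "z=w"
proof (rule s4.R_inj[unfolded W4_eq, OF assms(1,2)])
 fix i assume i: "i < n"
 have "un (R4 z i)=un (R4 w i)" using frame_J[OF i] assms by metis
 then have "tw (un (R4 z i))=tw (un (R4 w i))" by simp
 then show "R4 z i=R4 w i" using assms i by (simp only: tw_un R4_closed)
qed

text \<open>The four stages are climbed with elementary tensors; only the last needs a limit, of
  formal sums from \<open>Y'\<close> and \<open>Y\<close> whose \<open>W\<close> tends to 1. The
  resulting coordinates are those of \<open>x\<close>, twisted.\<close>

lemma J_surj: assumes x: "x:carrier X" shows "\<exists>z\<in>carrier W4. J z=x"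
proof -
 have g: "hip X (xi i) x:carrier C" if "i < n" for i using that x frame_closed by (simp add: X.ip_closed)
 \<comment> \<open>With units in the algebra slots the coordinates remain those of \<open>x\<close>,
   merely embedded in the larger algebras.\<close>
 define w where "w=s1.q (%j. [(\<one>\<^bsub>alg A\<^esub>, x)])"
 have w: "w:carrier W1" "!!i. i < n==>R1 w i=be1 \<one>\<^bsub>alg A\<^esub> (hip X (xi i) x)"
  using s1.single_W[of "\<one>\<^bsub>alg A\<^esub>" x] x unfolding W1_eq w_def by (simp_all add: tau1_def)
 define p where "p=s2.q (%j. [(w, \<one>\<^bsub>alg N\<^esub>)])"
 have p: "p:carrier W2" "!!i. i < n==>R2 p i=rho (hip X (xi i) x)"
  using s2.single_W[of w "\<one>\<^bsub>alg N\<^esub>"] w unfolding W2_eq p_def by (simp_all add: tau2_def rho_def)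
 define z where "z y=s3.q (%j. [(y, p)])" for y
 have z: "z y:carrier W3" "!!i. i < n==>R3 (z y) i=hleft Y' (tw (hip X (xi i) x)) y" if "y:carrier Y'" for y
  using s3.single_W[of y p] p that g unfolding W3_eq z_def by (simp_all add: tau3_def rho_right)
 obtain s where s: "!!m. s m:pr.L" "C.nv.lim_to (%m. lsum C pr.W (s m)) \<one>\<^bsub>C\<^esub>"
  using pr.W_dense by blast
 define l where "l m=map (%(y', y). (z y', y)) (s m)" for m
 have "map (%(y', y). (z y', y)) l':s4.L" if "l':pr.L" for l'
  using that by (induction l' rule: pair_lists_induct) (simp_all add: z(1))
 then have lL: "l m:s4.L" for m using s(1) by (simp add: l_def)
 have sum: "lsum C (tau4 i) (l m)=tw (hip X (xi i) x)\<otimes>\<^bsub>C\<^esub> lsum C pr.W (s m)" if i: "i < n" for i m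
 proof -
  have *: "tau4 i (case r of (y', y)=>(z y', y))=tw (hip X (xi i) x)\<otimes>\<^bsub>C\<^esub> pr.W r" if rs: "r:set (s m)" for r
  proof -
   obtain y' y where r: "r=(y', y)" "y':carrier Y'" "y:carrier Y" using pr.list_mem[OF s(1) rs] by blast
   then show ?thesis using z(2)[OF r(2) i] W_tw[OF g[OF i] r(2,3)] by (simp add: tau4_def)
  qed
  have "lsum C (tau4 i) (l m)=lsum C (%r. tw (hip X (xi i) x)\<otimes>\<^bsub>C\<^esub> pr.W r) (s m)"
   unfolding l_def lsum_map by (rule lsum_cong) (rule *)
  also have "...=tw (hip X (xi i) x)\<otimes>\<^bsub>C\<^esub> lsum C pr.W (s m)"
   by (rule C.lsum_mult_left[symmetric]) (use g i pr.list_mem[OF s(1)] in auto)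
  finally show ?thesis .
 qed
 have lim: "C.nv.lim_to (%m. lsum C (tau4 i) (l m)) (tw (hip X (xi i) x))" if i: "i < n" for i
 proof -
  have "C.nv.lim_to (%m. tw (hip X (xi i) x)\<otimes>\<^bsub>C\<^esub> lsum C pr.W (s m)) (tw (hip X (xi i) x)\<otimes>\<^bsub>C\<^esub> \<one>\<^bsub>C\<^esub>)"
   by (rule C.lim_mult[OF C.nv.lim_to_const s(2)]) (use g i in simp)
  then show ?thesis unfolding sum[OF i] using monoid.r_one[OF ring.is_monoid[OF C.ring_A] tw_closed[OF g[OF i]]] by (simp only:)
 qed
 have q: "s4.q l:carrier W4" "!!i. i < n==>R4 (s4.q l) i=tw (hip X (xi i) x)"
  using s4.alg_seq[of l "%i. tw (hip X (xi i) x)", OF lL lim] unfolding W4_eq by blast+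
 have "J (s4.q l)=finsum X (%i. hright X (xi i) (hip X (xi i) x)) {..<n}"
  unfolding J_def using q(2) g x frame_closed
  by (intro X.Xn.fs_cong HOL.refl) (simp_all only: lessThan_iff un_tw X.right_closed)
 then show ?thesis using q(1) frame[OF x] by (intro bexI[of _ "s4.q l"]) auto
qed

lemma bij_J: "bij_betw J (carrier W4) (carrier X)"
 using J_inj J_surj J_closed by (auto simp: bij_betw_def inj_on_def image_iff) metis

lemma act2_eq: "act2 T A N Y Y' X=W4"
 by (simp only: act2_def conj_corr_def mor1_comp_simps)

text \<open>In coordinates the induced maps multiply by \<open>1 \<otimes> f\<close> on
  \<open>W1\<close>, by \<open>rho f\<close> on \<open>W2\<close>, and act by \<open>tw f\<close>
  from the left on \<open>W3\<close>. There the induced map is \<open>hleft\<close>, since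
  coordinates determine an element, and the last stage applies it to first entries exactly as
  \<open>hleft\<close> on \<open>W4\<close> does.\<close>

lemma act3_eq: assumes f: "f:carrier C" and z: "z:carrier W4"
 shows "act3 T A N Y Y' X (hleft X f) z=hleft W4 (tw f) z"
proof -
 define E1 where "E1=ext_map T A I (id_corr (alg A)) X (%a. a) (hleft X f)"
 have E1: "E1 w:carrier W1" "!!i. i < n==>R1 (E1 w) i=be1 \<one>\<^bsub>alg A\<^esub> f\<otimes>\<^bsub>D1\<^esub> R1 w i" if "w:carrier W1" for w
 proof -
  have eq: "E1 w=s1.q (%n. map (%(x, y). (x, hleft X f y)) (rep w n))"
   by (simp only: E1_def ext_map_def)
  show "E1 w:carrier W1" "!!i. i < n==>R1 (E1 w) i=be1 \<one>\<^bsub>alg A\<^esub> f\<otimes>\<^bsub>D1\<^esub> R1 w i"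
   unfolding eq
   by (rule s1.alg_map[OF that [folded W1_eq] be1_closed[OF A.one_closed f], unfolded W1_eq];
    use f frame_closed in "simp add: tau1_def X_sym X.right_closed X.ip_right X.ip_closed p1.be_mult[simplified] C_comm")+
 qed
 define E2 where "E2=conj_map T A N X (hleft X f)"
 have E2: "E2 w:carrier W2" "!!i. i < n==>R2 (E2 w) i=rho f\<otimes>\<^bsub>D\<^esub> R2 w i" if "w:carrier W2" for w
 proof -
  have eq: "E2 w=s2.q (%n. map (%(x, y). (E1 x, y)) (rep w n))"
   by (simp only: E2_def conj_map_def ext_map_def E1_def mor1_comp_simps)
  show "E2 w:carrier W2" "!!i. i < n==>R2 (E2 w) i=rho f\<otimes>\<^bsub>D\<^esub> R2 w i"
   unfolding eq
   by (rule s2.alg_map[OF that [folded W2_eq] rho_closed[OF f], unfolded W2_eq];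
    use f E1 in "simp add: tau2_def rho_def q2.be_mult[simplified]")+
 qed
 define E3 where "E3=rel_map D Y' W2 (%y. y) E2"
 have E3: "E3 w=hleft W3 (tw f) w" if w: "w:carrier W3" for w
 proof -
  have eq: "E3 w=s3.q (%n. map (%(x, y). (x, E2 y)) (rep w n))"
   by (simp only: E3_def rel_map_def)
  have "E3 w:carrier W3" "!!i. i < n==>R3 (E3 w) i=hleft Y' (tw f) (R3 w i)"
   unfolding eq
   by (rule W3_map[OF f w];
    use f E2 in "simp add: tau3_def Yc'.right_mult rho_right Yc'.left_right")+
  then show ?thesis using W3_left[OF f w] by (intro s3.R_inj[unfolded W3_eq]) auto
 qed
 have "act3 T A N Y Y' X (hleft X f) z=s4.q (%n. map (%(x, y). (E3 x, y)) (rep z n))"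
  by (simp only: act3_def rel_map_def E3_def E2_def conj_corr_def mor1_comp_simps)
 \<comment> \<open>The representing lists have their first entries in \<open>W3\<close>, where the
   two maps agree.\<close>
 also have "(%n. map (%(x, y). (E3 x, y)) (rep z n))=(%n. map (%(x, y). (hleft W3 (tw f) x, y)) (rep z n))"
 proof
  fix m
  have "fst p:carrier W3" if "p:set (rep z m)" for p
   using pair_listsD[OF s4.carrier_rep(3)[unfolded W4_eq, OF z] that] by blast
  then show "map (%(x, y). (E3 x, y)) (rep z m)=map (%(x, y). (hleft W3 (tw f) x, y)) (rep z m)"
   by (auto simp: E3)
 qed
 also have "s4.q ...=hleft W4 (tw f) z" by (rule s4.W_simps(4)[unfolded W4_eq, symmetric])
 finally show ?thesis .
qed

end

section \<open>The central maps of the representing 1-morphism\<close>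

text \<open>For general correspondences the distance is not yet known to be a pseudometric. That a
  class contains its own sequence only takes \<open>d l l = 0\<close>, which follows from linearity
  of the kernel in its second argument.\<close>

lemma rel_tensor_rep:
 assumes X: "correspondence A B X" and Y: "correspondence B C Y" and z: "z:carrier (rel_tensor C X Y)"
 shows "rep z n:pair_lists X Y"
proof -
 interpret X: correspondence A B X by fact
 interpret Y: correspondence B C Y by fact
 let ?k = "rel_kernel X Y" and ?P = "carrier X\<times>carrier Y"
 have kc: "?k p r:carrier C" if "p:?P" "r:?P" for p r
  using that by (auto simp: rel_kernel_def X.ip_closed Y.ip_closed Y.left_closed)
 have dd: "pair_dist C ?k X l l=0" if l: "l:pair_lists X Y" for l
 proof -
  have lP: "p:?P" if "p:set l" for p using pair_listsD[OF l that] by (simp add: mem_Times_iff)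
  define m where "m=l @ pair_scale X (- 1) l"
  have "pair_scale X (- 1) l:pair_lists X Y" using l by (induction l rule: pair_lists_induct) auto
  then have mL: "m:pair_lists X Y" using l by (simp add: m_def pair_lists_def)
  have mP: "p:?P" if "p:set m" for p using pair_listsD[OF mL that] by (simp add: mem_Times_iff)
  have "lsum C (?k p) m=\<zero>\<^bsub>C\<^esub>" if p: "p:?P" for p
  proof -
   have neg: "?k p (case r of (x, y)=>((- 1)\<odot>\<^bsub>X\<^esub> x, y))=(- 1)\<odot>\<^bsub>C\<^esub> ?k p r" if "r:?P" for r
    using p that by (cases p; cases r) (simp add: rel_kernel_def X.ip_smult X.ip_closed Y.left_smult Y.left_closed Y.ip_smult)
   have "lsum C (?k p) m=lsum C (?k p) l\<oplus>\<^bsub>C\<^esub> lsum C (?k p) (pair_scale X (- 1) l)"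
    unfolding m_def using mP p by (intro Y.B.nv.lsum_append kc) (auto simp: m_def)
   also have "lsum C (?k p) (pair_scale X (- 1) l)=lsum C (%r. (- 1)\<odot>\<^bsub>C\<^esub> ?k p r) l"
    unfolding pair_scale_def lsum_map by (rule lsum_cong) (rule neg[OF lP])
   also have "...=(- 1)\<odot>\<^bsub>C\<^esub> lsum C (?k p) l"
    by (rule Y.B.nv.lsum_smult[symmetric]) (rule kc[OF p lP])
   finally have "lsum C (?k p) m=lsum C (?k p) l\<oplus>\<^bsub>C\<^esub> (- 1)\<odot>\<^bsub>C\<^esub> lsum C (?k p) l" .
   moreover have "lsum C (?k p) l:carrier C" by (intro Y.B.nv.lsum_closed kc p lP)
   ultimately show ?thesis using Y.B.nv.diff_self by (simp flip: Y.B.nv.diff_conv)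
  qed
  then have "pair_ip C ?k m m=lsum C (%p. \<zero>\<^bsub>C\<^esub>) m"
   using mP by (subst concat_pairs_lsum[OF Y.B.cstar_algebra_axioms]) (auto intro!: kc lsum_cong)
  then show ?thesis by (simp add: pair_dist_def Let_def Y.B.nv.lsum_zero flip: m_def)
 qed
 let ?L = "pair_lists X Y" and ?d = "pair_dist C ?k X"
 obtain s where s: "cauchy_in ?L ?d s" "z=cauchy_class ?L ?d s"
  using z by (auto simp: rel_tensor_def pair_completion_def Let_def completion_def)
 have "s:z" using s dd by (simp add: cauchy_class_def) (simp add: cauchy_in_def)
 then have "rep z:z" unfolding rep_def by (rule someI[where P = "%r. r:z"])
 then have "cauchy_in ?L ?d (rep z)" unfolding s(2) cauchy_class_def by blast
 then show ?thesis unfolding cauchy_in_def by blast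
qed

text \<open>With \<open>z = v 1\<close>, an element \<open>b\<close> is recovered as the image under
  \<open>u\<close> of \<open>b z\<close>, and \<open>b z\<close> is formed on lists from the action
  on \<open>X\<close> alone.\<close>

lemma iso_faithful:
 assumes X: "correspondence A B X" and Y: "correspondence B A Y"
  and iso: "iso3 A A (rel_tensor A X Y) (id_corr A) u v"
  and a: "a:carrier A" "a':carrier A" and eq: "!!x. x:carrier X==>hleft X a x=hleft X a' x"
 shows "a=a'"
proof -
 interpret X: correspondence A B X by fact
 define z where "z=v \<one>\<^bsub>A\<^esub>"
 have z: "z:carrier (rel_tensor A X Y)" "u z=\<one>\<^bsub>A\<^esub>"
  using iso X.A.one_closed by (auto simp: z_def iso3_def mor3_def)
 have u: "u (hleft (rel_tensor A X Y) b z)=b" if "b:carrier A" for b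
  using iso that z by (auto simp: iso3_def mor3_def)
 have "map (%(x, y). (hleft X a x, y)) (rep z n)=map (%(x, y). (hleft X a' x, y)) (rep z n)" for n
  using pair_listsD[OF rel_tensor_rep[OF X Y z(1), of n]] eq by (fastforce simp: case_prod_unfold)
 then have "(%n. map (%(x, y). (hleft X a x, y)) (rep z n))=(%n. map (%(x, y). (hleft X a' x, y)) (rep z n))"
  by (rule ext)
 moreover have "hleft (rel_tensor A X Y) b z=cauchy_class (pair_lists X Y) (pair_dist A (rel_kernel X Y) X)
   (%n. map (%(x, y). (hleft X b x, y)) (rep z n))" for b
  by (simp add: rel_tensor_def pair_completion_def Let_def)
 ultimately have "u (hleft (rel_tensor A X Y) a z)=u (hleft (rel_tensor A X Y) a' z)"
  by (simp only:)
 then show ?thesis by (simp only: u a)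
qed

lemma homeo_mor1_simps [simp]: "alg (homeo_mor1 T Phi)=cfun_alg T"
 "lmap (homeo_mor1 T Phi) f=(\<lambda>t\<in>topspace T. f (Phi t))" "rmap (homeo_mor1 T Phi) g=g"
 by (simp_all add: homeo_mor1_def)

text \<open>In the product algebra the left map at \<open>?g\<close> equals the right map at
  \<open>?g\<close> composed with \<open>Phi\<close>, by balancing, and that composite is
  \<open>f\<close>. As \<open>P\<close> intertwines the central maps, \<open>lmap A ?g\<close> and
  \<open>rmap A f\<close> act alike on it, and it is faithful.\<close>

lemma twisted_center:
 assumes T: "compact_space T" and hom: "homeomorphic_maps T T Phi Phiinv"
  and M: "mor1 T T M" "rmap M=lmap M" and A: "mor1 T T A"
  and P: "inverse2 T T A (mor1_comp T M (homeo_mor1 T Phi)) P P'"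
  and f: "f:carrier (cfun_alg T)"
 shows "rmap A f=lmap A (\<lambda>t\<in>topspace T. f (Phiinv t))"
proof -
 let ?C = "cfun_alg T" and ?H = "homeo_mor1 T Phi" and ?g = "\<lambda>t\<in>topspace T. f (Phiinv t)"
 interpret C: cstar_algebra ?C by (rule cstar_algebra_cfun[OF T])
 have c: "(\<lambda>t\<in>topspace T. f (Psi t)):carrier ?C" if "continuous_map T T Psi" "f:carrier ?C" for Psi f
  using continuous_map_compose[OF that(1), of euclidean f] that(2) by (simp add: cfun_carrier o_def)
 have cont: "continuous_map T T Phi" "continuous_map T T Phiinv" using hom by (auto simp: homeomorphic_maps_def)
 have g: "?g:carrier ?C" by (rule c[OF cont(2) f])
 interpret b: bal_pair M ?H T
 proof (intro bal_pair.intro cstar_pair.intro bal_pair_axioms.intro)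
  show "lmap ?H f:center (alg ?H)" if "f:carrier ?C" for f
   using c[OF cont(1) that] by (simp add: center_def mult.commute cong: restrict_cong)
  show "cstar_algebra (alg ?H)" using C.cstar_algebra_axioms by simp
 qed (rule mor1D[OF M(1)], assumption?)+
 have fg: "(\<lambda>t\<in>topspace T. ?g (Phi t))=f"
  by (rule cfun_eqI[OF c[OF cont(1) g] f])
   (use hom in "auto simp: homeomorphic_maps_def continuous_map_def")
 have "lmap (mor1_comp T M ?H) ?g=rmap (mor1_comp T M ?H) f"
  using b.be_rmap[OF g] M(2) fg by simp
 then have eq: "hleft P (lmap A ?g) x=hleft P (rmap A f) x" if "x:carrier P" for x
  using P that f g by (simp only: inverse2_def mor2_def) 
 obtain u v where "iso3 (alg A) (alg A) (rel_tensor (alg A) P P') (id_corr (alg A)) u v"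
  using P by (auto simp: inverse2_def isomorphic3_def)
 then show ?thesis
  using iso_faithful[of "alg A" "alg (mor1_comp T M ?H)" P P' u v "lmap A ?g" "rmap A f"] eq P
   centerD(1)[OF mor1D(4)[OF A g]] centerD(1)[OF mor1D(5)[OF A f]]
  by (simp add: inverse2_def mor2_def)
qed

section \<open>Line bundles and their sections\<close>

lemma continuous_map_locally:
 assumes "!!t. t:topspace X==>\<exists>V. openin X V&t:V&continuous_map (subtopology X V) Z f"
 shows "continuous_map X Z f"
 unfolding continuous_map_alt
proof (intro conjI allI impI)
 show "f:topspace X \<rightarrow> topspace Z"
 proof
  fix t assume "t:topspace X"
  then obtain V where "openin X V" "t:V" "continuous_map (subtopology X V) Z f" using assms by blast
  then show "f t:topspace Z" using \<open>t \<in> topspace X\<close> by (auto simp: continuous_map_def)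
 qed
 fix S assume S: "openin Z S"
 show "openin X (f -` S\<inter>topspace X)"
 proof (subst openin_subopen, intro ballI)
  fix t assume t: "t:f -` S\<inter>topspace X"
  then obtain V where V: "openin X V" "t:V" "continuous_map (subtopology X V) Z f" using assms by blast
  have "openin (subtopology X V) {x:topspace (subtopology X V). f x:S}"
   using V(3) S by (rule openin_continuous_map_preimage)
  then have "openin X {x:topspace (subtopology X V). f x:S}"
   using V(1) openin_trans_full by blast
  then show "\<exists>W. openin X W&t:W&W\<subseteq>f -` S\<inter>topspace X"
   using t V(2) by (intro exI[of _ "{x:topspace (subtopology X V). f x:S}"]) auto
 qed
qed

lemma continuous_map_mem: "[|continuous_map X Z f; x:topspace X|]==>f x:topspace Z"
 by (auto simp: continuous_map_def)

lemma continuous_map_cong_on: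
 "[|continuous_map (subtopology X V) Z f; !!x. x:V==>f x=g x|]==>continuous_map (subtopology X V) Z g"
 by (subst continuous_map_eq[of _ _ f]) auto

text \<open>A trivialisation described by its effect on local sections and scalar functions over
  every subset of \<open>U\<close>. Continuity of operations on sections then reduces to continuity
  of complex functions.\<close>

definition local_triv :: "'t topology=>('t, 'e) cbundle=>'t set=>('t\<times>complex=>'e)=>bool" where
 "local_triv T E U kappa\<longleftrightarrow>openin T U &
  (\<forall>V\<subseteq>U. \<forall>g. continuous_map (subtopology T V) euclidean g\<longrightarrow>continuous_map (subtopology T V) (tspace E) (%x. kappa (x, g x))) &
  (\<forall>V\<subseteq>U. \<forall>s. continuous_map (subtopology T V) (tspace E) s&(\<forall>x\<in>V. proj E (s x)=x) \<longrightarrow>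
   (\<exists>g. continuous_map (subtopology T V) euclidean g&(\<forall>x\<in>V. s x=kappa (x, g x)))) &
  (\<forall>x\<in>U. \<forall>z w. kappa (x, z):topspace (tspace E)&proj E (kappa (x, z))=x &
   fadd E (kappa (x, z)) (kappa (x, w))=kappa (x, z + w)&fscale E w (kappa (x, z))=kappa (x, w * z) &
   (kappa (x, z)=kappa (x, w)\<longrightarrow>z=w)) &
  (\<forall>e\<in>topspace (tspace E). proj E e:U\<longrightarrow>(\<exists>z. e=kappa (proj E e, z)))"

lemma line_bundle_local_triv:
 assumes "line_bundle T E" "t:topspace T"
 shows "\<exists>U kappa. local_triv T E U kappa&t:U"
proof -
 obtain U kappa where U: "openin T U" "t:U"
  and kappa: "homeomorphic_map (prod_topology (subtopology T U) (euclidean :: complex topology))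
     (subtopology (tspace E) {e. proj E e:U}) kappa"
  and lin: "!!x z w. x:U==>proj E (kappa (x, z))=x&fadd E (kappa (x, z)) (kappa (x, w))=kappa (x, z + w) &
      fscale E w (kappa (x, z))=kappa (x, w * z)"
  using assms unfolding line_bundle_def by meson
 have UT: "U\<subseteq>topspace T" using U(1) by (rule openin_subset)
 obtain theta where theta: "homeomorphic_maps (prod_topology (subtopology T U) (euclidean :: complex topology))
     (subtopology (tspace E) {e. proj E e:U}) kappa theta"
  using kappa unfolding homeomorphic_map_maps by blast
 then have c: "continuous_map (prod_topology (subtopology T U) euclidean) (subtopology (tspace E) {e. proj E e:U}) kappa"
  "continuous_map (subtopology (tspace E) {e. proj E e:U}) (prod_topology (subtopology T U) euclidean) theta"
  and inv: "!!p. p:U\<times>UNIV==>theta (kappa p)=p"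
   "!!e. [|e:topspace (tspace E); proj E e:U|]==>kappa (theta e)=e"
  using UT by (auto simp: homeomorphic_maps_def)
 have kE: "kappa (x, z):topspace (tspace E)" if "x:U" for x z
 proof -
  have "(x, z):topspace (prod_topology (subtopology T U) (euclidean :: complex topology))" using that UT by auto
  then have "kappa (x, z):topspace (subtopology (tspace E) {e. proj E e:U})"
   using continuous_map_image_subset_topspace[OF c(1)] by blast
  then show ?thesis by simp
 qed
 have th: "theta e:U\<times>UNIV" if "e:topspace (tspace E)" "proj E e:U" for e
  using continuous_map_image_subset_topspace[OF c(2)] that UT by auto
 have thp: "fst (theta e)=proj E e" if "e:topspace (tspace E)" "proj E e:U" for e
  using lin[of "fst (theta e)" "snd (theta e)"] inv(2)[OF that] th[OF that] by (auto simp: mem_Times_iff)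
 have 1: "continuous_map (subtopology T V) (tspace E) (%x. kappa (x, g x))"
  if "V\<subseteq>U" "continuous_map (subtopology T V) euclidean g" for V g
 proof -
  have "continuous_map (subtopology T V) (subtopology T U) (%x. x)"
   using that(1) by (auto simp: continuous_map_in_subtopology continuous_map_from_subtopology)
  then have "continuous_map (subtopology T V) (prod_topology (subtopology T U) euclidean) (%x. (x, g x))"
   using that(2) by (simp add: continuous_map_paired)
  from continuous_map_compose[OF this c(1)] show ?thesis
   by (simp add: o_def continuous_map_in_subtopology)
 qed
 have 2: "\<exists>g. continuous_map (subtopology T V) euclidean g&(\<forall>x\<in>V. s x=kappa (x, g x))"
  if "V\<subseteq>U" "continuous_map (subtopology T V) (tspace E) s" "\<forall>x\<in>V. proj E (s x)=x" for V s
 proof (intro exI conjI ballI)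
  have "continuous_map (subtopology T V) (subtopology (tspace E) {e. proj E e:U}) s"
   using that by (auto simp: continuous_map_in_subtopology)
  then have "continuous_map (subtopology T V) euclidean (snd\<circ>(theta\<circ>s))"
   by (intro continuous_map_compose[OF continuous_map_compose[OF _ c(2)] continuous_map_snd])
  then show "continuous_map (subtopology T V) euclidean (%x. snd (theta (s x)))"
   by (simp add: o_def)
  fix x assume x: "x:V"
  then have e: "s x:topspace (tspace E)" "proj E (s x):U"
   using that UT continuous_map_mem[OF that(2), of x] by auto
  then show "s x=kappa (x, snd (theta (s x)))"
   using inv(2)[OF e] thp[OF e] that(3) x by (metis prod.collapse)
 qed
 have 3: "z=w" if "x:U" "kappa (x, z)=kappa (x, w)" for x z w
  using inv(1)[of "(x, z)"] inv(1)[of "(x, w)"] that(1) unfolding that(2) by simp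
 have 4: "\<exists>z. e=kappa (proj E e, z)" if "e:topspace (tspace E)" "proj E e:U" for e
  using inv(2)[OF that] thp[OF that] by (metis prod.collapse)
 have "local_triv T E U kappa"
  unfolding local_triv_def
  by (intro conjI allI ballI impI; (rule U(1) | (rule 1; assumption) | (rule 2; simp) | (rule 3; assumption)
   | (rule 4; assumption) | (rule kE; assumption) | simp add: lin))
 then show ?thesis using U(2) by blast
qed

lemma local_trivD:
 assumes "local_triv T E U kappa"
 shows "openin T U"
  and "[|V\<subseteq>U; continuous_map (subtopology T V) euclidean g|]==>continuous_map (subtopology T V) (tspace E) (%x. kappa (x, g x))"
  and "[|V\<subseteq>U; continuous_map (subtopology T V) (tspace E) s; !!x. x:V==>proj E (s x)=x|] ==>
   \<exists>g. continuous_map (subtopology T V) euclidean g&(\<forall>x\<in>V. s x=kappa (x, g x))"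
  and "x:U==>kappa (x, z):topspace (tspace E)" "x:U==>proj E (kappa (x, z))=x"
  and "x:U==>fscale E w (kappa (x, z))=kappa (x, w * z)"
  and "x:U==>kappa (x, z)=kappa (x, w)\<longleftrightarrow>z=w"
  and "[|e:topspace (tspace E); proj E e:U|]==>\<exists>z. e=kappa (proj E e, z)"
proof -
 note a = assms[unfolded local_triv_def]
 note a2 = a[THEN conjunct2] and a3 = a[THEN conjunct2, THEN conjunct2]
  and a4 = a[THEN conjunct2, THEN conjunct2, THEN conjunct2]
 show "openin T U" using a by (rule conjunct1)
 show "continuous_map (subtopology T V) (tspace E) (%x. kappa (x, g x))"
  if "V\<subseteq>U" "continuous_map (subtopology T V) euclidean g"
  using a2[THEN conjunct1, rule_format, OF that] .
 show "\<exists>g. continuous_map (subtopology T V) euclidean g&(\<forall>x\<in>V. s x=kappa (x, g x))"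
  if "V\<subseteq>U" "continuous_map (subtopology T V) (tspace E) s" "!!x. x:V==>proj E (s x)=x"
  using a3[THEN conjunct1, rule_format, OF that(1)] that(2,3) by blast
 note lin = a4[THEN conjunct1, rule_format]
 show "kappa (x, z):topspace (tspace E)" "proj E (kappa (x, z))=x" "fscale E w (kappa (x, z))=kappa (x, w * z)"
  "kappa (x, z)=kappa (x, w)\<longleftrightarrow>z=w" if "x:U"
  using lin[OF that, of z w] by auto
 show "\<exists>z. e=kappa (proj E e, z)" if "e:topspace (tspace E)" "proj E e:U"
  using a4[THEN conjunct2, rule_format, OF that] .
qed

locale lbundle =
 fixes T :: "'t topology" and E :: "('t, 'e) cbundle"
 assumes line_bundle: "line_bundle T E"
begin

abbreviation "fib t\<equiv>{e:topspace (tspace E). proj E e=t}"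
abbreviation "sc\<equiv>fscale E"
abbreviation "nz e\<equiv>e\<noteq>sc 0 e"

lemma proj_closed: "e:topspace (tspace E)==>proj E e:topspace T"
 using line_bundle by (auto simp: line_bundle_def continuous_map_def)

text \<open>The fibre is a copy of the complex numbers under \<open>k\<close>; the vector space laws
  below are derived from this.\<close>

lemma fib_triv:
 assumes "t:topspace T"
 obtains k where "!!z. k z:fib t" "!!z w. sc w (k z)=k (w * z)" "!!z w. k z=k w\<longleftrightarrow>z=w" "!!e. e:fib t==>\<exists>z. e=k z"
proof -
 obtain U kappa where U: "local_triv T E U kappa" "t:U" using line_bundle_local_triv[OF line_bundle assms] by blast
 show thesis
  by (rule that[of "%z. kappa (t, z)"]) (use local_trivD[OF U(1)] U(2) in auto)
qed

lemma fib_topspace: "e:fib t==>t:topspace T"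
 using proj_closed by blast

lemma sc_closed: assumes "e:fib t" shows "sc c e:fib t"
proof -
 obtain k where "!!z. k z:fib t" "!!z w. sc w (k z)=k (w * z)" "\<exists>z. e=k z"
  using fib_triv[OF fib_topspace[OF assms]] assms by metis
 then show ?thesis by metis
qed

lemma sc_sc: assumes "e:fib t" shows "sc c (sc d e)=sc (c * d) e"
proof -
 obtain k where "!!z w. sc w (k z)=k (w * z)" "\<exists>z. e=k z"
  using fib_triv[OF fib_topspace[OF assms]] assms by metis
 then show ?thesis by (metis mult.assoc)
qed

lemma sc_one: assumes "e:fib t" shows "sc 1 e=e"
proof -
 obtain k where "!!z w. sc w (k z)=k (w * z)" "\<exists>z. e=k z"
  using fib_triv[OF fib_topspace[OF assms]] assms by metis
 then show ?thesis by (metis mult_1)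
qed

lemma sc_zero_eq: assumes "e:fib t" "e':fib t" shows "sc 0 e=sc 0 e'"
proof -
 obtain k where "!!z w. sc w (k z)=k (w * z)" "\<exists>z. e=k z" "\<exists>z. e'=k z"
  using fib_triv[OF fib_topspace[OF assms(1)]] assms by metis
 then show ?thesis by (metis mult_zero_left)
qed

lemma nz_basis: assumes "e:fib t" "nz e" "e':fib t" shows "\<exists>c. e'=sc c e"
proof -
 obtain k where k: "!!z w. sc w (k z)=k (w * z)" "!!z w. k z=k w\<longleftrightarrow>z=w" "\<exists>z. e=k z" "\<exists>z. e'=k z"
  using fib_triv[OF fib_topspace[OF assms(1)]] assms by metis
 then obtain z w where zw: "e=k z" "e'=k w" by blast
 then have "z\<noteq>0" using assms(2) k(1) by auto
 then have "e'=sc (w / z) e" using zw k(1) by simp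
 then show ?thesis ..
qed

lemma nz_exists: assumes "t:topspace T" shows "\<exists>e\<in>fib t. nz e"
proof (rule fib_triv[OF assms])
 fix k assume k: "!!z. k z:fib t" "!!z w. sc w (k z)=k (w * z)" "!!z w. k z=k w\<longleftrightarrow>z=w"
 have "nz (k 1)" by (simp add: k(2,3))
 then show ?thesis using k(1) by blast
qed

lemma scale_continuous:
 assumes V: "openin T V" and s: "continuous_map (subtopology T V) (tspace E) s" "!!t. t:V==>proj E (s t)=t"
  and f: "continuous_map (subtopology T V) euclidean f"
 shows "continuous_map (subtopology T V) (tspace E) (%t. sc (f t) (s t))"
proof (rule continuous_map_locally)
 fix t assume t: "t:topspace (subtopology T V)"
 then have "t:topspace T" by simp
 then obtain U kappa where U: "local_triv T E U kappa" "t:U" using line_bundle_local_triv[OF line_bundle] by blast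
 note tr = local_trivD[OF U(1)]
 let ?W = "U\<inter>V"
 have sub: "subtopology (subtopology T V) ?W=subtopology T ?W"
  by (simp add: subtopology_subtopology inf.absorb2 Int_commute)
 have sW: "continuous_map (subtopology T ?W) (tspace E) s" and fW: "continuous_map (subtopology T ?W) euclidean f"
  using s(1) f by (auto intro: continuous_map_from_subtopology_mono)
 obtain g where g: "continuous_map (subtopology T ?W) euclidean g" "!!x. x:?W==>s x=kappa (x, g x)"
  using tr(3)[OF _ sW] s(2) by auto
 have "continuous_map (subtopology T ?W) (tspace E) (%x. kappa (x, f x * g x))"
  by (intro tr(2) continuous_map_mult_complex fW g) auto
 then have "continuous_map (subtopology T ?W) (tspace E) (%t. sc (f t) (s t))"
  by (rule continuous_map_cong_on) (simp add: g(2) tr(6))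
 then show "\<exists>W. openin (subtopology T V) W&t:W&continuous_map (subtopology (subtopology T V) W) (tspace E) (%t. sc (f t) (s t))"
  using U(2) t tr(1) by (intro exI[of _ ?W]) (auto simp: sub openin_subtopology)
qed

lemma sections_iff: "s:sections T E\<longleftrightarrow>s:extensional (topspace T)&continuous_map T (tspace E) s&(\<forall>t\<in>topspace T. s t:fib t)"
 by (auto simp: sections_def continuous_map_def)

lemma section_fib: "[|s:sections T E; t:topspace T|]==>s t:fib t"
 by (auto simp: sections_iff)

lemma section_scale:
 assumes "s:sections T E" "f:carrier (cfun_alg T)" shows "(\<lambda>t\<in>topspace T. sc (f t) (s t)):sections T E"
 unfolding sections_iff
proof (intro conjI ballI)
 have "continuous_map (subtopology T (topspace T)) (tspace E) (%t. sc (f t) (s t))"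
  using assms by (intro scale_continuous) (auto simp: sections_iff cfun_carrier)
 then show "continuous_map T (tspace E) (\<lambda>t\<in>topspace T. sc (f t) (s t))" by simp
qed (use assms sc_closed[OF section_fib] in auto)

text \<open>The zero section; the choice is immaterial by \<open>sc_zero_eq\<close>.\<close>

definition "zs=(\<lambda>t\<in>topspace T. sc 0 (SOME e. e:fib t))"

lemma zs_eq: assumes "e:fib t" shows "zs t=sc 0 e"
proof -
 have "(SOME e. e:fib t):fib t" using assms by (rule someI)
 then show ?thesis using sc_zero_eq[OF _ assms] fib_topspace[OF assms] by (simp add: zs_def)
qed

text \<open>Continuity is local: on \<open>U\<close> the formula is a scaled section, and a point
  outside \<open>U\<close> has a neighbourhood avoiding the closed set \<open>K\<close>, where the
  result is the zero section.\<close>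

lemma bump_section:
 assumes phi: "continuous_map T euclidean phi" and U: "openin T U" and K: "closedin T K" "K\<subseteq>U"
  and z: "!!t. t:topspace T - K==>phi t=0"
  and s: "continuous_map (subtopology T U) (tspace E) s" "!!t. t:U==>proj E (s t)=t"
 shows "(\<lambda>t\<in>topspace T. if t:U then sc (phi t) (s t) else zs t):sections T E"
proof -
 let ?s = "%t. if t:U then sc (phi t) (s t) else zs t"
 have UT: "U\<subseteq>topspace T" using U by (rule openin_subset)
 have sf: "s t:fib t" if "t:U" for t
  using s(2) that UT continuous_map_mem[OF s(1), of t] by auto
 have zf: "zs t:fib t" if t: "t:topspace T" for t
 proof -
  obtain e where e: "e:fib t" using nz_exists[OF t] by blast
  show ?thesis using sc_closed[OF e, of 0] unfolding zs_eq[OF e] .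
 qed
 have out: "?s t=zs t" if "t:topspace T - K" for t
  using z[OF that] zs_eq[OF sf[of t]] by simp
 have "continuous_map T (tspace E) ?s"
 proof (rule continuous_map_locally)
  fix t assume t: "t:topspace T"
  show "\<exists>V. openin T V&t:V&continuous_map (subtopology T V) (tspace E) ?s"
  proof (cases "t:U")
   case True
   have "continuous_map (subtopology T U) (tspace E) (%t. sc (phi t) (s t))"
    by (rule scale_continuous[OF U s]) (auto intro: continuous_map_from_subtopology phi)
   then have "continuous_map (subtopology T U) (tspace E) ?s" by (rule continuous_map_cong_on) simp
   then show ?thesis using U True by blast
  next
   case False
   obtain U' kappa where U': "local_triv T E U' kappa" "t:U'" using line_bundle_local_triv[OF line_bundle t] by blast
   note tr = local_trivD[OF U'(1)]
   let ?V = "U' - K"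
   have "continuous_map (subtopology T ?V) (tspace E) (%x. kappa (x, 0))" by (rule tr(2)) auto
   then have "continuous_map (subtopology T ?V) (tspace E) ?s"
   proof (rule continuous_map_cong_on)
    fix x assume x: "x:?V"
    then have x': "x:U'" "x:topspace T - K" using openin_subset[OF tr(1)] by auto
    have "zs x=sc 0 (kappa (x, 0))" by (rule zs_eq) (simp add: tr(4,5)[OF x'(1)])
    then have "zs x=kappa (x, 0)" unfolding tr(6)[OF x'(1)] by simp
    then show "kappa (x, 0)=?s x" using out[OF x'(2)] by (simp only:)
   qed
   moreover have "openin T ?V" "t:?V" using openin_diff[OF tr(1) K(1)] U'(2) K(2) False by blast+
   ultimately show ?thesis by blast
  qed
 qed
 then show ?thesis
  unfolding sections_iff using sc_closed[OF sf] zf by auto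
qed

end

lemma bump_function:
 assumes "compact_space T" "Hausdorff_space T" "openin T U" "t:U"
 shows "\<exists>phi K. continuous_map T euclidean (phi :: 't=>complex)&phi t=1&closedin T K&K\<subseteq>U&(\<forall>x\<in>topspace T - K. phi x=0)"
proof -
 have t: "t:topspace T" using assms(3,4) openin_subset by blast
 have "normal_space T" using assms by (simp add: compact_Hausdorff_or_regular_imp_normal_space)
 moreover have "closedin T (topspace T - U)" "closedin T {t}" "disjnt (topspace T - U) {t}"
  using assms t by (auto simp: closedin_Hausdorff_singleton)
 ultimately obtain f where f: "continuous_map T euclideanreal f" "f ` (topspace T - U)\<subseteq>{0}" "f ` {t}\<subseteq>{1 :: real}"
  by (rule Urysohn_lemma_alt)
 \<comment> \<open>Urysohn's function is only known to vanish off \<open>U\<close>. Cutting it at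
   1/2 makes \<open>phi\<close> vanish off the closed set where it is at least 1/2, and keeps the
   value 1 at \<open>t\<close>.\<close>
 define phi where "phi=complex_of_real\<circ>((%y. max 0 (2 * y - 1))\<circ>f)"
 have "continuous_map T euclidean phi"
  unfolding phi_def
  by (intro continuous_map_compose[OF continuous_map_compose[OF f(1)]])
   (auto simp: continuous_map_iff_continuous2 intro!: continuous_intros)
 moreover have "closedin T {x:topspace T. f x:{1/2..}}"
  by (rule closedin_continuous_map_preimage[OF f(1)]) simp
 moreover have "{x:topspace T. f x:{1/2..}}\<subseteq>U" using f(2) by force
 moreover have "phi t=1" using f(3) by (simp add: phi_def)
 ultimately show ?thesis
  by (intro exI[of _ phi] exI[of _ "{x:topspace T. f x:{1/2..}}"]) (auto simp: phi_def)
qed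

text \<open>A local section extends after multiplication by a bump; the factor \<open>phi\<close> is
  reported so that it can be divided out near \<open>t\<close>.\<close>

lemma (in lbundle) section_through:
 assumes "compact_space T" "Hausdorff_space T" and U: "openin T U" "t:U"
  and \<sigma>: "continuous_map (subtopology T U) (tspace E) \<sigma>" "!!x. x:U==>proj E (\<sigma> x)=x"
 shows "\<exists>s\<in>sections T E. \<exists>phi. continuous_map T euclidean phi&phi t=1&(\<forall>x\<in>U. s x=sc (phi x) (\<sigma> x))"
proof -
 obtain phi K where phi: "continuous_map T euclidean (phi :: 't=>complex)" "phi t=1" "closedin T K" "K\<subseteq>U"
  "!!x. x:topspace T - K==>phi x=0"
  using bump_function[OF assms(1-4)] by blast
 have "U\<subseteq>topspace T" using U(1) by (rule openin_subset)
 then show ?thesis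
  using bump_section[OF phi(1) U(1) phi(3,4,5) \<sigma>] phi(1,2)
  by (intro bexI[of _ "\<lambda>t\<in>topspace T. if t:U then sc (phi t) (\<sigma> t) else zs t"] exI[of _ phi]) auto
qed

lemma (in lbundle) local_frame:
 assumes "e:fib t"
 shows "\<exists>U \<sigma>. openin T U&t:U&continuous_map (subtopology T U) (tspace E) \<sigma>&(\<forall>x\<in>U. \<sigma> x:fib x)
&(nz e\<longrightarrow>(\<forall>x\<in>U. nz (\<sigma> x)))&\<sigma> t=e"
proof -
 obtain U kappa where U: "local_triv T E U kappa" "t:U" using line_bundle_local_triv[OF line_bundle fib_topspace[OF assms]] by blast
 note tr = local_trivD[OF U(1)]
 obtain z where z: "e=kappa (t, z)" using tr(8)[of e] assms U(2) by auto
 have "z\<noteq>0" if "nz e" using that U(2) by (auto simp: z tr(6))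
 then have "nz (kappa (x, z))" if "nz e" "x:U" for x using that by (auto simp: tr(6,7))
 then show ?thesis
  using tr(1) U(2) tr(2)[of U "%x. z"] tr(4,5) by (intro exI[of _ U] exI[of _ "%x. kappa (x, z)"]) (auto simp: z)
qed

lemma (in lbundle) section_value:
 assumes "compact_space T" "Hausdorff_space T" "e:fib t" shows "\<exists>s\<in>sections T E. s t=e"
proof -
 obtain U \<sigma> where U: "openin T U" "t:U" "continuous_map (subtopology T U) (tspace E) \<sigma>"
  "!!x. x:U==>\<sigma> x:fib x" "\<sigma> t=e"
  using local_frame[OF assms(3)] by blast
 have "!!x. x:U==>proj E (\<sigma> x)=x" using U(4) by blast
 then obtain s phi where s: "s:sections T E" "phi t=1" "\<forall>x\<in>U. s x=sc (phi x) (\<sigma> x)"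
  using section_through[OF assms(1,2) U(1,2,3)] by blast
 then have "s t=sc 1 e" using U(2,5) by simp
 then show ?thesis using s(1) sc_one[OF assms(3)] by auto
qed

lemma hermitian_metricD:
 assumes "hermitian_metric E h"
 shows "[|e:topspace (tspace E); e':topspace (tspace E); proj E e=proj E e'|]==>h e' e=cnj (h e e')"
  and "[|e:topspace (tspace E); e':topspace (tspace E); proj E e=proj E e'|]==>h e (fscale E c e')=c * h e e'"
  and "[|e:topspace (tspace E); e\<noteq>fscale E 0 e|]==>0 < Re (h e e)"
proof -
 note m = assms[unfolded hermitian_metric_def, THEN conjunct2]
 have a: "h e' e=cnj (h e e')&(\<forall>c. h e (fscale E c e')=c * h e e')"
  if "e:topspace (tspace E)" "e':topspace (tspace E)" "proj E e=proj E e'"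
  using m[THEN conjunct1, THEN bspec, THEN bspec, THEN mp, of e e'] that by simp
 show "[|e:topspace (tspace E); e':topspace (tspace E); proj E e=proj E e'|]==>h e' e=cnj (h e e')"
  using a by blast
 show "[|e:topspace (tspace E); e':topspace (tspace E); proj E e=proj E e'|]==>h e (fscale E c e')=c * h e e'"
  using a by blast
 show "[|e:topspace (tspace E); e\<noteq>fscale E 0 e|]==>0 < Re (h e e)"
  using m[THEN conjunct2, THEN bspec, THEN mp, of e] by simp
qed

lemma hermitian_metric_continuous:
 assumes metric: "hermitian_metric E h" and "continuous_map Z (tspace E) s" "continuous_map Z (tspace E) s'" "!!z. z:topspace Z==>proj E (s z)=proj E (s' z)"
 shows "continuous_map Z euclidean (%z. h (s z) (s' z))"
proof -
 have "continuous_map Z (subtopology (prod_topology (tspace E) (tspace E)) {(e, e'). proj E e=proj E e'}) (%z. (s z, s' z))"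
  using assms by (auto simp: continuous_map_in_subtopology continuous_map_paired)
 from continuous_map_compose[OF this metric[unfolded hermitian_metric_def, THEN conjunct1]] show ?thesis
  by (simp add: o_def)
qed

locale metric_bundle = lbundle T E for T :: "'t topology" and E :: "('t, 'e) cbundle" +
 fixes h :: "'e=>'e=>complex"
 assumes metric: "hermitian_metric E h" and compact: "compact_space T" and Hausdorff: "Hausdorff_space T"
begin

lemma h_herm: "[|e:fib t; e':fib t|]==>h e' e=cnj (h e e')"
 and h_scale: "[|e:fib t; e':fib t|]==>h e (sc c e')=c * h e e'"
 and h_pos: "[|e:fib t; nz e|]==>0 < Re (h e e)"
 by (rule hermitian_metricD[OF metric]; simp)+

lemma h_scale_left: "[|e:fib t; e':fib t|]==>h (sc c e) e'=cnj c * h e e'"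
 using h_herm[of e' t "sc c e"] h_herm[of e t e'] h_scale[of e' t e c] sc_closed[of e t c] by simp

lemma h_nz: "[|e:fib t; nz e|]==>h e e\<noteq>0"
 using h_pos by force

lemma h_eqI:
 assumes e: "e1:fib t" "e2:fib t" and eq: "!!e. e:fib t==>h e1 e=h e2 e" shows "e1=e2"
proof -
 obtain e where n: "e:fib t" "nz e" using nz_exists[OF fib_topspace[OF e(1)]] by blast
 obtain c d where cd: "e1=sc c e" "e2=sc d e" using nz_basis[OF n] e by metis
 have "cnj c * h e e=cnj d * h e e" using eq[OF n(1)] n(1) by (simp add: cd h_scale_left)
 then have "c=d" using h_nz[OF n] by simp
 then show ?thesis using cd by simp
qed

end

lemma section_corr_simps [simp]:
 "carrier (section_corr T E h)=sections T E"
 "hleft (section_corr T E h) f s=(\<lambda>t\<in>topspace T. fscale E (f t) (s t))"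
 "hright (section_corr T E h) s f=(\<lambda>t\<in>topspace T. fscale E (f t) (s t))"
 "hip (section_corr T E h) s s'=(\<lambda>t\<in>topspace T. h (s t) (s' t))"
 by (simp_all add: section_corr_def)

section \<open>Frames for modules isomorphic to section modules\<close>

locale section_iso = metric_bundle T E h + X: correspondence "cfun_alg T" "cfun_alg T" X
 for T :: "'t topology" and E :: "('t, 'e) cbundle" and h and X :: "('t=>complex, 't=>complex, 'x) corr" +
 fixes u :: "'x=>'t=>'e" and v
 assumes iso: "iso3 (cfun_alg T) (cfun_alg T) X (section_corr T E h) u v"
begin

abbreviation "C\<equiv>cfun_alg T"

declare cfun_alg_simps [simp del]

lemma uv: "x:carrier X==>u x:sections T E" "s:sections T E==>v s:carrier X"
 "x:carrier X==>v (u x)=x" "s:sections T E==>u (v s)=s"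
 using iso by (auto simp: iso3_def mor3_def)

lemma u_right: "[|x:carrier X; f:carrier C; t:topspace T|]==>u (hright X x f) t=sc (f t) (u x t)"
 using iso by (auto simp: iso3_def mor3_def)

lemma v_right: "[|s:sections T E; f:carrier C|]==>v (\<lambda>t\<in>topspace T. sc (f t) (s t))=hright X (v s) f"
 using iso by (auto simp: iso3_def mor3_def)

lemma u_fib: "[|x:carrier X; t:topspace T|]==>u x t:fib t"
 using section_fib uv(1) .

lemma u_adjoint: "\<exists>w. (\<forall>s\<in>sections T E. w s:carrier X) &
  (\<forall>x\<in>carrier X. \<forall>s\<in>sections T E. \<forall>t\<in>topspace T. h (u x t) (s t)=hip X x (w s) t)"
proof -
 obtain w where "\<forall>s\<in>sections T E. w s:carrier X"
  "\<forall>x\<in>carrier X. \<forall>s\<in>sections T E. hip (section_corr T E h) (u x) s=hip X x (w s)"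
  using iso3_adjoint(1)[OF iso] unfolding section_corr_simps(1) by blast
 moreover have "hip (section_corr T E h) s s' t=h (s t) (s' t)" if "t:topspace T" for s s' t
  using that by simp
 ultimately show ?thesis by metis
qed

lemma v_adjoint: "\<exists>w. (\<forall>x\<in>carrier X. w x:sections T E) &
  (\<forall>s\<in>sections T E. \<forall>x\<in>carrier X. \<forall>t\<in>topspace T. hip X (v s) x t=h (s t) (w x t))"
proof -
 obtain w where "\<forall>x\<in>carrier X. w x:sections T E"
  "\<forall>s\<in>sections T E. \<forall>x\<in>carrier X. hip X (v s) x=hip (section_corr T E h) s (w x)"
  using iso3_adjoint(2)[OF iso] by auto
 then show ?thesis by (intro exI[of _ w]) auto
qed

text \<open>Fibres are one-dimensional, so at each point the images of \<open>x\<close> and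
  \<open>z\<close> are multiples of one vector. As \<open>u\<close> need not preserve inner
  products, those with \<open>y\<close> are first written through the adjoint \<open>w\<close> of
  \<open>v\<close>.\<close>

lemma rank_one:
 assumes x: "x:carrier X" and y: "y:carrier X" and z: "z:carrier X"
 shows "hright X x (hip X y z)=hright X z (hip X y x)"
proof -
 obtain w where w: "w x:sections T E" "!!s x t. [|s:sections T E; x:carrier X; t:topspace T|]==>hip X (v s) x t=h (s t) (w x t)"
  "!!x. x:carrier X==>w x:sections T E"
  using v_adjoint x by metis
 have c: "hright X x (hip X y z):carrier X" "hright X z (hip X y x):carrier X"
  using assms by (simp_all add: X.right_closed X.ip_closed)
 have ip: "hip X y x t=h (w y t) (u x t)" if x: "x:carrier X" and t: "t:topspace T" for x t
 proof -
  have "hip X y x t=cnj (hip X x y t)" using X.ip_adj[OF x y, symmetric] t by (simp add: cfun_alg_simps)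
  also have "hip X x y t=h (u x t) (w y t)" using w(2)[OF uv(1)[OF x] y t] uv(3)[OF x] by simp
  also have "cnj ...=h (w y t) (u x t)"
   using h_herm[OF u_fib[OF x t] section_fib[OF w(3)[OF y] t]] by simp
  finally show ?thesis .
 qed
 have "u (hright X x (hip X y z))=u (hright X z (hip X y x))"
 proof (rule extensionalityI[of _ "topspace T"])
  fix t assume t: "t:topspace T"
  obtain e where n: "e:fib t" "nz e" using nz_exists[OF t] by blast
  obtain a b where ab: "u x t=sc a e" "u z t=sc b e"
   using nz_basis[OF n u_fib[OF x t]] nz_basis[OF n u_fib[OF z t]] by blast
  note wf = section_fib[OF w(3)[OF y] t]
  have "u (hright X x (hip X y z)) t=sc (h (w y t) (sc b e)) (sc a e)"
   using x y z t by (simp add: u_right X.ip_closed ip ab)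
  also have "...=sc (h (w y t) (sc a e)) (sc b e)"
   using h_scale[OF wf n(1)] sc_sc[OF n(1)] by (simp add: mult.commute mult.left_commute)
  also have "...=u (hright X z (hip X y x)) t"
   using x y z t by (simp add: u_right X.ip_closed ip ab)
  finally show "u (hright X x (hip X y z)) t=u (hright X z (hip X y x)) t" .
 qed (use uv(1) c in \<open>auto simp: sections_iff\<close>)
 then show ?thesis using uv(3) c by metis
qed

text \<open>Adjointability gives \<open>x\<close> and \<open>y\<close> whose pairing is nonzero at
  \<open>t\<close>. By \<open>rank_one\<close> the product of their squared lengths is the squared
  modulus of this pairing, so \<open>x\<close> itself has nonzero length there.\<close>

lemma exists_nonzero: assumes t: "t:topspace T" shows "\<exists>x\<in>carrier X. hip X x x t\<noteq>0"
proof -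
 obtain e where n: "e:fib t" "nz e" using nz_exists[OF t] by blast
 obtain s where s: "s:sections T E" "s t=e" using section_value[OF compact Hausdorff n(1)] by blast
 obtain w where w: "w s:carrier X" "h (u (v s) t) (s t)=hip X (v s) (w s) t"
  using u_adjoint s uv(2) t by metis
 define x y where "x=v s" and "y=w s"
 have x: "x:carrier X" and y: "y:carrier X" using uv(2) s(1) w(1) by (simp_all add: x_def y_def)
 have nz: "hip X x y t\<noteq>0" using w(2) h_nz[OF n] s uv(4) by (simp add: x_def y_def)
 have "hip X x (hright X x (hip X y y))=hip X x (hright X y (hip X y x))" using rank_one[OF x y y] by simp
 then have "hip X x x\<otimes>\<^bsub>C\<^esub> hip X y y=hip X x y\<otimes>\<^bsub>C\<^esub> hip X y x"
  using x y by (simp add: X.ip_right X.ip_closed)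
 then have "(hip X x x\<otimes>\<^bsub>C\<^esub> hip X y y) t=(hip X x y\<otimes>\<^bsub>C\<^esub> hip X y x) t" by simp
 moreover have "hip X y x t=cnj (hip X x y t)" using X.ip_adj[OF x y, symmetric] t by (simp add: cfun_alg_simps)
 ultimately have "hip X x x t\<noteq>0" using nz t by (auto simp: cfun_alg_simps)
 then show ?thesis using x by blast
qed

end

text \<open>Finitely many vectors have no common zero by compactness. Dividing them by the root of
  \<open>g\<close>, the sum of their squared lengths, gives a frame: each term of the expansion is
  \<open>y\<close> times a normalised squared length, and these add up to 1.\<close>

lemma (in section_iso) frame_exists:
 "\<exists>(xi :: nat=>'x) n. (\<forall>i<n. xi i:carrier X) &
  (\<forall>x\<in>carrier X. finsum X (%i. hright X (xi i) (hip X (xi i) x)) {..<n}=x)"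
proof -
 define N where "N x={t:topspace T. hip X x x t:- {0}}" for x
 have N: "openin T (N x)" if "x:carrier X" for x
  unfolding N_def by (rule openin_continuous_map_preimage) (use X.ip_closed[OF that that] in "auto simp: cfun_carrier")
 have "topspace T\<subseteq>\<Union>(N ` carrier X)" using exists_nonzero by (auto simp: N_def)
 then obtain \<F> where "finite \<F>" "\<F>\<subseteq>N ` carrier X" "topspace T\<subseteq>\<Union>\<F>"
  using compact N unfolding compact_space_alt by (metis (no_types, lifting) imageE)
 then obtain G where G: "finite G" "G\<subseteq>carrier X" "topspace T\<subseteq>\<Union>(N ` G)"
  using finite_subset_image[of \<F> N "carrier X"] by metis
 obtain x :: "nat=>'x" and n where n: "G=x ` {..<n}"
  using finite_imp_nat_seg_image_inj_on[OF G(1)] by (metis lessThan_def)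
 have x: "x i:carrier X" if "i < n" for i using that n G(2) by auto
 define g where "g=finsum C (%i. hip X (x i) (x i)) {..<n}"
 have ipc: "hip X (x i) (x i):carrier C" if "i < n" for i using x[OF that] by (simp add: X.ip_closed)
 have gc: "g:carrier C" unfolding g_def using ipc by (intro X.A.nv.finsum_closed') simp
 have gt: "g t=(\<Sum>i<n. hip X (x i) (x i) t)" if "t:topspace T" for t
  unfolding g_def using ipc that by (rule cfun_finsum[OF compact])
 have pos: "hip X (x i) (x i) t=complex_of_real (Re (hip X (x i) (x i) t))&0<=Re (hip X (x i) (x i) t)"
  if i: "i < n" and t: "t:topspace T" for i t
 proof -
  obtain b where "b:carrier C" "hip X (x i) (x i)=adj C b\<otimes>\<^bsub>C\<^esub> b" using X.ip_pos[OF x[OF i]] by blast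
  then have "hip X (x i) (x i) t=(adj C b\<otimes>\<^bsub>C\<^esub> b) t" by (simp only:)
  also have "...=cnj (b t) * b t" using t by (simp add: cfun_alg_simps)
  also have "...=complex_of_real ((cmod (b t))\<^sup>2)" by (metis complex_norm_square mult.commute)
  finally show ?thesis by simp
 qed
 have g_pos: "g t=complex_of_real (Re (g t))&0 < Re (g t)" if t: "t:topspace T" for t
 proof -
  obtain i where i: "i < n" "hip X (x i) (x i) t\<noteq>0" using G(3) t n by (force simp: N_def)
  have "g t=complex_of_real (\<Sum>i<n. Re (hip X (x i) (x i) t))"
   unfolding gt[OF t] of_real_sum using pos t by (intro sum.cong) auto
  moreover have "0 < (\<Sum>i<n. Re (hip X (x i) (x i) t))"
  proof (rule sum_pos2[of _ i])
   show "0 < Re (hip X (x i) (x i) t)" using pos[OF i(1) t] i(2) by (metis less_eq_real_def of_real_0)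
  qed (use i pos t in auto)
  ultimately show ?thesis by simp
 qed
 define r where "r=(\<lambda>t\<in>topspace T. complex_of_real (1 / sqrt (Re (g t))))"
 have rt: "r t * r t * g t=1" "cnj (r t)=r t" if "t:topspace T" for t
 proof -
  note gr = conjunct1[OF g_pos[OF that]] and p = conjunct2[OF g_pos[OF that]]
  have "r t * r t * g t=complex_of_real (1 / sqrt (Re (g t)) * (1 / sqrt (Re (g t))) * Re (g t))"
   by (simp only: r_def restrict_apply'[OF that] of_real_mult gr[symmetric])
  also have "1 / sqrt (Re (g t)) * (1 / sqrt (Re (g t))) * Re (g t)=1" using p by (simp add: field_simps)
  finally show "r t * r t * g t=1" by simp
 qed (simp add: r_def that)
 have "continuous_map T euclidean (%t. inverse (complex_of_real (sqrt (Re (g t)))))"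
 proof (rule continuous_map_inverse_complex)
  have "continuous_map T euclidean ((%z. complex_of_real (sqrt (Re z)))\<circ>g)"
   using gc by (intro continuous_map_compose[of T euclidean g])
    (auto simp: cfun_carrier continuous_map_iff_continuous2 intro!: continuous_intros)
  then show "continuous_map T euclidean (%t. complex_of_real (sqrt (Re (g t))))" by (simp add: o_def)
 qed (use g_pos in force)
 then have rc: "r:carrier C"
  unfolding r_def by (intro cfun_restrict_closed) (simp add: divide_inverse)
 define xi where "xi i=hright X (x i) r" for i
 have xi: "xi i:carrier X" if "i < n" for i using x[OF that] rc by (simp add: xi_def X.right_closed)
 have "finsum X (%i. hright X (xi i) (hip X (xi i) y)) {..<n}=y" if y: "y:carrier X" for y
 proof -
  have "hright X (xi i) (hip X (xi i) y)=hright X y (hip X (x i) (x i)\<otimes>\<^bsub>C\<^esub> (r\<otimes>\<^bsub>C\<^esub> r))" if i: "i < n" for i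
  proof -
   note xi = x[OF i]
   have ra: "adj C r=r" by (rule cfun_eqI[OF cfun_adj_closed[OF compact rc] rc]) (simp add: cfun_alg_simps rt(2))
   have "hright X (xi i) (hip X (xi i) y)=hright X (x i) (r\<otimes>\<^bsub>C\<^esub> (r\<otimes>\<^bsub>C\<^esub> hip X (x i) y))"
    using xi rc y by (simp add: xi_def X.ip_right_left ra X.right_mult X.ip_closed)
   also have "r\<otimes>\<^bsub>C\<^esub> (r\<otimes>\<^bsub>C\<^esub> hip X (x i) y)=hip X (x i) y\<otimes>\<^bsub>C\<^esub> (r\<otimes>\<^bsub>C\<^esub> r)"
    by (simp add: cfun_alg_simps mult_ac cong: restrict_cong)
   also have "hright X (x i) (hip X (x i) y\<otimes>\<^bsub>C\<^esub> (r\<otimes>\<^bsub>C\<^esub> r))=hright X (hright X (x i) (hip X (x i) y)) (r\<otimes>\<^bsub>C\<^esub> r)"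
    using xi rc y by (simp add: X.right_mult X.ip_closed)
   \<comment> \<open>\<open>rank_one\<close> trades the inner product with \<open>y\<close> for the
     squared length of \<open>x i\<close>.\<close>
   also have "...=hright X (hright X y (hip X (x i) (x i))) (r\<otimes>\<^bsub>C\<^esub> r)" using rank_one[OF xi xi y] by simp
   also have "...=hright X y (hip X (x i) (x i)\<otimes>\<^bsub>C\<^esub> (r\<otimes>\<^bsub>C\<^esub> r))"
    using xi rc y X.right_mult[OF y ipc[OF i], of "r\<otimes>\<^bsub>C\<^esub> r"] by simp
   finally show ?thesis .
  qed
  then have "finsum X (%i. hright X (xi i) (hip X (xi i) y)) {..<n}=finsum X (%i. hright X y (hip X (x i) (x i)\<otimes>\<^bsub>C\<^esub> (r\<otimes>\<^bsub>C\<^esub> r))) {..<n}"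
   using y rc ipc by (intro X.Xn.fs_cong) (auto simp: X.right_closed)
  also have "...=hright X y (finsum C (%i. hip X (x i) (x i)\<otimes>\<^bsub>C\<^esub> (r\<otimes>\<^bsub>C\<^esub> r)) {..<n})"
   using y rc ipc by (intro X.hright_finsum[symmetric]) auto
  also have "finsum C (%i. hip X (x i) (x i)\<otimes>\<^bsub>C\<^esub> (r\<otimes>\<^bsub>C\<^esub> r)) {..<n}=\<one>\<^bsub>C\<^esub>"
  proof (rule cfun_eqI)
   fix t assume t: "t:topspace T"
   have "finsum C (%i. hip X (x i) (x i)\<otimes>\<^bsub>C\<^esub> (r\<otimes>\<^bsub>C\<^esub> r)) {..<n} t=(\<Sum>i<n. hip X (x i) (x i) t * (r t * r t))"
    using rc ipc t by (subst cfun_finsum[OF compact]) (auto, simp add: cfun_alg_simps)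
   also have "...=r t * r t * g t" by (simp add: gt[OF t] sum_distrib_left mult.commute)
   finally show "finsum C (%i. hip X (x i) (x i)\<otimes>\<^bsub>C\<^esub> (r\<otimes>\<^bsub>C\<^esub> r)) {..<n} t=\<one>\<^bsub>C\<^esub> t"
    using rt(1)[OF t] t by (simp add: cfun_alg_simps)
  qed (use rc ipc in "auto intro!: X.A.nv.finsum_closed'")
  finally show ?thesis using X.right_one[OF y] by simp
 qed
 then show ?thesis using xi by blast
qed

section \<open>Pullback bundles\<close>

lemma pullback_simps [simp]:
 "topspace (tspace (pullback_bundle S Psi E))={(s, e). s:topspace S&e:topspace (tspace E)&Psi s=proj E e}"
 "proj (pullback_bundle S Psi E)=fst" "fscale (pullback_bundle S Psi E) c (s, e)=(s, fscale E c e)"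
 by (auto simp: pullback_bundle_def)

lemma continuous_map_pullback:
 "continuous_map Z (tspace (pullback_bundle S Psi E)) f \<longleftrightarrow>
  continuous_map Z S (%z. fst (f z))&continuous_map Z (tspace E) (%z. snd (f z)) &
  (\<forall>z\<in>topspace Z. Psi (fst (f z))=proj E (snd (f z)))"
 by (auto simp: pullback_bundle_def continuous_map_in_subtopology continuous_map_pairwise o_def case_prod_unfold Pi_iff)

locale pullback = metric_bundle T E h
 for T :: "'t topology" and E :: "('t, 'e) cbundle" and h +
 fixes Phi Phiinv :: "'t=>'t" and h' :: "'t\<times>'e=>'t\<times>'e=>complex"
 assumes hom: "homeomorphic_maps T T Phi Phiinv" and metric': "hermitian_metric (pullback_bundle T Phiinv E) h'"
begin

abbreviation "PB\<equiv>pullback_bundle T Phiinv E"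

lemma hom_facts: "t:topspace T==>Phi t:topspace T" "t:topspace T==>Phiinv t:topspace T"
 "t:topspace T==>Phiinv (Phi t)=t" "t:topspace T==>Phi (Phiinv t)=t"
 "continuous_map T T Phi" "continuous_map T T Phiinv"
 using hom by (auto simp: homeomorphic_maps_def continuous_map_def)

lemma h'_scale:
 assumes "t:topspace T" "e:fib (Phiinv t)" "e':fib (Phiinv t)"
 shows "h' (t, sc c e) (t, sc d e')=cnj c * d * h' (t, e) (t, e')"
proof -
 note c = sc_closed[OF assms(2), of c] sc_closed[OF assms(3), of d]
 have "h' (t, sc c e) (t, sc d e')=d * cnj (h' (t, e') (t, sc c e))"
  using hermitian_metricD(2)[OF metric', of "(t, sc c e)" "(t, e')" d] hermitian_metricD(1)[OF metric', of "(t, e')" "(t, sc c e)"]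
   assms c by simp
 also have "...=cnj c * d * h' (t, e) (t, e')"
  using hermitian_metricD(2)[OF metric', of "(t, e')" "(t, e)" c] hermitian_metricD(1)[OF metric', of "(t, e')" "(t, e)"]
   assms by simp
 finally show ?thesis .
qed

text \<open>On a line any two Hermitian inner products are proportional, so the factor can be
  computed with any nonzero vector; a local frame shows that it is continuous.\<close>

lemma metric_ratio:
 "\<exists>rho\<in>carrier (cfun_alg T). (\<forall>t\<in>topspace T. rho t\<noteq>0 &
  (\<forall>e\<in>fib (Phiinv t). \<forall>e'\<in>fib (Phiinv t). h' (t, e) (t, e')=rho t * h e e'))"
proof -
 define rho where "rho t=(let e=SOME e. e:fib (Phiinv t)&nz e in h' (t, e) (t, e) / h e e)" for t
 have rho: "rho t\<noteq>0" "[|e:fib (Phiinv t); e':fib (Phiinv t)|]==>h' (t, e) (t, e')=rho t * h e e'"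
  if t: "t:topspace T" for t e e'
 proof -
  define e0 where "e0=(SOME e. e:fib (Phiinv t)&nz e)"
  have "\<exists>e. e:fib (Phiinv t)&nz e" using nz_exists[OF hom_facts(2)[OF t]] by blast
  from someI_ex[OF this] have e0: "e0:fib (Phiinv t)" "nz e0" unfolding e0_def by blast+
  have r: "rho t=h' (t, e0) (t, e0) / h e0 e0" by (simp add: rho_def e0_def Let_def)
  have "0 < Re (h' (t, e0) (t, e0))"
   using hermitian_metricD(3)[OF metric', of "(t, e0)"] t e0 by simp
  then show "rho t\<noteq>0" using h_nz[OF e0] by (auto simp: r)
  assume e: "e:fib (Phiinv t)" "e':fib (Phiinv t)"
  obtain c d where "e=sc c e0" "e'=sc d e0" using nz_basis[OF e0] e by metis
  then show "h' (t, e) (t, e')=rho t * h e e'"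
   using h'_scale[OF t e0(1) e0(1), of c d] h_scale_left[OF e0(1) sc_closed[OF e0(1)], of c d] h_scale[OF e0(1) e0(1), of d] h_nz[OF e0]
   by (simp add: r)
 qed
 have "continuous_map T euclidean rho"
 proof (rule continuous_map_locally)
  fix t0 assume t0: "t0:topspace T"
  obtain e0 where e0: "e0:fib (Phiinv t0)" "nz e0" using nz_exists[OF hom_facts(2)[OF t0]] by blast
  obtain U \<sigma> where U: "openin T U" "Phiinv t0:U" "continuous_map (subtopology T U) (tspace E) \<sigma>"
   "!!x. x:U==>\<sigma> x:fib x" "!!x. x:U==>nz (\<sigma> x)"
   using local_frame[OF e0(1)] e0(2) by blast
  define V where "V={t:topspace T. Phiinv t:U}"
  have V: "openin T V" unfolding V_def by (rule openin_continuous_map_preimage[OF hom_facts(6) U(1)])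
  have "continuous_map (subtopology T V) (subtopology T U) Phiinv"
   using hom_facts(6) by (auto simp: V_def continuous_map_in_subtopology continuous_map_from_subtopology)
  from continuous_map_compose[OF this U(3)]
  have \<sigma>: "continuous_map (subtopology T V) (tspace E) (%t. \<sigma> (Phiinv t))" by (simp add: o_def)
  have \<sigma>': "continuous_map (subtopology T V) (tspace PB) (%t. (t, \<sigma> (Phiinv t)))"
   unfolding continuous_map_pullback using \<sigma> U(4) by (auto simp: V_def continuous_map_from_subtopology)
  have "continuous_map (subtopology T V) euclidean
    (%t. h' (t, \<sigma> (Phiinv t)) (t, \<sigma> (Phiinv t)) * inverse (h (\<sigma> (Phiinv t)) (\<sigma> (Phiinv t))))"
  proof (intro continuous_map_mult_complex continuous_map_inverse_complex)
   show "h (\<sigma> (Phiinv t)) (\<sigma> (Phiinv t))\<noteq>0" if "t:topspace (subtopology T V)" for t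
    using that h_nz[OF U(4,5)] by (simp add: V_def)
  qed (use hermitian_metric_continuous[OF metric' \<sigma>' \<sigma>'] hermitian_metric_continuous[OF metric \<sigma> \<sigma>] in simp_all)
  then have "continuous_map (subtopology T V) euclidean rho"
  proof (rule continuous_map_cong_on)
   fix t assume "t:V"
   then have t: "t:topspace T" "Phiinv t:U" by (auto simp: V_def)
   show "h' (t, \<sigma> (Phiinv t)) (t, \<sigma> (Phiinv t)) * inverse (h (\<sigma> (Phiinv t)) (\<sigma> (Phiinv t)))=rho t"
    using rho(2)[OF t(1) U(4)[OF t(2)] U(4)[OF t(2)]] h_nz[OF U(4,5)[OF t(2)]] t(2) by simp
  qed
  then show "\<exists>V. openin T V&t0:V&continuous_map (subtopology T V) euclidean rho"
   using V t0 U(2) by (auto simp: V_def)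
 qed
 then have "restrict rho (topspace T):carrier (cfun_alg T)" by (rule cfun_restrict_closed)
 then show ?thesis using rho by (intro bexI[of _ "restrict rho (topspace T)"]) auto
qed

definition "pull s=(\<lambda>t\<in>topspace T. (t, s (Phiinv t)))" for s :: "'t=>'e"
definition "back r=(\<lambda>t\<in>topspace T. snd (r (Phi t)))" for r :: "'t=>'t\<times>'e"

lemma pull_apply [simp]: "t:topspace T==>pull s t=(t, s (Phiinv t))"
 and back_apply [simp]: "t:topspace T==>back r t=snd (r (Phi t))"
 by (simp_all add: pull_def back_def)

lemma pull_section: assumes s: "s:sections T E" shows "pull s:sections T PB"
proof -
 have "continuous_map T (tspace E) (%t. s (Phiinv t))"
  using continuous_map_compose[OF hom_facts(6), of "tspace E" s] s by (simp add: sections_iff o_def)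
 moreover have "s (Phiinv t):fib (Phiinv t)" if "t:topspace T" for t using section_fib[OF s hom_facts(2)[OF that]] .
 ultimately have "continuous_map T (tspace PB) (%t. (t, s (Phiinv t)))"
  unfolding continuous_map_pullback by simp
 then show ?thesis by (simp add: sections_def pull_def)
qed

lemma pb_section: assumes r: "r:sections T PB" and t: "t:topspace T" shows "r t=(t, snd (r t))" "snd (r t):fib (Phiinv t)"
proof -
 have m: "r t:topspace (tspace PB)"
  by (rule continuous_map_mem[OF _ t]) (use r in "simp add: sections_def")
 have f: "fst (r t)=t" using r t by (simp add: sections_def)
 show "r t=(t, snd (r t))" "snd (r t):fib (Phiinv t)" using m f by (cases "r t"; simp)+
qed

lemma back_section: assumes r: "r:sections T PB" shows "back r:sections T E"
proof -
 have "continuous_map T (tspace E) (%t. snd (r t))" using r by (simp add: sections_def continuous_map_pullback)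
 from continuous_map_compose[OF hom_facts(5) this]
 have "continuous_map T (tspace E) (back r)" by (simp add: o_def back_def)
 moreover have "back r t:fib t" if t: "t:topspace T" for t
  using pb_section(2)[OF r hom_facts(1)[OF t]] t by (simp add: hom_facts)
 ultimately show ?thesis unfolding sections_iff by (auto simp: back_def)
qed

lemma pull_back: assumes r: "r:sections T PB" shows "pull (back r)=r"
proof (rule extensionalityI[of _ "topspace T"])
 show "pull (back r) t=r t" if "t:topspace T" for t
  using pb_section(1)[OF r that] that by (simp add: hom_facts)
qed (use r in "simp_all add: pull_def sections_def")

lemma back_pull: assumes s: "s:sections T E" shows "back (pull s)=s"
 by (rule extensionalityI[of _ "topspace T"]) (use s in "simp_all add: hom_facts back_def sections_def")

end

section \<open>Twisted modules and sections of the pullback bundle\<close>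

text \<open>The interface between tensor products and bundles. Both actions on \<open>W\<close>
  correspond to the right action on \<open>X\<close>.\<close>

locale twisted =
 fixes T :: "'t topology" and Phi Phiinv :: "'t=>'t" and W :: "('t=>complex, 't=>complex, 'w) corr"
  and X :: "('t=>complex, 't=>complex, 'x) corr" and J :: "'w=>'x"
 assumes hom': "homeomorphic_maps T T Phi Phiinv"
  and J_bij: "bij_betw J (carrier W) (carrier X)"
  and W_ip: "[|z:carrier W; w:carrier W|]==>hip W z w=(\<lambda>t\<in>topspace T. hip X (J z) (J w) (Phiinv t))"
  and W_left: "[|z:carrier W; f:carrier (cfun_alg T)|]==>hleft W f z:carrier W&J (hleft W f z)=hright X (J z) (\<lambda>t\<in>topspace T. f (Phi t))"
  and W_right: "[|z:carrier W; f:carrier (cfun_alg T)|]==>hright W z f:carrier W&J (hright W z f)=hright X (J z) (\<lambda>t\<in>topspace T. f (Phi t))"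
begin

definition "K=inv_into (carrier W) J"

lemma JK: "z:carrier W==>J z:carrier X" "x:carrier X==>K x:carrier W"
 "z:carrier W==>K (J z)=z" "x:carrier X==>J (K x)=x"
 using J_bij by (auto simp: K_def bij_betw_def inv_into_into f_inv_into_f)

lemma J_eqI: "[|z:carrier W; w:carrier W; J z=J w|]==>z=w"
 using J_bij by (auto simp: bij_betw_def inj_on_def)

end

locale twisted_sections = twisted T Phi Phiinv W X J + section_iso T E h X u v + pullback T E h Phi Phiinv h'
 for T :: "'t topology" and Phi Phiinv :: "'t=>'t" and W :: "('t=>complex, 't=>complex, 'w) corr"
  and X :: "('t=>complex, 't=>complex, 'x) corr" and J :: "'w=>'x"
  and E :: "('t, 'e) cbundle" and h u v h'
begin

abbreviation "\<Gamma>\<equiv>section_corr T PB h'"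

definition "U1 z=pull (u (J z))"
definition "V1 r=K (v (back r))"

lemma un_carrier: "f:carrier C==>(\<lambda>t\<in>topspace T. f (Phi t)):carrier C"
 using continuous_map_compose[OF hom_facts(5), of euclidean f] by (simp add: cfun_carrier o_def)

lemma UV: "z:carrier W==>U1 z:sections T PB" "r:sections T PB==>V1 r:carrier W"
 "z:carrier W==>V1 (U1 z)=z" "r:sections T PB==>U1 (V1 r)=r"
 by (simp_all add: U1_def V1_def pull_section back_section JK uv back_pull pull_back)

lemma J_V1: "r:sections T PB==>J (V1 r)=v (back r)"
 by (simp add: V1_def JK uv back_section)

lemma U1_scale: assumes z: "z:carrier W" and f: "f:carrier C" and w: "J w=hright X (J z) (\<lambda>t\<in>topspace T. f (Phi t))"
 shows "U1 w=(\<lambda>t\<in>topspace T. fscale PB (f t) (U1 z t))"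
 by (rule extensionalityI[of _ "topspace T"])
  (use z f in "simp_all add: U1_def pull_def w u_right JK un_carrier hom_facts")

lemma V1_scale: assumes r: "r:sections T PB" and f: "f:carrier C"
 shows "J (V1 (\<lambda>t\<in>topspace T. fscale PB (f t) (r t)))=hright X (J (V1 r)) (\<lambda>t\<in>topspace T. f (Phi t))"
  and "(\<lambda>t\<in>topspace T. fscale PB (f t) (r t)):sections T PB"
proof -
 let ?g = "\<lambda>t\<in>topspace T. f (Phi t)" and ?r = "\<lambda>t\<in>topspace T. fscale PB (f t) (r t)"
 have b: "(\<lambda>t\<in>topspace T. sc (?g t) (back r t)):sections T E"
  using section_scale[OF back_section[OF r] un_carrier[OF f]] .
 have "fscale PB (f t) (r t)=(t, sc (f t) (snd (r t)))" if "t:topspace T" for t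
  by (subst pb_section(1)[OF r that]) simp
 then have p: "?r=pull (\<lambda>t\<in>topspace T. sc (?g t) (back r t))"
  unfolding pull_def by (intro restrict_ext) (simp add: hom_facts)
 show c: "?r:sections T PB" unfolding p using b by (rule pull_section)
 have "back ?r=(\<lambda>t\<in>topspace T. sc (?g t) (back r t))" unfolding p by (rule back_pull[OF b])
 then show "J (V1 ?r)=hright X (J (V1 r)) ?g"
  using c r v_right[OF back_section[OF r] un_carrier[OF f]] by (simp only: J_V1)
qed

text \<open>The adjoint is built from that of \<open>u\<close>, corrected by the ratio of
  \<open>h'\<close> to the pulled-back metric; for the inverse map the reciprocal of the ratio
  appears.\<close>

lemma U1_adjoint: "\<exists>w. w ` sections T PB\<subseteq>carrier W&(\<forall>z\<in>carrier W. \<forall>r\<in>sections T PB. hip \<Gamma> (U1 z) r=hip W z (w r))"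
proof -
 obtain rho where r: "rho:carrier C" "\<forall>t\<in>topspace T. rho t\<noteq>0 &
  (\<forall>e\<in>fib (Phiinv t). \<forall>e'\<in>fib (Phiinv t). h' (t, e) (t, e')=rho t * h e e')"
  using metric_ratio by blast
 have rho: "rho:carrier C" "!!t. t:topspace T==>rho t\<noteq>0"
  "!!t e e'. [|t:topspace T; e:fib (Phiinv t); e':fib (Phiinv t)|]==>h' (t, e) (t, e')=rho t * h e e'"
  using r by blast+
 obtain a where a0: "(\<forall>s\<in>sections T E. a s:carrier X) &
  (\<forall>x\<in>carrier X. \<forall>s\<in>sections T E. \<forall>t\<in>topspace T. h (u x t) (s t)=hip X x (a s) t)"
  using u_adjoint ..
 note a = a0[THEN conjunct1, rule_format] a0[THEN conjunct2, rule_format]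
 define y where "y r=hright X (a (back r)) (\<lambda>t\<in>topspace T. rho (Phi t))" for r
 have y: "y r:carrier X" if "r:sections T PB" for r
  using that rho(1) by (simp add: y_def X.right_closed a(1) back_section un_carrier)
 have "hip \<Gamma> (U1 z) r=hip W z (K (y r))" if z: "z:carrier W" and r: "r:sections T PB" for z r
 proof -
  have "h' (U1 z t) (r t)=hip X (J z) (y r) (Phiinv t)" if t: "t:topspace T" for t
  proof -
   note i = hom_facts(2)[OF t]
   have "h' (U1 z t) (r t)=h' (t, u (J z) (Phiinv t)) (t, snd (r t))"
    using t pb_section(1)[OF r t] by (simp add: U1_def)
   also have "...=rho t * h (u (J z) (Phiinv t)) (back r (Phiinv t))"
    using rho(3)[OF t u_fib[OF JK(1)[OF z] i] pb_section(2)[OF r t]] t i by (simp add: hom_facts)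
   also have "...=rho t * hip X (J z) (a (back r)) (Phiinv t)"
    using a(2)[OF JK(1)[OF z] back_section[OF r] i] by simp
   also have "...=hip X (J z) (y r) (Phiinv t)"
    unfolding y_def X.ip_right[OF JK(1)[OF z] a(1)[OF back_section[OF r]] un_carrier[OF rho(1)]]
    using t i by (simp add: cfun_alg_simps hom_facts)
   finally show ?thesis .
  qed
  then show ?thesis using z y[OF r] by (simp add: W_ip JK cong: restrict_cong)
 qed
 then show ?thesis using y JK(2) by (intro exI[of _ "%r. K (y r)"]) blast
qed

lemma V1_adjoint: "\<exists>w. w ` carrier W\<subseteq>sections T PB&(\<forall>r\<in>sections T PB. \<forall>z\<in>carrier W. hip W (V1 r) z=hip \<Gamma> r (w z))"
proof -
 obtain rho where r: "rho:carrier C" "\<forall>t\<in>topspace T. rho t\<noteq>0 &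
  (\<forall>e\<in>fib (Phiinv t). \<forall>e'\<in>fib (Phiinv t). h' (t, e) (t, e')=rho t * h e e')"
  using metric_ratio by blast
 have rho: "rho:carrier C" "!!t. t:topspace T==>rho t\<noteq>0"
  "!!t e e'. [|t:topspace T; e:fib (Phiinv t); e':fib (Phiinv t)|]==>h' (t, e) (t, e')=rho t * h e e'"
  using r by blast+
 obtain a where a0: "(\<forall>x\<in>carrier X. a x:sections T E) &
  (\<forall>s\<in>sections T E. \<forall>x\<in>carrier X. \<forall>t\<in>topspace T. hip X (v s) x t=h (s t) (a x t))"
  using v_adjoint ..
 note a = a0[THEN conjunct1, rule_format] a0[THEN conjunct2, rule_format]
 define g where "g=(\<lambda>t\<in>topspace T. inverse (rho t))"
 have g: "g:carrier C"
  unfolding g_def using rho(1,2) by (intro cfun_restrict_closed continuous_map_inverse_complex) (auto simp: cfun_carrier)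
 define w where "w z=(\<lambda>t\<in>topspace T. fscale PB (g t) (pull (a (J z)) t))" for z
 have w: "w z:sections T PB" if "z:carrier W" for z
  unfolding w_def using V1_scale(2)[OF pull_section[OF a(1)[OF JK(1)[OF that]]] g] .
 have "hip W (V1 r) z=hip \<Gamma> r (w z)" if z: "z:carrier W" and r: "r:sections T PB" for z r
 proof -
  have "hip X (J (V1 r)) (J z) (Phiinv t)=h' (r t) (w z t)" if t: "t:topspace T" for t
  proof -
   note i = hom_facts(2)[OF t]
   note af = section_fib[OF a(1)[OF JK(1)[OF z]] i]
   have "h' (r t) (w z t)=h' (t, snd (r t)) (t, sc (g t) (a (J z) (Phiinv t)))"
    using t pb_section(1)[OF r t] by (simp add: w_def)
   also have "...=rho t * (g t * h (snd (r t)) (a (J z) (Phiinv t)))"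
    using rho(3)[OF t pb_section(2)[OF r t] sc_closed[OF af]] h_scale[OF pb_section(2)[OF r t] af] by simp
   also have "...=h (back r (Phiinv t)) (a (J z) (Phiinv t))" using t i rho(2)[OF t] by (simp add: g_def hom_facts)
   also have "...=hip X (J (V1 r)) (J z) (Phiinv t)"
    using a(2)[OF back_section[OF r] JK(1)[OF z] i] by (simp add: J_V1[OF r])
   finally show ?thesis by simp
  qed
  then show ?thesis using z r UV(2)[OF r] by (simp add: W_ip JK cong: restrict_cong)
 qed
 then show ?thesis using w by (intro exI[of _ w]) blast
qed

theorem twisted_isomorphic: "isomorphic3 C C W \<Gamma>"
proof -
 have "mor3 C C W \<Gamma> U1"
  unfolding mor3_def section_corr_simps(1)
 proof (intro conjI ballI)
  show "U1 (hleft W f z)=hleft \<Gamma> f (U1 z)" if "f:carrier C" "z:carrier W" for f z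
   using U1_scale[OF that(2,1)] W_left[OF that(2,1)] by simp
  show "U1 (hright W z f)=hright \<Gamma> (U1 z) f" if "f:carrier C" "z:carrier W" for f z
   using U1_scale[OF that(2,1)] W_right[OF that(2,1)] by simp
 qed (use U1_adjoint UV in blast)+
 moreover have "mor3 C C \<Gamma> W V1"
  unfolding mor3_def section_corr_simps(1)
 proof (intro conjI ballI)
  show "V1 (hleft \<Gamma> f r)=hleft W f (V1 r)" if "f:carrier C" "r:sections T PB" for f r
   using V1_scale[OF that(2,1)] W_left[OF UV(2)[OF that(2)] that(1)] UV(2)
   by (intro J_eqI) simp_all
  show "V1 (hright \<Gamma> r f)=hright W (V1 r) f" if "f:carrier C" "r:sections T PB" for f r
   using V1_scale[OF that(2,1)] W_right[OF UV(2)[OF that(2)] that(1)] UV(2)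
   by (intro J_eqI) simp_all
 qed (use V1_adjoint UV in blast)+
 ultimately show ?thesis
  unfolding isomorphic3_def iso3_def section_corr_simps(1) using UV by blast
qed

end

section \<open>Cech cocycles and their transport along homeomorphisms\<close>

text \<open>Both arguments are constant on an intersection of two open level sets, whatever the
  operation \<open>F\<close>.\<close>

lemma continuous_map_discrete_binop:
 assumes f: "continuous_map X (discrete_topology UNIV) f" and g: "continuous_map X (discrete_topology UNIV) g"
 shows "continuous_map X (discrete_topology UNIV) (%x. F (f x) (g x))"
 unfolding continuous_map_alt
proof (intro conjI allI impI)
 fix S
 show "openin X ((%x. F (f x) (g x)) -` S\<inter>topspace X)"
 proof (subst openin_subopen, intro ballI)
  fix x assume x: "x:(%x. F (f x) (g x)) -` S\<inter>topspace X"
  let ?N = "{y:topspace X. f y:{f x}}\<inter>{y:topspace X. g y:{g x}}"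
  have "openin X ?N"
   by (intro openin_Int openin_continuous_map_preimage[OF f] openin_continuous_map_preimage[OF g]) auto
  then show "\<exists>N. openin X N&x:N&N\<subseteq>(%x. F (f x) (g x)) -` S\<inter>topspace X"
   using x by (intro exI[of _ ?N]) auto
 qed
qed auto

lemma cobd_map: "cobd (%l t. c (map f l) (g t)) l t=cobd c (map f l) (g t)"
 by (simp add: cobd_def take_map drop_map)

lemma cobd_2: "cobd c [A, B, D] t=c [B, D] t - c [A, D] t + c [A, B] t"
 by (simp add: cobd_def numeral_3_eq_3 lessThan_Suc)

lemma cobd_3: "cobd c [A, B, D, E] t=c [B, D, E] t - c [A, D, E] t + c [A, B, E] t - c [A, B, D] t"
 by (simp add: cobd_def eval_nat_numeral lessThan_Suc)

lemma simplices_2: "l:simplices 2 \<U>\<longleftrightarrow>(\<exists>A\<in>\<U>. \<exists>B\<in>\<U>. \<exists>D\<in>\<U>. l=[A, B, D])"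
 by (auto simp: simplices_def length_Suc_conv numeral_2_eq_2)

lemma cech_rel_iff: "cech_rel T n (\<U>, c) (\<V>, c')\<longleftrightarrow>(\<exists>\<W> r s b. open_cover T \<W> &
   (\<forall>W\<in>\<W>. r W:\<U>&W\<subseteq>r W&s W:\<V>&W\<subseteq>s W) &
   (if n=0 then b=(%l t. 0) else cech_cochain T (n - 1) \<W> b) &
   (\<forall>l\<in>simplices n \<W>. \<forall>t\<in>\<Inter>(set l). c (map r l) t - c' (map s l) t=cobd b l t))"
 by (simp add: cech_rel_def)

lemma cech_rel_2E:
 assumes "cech_rel T 2 (\<U>, c) (\<V>, c')"
 obtains \<W> r s b where "open_cover T \<W>" "\<forall>W\<in>\<W>. r W:\<U>&W\<subseteq>r W&s W:\<V>&W\<subseteq>s W"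
  "cech_cochain T 1 \<W> b" "\<forall>l\<in>simplices 2 \<W>. \<forall>t\<in>\<Inter>(set l). c (map r l) t - c' (map s l) t=cobd b l t"
proof -
 obtain \<W> r s b where w: "open_cover T \<W>&(\<forall>W\<in>\<W>. r W:\<U>&W\<subseteq>r W&s W:\<V>&W\<subseteq>s W) &
  (if (2 :: nat)=0 then b=(%l t. 0) else cech_cochain T (2 - 1) \<W> b) &
  (\<forall>l\<in>simplices 2 \<W>. \<forall>t\<in>\<Inter>(set l). c (map r l) t - c' (map s l) t=cobd b l t)"
  using assms unfolding cech_rel_iff by (elim exE)
 note w2 = w[THEN conjunct2] and w3 = w[THEN conjunct2, THEN conjunct2]
 have "cech_cochain T 1 \<W> b" using w3[THEN conjunct1] by simp
 then show thesis by (rule that[OF w[THEN conjunct1] w2[THEN conjunct1] _ w3[THEN conjunct2]])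
qed

lemma simplices_map: "[|l:simplices n \<W>; !!W. W:\<W>==>r W:\<U>|]==>map r l:simplices n \<U>"
 by (auto simp: simplices_def)

lemma Inter_map_mono: "[|l:simplices n \<W>; !!W. W:\<W>==>W\<subseteq>r W|]==>\<Inter>(set l)\<subseteq>\<Inter>(set (map r l))"
 by (fastforce simp: simplices_def)

lemma cech_cochain_refine:
 assumes "cech_cochain T n \<U> c" "!!W. W:\<W>==>r W:\<U>&W\<subseteq>r W"
 shows "cech_cochain T n \<W> (%l. c (map r l))"
 unfolding cech_cochain_def
proof
 fix l assume l: "l:simplices n \<W>"
 have "map r l:simplices n \<U>" using l assms(2) by (intro simplices_map) auto
 then have "continuous_map (subtopology T (\<Inter>(set (map r l)))) (discrete_topology UNIV) (c (map r l))"
  using assms(1) by (auto simp: cech_cochain_def)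
 moreover have "\<Inter>(set l)\<subseteq>\<Inter>(set (map r l))" using l assms(2) by (intro Inter_map_mono) auto
 ultimately show "continuous_map (subtopology T (\<Inter>(set l))) (discrete_topology UNIV) (c (map r l))"
  by (rule continuous_map_from_subtopology_mono)
qed

text \<open>Two refinement maps are homotopic; \<open>b\<close> is the prism operator applied to the cocycle.\<close>

lemma cech_prism:
 assumes x: "(\<V>, c):cech_cocycles T 2"
  and r: "!!W. W:\<W>==>r W:\<V>&W\<subseteq>r W" and s: "!!W. W:\<W>==>s W:\<V>&W\<subseteq>s W"
 defines "b\<equiv>(%l t. c [r (l ! 0), r (l ! 1), s (l ! 1)] t - c [r (l ! 0), s (l ! 0), s (l ! 1)] t)"
 shows "cech_cochain T 1 \<W> b"
  and "[|l:simplices 2 \<W>; t:\<Inter>(set l)|]==>c (map r l) t - c (map s l) t=cobd b l t"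
proof -
 have cc: "cech_cochain T 2 \<V> c" and z: "!!l t. [|l:simplices 3 \<V>; t:\<Inter>(set l)|]==>cobd c l t=0"
  using x by (auto simp: cech_cocycles_def numeral_3_eq_3 numeral_2_eq_2)
 show "cech_cochain T 1 \<W> b"
  unfolding cech_cochain_def
 proof
  fix l assume "l:simplices 1 \<W>"
  then obtain A B where l: "l=[A, B]" "A:\<W>" "B:\<W>" by (auto simp: simplices_def length_Suc_conv)
  have c: "continuous_map (subtopology T (\<Inter>(set l))) (discrete_topology UNIV) (c m)"
   if "m:simplices 2 \<V>" "\<Inter>(set l)\<subseteq>\<Inter>(set m)" for m
   using cc that by (auto simp: cech_cochain_def intro: continuous_map_from_subtopology_mono)
  show "continuous_map (subtopology T (\<Inter>(set l))) (discrete_topology UNIV) (b l)"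
   unfolding b_def
   by (rule continuous_map_discrete_binop[where F = "(-)"]; rule c)
    (use l r[OF l(2)] r[OF l(3)] s[OF l(2)] s[OF l(3)] in \<open>auto simp: simplices_2\<close>)
 qed
 assume "l:simplices 2 \<W>" and t: "t:\<Inter>(set l)"
 then obtain A B D where l: "l=[A, B, D]" "A:\<W>" "B:\<W>" "D:\<W>" by (auto simp: simplices_2)
 have t': "t:A" "t:B" "t:D" using t l by auto
 note rs = r[OF l(2)] r[OF l(3)] r[OF l(4)] s[OF l(2)] s[OF l(3)] s[OF l(4)]
 have q: "c [b', d', e'] t - c [a', d', e'] t + c [a', b', e'] t - c [a', b', d'] t=0"
  if "a':\<V>" "b':\<V>" "d':\<V>" "e':\<V>" "t:a'" "t:b'" "t:d'" "t:e'" for a' b' d' e'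
  using z[of "[a', b', d', e']" t] that by (simp add: cobd_3 simplices_def)
 have m: "t:r A" "t:r B" "t:r D" "t:s A" "t:s B" "t:s D" using rs t' by blast+
 show "c (map r l) t - c (map s l) t=cobd b l t"
  \<comment> \<open>The three tetrahedra that triangulate the prism over \<open>l\<close>; their
    common interior faces cancel.\<close>
  using q[of "r A" "r B" "r D" "s D"] q[of "r A" "r B" "s B" "s D"] q[of "r A" "s A" "s B" "s D"] rs m
  by (simp add: l(1) cobd_2 b_def)
qed

text \<open>On a common refinement the middle cocycle appears through two different refinement maps,
  \<open>s1\<close> after \<open>\<alpha>\<close> and \<open>r2\<close> after
  \<open>\<beta>\<close>; \<open>cech_prism\<close> bridges them.\<close>

lemma cech_rel_trans:
 assumes xy: "cech_rel T 2 x y" and yz: "cech_rel T 2 y z" and y: "y:cech_cocycles T 2"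
 shows "cech_rel T 2 x z"
proof -
 obtain \<U> c \<V> c' \<V>' c'' where p: "x=(\<U>, c)" "y=(\<V>, c')" "z=(\<V>', c'')" by (metis surj_pair)
 obtain \<W>1 r1 s1 b1 where w1: "open_cover T \<W>1" "\<forall>W\<in>\<W>1. r1 W:\<U>&W\<subseteq>r1 W&s1 W:\<V>&W\<subseteq>s1 W"
  "cech_cochain T 1 \<W>1 b1" "\<forall>l\<in>simplices 2 \<W>1. \<forall>t\<in>\<Inter>(set l). c (map r1 l) t - c' (map s1 l) t=cobd b1 l t"
  by (rule cech_rel_2E[OF xy[unfolded p]])
 note 1 = w1(1) w1(2) [rule_format] w1(3) w1(4) [rule_format]
 obtain \<W>2 r2 s2 b2 where w2: "open_cover T \<W>2" "\<forall>W\<in>\<W>2. r2 W:\<V>&W\<subseteq>r2 W&s2 W:\<V>'&W\<subseteq>s2 W"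
  "cech_cochain T 1 \<W>2 b2" "\<forall>l\<in>simplices 2 \<W>2. \<forall>t\<in>\<Inter>(set l). c' (map r2 l) t - c'' (map s2 l) t=cobd b2 l t"
  by (rule cech_rel_2E[OF yz[unfolded p]])
 note 2 = w2(1) w2(2) [rule_format] w2(3) w2(4) [rule_format]
 define \<W> where "\<W>={A\<inter>B |A B. A:\<W>1&B:\<W>2}"
 have "\<forall>W\<in>\<W>. \<exists>A B. A:\<W>1&B:\<W>2&W=A\<inter>B" by (auto simp: \<W>_def)
 then obtain \<alpha> \<beta> where ab: "!!W. W:\<W>==>\<alpha> W:\<W>1&\<beta> W:\<W>2&W=\<alpha> W\<inter>\<beta> W" by metis
 have cover: "open_cover T \<W>"
 proof -
  have "\<Union>\<W>=\<Union>\<W>1\<inter>\<Union>\<W>2" unfolding \<W>_def by blast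
  moreover have "openin T (A\<inter>B)" if "A:\<W>1" "B:\<W>2" for A B
   using 1(1) 2(1) that unfolding open_cover_def by (intro openin_Int) blast+
  ultimately show ?thesis using 1(1) 2(1) unfolding open_cover_def \<W>_def by auto
 qed
 have a: "W\<subseteq>\<alpha> W" "W\<subseteq>\<beta> W" "\<alpha> W:\<W>1" "\<beta> W:\<W>2" if "W:\<W>" for W
  using ab[OF that] by blast+
 define b3 where "b3=(%l t. c' [(s1\<circ>\<alpha>) (l ! 0), (s1\<circ>\<alpha>) (l ! 1), (r2\<circ>\<beta>) (l ! 1)] t
  - c' [(s1\<circ>\<alpha>) (l ! 0), (r2\<circ>\<beta>) (l ! 0), (r2\<circ>\<beta>) (l ! 1)] t)"
 have rs: "(s1\<circ>\<alpha>) W:\<V>&W\<subseteq>(s1\<circ>\<alpha>) W" "(r2\<circ>\<beta>) W:\<V>&W\<subseteq>(r2\<circ>\<beta>) W" if "W:\<W>" for W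
  using a[OF that] 1(2)[OF a(3)[OF that]] 2(2)[OF a(4)[OF that]] by auto
 note prism = cech_prism[OF y[unfolded p] rs, folded b3_def]
 define b where "b=(%l t. b1 (map \<alpha> l) t + b3 l t + b2 (map \<beta> l) t)"
 have bc: "cech_cochain T 1 \<W> b"
  using cech_cochain_refine[OF 1(3), of \<W> \<alpha>] cech_cochain_refine[OF 2(3), of \<W> \<beta>] prism(1) a
  unfolding cech_cochain_def b_def
  by (intro ballI continuous_map_discrete_binop[where F = "(+)"]) auto
 have eq: "c (map (r1\<circ>\<alpha>) l) t - c'' (map (s2\<circ>\<beta>) l) t=cobd b l t"
  if l: "l:simplices 2 \<W>" and t: "t:\<Inter>(set l)" for l t
 proof -
  have "map \<alpha> l:simplices 2 \<W>1" "map \<beta> l:simplices 2 \<W>2"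
   using simplices_map[OF l] a by blast+
  moreover have "t:\<Inter>(set (map \<alpha> l))" "t:\<Inter>(set (map \<beta> l))"
   using Inter_map_mono[OF l, of \<alpha>] Inter_map_mono[OF l, of \<beta>] a t by blast+
  ultimately have "c (map r1 (map \<alpha> l)) t - c' (map s1 (map \<alpha> l)) t=cobd b1 (map \<alpha> l) t"
   "c' (map r2 (map \<beta> l)) t - c'' (map s2 (map \<beta> l)) t=cobd b2 (map \<beta> l) t"
   using 1(4) 2(4) by blast+
  moreover have "c' (map (s1\<circ>\<alpha>) l) t - c' (map (r2\<circ>\<beta>) l) t=cobd b3 l t" using prism(2) l t by blast
  moreover have "cobd b l t=cobd b1 (map \<alpha> l) t + cobd b3 l t + cobd b2 (map \<beta> l) t"
   using l by (auto simp: simplices_2 cobd_2 b_def)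
  ultimately show ?thesis by simp
 qed
 have sub: "(r1\<circ>\<alpha>) W:\<U>&W\<subseteq>(r1\<circ>\<alpha>) W&(s2\<circ>\<beta>) W:\<V>'&W\<subseteq>(s2\<circ>\<beta>) W" if "W:\<W>" for W
  using a[OF that] 1(2)[OF a(3)[OF that]] 2(2)[OF a(4)[OF that]] by auto
 show ?thesis
  unfolding p cech_rel_iff
  by (rule exI[of _ \<W>], rule exI[of _ "r1\<circ>\<alpha>"], rule exI[of _ "s2\<circ>\<beta>"], rule exI[of _ b])
   (use cover sub bc eq in simp)
qed

lemma cech_rel_refine:
 assumes "open_cover T \<W>" "!!W. W:\<W>==>r W:\<U>&W\<subseteq>r W"
  and "!!l t. [|l:simplices 2 \<W>; t:\<Inter>(set l)|]==>c (map r l) t=c' l t"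
 shows "cech_rel T 2 (\<U>, c) (\<W>, c')"
proof -
 have "cech_cochain T 1 \<W> (%l t. 0)" by (simp add: cech_cochain_def)
 then show ?thesis
  unfolding cech_rel_iff using assms
  by (intro exI[of _ \<W>] exI[of _ r] exI[of _ "%W. W"] exI[of _ "%l t. 0"]) (auto simp: cobd_def)
qed

locale cech_homeo =
 fixes T :: "'t topology" and Psi Psi' :: "'t=>'t"
 assumes homeo: "homeomorphic_maps T T Psi Psi'"
begin

lemma maps: "t:topspace T==>Psi t:topspace T" "t:topspace T==>Psi' t:topspace T"
 "t:topspace T==>Psi' (Psi t)=t" "t:topspace T==>Psi (Psi' t)=t"
 "continuous_map T T Psi" "continuous_map T T Psi'"
 using homeo by (auto simp: homeomorphic_maps_def continuous_map_def)

lemma image_image: "U\<subseteq>topspace T==>Psi ` Psi' ` U=U" "U\<subseteq>topspace T==>Psi' ` Psi ` U=U"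
 using maps(3,4) by (force simp: image_iff subset_eq)+

lemma mem_image: "U\<subseteq>topspace T==>t:Psi' ` U\<longleftrightarrow>t:topspace T&Psi t:U"
 using maps by (force simp: image_iff subset_eq)

text \<open>The members of the new cover are images under \<open>Psi'\<close>, so taking images
  under \<open>Psi\<close> leads back to the old cover and no refinement map has to be
  chosen.\<close>

definition "trU \<U>=(`) Psi' ` \<U>" for \<U> :: "'t set set"
definition "trc c=(%l t. c (map ((`) Psi) l) (Psi t))" for c :: "'t set list=>'t=>'r"

lemma open_cover_sub: "[|open_cover T \<U>; U:\<U>|]==>U\<subseteq>topspace T"
 by (auto simp: open_cover_def dest: openin_subset)

lemma trU_mem:
 assumes "open_cover T \<U>" "W:trU \<U>" shows "Psi ` W:\<U>&W\<subseteq>topspace T&W=Psi' ` Psi ` W"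
proof -
 obtain U where U: "U:\<U>" "W=Psi' ` U" using assms(2) by (auto simp: trU_def)
 have UT: "U\<subseteq>topspace T" using open_cover_sub[OF assms(1) U(1)] .
 then have "Psi ` W=U" using image_image(1) U(2) by simp
 moreover have "W\<subseteq>topspace T" using UT maps(2) unfolding U(2) by blast
 ultimately show ?thesis using U by simp
qed

lemma open_trU: assumes "open_cover T \<U>" shows "open_cover T (trU \<U>)"
proof -
 have o: "openin T (Psi' ` U)" if "U:\<U>" for U
 proof -
  have "openin T {t:topspace T. Psi t:U}"
   using assms that by (intro openin_continuous_map_preimage[OF maps(5)]) (auto simp: open_cover_def)
  moreover have "Psi' ` U={t:topspace T. Psi t:U}" using mem_image[OF open_cover_sub[OF assms that]] by blast
  ultimately show ?thesis by simp
 qed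
 have "\<Union>(trU \<U>)=Psi' ` \<Union>\<U>" by (auto simp: trU_def)
 also have "...=topspace T"
  using assms mem_image[of "topspace T"] maps(1) by (auto simp: open_cover_def)
 finally show ?thesis using o by (auto simp: open_cover_def trU_def)
qed

lemma trU_simplex: "[|open_cover T \<U>; l:simplices n (trU \<U>)|]==>map ((`) Psi) l:simplices n \<U>"
 by (rule simplices_map) (use trU_mem in blast)+

lemma Inter_tr: "t:\<Inter>(set l)==>Psi t\<in>\<Inter>(set (map ((`) Psi) l))"
 by auto

lemma simplex_sub: "[|open_cover T \<U>; l:simplices n \<U>; t:\<Inter>(set l)|]==>t\<in>topspace T"
 using open_cover_sub by (cases l) (auto simp: simplices_def)

lemma continuous_tr:
 assumes "continuous_map (subtopology T B) Z f" "!!t. t:A==>Psi t:B"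
 shows "continuous_map (subtopology T A) Z (%t. f (Psi t))"
proof -
 have "continuous_map (subtopology T A) (subtopology T B) Psi"
  using maps(5) assms(2) by (auto simp: continuous_map_in_subtopology continuous_map_from_subtopology)
 from continuous_map_compose[OF this assms(1)] show ?thesis by (simp add: o_def)
qed

lemma cochain_tr:
 assumes "open_cover T \<U>" "cech_cochain T n \<U> c" shows "cech_cochain T n (trU \<U>) (trc c)"
 unfolding cech_cochain_def trc_def
proof
 fix l assume "l:simplices n (trU \<U>)"
 then have "continuous_map (subtopology T (\<Inter>(set (map ((`) Psi) l)))) (discrete_topology UNIV) (c (map ((`) Psi) l))"
  using assms(2) trU_simplex[OF assms(1)] unfolding cech_cochain_def by blast
 then show "continuous_map (subtopology T (\<Inter>(set l))) (discrete_topology UNIV) (%t. c (map ((`) Psi) l) (Psi t))"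
  by (rule continuous_tr) (rule Inter_tr)
qed

lemma cocycles_tr: assumes "(\<U>, c):cech_cocycles T n" shows "(trU \<U>, trc c):cech_cocycles T n"
proof -
 have *: "open_cover T \<U>" "cech_cochain T n \<U> c" "!!l t. [|l:simplices (Suc n) \<U>; t:\<Inter>(set l)|]==>cobd c l t=0"
  using assms by (auto simp: cech_cocycles_def)
 have "cobd (trc c) l t=0" if "l:simplices (Suc n) (trU \<U>)" "t:\<Inter>(set l)" for l t
  unfolding trc_def cobd_map using *(3) trU_simplex[OF *(1) that(1)] Inter_tr[OF that(2)] by blast
 then show ?thesis using open_trU[OF *(1)] cochain_tr[OF *(1,2)] by (auto simp: cech_cocycles_def)
qed

lemma map_image_cong: "[|l:simplices n \<W>; !!W. W:\<W>==>f W=g W|]==>map f l=map g l"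
 by (auto simp: simplices_def)

text \<open>The refinement maps are conjugated by the two image maps, and the primitive is
  transported like a cocycle.\<close>

lemma cech_rel_tr:
 assumes U: "open_cover T \<U>" and V: "open_cover T \<V>" and rel: "cech_rel T 2 (\<U>, c) (\<V>, c')"
 shows "cech_rel T 2 (trU \<U>, trc c) (trU \<V>, trc c')"
proof -
 obtain \<W> r s b where wW: "open_cover T \<W>" "\<forall>W\<in>\<W>. r W:\<U>&W\<subseteq>r W&s W:\<V>&W\<subseteq>s W"
  "cech_cochain T 1 \<W> b" "\<forall>l\<in>simplices 2 \<W>. \<forall>t\<in>\<Inter>(set l). c (map r l) t - c' (map s l) t=cobd b l t"
  by (rule cech_rel_2E[OF rel])
 note W = wW(1) wW(2) [rule_format] wW(3) wW(4) [rule_format]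
 define r' s' where "r' W=Psi' ` r (Psi ` W)" and "s' W=Psi' ` s (Psi ` W)" for W
 have m: "r' W:trU \<U>&W\<subseteq>r' W&s' W:trU \<V>&W\<subseteq>s' W" if W': "W:trU \<W>" for W
 proof -
  note t = trU_mem[OF W(1) W']
  have "Psi' ` Psi ` W\<subseteq>Psi' ` r (Psi ` W)" "Psi' ` Psi ` W\<subseteq>Psi' ` s (Psi ` W)"
   using W(2)[of "Psi ` W"] t by (intro image_mono; simp)+
  then show ?thesis using t W(2)[of "Psi ` W"] by (auto simp: r'_def s'_def trU_def)
 qed
 have "trc c (map r' l) t - trc c' (map s' l) t=cobd (trc b) l t"
  if l: "l:simplices 2 (trU \<W>)" and t: "t:\<Inter>(set l)" for l t
 proof -
  have e: "Psi ` r' W=r (Psi ` W)&Psi ` s' W=s (Psi ` W)" if "W:trU \<W>" for W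
   using W(2)[of "Psi ` W"] trU_mem[OF W(1) that] image_image(1) open_cover_sub[OF U] open_cover_sub[OF V]
   by (simp add: r'_def s'_def)
  have "map ((`) Psi) (map r' l)=map r (map ((`) Psi) l)" "map ((`) Psi) (map s' l)=map s (map ((`) Psi) l)"
   using map_image_cong[OF l, of "%W. Psi ` r' W" "%W. r (Psi ` W)"] map_image_cong[OF l, of "%W. Psi ` s' W" "%W. s (Psi ` W)"] e
   by (simp_all add: o_def)
  then show ?thesis
   unfolding trc_def cobd_map using W(4)[OF trU_simplex[OF W(1) l] Inter_tr[OF t]] by (simp only:)
 qed
 then show ?thesis
  unfolding cech_rel_iff
  using open_trU[OF W(1)] m cochain_tr[OF W(1,3)]
  by (intro exI[of _ "trU \<W>"] exI[of _ r'] exI[of _ s'] exI[of _ "trc b"]) simp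
qed

end

text \<open>Composing the refinement maps directly imposes no cocycle condition on
  \<open>c'\<close>, in contrast to \<open>cech_rel_trans\<close> for its middle term.\<close>

lemma cech_rel_refine_left:
 assumes rel: "cech_rel T 2 (\<W>, c') y" and r: "!!W. W:\<W>==>r W:\<U>&W\<subseteq>r W"
  and c: "!!l t. [|l:simplices 2 \<W>; t:\<Inter>(set l)|]==>c (map r l) t=c' l t"
 shows "cech_rel T 2 (\<U>, c) y"
proof -
 obtain \<V> d where y: "y=(\<V>, d)" by (metis surj_pair)
 obtain \<W>1 r1 s1 b1 where w: "open_cover T \<W>1" "\<forall>W\<in>\<W>1. r1 W:\<W>&W\<subseteq>r1 W&s1 W:\<V>&W\<subseteq>s1 W"
  "cech_cochain T 1 \<W>1 b1" "\<forall>l\<in>simplices 2 \<W>1. \<forall>t\<in>\<Inter>(set l). c' (map r1 l) t - d (map s1 l) t=cobd b1 l t"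
  by (rule cech_rel_2E[OF rel[unfolded y]])
 have sub: "(r\<circ>r1) W:\<U>&W\<subseteq>(r\<circ>r1) W&s1 W:\<V>&W\<subseteq>s1 W" if "W:\<W>1" for W
  using bspec[OF w(2) that] r[of "r1 W"] by auto
 have eq: "c (map (r\<circ>r1) l) t - d (map s1 l) t=cobd b1 l t" if l: "l:simplices 2 \<W>1" and t: "t:\<Inter>(set l)" for l t
 proof -
  have "map r1 l:simplices 2 \<W>" by (rule simplices_map[OF l]) (use w(2) in blast)
  moreover have "t:\<Inter>(set (map r1 l))" using Inter_map_mono[OF l, of r1] w(2) t by blast
  ultimately have "c (map r (map r1 l)) t=c' (map r1 l) t" by (rule c)
  then show ?thesis using w(4) l t by simp
 qed
 show ?thesis
  unfolding y cech_rel_iff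
  by (rule exI[of _ \<W>1], rule exI[of _ "r\<circ>r1"], rule exI[of _ s1], rule exI[of _ b1])
   (use w sub eq in simp)
qed

section \<open>Transfer of Chern cocycles between bundles\<close>

lemma cech_class_self: "(\<U>, c):cech_cocycles T 2==>(\<U>, c):cech_class T 2 (\<U>, c)"
 by (auto simp: cech_class_def cech_cocycles_def intro: cech_rel_refine[where r = "%U. U"])

lemma chern_cocyclesD: "(\<U>, c):chern_cocycles T E==>(\<U>, c):cech_cocycles T 2"
 unfolding chern_cocycles_def mem_Collect_eq case_prod_conv by (rule conjunct1)

lemma cech_cocycles_cover: "(\<U>, c):cech_cocycles T n==>open_cover T \<U>"
 by (simp add: cech_cocycles_def)

lemma chern_classE:
 assumes "y:chern_class T E"
 obtains \<U> c where "(\<U>, c):chern_cocycles T E" "y:cech_class T 2 (\<U>, c)"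
proof -
 obtain x where x: "x:chern_cocycles T E" "y:cech_class T 2 x" using assms unfolding chern_class_def by blast
 then show thesis using that[of "fst x" "snd x"] by simp
qed

lemma cech_classD: "y:cech_class T n x==>y:cech_cocycles T n" "y:cech_class T n x==>cech_rel T n x y"
 and cech_classI: "[|y:cech_cocycles T n; cech_rel T n x y|]==>y:cech_class T n x"
 by (simp_all add: cech_class_def)

text \<open>Transport in both directions gives the two inclusions: a cocycle of \<open>F\<close> is
  recovered by pulling back its transport, and any refinement map in \<open>cech_pullback\<close>
  factors through the transported cover.\<close>

lemma chern_class_pullback:
 fixes E :: "('t, 'e) cbundle" and F :: "('t, 'f) cbundle"
 assumes hom: "homeomorphic_maps T T Psi Psi'"
  and EF: "!!\<U> c. (\<U>, c):chern_cocycles T E==>(cech_homeo.trU Psi' \<U>, cech_homeo.trc Psi c):chern_cocycles T F"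
  and FE: "!!\<U> c. (\<U>, c):chern_cocycles T F==>(cech_homeo.trU Psi \<U>, cech_homeo.trc Psi' c):chern_cocycles T E"
 shows "chern_class T F=cech_pullback T Psi 2 (chern_class T E)"
proof -
 interpret p: cech_homeo T Psi Psi' by (rule cech_homeo.intro[OF hom])
 interpret n: cech_homeo T Psi' Psi by (rule cech_homeo.intro[OF homeomorphic_maps_sym[THEN iffD1, OF hom]])
 show ?thesis
 proof (intro subset_antisym subsetI)
  fix y assume "y:chern_class T F"
  then obtain \<U> c where c: "(\<U>, c):chern_cocycles T F" "y:cech_class T 2 (\<U>, c)"
   by (rule chern_classE)
  note cc = chern_cocyclesD[OF c(1)] cech_cocycles_cover[OF chern_cocyclesD[OF c(1)]]
  have UT: "U\<subseteq>topspace T" if "U:\<U>" for U using p.open_cover_sub[OF cc(2) that] .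
  \<comment> \<open>Transport followed by pullback along the image map; it returns \<open>c\<close>
    at the points of the simplex and need not coincide with it elsewhere.\<close>
  define d where "d=(%l s. n.trc c (map ((`) Psi) l) (Psi s))"
  have de: "d l t=c l t" if l: "l:simplices 2 \<U>" and t: "t:\<Inter>(set l)" for l t
  proof -
   have "map (%W. Psi' ` Psi ` W) l=map (%W. W) l"
    by (rule p.map_image_cong[OF l]) (rule p.image_image(2)[OF UT])
   then show ?thesis using p.maps(3)[OF p.simplex_sub[OF cc(2) l t]] by (simp add: d_def n.trc_def o_def)
  qed
  have "cech_rel T 2 (\<U>, d) y"
   by (rule cech_rel_refine_left[where \<W> = \<U> and c' = c and r = "%U. U"]) (use cech_classD(2)[OF c(2)] de in auto)
  then have "y:cech_class T 2 (\<U>, d)" using cech_classD(1)[OF c(2)] by (rule cech_classI [rotated])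
  moreover have "(n.trU \<U>, n.trc c):chern_class T E"
   unfolding chern_class_def
   using FE[OF c(1)] cech_class_self[OF chern_cocyclesD[OF FE[OF c(1)]]] by (rule UN_I[where a = "(n.trU \<U>, n.trc c)"])
  moreover have "\<forall>W\<in>\<U>. (`) Psi W:n.trU \<U>&Psi ` W\<subseteq>(`) Psi W" by (auto simp: n.trU_def)
  ultimately show "y:cech_pullback T Psi 2 (chern_class T E)"
   unfolding cech_pullback_def d_def using cc(2) by blast
 next
  fix y assume "y:cech_pullback T Psi 2 (chern_class T E)"
  then obtain \<W> c r \<U> where w: "y:cech_class T 2 (\<W>, %l s. c (map r l) (Psi s))" "(\<U>, c):chern_class T E"
   "open_cover T \<W>" "\<forall>W\<in>\<W>. r W:\<U>&Psi ` W\<subseteq>r W"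
   unfolding cech_pullback_def by blast
  obtain \<U>0 c0 where c0: "(\<U>0, c0):chern_cocycles T E" "(\<U>, c):cech_class T 2 (\<U>0, c0)"
   using w(2) by (rule chern_classE)
  note cc = cech_classD[OF c0(2)]
  note U = cech_cocycles_cover[OF cc(1)] cech_cocycles_cover[OF chern_cocyclesD[OF c0(1)]]
  have 1: "cech_rel T 2 (p.trU \<U>0, p.trc c0) (p.trU \<U>, p.trc c)" by (rule p.cech_rel_tr[OF U(2,1) cc(2)])
  have "cech_rel T 2 (p.trU \<U>, p.trc c) y"
  proof (rule cech_rel_refine_left[where r = "%W. Psi' ` r W"])
   show "cech_rel T 2 (\<W>, %l s. c (map r l) (Psi s)) y" by (rule cech_classD(2)[OF w(1)])
   show "Psi' ` r W:p.trU \<U>&W\<subseteq>Psi' ` r W" if "W:\<W>" for W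
   proof
    have r: "r W:\<U>" "Psi ` W\<subseteq>r W" using bspec[OF w(4) that] by blast+
    show "Psi' ` r W:p.trU \<U>" unfolding p.trU_def using r(1) by blast
    show "W\<subseteq>Psi' ` r W"
     using p.mem_image[OF p.open_cover_sub[OF U(1) r(1)]] p.open_cover_sub[OF w(3) that] r(2) by blast
   qed
   show "p.trc c (map (%W. Psi' ` r W) l) t=c (map r l) (Psi t)" if "l:simplices 2 \<W>" for l t
   proof -
    have "map (%W. Psi ` Psi' ` r W) l=map r l"
     by (rule p.map_image_cong[OF that]) (use p.image_image(1) p.open_cover_sub[OF U(1)] w(4) in blast)
    then have "map ((`) Psi) (map (%W. Psi' ` r W) l)=map r l" by (simp only: map_map o_def)
    then show ?thesis unfolding p.trc_def by (simp only:)
   qed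
  qed
  then have "cech_rel T 2 (p.trU \<U>0, p.trc c0) y" by (rule cech_rel_trans[OF 1 _ p.cocycles_tr[OF cc(1)]])
  then have "y:cech_class T 2 (p.trU \<U>0, p.trc c0)" by (rule cech_classI[OF cech_classD(1)[OF w(1)]])
  then show "y:chern_class T F" using EF[OF c0(1)] unfolding chern_class_def by blast
 qed
qed

text \<open>Conditions on a map of sections over \<open>Psi\<close> that suffice to induce linear
  injections of fibres.\<close>

locale bundle_transfer = cech_homeo T Psi Psi' + E: lbundle T E + F: lbundle T F
 for T :: "'t topology" and Psi Psi' :: "'t=>'t" and E :: "('t, 'e) cbundle" and F :: "('t, 'f) cbundle" +
 fixes theta :: "('t=>'e)=>'t=>'f"
 assumes compact: "compact_space T" and Hausdorff: "Hausdorff_space T"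
  and closed: "s:sections T E==>theta s:sections T F"
  and local: "[|s:sections T E; s':sections T E; t:topspace T; s (Psi t)=s' (Psi t)|]==>theta s t=theta s' t"
  and scale: "[|s:sections T E; f:carrier (cfun_alg T); t:topspace T|]
==>theta (\<lambda>x\<in>topspace T. fscale E (f x) (s x)) t=fscale F (f (Psi t)) (theta s t)"
  and nonzero: "[|s:sections T E; t:topspace T; E.nz (s (Psi t))|]==>F.nz (theta s t)"
begin

text \<open>The induced fibre map: extend the vector to a global section and evaluate. The
  assumption \<open>local\<close> makes the choice immaterial.\<close>

definition "th t e=theta (SOME s. s:sections T E&s (Psi t)=e) t"

lemma th_eq: assumes "s:sections T E" "t:topspace T" shows "th t (s (Psi t))=theta s t"
proof -
 define s' where "s'=(SOME r. r:sections T E&r (Psi t)=s (Psi t))"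
 have "s':sections T E&s' (Psi t)=s (Psi t)"
  unfolding s'_def by (rule someI[of _ s]) (use assms in simp)
 then show ?thesis using local[of s' s t] assms by (simp add: th_def s'_def)
qed

lemma th_facts:
 assumes t: "t:topspace T" and e: "e:E.fib (Psi t)"
 shows "th t e:F.fib t" "th t (fscale E c e)=fscale F c (th t e)" "E.nz e==>F.nz (th t e)"
proof -
 obtain s where s: "s:sections T E" "s (Psi t)=e" using E.section_value[OF compact Hausdorff e] by blast
 show "th t e:F.fib t" using F.section_fib[OF closed[OF s(1)] t] th_eq[OF s(1) t] s(2) by simp
 show "E.nz e==>F.nz (th t e)" using nonzero[OF s(1) t] th_eq[OF s(1) t] s(2) by simp
 have c: "(\<lambda>x\<in>topspace T. c):carrier (cfun_alg T)" by (rule cfun_restrict_closed) simp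
 show "th t (fscale E c e)=fscale F c (th t e)"
  using th_eq[OF E.section_scale[OF s(1) c] t] scale[OF s(1) c t] th_eq[OF s(1) t] s(2) maps(1)[OF t] by simp
qed

text \<open>A local section becomes global only after multiplication by a bump that is 1 at one
  point. Where the bump does not vanish it is divided out again.\<close>

lemma th_continuous:
 assumes U: "openin T U" and e: "continuous_map (subtopology T U) (tspace E) e" "!!x. x:U==>e x:E.fib x"
 shows "continuous_map (subtopology T (Psi' ` U)) (tspace F) (%t. th t (e (Psi t)))"
proof (rule continuous_map_locally)
 note UT = openin_subset[OF U]
 fix t0 assume "t0:topspace (subtopology T (Psi' ` U))"
 then have t0: "t0:topspace T" "Psi t0:U" using mem_image[OF UT] by auto
 have "!!x. x:U==>proj E (e x)=x" using e(2) by blast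
 then obtain s phi where s: "s:sections T E" "continuous_map T euclidean phi" "phi (Psi t0)=1" "\<forall>x\<in>U. s x=fscale E (phi x) (e x)"
  using E.section_through[OF compact Hausdorff U t0(2) e(1)] by blast
 define N where "N={t:topspace T. Psi t:U}\<inter>{t:topspace T. (phi\<circ>Psi) t:- {0}}"
 have N: "openin T N"
  unfolding N_def
  by (intro openin_Int openin_continuous_map_preimage[OF maps(5)] U
    openin_continuous_map_preimage[OF continuous_map_compose[OF maps(5) s(2)]]) auto
 have NU: "N\<subseteq>Psi' ` U" using mem_image[OF UT] by (auto simp: N_def)
 have "continuous_map (subtopology T N) (tspace F) (%t. fscale F (inverse ((phi\<circ>Psi) t)) (theta s t))"
 proof (rule F.scale_continuous[OF N])
  show "continuous_map (subtopology T N) (tspace F) (theta s)" "!!t. t:N==>proj F (theta s t)=t"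
   using closed[OF s(1)] by (auto simp: F.sections_iff N_def intro: continuous_map_from_subtopology)
  show "continuous_map (subtopology T N) euclidean (%t. inverse ((phi\<circ>Psi) t))"
   by (intro continuous_map_inverse_complex continuous_map_from_subtopology continuous_map_compose[OF maps(5) s(2)])
    (simp add: N_def)
 qed
 then have "continuous_map (subtopology T N) (tspace F) (%t. th t (e (Psi t)))"
 proof (rule continuous_map_cong_on)
  fix t assume "t:N"
  then have t: "t:topspace T" "Psi t:U" "phi (Psi t)\<noteq>0" by (auto simp: N_def)
  have "theta s t=fscale F (phi (Psi t)) (th t (e (Psi t)))"
   using th_eq[OF s(1) t(1)] s(4) t(2) th_facts(2)[OF t(1) e(2)[OF t(2)]] by simp
  then show "fscale F (inverse ((phi\<circ>Psi) t)) (theta s t)=th t (e (Psi t))"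
   using F.sc_sc[OF th_facts(1)[OF t(1) e(2)[OF t(2)]]] F.sc_one[OF th_facts(1)[OF t(1) e(2)[OF t(2)]]] t(3) by simp
 qed
 moreover have "subtopology (subtopology T (Psi' ` U)) N=subtopology T N"
  using NU by (simp add: subtopology_subtopology inf.absorb2)
 moreover have "openin (subtopology T (Psi' ` U)) N" using N NU by (auto simp: openin_subtopology)
 moreover have "t0:N" using t0 s(3) by (simp add: N_def)
 ultimately show "\<exists>V. openin (subtopology T (Psi' ` U)) V&t0:V &
   continuous_map (subtopology (subtopology T (Psi' ` U)) V) (tspace F) (%t. th t (e (Psi t)))"
  by (intro exI[of _ N]) simp
qed

text \<open>Homogeneity on fibres carries frames to frames with the same transition factors moved by
  \<open>Psi\<close>, so the transported logarithms and cocycle serve for \<open>F\<close>.\<close>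

lemma chern_transfer:
 assumes "(\<U>, c):chern_cocycles T E" shows "(trU \<U>, trc c):chern_cocycles T F"
proof -
 note cc = chern_cocyclesD[OF assms]
 obtain e h where eh: "(\<forall>U\<in>\<U>. continuous_map (subtopology T U) (tspace E) (e U)&(\<forall>t\<in>U. proj E (e U t)=t&e U t\<noteq>fscale E 0 (e U t))) &
  (\<forall>U\<in>\<U>. \<forall>V\<in>\<U>. continuous_map (subtopology T (U\<inter>V)) euclidean (h [U, V]) &
    (\<forall>t\<in>U\<inter>V. e V t=fscale E (exp (2 * complex_of_real pi * \<i> * h [U, V] t)) (e U t))) &
  (\<forall>l\<in>simplices 2 \<U>. \<forall>t\<in>\<Inter>(set l). of_int (c l t)=cobd h l t)"
  using assms[unfolded chern_cocycles_def mem_Collect_eq case_prod_conv, THEN conjunct2] by (elim exE)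
 note e = eh[THEN conjunct1] and h = eh[THEN conjunct2, THEN conjunct1] and ch = eh[THEN conjunct2, THEN conjunct2]
 have cov: "open_cover T \<U>" using cc by (simp add: cech_cocycles_def)
 have UT: "U\<subseteq>topspace T" if "U:\<U>" for U using open_cover_sub[OF cov that] .
 have ef: "e U x:E.fib x" if "U:\<U>" "x:U" for U x
  using e that UT continuous_map_mem[of "subtopology T U" "tspace E" "e U" x] by auto
 define e' where "e' W t=th t (e (Psi ` W) (Psi t))" for W t
 have mem: "Psi ` W:\<U>" "t:W==>Psi t:Psi ` W" "t:W==>t:topspace T" "W=Psi' ` Psi ` W" if "W:trU \<U>" for W t
  using trU_mem[OF cov that] by auto
 have 1: "continuous_map (subtopology T W) (tspace F) (e' W)&(\<forall>t\<in>W. proj F (e' W t)=t&e' W t\<noteq>fscale F 0 (e' W t))"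
  if W: "W:trU \<U>" for W
 proof -
  note m = mem[OF W]
  have "continuous_map (subtopology T (Psi' ` Psi ` W)) (tspace F) (%t. th t (e (Psi ` W) (Psi t)))"
   by (rule th_continuous) (use m(1) e cov ef in \<open>auto simp: open_cover_def\<close>)
  moreover have "e' W t:F.fib t&F.nz (e' W t)" if t: "t:W" for t
   using th_facts(1,3)[OF m(3)[OF t] ef[OF m(1) m(2)[OF t]]] e m(1) m(2)[OF t] by (simp add: e'_def)
  ultimately show ?thesis using m(4) by (simp add: e'_def [abs_def])
 qed
 have 2: "continuous_map (subtopology T (W\<inter>V)) euclidean (trc h [W, V]) &
   (\<forall>t\<in>W\<inter>V. e' V t=fscale F (exp (2 * complex_of_real pi * \<i> * trc h [W, V] t)) (e' W t))"
  if W: "W:trU \<U>" and V: "V:trU \<U>" for W V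
 proof
  note w = mem[OF W] and v = mem[OF V]
  note hh = h[THEN bspec, THEN bspec, OF w(1) v(1)]
  show "continuous_map (subtopology T (W\<inter>V)) euclidean (trc h [W, V])"
   unfolding trc_def using hh by (intro continuous_tr[where B = "Psi ` W\<inter>Psi ` V"]) auto
  show "\<forall>t\<in>W\<inter>V. e' V t=fscale F (exp (2 * complex_of_real pi * \<i> * trc h [W, V] t)) (e' W t)"
  proof
   fix t assume t: "t:W\<inter>V"
   then have "e (Psi ` V) (Psi t)=fscale E (exp (2 * complex_of_real pi * \<i> * h [Psi ` W, Psi ` V] (Psi t))) (e (Psi ` W) (Psi t))"
    using hh by blast
   then show "e' V t=fscale F (exp (2 * complex_of_real pi * \<i> * trc h [W, V] t)) (e' W t)"
    using th_facts(2)[OF w(3) ef[OF w(1) w(2)]] t by (simp add: e'_def trc_def)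
  qed
 qed
 have 3: "of_int (trc c l t)=cobd (trc h) l t" if l: "l:simplices 2 (trU \<U>)" and t: "t:\<Inter>(set l)" for l t
  unfolding trc_def cobd_map using ch[THEN bspec, THEN bspec, OF trU_simplex[OF cov l] Inter_tr[OF t]] .
 show ?thesis
  unfolding chern_cocycles_def mem_Collect_eq case_prod_conv
  by (rule conjI[OF cocycles_tr[OF cc]], rule exI[of _ e'], rule exI[of _ "trc h"])
   (intro conjI ballI; (rule 1[THEN conjunct1] 2[THEN conjunct1] 3; assumption | rule 1[THEN conjunct2, THEN bspec, THEN conjunct1]
    1[THEN conjunct2, THEN bspec, THEN conjunct2] 2[THEN conjunct2, THEN bspec]; assumption))
qed

end

text \<open>Every vector of a fibre is the value of a global section, so pairings with sections
  separate values.\<close>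

lemma (in metric_bundle) pair_local:
 assumes s: "s:sections T E" "s':sections T E" and t: "t:topspace T"
  and eq: "!!r. r:sections T E==>h (s t) (r t)=h (s' t) (r t)"
 shows "s t=s' t"
proof (rule h_eqI[OF section_fib[OF s(1) t] section_fib[OF s(2) t]])
 fix e assume "e:fib t"
 then obtain r where "r:sections T E" "r t=e" using section_value[OF compact Hausdorff] by blast
 then show "h (s t) e=h (s' t) e" using eq[of r] by simp
qed

text \<open>A map of sections with an adjoint is local: its value at \<open>t\<close> is determined by its pairings, which
 only involve the value of the argument at \<open>Psi t\<close>.\<close>

lemma bundle_transferI:
 assumes E: "metric_bundle T E h" and F: "metric_bundle T F k" and hom: "homeomorphic_maps T T Psi Psi'"
  and theta: "!!s. s:sections T E==>theta s:sections T F" "!!r. r:sections T F==>theta' r:sections T E"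
   "!!s. s:sections T E==>theta' (theta s)=s"
  and pair: "!!s r t. [|s:sections T E; r:sections T F; t:topspace T|]==>k (theta s t) (r t)=h (s (Psi t)) (b r (Psi t))"
  and pair': "!!s r t. [|s:sections T E; r:sections T F; t:topspace T|]==>h (theta' r t) (s t)=k (r (Psi' t)) (b' s (Psi' t))"
  and scale: "!!s f t. [|s:sections T E; f:carrier (cfun_alg T); t:topspace T|]
==>theta (\<lambda>x\<in>topspace T. fscale E (f x) (s x)) t=fscale F (f (Psi t)) (theta s t)"
  and scale': "!!r f t. [|r:sections T F; f:carrier (cfun_alg T); t:topspace T|]
==>theta' (\<lambda>x\<in>topspace T. fscale F (f x) (r x)) t=fscale E (f (Psi' t)) (theta' r t)"
 shows "bundle_transfer T Psi Psi' E F theta"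
proof -
 interpret E: metric_bundle T E h by fact
 interpret F: metric_bundle T F k by fact
 interpret cech_homeo T Psi Psi' by (rule cech_homeo.intro[OF hom])
 have loc': "theta' r t=theta' r' t" if r: "r:sections T F" "r':sections T F" and t: "t:topspace T"
  and eq: "r (Psi' t)=r' (Psi' t)" for r r' t
  by (rule E.pair_local[OF theta(2)[OF r(1)] theta(2)[OF r(2)] t]) (simp only: pair'[OF _ r(1) t] pair'[OF _ r(2) t] eq)
 show ?thesis
 proof (intro bundle_transfer.intro bundle_transfer_axioms.intro)
  fix s s' t assume s: "s:sections T E" "s':sections T E" and t: "t:topspace T" and eq: "s (Psi t)=s' (Psi t)"
  show "theta s t=theta s' t"
   by (rule F.pair_local[OF theta(1)[OF s(1)] theta(1)[OF s(2)] t]) (simp only: pair[OF s(1) _ t] pair[OF s(2) _ t] eq)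
 next
  fix s t assume s: "s:sections T E" and t: "t:topspace T" and n: "E.nz (s (Psi t))"
  show "F.nz (theta s t)"
  proof
   \<comment> \<open>A section vanishing at \<open>t\<close> agrees there with its multiple by the
     zero function; locality of \<open>theta'\<close> carries this back and forces \<open>s\<close>
     to vanish at \<open>Psi t\<close>.\<close>
   assume z: "theta s t=fscale F 0 (theta s t)"
   have c: "(\<lambda>x\<in>topspace T. 0):carrier (cfun_alg T)" by (rule cfun_restrict_closed) simp
   let ?r = "\<lambda>x\<in>topspace T. fscale F ((\<lambda>x\<in>topspace T. 0) x) (theta s x)"
   have "theta' (theta s) (Psi t)=theta' ?r (Psi t)"
    by (rule loc'[OF theta(1)[OF s] F.section_scale[OF theta(1)[OF s] c] maps(1)[OF t]]) (use z t maps(3) in simp)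
   also have "...=fscale E 0 (theta' (theta s) (Psi t))"
    using scale'[OF theta(1)[OF s] c maps(1)[OF t]] t maps(3) by simp
   finally show False using n unfolding theta(3)[OF s] by blast
  qed
 qed (rule E.compact E.Hausdorff E.lbundle_axioms F.lbundle_axioms cech_homeo_axioms theta(1) scale; assumption)+
qed

locale twisted_line = twisted T Phi Phiinv W X J + section_iso T E h X u v + F: metric_bundle T F k
 for T :: "'t topology" and Phi Phiinv :: "'t=>'t" and W :: "('t=>complex, 't=>complex, 'w) corr"
  and X :: "('t=>complex, 't=>complex, 'x) corr" and J :: "'w=>'x"
  and E :: "('t, 'e) cbundle" and h u v and F :: "('t, 'f) cbundle" and k +
 fixes u' v'
 assumes iso': "iso3 (cfun_alg T) (cfun_alg T) W (section_corr T F k) u' v'"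
begin

lemma uv': "z:carrier W==>u' z:sections T F" "r:sections T F==>v' r:carrier W"
 "z:carrier W==>v' (u' z)=z" "r:sections T F==>u' (v' r)=r"
 using iso' by (auto simp: iso3_def mor3_def)

lemma u'_right: "[|z:carrier W; f:carrier C; t:topspace T|]==>u' (hright W z f) t=fscale F (f t) (u' z t)"
 using iso' by (auto simp: iso3_def mor3_def)

lemma v'_right: "[|r:sections T F; f:carrier C|]==>v' (\<lambda>t\<in>topspace T. fscale F (f t) (r t))=hright W (v' r) f"
 using iso' by (auto simp: iso3_def mor3_def)

text \<open>\<open>v\<close>, the inverse \<open>K\<close> of \<open>J\<close>, and
  \<open>u'\<close> compose to a map of sections over \<open>Phiinv\<close>, whose inverse runs over
  \<open>Phi\<close>. Pairings are expressed by the adjoints of the two 3-isomorphisms, so neither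
  has to be unitary.\<close>

lemma chern_class_twisted: "chern_class T F=cech_pullback T Phiinv 2 (chern_class T E)"
proof -
 have hs: "homeomorphic_maps T T Phiinv Phi" using homeomorphic_maps_sym hom' by (rule iffD1)
 interpret p: cech_homeo T Phiinv Phi by (rule cech_homeo.intro[OF hs])
 define theta where "theta s=u' (K (v s))" for s
 define theta' where "theta' r=u (J (v' r))" for r
 have theta: "theta s:sections T F" "theta' (theta s)=s" if "s:sections T E" for s
  using that by (simp_all add: theta_def theta'_def uv uv' JK)
 have theta': "theta' r:sections T E" "theta (theta' r)=r" if "r:sections T F" for r
  using that by (simp_all add: theta_def theta'_def uv uv' JK)
 have pc: "(\<lambda>t\<in>topspace T. f (Phiinv t)):carrier C" if "f:carrier C" for f
  using continuous_map_compose[OF p.maps(5), of euclidean f] that by (simp add: cfun_carrier o_def)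
 have un: "(\<lambda>t\<in>topspace T. (\<lambda>t\<in>topspace T. f (Phiinv t)) (Phi t))=f" if "f:carrier C" for f
  by (rule extensionalityI[of _ "topspace T"]) (use that in "simp_all add: cfun_carrier p.maps")
 have K_right: "K (hright X x f)=hright W (K x) (\<lambda>t\<in>topspace T. f (Phiinv t))" if x: "x:carrier X" and f: "f:carrier C" for x f
 proof (rule J_eqI)
  note w = W_right[OF JK(2)[OF x] pc[OF f]]
  show "J (K (hright X x f))=J (hright W (K x) (\<lambda>t\<in>topspace T. f (Phiinv t)))"
   using w un[OF f] JK(4) X.right_closed[OF x f] x by simp
  show "hright W (K x) (\<lambda>t\<in>topspace T. f (Phiinv t)):carrier W" using w ..
  show "K (hright X x f):carrier W" by (rule JK(2)[OF X.right_closed[OF x f]])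
 qed
 have scale: "theta (\<lambda>x\<in>topspace T. sc (f x) (s x)) t=fscale F (f (Phiinv t)) (theta s t)"
  if s: "s:sections T E" and f: "f:carrier C" and t: "t:topspace T" for s f t
  using u'_right[OF JK(2)[OF uv(2)[OF s]] pc[OF f] t] t by (simp add: theta_def v_right[OF s f] K_right[OF uv(2)[OF s] f])
 have fc: "(\<lambda>t\<in>topspace T. f (Phi t)):carrier C" if "f:carrier C" for f
  using continuous_map_compose[OF p.maps(6), of euclidean f] that by (simp add: cfun_carrier o_def)
 have scale': "theta' (\<lambda>x\<in>topspace T. fscale F (f x) (r x)) t=sc (f (Phi t)) (theta' r t)"
  if r: "r:sections T F" and f: "f:carrier C" and t: "t:topspace T" for r f t
  using u_right[OF JK(1)[OF uv'(2)[OF r]] fc[OF f] t] W_right[OF uv'(2)[OF r] f] t by (simp add: theta'_def v'_right[OF r f])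
 obtain a where "(\<forall>x\<in>carrier X. a x:sections T E) &
  (\<forall>s\<in>sections T E. \<forall>x\<in>carrier X. \<forall>t\<in>topspace T. hip X (v s) x t=h (s t) (a x t))" using v_adjoint ..
 note a = this[THEN conjunct2, rule_format]
 obtain a' where "(\<forall>s\<in>sections T E. a' s:carrier X) &
  (\<forall>x\<in>carrier X. \<forall>s\<in>sections T E. \<forall>t\<in>topspace T. h (u x t) (s t)=hip X x (a' s) t)" using u_adjoint ..
 note a' = this[THEN conjunct1, rule_format] this[THEN conjunct2, rule_format]
 obtain b where "(\<forall>r\<in>sections T F. b r:carrier W) &
  (\<forall>z\<in>carrier W. \<forall>r\<in>sections T F. hip (section_corr T F k) (u' z) r=hip W z (b r))"
  using iso3_adjoint(1)[OF iso'] unfolding section_corr_simps(1) ..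
 note b = this[THEN conjunct1, rule_format] this[THEN conjunct2, rule_format]
 obtain b' where "(\<forall>z\<in>carrier W. b' z:sections T F) &
  (\<forall>r\<in>sections T F. \<forall>z\<in>carrier W. hip W (v' r) z=hip (section_corr T F k) r (b' z))"
  using iso3_adjoint(2)[OF iso'] unfolding section_corr_simps(1) ..
 note b' = this[THEN conjunct2, rule_format]
 \<comment> \<open>Moving all maps to the other side leaves \<open>s\<close> evaluated at
   \<open>Phiinv t\<close> only, which is the locality that \<open>bundle_transferI\<close> asks
   for.\<close>
 have pair: "k (theta s t) (r t)=h (s (Phiinv t)) (a (J (b r)) (Phiinv t))"
  if s: "s:sections T E" and r: "r:sections T F" and t: "t:topspace T" for s r t
 proof -
  have "k (theta s t) (r t)=hip (section_corr T F k) (theta s) r t" using t by simp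
  also have "...=hip W (K (v s)) (b r) t" unfolding theta_def by (simp only: b(2)[OF JK(2)[OF uv(2)[OF s]] r])
  also have "...=hip X (v s) (J (b r)) (Phiinv t)"
   unfolding W_ip[OF JK(2)[OF uv(2)[OF s]] b(1)[OF r]] by (simp only: restrict_apply'[OF t] JK(4)[OF uv(2)[OF s]])
  also have "...=h (s (Phiinv t)) (a (J (b r)) (Phiinv t))"
   by (rule a[OF s JK(1)[OF b(1)[OF r]] p.maps(1)[OF t]])
  finally show ?thesis .
 qed
 have pair': "h (theta' r t) (s t)=k (r (Phi t)) (b' (K (a' s)) (Phi t))"
  if s: "s:sections T E" and r: "r:sections T F" and t: "t:topspace T" for s r t
 proof -
  note Ka = JK(2)[OF a'(1)[OF s]]
  have "h (theta' r t) (s t)=hip X (J (v' r)) (a' s) t"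
   unfolding theta'_def by (rule a'(2)[OF JK(1)[OF uv'(2)[OF r]] s t])
  also have "...=hip W (v' r) (K (a' s)) (Phi t)"
   unfolding W_ip[OF uv'(2)[OF r] Ka]
   by (simp only: restrict_apply'[OF p.maps(2)[OF t]] JK(4)[OF a'(1)[OF s]] p.maps(4)[OF t])
  also have "...=k (r (Phi t)) (b' (K (a' s)) (Phi t))"
   unfolding b'[OF r Ka] section_corr_simps(4) by (simp only: restrict_apply'[OF p.maps(2)[OF t]])
  finally show ?thesis .
 qed
 note M = metric_bundle_axioms and M' = F.metric_bundle_axioms
 have EF: "bundle_transfer T Phiinv Phi E F theta"
  by (rule bundle_transferI[where theta = theta and theta' = theta' and b = "%r. a (J (b r))" and b' = "%s. b' (K (a' s))", OF M M' hs];
   rule theta theta' pair pair' scale scale'; assumption)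
 have FE: "bundle_transfer T Phi Phiinv F E theta'"
  by (rule bundle_transferI[where theta = theta' and theta' = theta and b = "%s. b' (K (a' s))" and b' = "%r. a (J (b r))", OF M' M hom'];
   rule theta theta' pair pair' scale scale'; assumption)
 show ?thesis
  by (rule chern_class_pullback[OF hs]) (rule bundle_transfer.chern_transfer[OF EF] bundle_transfer.chern_transfer[OF FE]; assumption)+
qed

end

section \<open>Assembly of the three statements\<close>

lemma (in conjugation) twisted_act2: "twisted T Phi Phiinv (act2 T A N Y Y' X) X J"
proof (intro twisted.intro)
 show "bij_betw J (carrier (act2 T A N Y Y' X)) (carrier X)" unfolding act2_eq by (rule bij_J)
 show "hip (act2 T A N Y Y' X) z w=(\<lambda>t\<in>topspace T. hip X (J z) (J w) (Phiinv t))"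
  if "z:carrier (act2 T A N Y Y' X)" "w:carrier (act2 T A N Y Y' X)" for z w
 proof (rule extensionalityI[of _ "topspace T"])
  note zw = that[unfolded act2_eq]
  have "hip W4 z w:carrier C"
   using s4.alg_hip[unfolded W4_eq, OF zw] by (simp only:) (use zw in "intro C.nv.finsum_closed' C.m_closed C.adj_closed; simp")
  then show "hip (act2 T A N Y Y' X) z w:extensional (topspace T)" by (simp add: act2_eq cfun_carrier)
  show "hip (act2 T A N Y Y' X) z w t=(\<lambda>t\<in>topspace T. hip X (J z) (J w) (Phiinv t)) t" if "t:topspace T" for t
   using J_hip[OF zw that] that by (simp add: act2_eq)
 qed simp
 show "hleft (act2 T A N Y Y' X) f z:carrier (act2 T A N Y Y' X) &
   J (hleft (act2 T A N Y Y' X) f z)=hright X (J z) (\<lambda>t\<in>topspace T. f (Phi t))"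
  if "z:carrier (act2 T A N Y Y' X)" "f:carrier C" for z f
  using left_closed_W4 J_left that unfolding act2_eq un_def by blast
 show "hright (act2 T A N Y Y' X) z f:carrier (act2 T A N Y Y' X) &
   J (hright (act2 T A N Y Y' X) z f)=hright X (J z) (\<lambda>t\<in>topspace T. f (Phi t))"
  if "z:carrier (act2 T A N Y Y' X)" "f:carrier C" for z f
  using W4_right(1) J_right that unfolding act2_eq un_def by blast
qed (rule hom)

text \<open>\<open>u\<close> and \<open>v\<close> form the 3-isomorphism from the product of
  \<open>Yinv\<close> and \<open>Y\<close> to the identity that is contained in the invertibility of
  \<open>Y\<close>.\<close>

lemma conjugationI:
 assumes "compact_space T" and "dd_mor1 T \<omega> A\<omega>" and "homeomorphic_maps T T Phi Phiinv"
  and "inverse2 T T A (mor1_comp T A\<omega> (homeo_mor1 T Phi)) P Pinv"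
  and "inverse1 T T A Ainv V Vinv W Winv"
  and "inverse2 T T (conj_mor1 T A Ainv) (mor1_id T) Y Yinv"
  and "mor2 T T (mor1_id T) (mor1_id T) X"
  and "!!i. i < n==>xi i:carrier X"
  and "!!x. x:carrier X==>finsum X (%i. hright X (xi i) (hip X (xi i) x)) {..<n}=x"
 shows "\<exists>u v. conjugation T Phi Phiinv A Ainv Y Yinv u v X xi n"
proof -
 have A: "mor1 T T A" and N: "mor1 T T Ainv" using assms(5) by (simp_all add: inverse1_def)
 have M: "mor1 T T A\<omega>" "rmap A\<omega>=lmap A\<omega>" using assms(2) unfolding dd_mor1_def by blast+
 have Y: "mor2 T T (conj_mor1 T A Ainv) (mor1_id T) Y" and Y': "mor2 T T (mor1_id T) (conj_mor1 T A Ainv) Yinv"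
  and i: "isomorphic3 (cfun_alg T) (cfun_alg T) (rel_tensor (cfun_alg T) Yinv Y) (id_corr (cfun_alg T))"
  using assms(6) unfolding inverse2_def mor1_id_simps by blast+
 obtain u v where iso: "iso3 (cfun_alg T) (cfun_alg T) (rel_tensor (cfun_alg T) Yinv Y) (id_corr (cfun_alg T)) u v"
  using i[unfolded isomorphic3_def] by (elim exE)
 have "conjugation T Phi Phiinv A Ainv Y Yinv u v X xi n"
  by (rule conjugation.intro[OF assms(1,3) A N Y Y' iso])
   (rule twisted_center[OF assms(1,3) M A assms(4)] assms(7-9); assumption?)+
 then show ?thesis by blast
qed

text \<open>The constant function 1 is a frame of length one, which brings the action on functions
  under the same computation as that on line bundles.\<close>

lemma id_corr_frame:
 assumes "compact_space T"
 shows "mor2 T T (mor1_id T) (mor1_id T) (id_corr (cfun_alg T))"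
  and "\<one>\<^bsub>cfun_alg T\<^esub>:carrier (id_corr (cfun_alg T))"
  and "x:carrier (id_corr (cfun_alg T)) ==>
   finsum (id_corr (cfun_alg T)) (%i. hright (id_corr (cfun_alg T)) \<one>\<^bsub>cfun_alg T\<^esub> (hip (id_corr (cfun_alg T)) \<one>\<^bsub>cfun_alg T\<^esub> x)) {..<Suc 0}=x"
proof -
 interpret C: cstar_algebra "cfun_alg T" by (rule cstar_algebra_cfun[OF assms])
 interpret X: correspondence "cfun_alg T" "cfun_alg T" "id_corr (cfun_alg T)" by (rule id_corr_correspondence[OF C.cstar_algebra_axioms])
 show "mor2 T T (mor1_id T) (mor1_id T) (id_corr (cfun_alg T))"
  unfolding mor2_def mor1_id_simps id_corr_simps
  by (intro conjI ballI X.correspondence_axioms) (simp_all add: mult.commute cong: restrict_cong)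
 show one: "\<one>\<^bsub>cfun_alg T\<^esub>:carrier (id_corr (cfun_alg T))" using C.one_closed by (simp del: cfun_alg_simps)
 show "finsum (id_corr (cfun_alg T)) (%i. hright (id_corr (cfun_alg T)) \<one>\<^bsub>cfun_alg T\<^esub> (hip (id_corr (cfun_alg T)) \<one>\<^bsub>cfun_alg T\<^esub> x)) {..<Suc 0}=x"
  if x: "x:carrier (id_corr (cfun_alg T))"
 proof -
 have "hright (id_corr (cfun_alg T)) \<one>\<^bsub>cfun_alg T\<^esub> (hip (id_corr (cfun_alg T)) \<one>\<^bsub>cfun_alg T\<^esub> x)=x"
 proof (rule cfun_eqI)
  have x': "x:carrier (cfun_alg T)" using x by simp
  show "hright (id_corr (cfun_alg T)) \<one>\<^bsub>cfun_alg T\<^esub> (hip (id_corr (cfun_alg T)) \<one>\<^bsub>cfun_alg T\<^esub> x):carrier (cfun_alg T)"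
   unfolding id_corr_simps
   by (intro monoid.m_closed[OF ring.is_monoid[OF C.ring_A]] C.adj_closed monoid.one_closed[OF ring.is_monoid[OF C.ring_A]] x')
  show "x:carrier (cfun_alg T)" by (rule x')
 qed simp
 then show ?thesis
  using x X.X.r_zero by (simp only: lessThan_Suc lessThan_0) (subst X.X.finsum_insert, auto)
 qed
qed

theorem theoremB:
  fixes T :: "'t topology" and K :: "'k topology"
    and \<omega> :: "'t cech set" and \<Phi> \<Phi>inv :: "'t \<Rightarrow> 't"
    and A\<omega> :: "('t, 't, 'a) one_mor"
    and A :: "('t, 't, 'm) one_mor" and Ainv :: "('t, 't, 'n) one_mor"
  assumes "compact_space T" and "Hausdorff_space T"
    and "\<omega> \<in> cech_H_tor T 3" and "dd_mor1 T \<omega> A\<omega>"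
    and "homeomorphic_maps T T \<Phi> \<Phi>inv"
    and "inverse2 T T A (mor1_comp T A\<omega> (homeo_mor1 T \<Phi>)) P Pinv"
    and "inverse1 T T A Ainv V Vinv W Winv"
    and "inverse2 T T (conj_mor1 T A Ainv) (mor1_id T) Y Yinv"
  shows "(\<forall>(E :: ('t, 'e) cbundle) h h' (X :: ('t \<Rightarrow> complex, 't \<Rightarrow> complex, 'x) corr).
      line_bundle T E \<and> hermitian_metric E h \<and> mor2 T T (mor1_id T) (mor1_id T) X \<and>
      isomorphic3 (cfun_alg T) (cfun_alg T) X (section_corr T E h) \<and>
      hermitian_metric (pullback_bundle T \<Phi>inv E) h' \<longrightarrow>
      isomorphic3 (cfun_alg T) (cfun_alg T) (act2 T A Ainv Y Yinv X)
        (section_corr T (pullback_bundle T \<Phi>inv E) h'))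
    \<and> (CW_complex K \<and> T homotopy_equivalent_space K \<longrightarrow>
      (\<forall>(E :: ('t, 'e) cbundle) h (X :: ('t \<Rightarrow> complex, 't \<Rightarrow> complex, 'x) corr)
          (F :: ('t, 'f) cbundle) h'.
        line_bundle T E \<and> hermitian_metric E h \<and> mor2 T T (mor1_id T) (mor1_id T) X \<and>
        isomorphic3 (cfun_alg T) (cfun_alg T) X (section_corr T E h) \<and>
        line_bundle T F \<and> hermitian_metric F h' \<and>
        isomorphic3 (cfun_alg T) (cfun_alg T) (act2 T A Ainv Y Yinv X) (section_corr T F h') \<longrightarrow>
        chern_class T F = cech_pullback T \<Phi>inv 2 (chern_class T E)))
    \<and> (\<forall>f\<in>Units (cfun_alg T). \<forall>g ginv.
      iso3 (cfun_alg T) (cfun_alg T) (act2 T A Ainv Y Yinv (id_corr (cfun_alg T)))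
        (id_corr (cfun_alg T)) g ginv \<longrightarrow>
      (\<forall>k\<in>carrier (cfun_alg T).
        g (act3 T A Ainv Y Yinv (id_corr (cfun_alg T)) (\<lambda>j. f \<otimes>\<^bsub>cfun_alg T\<^esub> j) (ginv k)) =
          (\<lambda>t\<in>topspace T. f (\<Phi>inv t)) \<otimes>\<^bsub>cfun_alg T\<^esub> k))"
proof (intro conjI allI impI ballI)
 note conj = conjugationI[OF assms(1,4-8)]
 {
  \<comment> \<open>A frame for \<open>X\<close> is taken from its isomorphism with a section
    module, so both bundle statements reduce to \<open>twisted\<close>.\<close>
  fix E :: "('t, 'e) cbundle" and h and X :: "('t=>complex, 't=>complex, 'x) corr"
  assume E: "line_bundle T E" "hermitian_metric E h" "mor2 T T (mor1_id T) (mor1_id T) X"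
   "isomorphic3 (cfun_alg T) (cfun_alg T) X (section_corr T E h)"
  obtain u v where uv: "iso3 (cfun_alg T) (cfun_alg T) X (section_corr T E h) u v"
   using E(4)[unfolded isomorphic3_def] by (elim exE)
  have "correspondence (cfun_alg T) (cfun_alg T) X" using E(3) unfolding mor2_def mor1_id_simps by blast
  then have S: "section_iso T E h X u v"
   by (intro section_iso.intro section_iso_axioms.intro metric_bundle.intro lbundle.intro metric_bundle_axioms.intro assms(1,2) E uv)
  obtain xi :: "nat=>'x" and n where x: "(\<forall>i<n. xi i:carrier X) &
    (\<forall>x\<in>carrier X. finsum X (%i. hright X (xi i) (hip X (xi i) x)) {..<n}=x)"
   using section_iso.frame_exists[OF S] by (elim exE)
  have "\<exists>u v. conjugation T \<Phi> \<Phi>inv A Ainv Y Yinv u v X xi n"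
   by (rule conj[OF E(3)]) (use x in blast)+
  then obtain u' v' where "conjugation T \<Phi> \<Phi>inv A Ainv Y Yinv u' v' X xi n" by (elim exE)
  from conjugation.twisted_act2[OF this]
  have "\<exists>J u v. twisted T \<Phi> \<Phi>inv (act2 T A Ainv Y Yinv X) X J&section_iso T E h X u v" using S by blast
 } note twist = this
 {
  fix E :: "('t, 'e) cbundle" and h h' and X :: "('t=>complex, 't=>complex, 'x) corr"
  assume a: "line_bundle T E&hermitian_metric E h&mor2 T T (mor1_id T) (mor1_id T) X &
   isomorphic3 (cfun_alg T) (cfun_alg T) X (section_corr T E h) &
   hermitian_metric (pullback_bundle T \<Phi>inv E) h'"
  then obtain J u v where J: "twisted T \<Phi> \<Phi>inv (act2 T A Ainv Y Yinv X) X J" "section_iso T E h X u v"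
   using twist by blast
  have "twisted_sections T \<Phi> \<Phi>inv (act2 T A Ainv Y Yinv X) X J E h u v h'"
   using J a assms(5) section_iso.axioms(1)[OF J(2)]
   by (intro twisted_sections.intro pullback.intro pullback_axioms.intro) blast+
  then show "isomorphic3 (cfun_alg T) (cfun_alg T) (act2 T A Ainv Y Yinv X) (section_corr T (pullback_bundle T \<Phi>inv E) h')"
   by (rule twisted_sections.twisted_isomorphic)
 }
 {
  fix E :: "('t, 'e) cbundle" and h and X :: "('t=>complex, 't=>complex, 'x) corr" and F :: "('t, 'f) cbundle" and h'
  assume a: "line_bundle T E&hermitian_metric E h&mor2 T T (mor1_id T) (mor1_id T) X &
    isomorphic3 (cfun_alg T) (cfun_alg T) X (section_corr T E h) &
    line_bundle T F&hermitian_metric F h' &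
    isomorphic3 (cfun_alg T) (cfun_alg T) (act2 T A Ainv Y Yinv X) (section_corr T F h')"
  then obtain J u v where J: "twisted T \<Phi> \<Phi>inv (act2 T A Ainv Y Yinv X) X J" "section_iso T E h X u v"
   using twist by blast
  obtain u' v' where "iso3 (cfun_alg T) (cfun_alg T) (act2 T A Ainv Y Yinv X) (section_corr T F h') u' v'"
   using a unfolding isomorphic3_def by blast
  then have "twisted_line T \<Phi> \<Phi>inv (act2 T A Ainv Y Yinv X) X J E h u v F h' u' v'"
   using J a assms(1,2)
   by (intro twisted_line.intro twisted_line_axioms.intro metric_bundle.intro lbundle.intro metric_bundle_axioms.intro) blast+
  then show "chern_class T F=cech_pullback T \<Phi>inv 2 (chern_class T E)" by (rule twisted_line.chern_class_twisted)
 }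
 {
  let ?C = "cfun_alg T"
  let ?I = "id_corr ?C" and ?W = "act2 T A Ainv Y Yinv (id_corr (cfun_alg T))"
  fix f g ginv k assume f: "f:Units ?C" and g: "iso3 ?C ?C ?W ?I g ginv" and k: "k:carrier ?C"
  have fc: "f:carrier ?C" using f by (simp only: Units_def mem_Collect_eq)
  note I = id_corr_frame[OF assms(1)]
  have "\<exists>u v. conjugation T \<Phi> \<Phi>inv A Ainv Y Yinv u v ?I (%_. \<one>\<^bsub>?C\<^esub>) (Suc 0)"
   by (rule conj[OF I(1)]) (rule I(2,3); assumption?)+
  then obtain u v where "conjugation T \<Phi> \<Phi>inv A Ainv Y Yinv u v ?I (%_. \<one>\<^bsub>?C\<^esub>) (Suc 0)" by (elim exE)
  then interpret c: conjugation T \<Phi> \<Phi>inv A Ainv Y Yinv u v ?I "%_. \<one>\<^bsub>?C\<^esub>" "Suc 0" .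
  note iso = g[unfolded iso3_def]
  have k': "k:carrier ?I" using k by simp
  have z: "ginv k:carrier ?W" "g (ginv k)=k"
   by (rule iso[THEN conjunct2, THEN conjunct1, unfolded mor3_def, THEN conjunct1, unfolded image_subset_iff, THEN bspec, OF k'])
    (rule iso[THEN conjunct2, THEN conjunct2, THEN conjunct2, THEN bspec, OF k'])
  \<comment> \<open>The conjugate of multiplication by \<open>f\<close> is the left action of the
    twisted function. As \<open>g\<close> is a bimodule map, it turns this action into
    multiplication, whatever isomorphism \<open>g\<close> was chosen.\<close>
  have "act3 T A Ainv Y Yinv ?I (hleft ?I f) (ginv k)=hleft ?W (\<lambda>t\<in>topspace T. f (\<Phi>inv t)) (ginv k)"
   using c.act3_eq[OF fc] z(1) unfolding c.act2_eq by blast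
  moreover have "hleft ?I f=(%j. f\<otimes>\<^bsub>?C\<^esub> j)" by (simp add: id_corr_def)
  moreover have "g (hleft ?W b (ginv k))=b\<otimes>\<^bsub>?C\<^esub> k" if "b:carrier ?C" for b
   using iso[THEN conjunct1, unfolded mor3_def, THEN conjunct2, THEN conjunct2, THEN conjunct1, THEN bspec, THEN bspec, OF that z(1)]
   by (simp only: id_corr_simps z(2))
  ultimately show "g (act3 T A Ainv Y Yinv ?I (%j. f\<otimes>\<^bsub>?C\<^esub> j) (ginv k))=(\<lambda>t\<in>topspace T. f (\<Phi>inv t))\<otimes>\<^bsub>?C\<^esub> k"
   using c.tw_closed[OF fc] by (simp only:)
 }
qed

end
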